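(* Let $R$ be a reduced irreducible root system with Weyl group $W$, adjoint torus $H$ and toric mirror arrangement complement $H^\circ$. For every $W$-invariant multiplicity parameter $\kappa=(k_\alpha)_{\alpha\in R}\in\mathbb C^R$ and every $W$-equivariant symmetric bilinear map $b^\kappa:\mathfrak h\times\mathfrak h\to\mathfrak h$, one can choose a $W$-invariant symmetric bilinear form $a^\kappa:\mathfrak h\times\mathfrak h\to\mathbb C$ such that the connection $\tilde\nabla^\kappa$ on the cotangent bundle of $H^\circ\times\mathbb C^\times$ (defined from $\kappa,a^\kappa,b^\kappa$ in the context) is flat; hence the connection $\nabla^\kappa$ defines a projective structure on $H^\circ$.
   Context: Setting: $\mathfrak a$ is a Euclidean vector space of dimension $n$, $R\subset\mathfrak a^*$ a reduced irreducible crystallographic root system spanning $\mathfrak a^*$, $W$ its Weyl group; sums over $\alpha>0$ are over positive roots. $Q=\mathbb ZR$, $P^\vee=\mathrm{Hom}(Q,\mathbb Z)\subset\mathfrak a$, $H=\mathrm{Hom}(Q,\mathbb C^\times)$, $\mathfrak h=\mathbb C\otimes\mathfrak a$ its Lie algebra, $H=\mathfrak h/2\pi\sqrt{-1}P^\vee$. $e^\alpha$ is the character of $H$ defined by $\alpha$, $H_\alpha=\{e^\alpha=1\}$, $H^\circ=H-\bigcup_{\alpha\in R}H_\alpha$. For $v\in\mathfrak h$, $\partial_v$ is the translation invariant vector field on $H$; for $\phi\in\mathfrak h^*$, $d\phi$ is the translation invariant differential; $\alpha^\vee\in\mathfrak h$ is the coroot. $A^\kappa$ is the translation invariant symmetric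 section of $\Omega_H\otimes\Omega_H$ defined by $a^\kappa$, and $(B^\kappa)^*(\zeta)$ is the section of $\Omega\otimes\Omega$ with $(B^\kappa)^*(\zeta)(\partial_u,\partial_v)=\zeta(\partial_{b^\kappa(u,v)})$. With $\nabla^0,\tilde\nabla^0$ the flat translation invariant connections on the cotangent bundles of $H$ and $H\times\mathbb C^\times$, and $t$ the coordinate on $\mathbb C^\times$, put $\nabla^\kappa=\nabla^0+\Omega^\kappa$ and $\tilde\nabla^\kappa=\tilde\nabla^0+\tilde\Omega^\kappa$ where $$\Omega^\kappa(\zeta)=\tfrac12\sum_{\alpha>0}k_\alpha\frac{e^\alpha+1}{e^\alpha-1}\zeta(\partial_{\alpha^\vee})\,d\alpha\otimes d\alpha+(B^\kappa)^*(\zeta),$$ $$\tilde\Omega^\kappa(\zeta)=\Omega^\kappa(\zeta)-\zeta\otimes\tfrac{dt}t-\tfrac{dt}t\otimes\zeta\quad(\zeta\in\Omega_{H^\circ}),\qquad \tilde\Omega^\kappa\big(\tfrac{dt}t\big)=A^\kappa-\tfrac{dt}t\otimes\tfrac{dt}t.$$ A projective structure on an $n$-dimensional complex manifold is a maximal atlas of holomorphic charts (into $\mathbb P^n$) with projective-linear transition maps. "$\nabla^\kappa$ defines a projective structure" means: the solutions $f$ of $\nabla^\kappa(df)+fA^\kappa=0$ form a local system of rank $n+1$ on $H^\circ$, and for a local basis $f_0,\dots,f_n$ the maps $[f_0:\cdots:f_n]$ are the charts of a projective structure on $H^\circ$ (equivalently, the torsion free flat connection $\tilde\nabla^\kappa$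 defines an affine structure on $H^\circ\times\mathbb C^\times$ whose local affine functions are $c+tf$, inducing the projective structure on the quotient by $\mathbb C^\times$). *)

theory Defs
  imports "HOL-Analysis.Analysis"
begin

text \<open>
  The Euclidean space \<open>\<aa>\<close> of dimension \<open>n\<close> is \<^typ>\<open>real^'n\<close> and its complexification \<open>\<hh>\<close> is
  \<^typ>\<open>complex^'n\<close>.  Elements of \<open>\<aa>\<^sup>*\<close> and \<open>\<hh>\<^sup>*\<close> are given by their coordinates with respect to the
  dual basis, so that a root \<open>\<alpha>\<close> is the linear form \<open>x \<mapsto> \<alpha> \<bullet> x\<close>, and the form defined by an
  orthogonal matrix \<open>w\<close> applied to \<open>\<alpha>\<close> is again \<open>w *v \<alpha>\<close>.
\<close>

definition coroot :: "real^'n \<Rightarrow> real^'n" where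
  "coroot \<alpha> = (2 / (\<alpha> \<bullet> \<alpha>)) *\<^sub>R \<alpha>"

definition reflection :: "real^'n \<Rightarrow> real^'n^'n" where
  "reflection \<alpha> = matrix (\<lambda>x. x - (\<alpha> \<bullet> x) *\<^sub>R coroot \<alpha>)"

definition root_system :: "(real^'n) set \<Rightarrow> bool" where
  "root_system R \<longleftrightarrow> finite R \<and> 0 \<notin> R \<and> span R = UNIV
     \<and> (\<forall>\<alpha>\<in>R. \<forall>\<beta>\<in>R. reflection \<alpha> *v \<beta> \<in> R)
     \<and> (\<forall>\<alpha>\<in>R. \<forall>\<beta>\<in>R. \<beta> \<bullet> coroot \<alpha> \<in> \<int>)"

definition reduced :: "(real^'n) set \<Rightarrow> bool" where
  "reduced R \<longleftrightarrow> (\<forall>\<alpha>\<in>R. \<forall>c. c *\<^sub>R \<alpha> \<in> R \<longrightarrow> c = 1 \<or> c = -1)"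

definition irreducible_roots :: "(real^'n) set \<Rightarrow> bool" where
  "irreducible_roots R \<longleftrightarrow> R \<noteq> {} \<and>
     (\<forall>R1 R2. R1 \<union> R2 = R \<and> R1 \<inter> R2 = {} \<and> (\<forall>\<alpha>\<in>R1. \<forall>\<beta>\<in>R2. \<alpha> \<bullet> \<beta> = 0) \<longrightarrow> R1 = {} \<or> R2 = {})"

definition positive_roots :: "(real^'n) set \<Rightarrow> (real^'n) set \<Rightarrow> bool" where
  "positive_roots R P \<longleftrightarrow> (\<exists>\<xi>. (\<forall>\<alpha>\<in>R. \<alpha> \<bullet> \<xi> \<noteq> 0) \<and> P = {\<alpha> \<in> R. \<alpha> \<bullet> \<xi> > 0})"

text \<open>Reflections are involutions, so the monoid they generate is already a group.\<close>

inductive_set weyl_group :: "(real^'n) set \<Rightarrow> (real^'n^'n) set" for R where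
  one: "mat 1 \<in> weyl_group R"
| step: "\<alpha> \<in> R \<Longrightarrow> w \<in> weyl_group R \<Longrightarrow> reflection \<alpha> ** w \<in> weyl_group R"

definition root_lattice :: "(real^'n) set \<Rightarrow> (real^'n) set" where
  "root_lattice R = {\<Sum>\<alpha>\<in>R. of_int (c \<alpha>) *\<^sub>R \<alpha> | c :: real^'n \<Rightarrow> int. True}"

definition cvec :: "real^'n \<Rightarrow> complex^'n" where
  "cvec x = (\<chi> i. complex_of_real (x $ i))"

definition pairing :: "complex^'m \<Rightarrow> complex^'m \<Rightarrow> complex" where
  "pairing \<phi> v = (\<Sum>i\<in>UNIV. \<phi> $ i * v $ i)"

definition weyl_act :: "real^'n^'n \<Rightarrow> complex^'n \<Rightarrow> complex^'n" where
  "weyl_act w z = map_matrix complex_of_real w *v z"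

definition sym_bilinear_form :: "(complex^'n \<Rightarrow> complex^'n \<Rightarrow> complex) \<Rightarrow> bool" where
  "sym_bilinear_form a \<longleftrightarrow>
     (\<forall>u v. a u v = a v u) \<and> (\<forall>u. Vector_Spaces.linear (*s) (*) (a u))"

definition sym_bilinear_map :: "(complex^'n \<Rightarrow> complex^'n \<Rightarrow> complex^'n) \<Rightarrow> bool" where
  "sym_bilinear_map b \<longleftrightarrow>
     (\<forall>u v. b u v = b v u) \<and> (\<forall>u. Vector_Spaces.linear (*s) (*s) (b u))"

definition complex_differentiable_at :: "(complex^'m \<Rightarrow> complex) \<Rightarrow> complex^'m \<Rightarrow> bool" where
  "complex_differentiable_at F z \<longleftrightarrow>
     (\<exists>D. Vector_Spaces.linear (*s) (*) D \<and> (F has_derivative D) (at z))"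

text \<open>
  Let \<open>G\<close> be a complex torus with Lie algebra \<^typ>\<open>complex^'m\<close>.  Below, \<open>\<tau> v p\<close> stands for the
  translate \<open>exp(v) p\<close> of \<open>p \<in> G\<close>.  The complex structure of \<open>G\<close> is the one for which
  \<open>v \<mapsto> \<tau> v p\<close> is locally biholomorphic at \<open>0\<close>, and \<open>s \<mapsto> \<tau> (s *s v) p\<close> is the integral curve of the
  invariant vector field \<open>\<partial>\<^sub>v\<close>.  The tangent and cotangent bundles are trivialized by translations:
  a vector field \<open>X\<close> with value \<open>\<partial>\<^sub>v\<close> at \<open>p\<close> has \<open>X p = v\<close>, and a 1-form \<open>\<zeta>\<close> satisfies
  \<open>\<zeta>(\<partial>\<^sub>v)(p) = pairing (\<zeta> p) v\<close>.
\<close>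

definition hol_on :: "(complex^'m \<Rightarrow> 'g \<Rightarrow> 'g) \<Rightarrow> 'g set \<Rightarrow> ('g \<Rightarrow> complex) \<Rightarrow> bool" where
  "hol_on \<tau> U F \<longleftrightarrow> (\<forall>p\<in>U. complex_differentiable_at (\<lambda>v. F (\<tau> v p)) 0)"

definition hol_vec_on :: "(complex^'m \<Rightarrow> 'g \<Rightarrow> 'g) \<Rightarrow> 'g set \<Rightarrow> ('g \<Rightarrow> complex^'m) \<Rightarrow> bool" where
  "hol_vec_on \<tau> U X \<longleftrightarrow> (\<forall>i. hol_on \<tau> U (\<lambda>p. X p $ i))"

definition inv_deriv ::
  "(complex^'m \<Rightarrow> 'g \<Rightarrow> 'g) \<Rightarrow> complex^'m \<Rightarrow> ('g \<Rightarrow> complex) \<Rightarrow> 'g \<Rightarrow> complex" where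
  "inv_deriv \<tau> v F p = deriv (\<lambda>s. F (\<tau> (s *s v) p)) 0"

definition inv_deriv_vec ::
  "(complex^'m \<Rightarrow> 'g \<Rightarrow> 'g) \<Rightarrow> complex^'m \<Rightarrow> ('g \<Rightarrow> complex^'m) \<Rightarrow> 'g \<Rightarrow> complex^'m" where
  "inv_deriv_vec \<tau> v X p = (\<chi> i. inv_deriv \<tau> v (\<lambda>q. X q $ i) p)"

definition differential ::
  "(complex^'m \<Rightarrow> 'g \<Rightarrow> 'g) \<Rightarrow> ('g \<Rightarrow> complex) \<Rightarrow> 'g \<Rightarrow> complex^'m" where
  "differential \<tau> f p = (\<chi> i. inv_deriv \<tau> (axis i 1) f p)"

text \<open>Invariant vector fields commute, so only the derivatives of the coefficients contribute.\<close>

definition lie_bracket ::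
  "(complex^'m \<Rightarrow> 'g \<Rightarrow> 'g) \<Rightarrow> ('g \<Rightarrow> complex^'m) \<Rightarrow> ('g \<Rightarrow> complex^'m) \<Rightarrow> 'g \<Rightarrow> complex^'m" where
  "lie_bracket \<tau> X Y p = inv_deriv_vec \<tau> (X p) Y p - inv_deriv_vec \<tau> (Y p) X p"

text \<open>
  \<open>\<Omega> p \<phi> u v\<close> is the value at \<open>p\<close> of \<open>\<Omega>(\<zeta>)(\<partial>\<^sub>u, \<partial>\<^sub>v)\<close> for a 1-form \<open>\<zeta>\<close> with \<open>\<zeta> p = \<phi>\<close>.  The
  covariant derivative \<open>\<nabla>\<^sub>X \<zeta>\<close> for \<open>\<nabla> = \<nabla>\<^sup>0 + \<Omega>\<close> is obtained by inserting \<open>X\<close> in the first slot;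
  \<open>\<nabla>\<^sup>0\<close> is the connection for which the invariant 1-forms are flat.
\<close>

type_synonym ('g, 'm) conn_form =
  "'g \<Rightarrow> complex^'m \<Rightarrow> complex^'m \<Rightarrow> complex^'m \<Rightarrow> complex"

definition cov_deriv ::
  "(complex^'m \<Rightarrow> 'g \<Rightarrow> 'g) \<Rightarrow> ('g, 'm) conn_form \<Rightarrow>
   ('g \<Rightarrow> complex^'m) \<Rightarrow> ('g \<Rightarrow> complex^'m) \<Rightarrow> 'g \<Rightarrow> complex^'m" where
  "cov_deriv \<tau> \<Omega> X \<zeta> p =
     inv_deriv_vec \<tau> (X p) \<zeta> p + (\<chi> j. \<Omega> p (\<zeta> p) (X p) (axis j 1))"

definition curvature ::
  "(complex^'m \<Rightarrow> 'g \<Rightarrow> 'g) \<Rightarrow> ('g, 'm) conn_form \<Rightarrow>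
   ('g \<Rightarrow> complex^'m) \<Rightarrow> ('g \<Rightarrow> complex^'m) \<Rightarrow> ('g \<Rightarrow> complex^'m) \<Rightarrow> 'g \<Rightarrow> complex^'m" where
  "curvature \<tau> \<Omega> X Y \<zeta> p =
     cov_deriv \<tau> \<Omega> X (cov_deriv \<tau> \<Omega> Y \<zeta>) p - cov_deriv \<tau> \<Omega> Y (cov_deriv \<tau> \<Omega> X \<zeta>) p
     - cov_deriv \<tau> \<Omega> (lie_bracket \<tau> X Y) \<zeta> p"

definition flat_connection ::
  "(complex^'m \<Rightarrow> 'g::topological_space \<Rightarrow> 'g) \<Rightarrow> 'g set \<Rightarrow> ('g, 'm) conn_form \<Rightarrow> bool" where
  "flat_connection \<tau> M \<Omega> \<longleftrightarrow>
     (\<forall>U X Y \<zeta>. openin (top_of_set M) U \<and> hol_vec_on \<tau> U X \<and> hol_vec_on \<tau> U Y \<and> hol_vec_on \<tau> U \<zeta>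
        \<longrightarrow> (\<forall>p\<in>U. curvature \<tau> \<Omega> X Y \<zeta> p = 0))"

text \<open>
  A point of the projective space of \<^typ>\<open>complex^'k\<close> is a line through \<open>0\<close>; the topology and the
  holomorphic functions are those of the quotient of \<open>- {0}\<close>.
\<close>

definition proj_pt :: "complex^'k \<Rightarrow> (complex^'k) set" where
  "proj_pt v = range (\<lambda>c. c *s v)"

definition proj_space :: "(complex^'k) set set" where
  "proj_space = proj_pt ` (- {0})"

definition proj_topology :: "(complex^'k) set topology" where
  "proj_topology = topology (\<lambda>W. W \<subseteq> proj_space \<and> open {v. v \<noteq> 0 \<and> proj_pt v \<in> W})"

lemma openin_proj_topology:
  fixes W :: "(complex^'k) set set"
  shows "openin proj_topology W \<longleftrightarrow> W \<subseteq> proj_space \<and> open {v. v \<noteq> 0 \<and> proj_pt v \<in> W}"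
proof -
  have "istopology (\<lambda>W::(complex^'k) set set. W \<subseteq> proj_space \<and> open {v. v \<noteq> 0 \<and> proj_pt v \<in> W})"
    unfolding istopology_def
  proof (intro conjI allI impI)
    fix S T :: "(complex^'k) set set"
    assume S: "S \<subseteq> proj_space \<and> open {v. v \<noteq> 0 \<and> proj_pt v \<in> S}"
      and T: "T \<subseteq> proj_space \<and> open {v. v \<noteq> 0 \<and> proj_pt v \<in> T}"
    show "S \<inter> T \<subseteq> proj_space" using S by blast
    have "{v. v \<noteq> 0 \<and> proj_pt v \<in> S \<inter> T}
        = {v. v \<noteq> 0 \<and> proj_pt v \<in> S} \<inter> {v. v \<noteq> 0 \<and> proj_pt v \<in> T}" by blast
    then show "open {v. v \<noteq> 0 \<and> proj_pt v \<in> S \<inter> T}" using S T by auto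
  next
    fix K :: "(complex^'k) set set set"
    assume K: "\<forall>S\<in>K. S \<subseteq> proj_space \<and> open {v. v \<noteq> 0 \<and> proj_pt v \<in> S}"
    show "\<Union>K \<subseteq> proj_space" using K by blast
    have "{v. v \<noteq> 0 \<and> proj_pt v \<in> \<Union>K} = (\<Union>S\<in>K. {v. v \<noteq> 0 \<and> proj_pt v \<in> S})" by blast
    then show "open {v. v \<noteq> 0 \<and> proj_pt v \<in> \<Union>K}" using K by auto
  qed
  then show ?thesis
    unfolding proj_topology_def by (simp add: topology_inverse')
qed

definition proj_hol_on ::
  "(complex^'k) set set \<Rightarrow> ((complex^'k) set \<Rightarrow> complex) \<Rightarrow> bool" where
  "proj_hol_on W g \<longleftrightarrow>
     (\<forall>v. v \<noteq> 0 \<and> proj_pt v \<in> W \<longrightarrow> complex_differentiable_at (\<lambda>z. g (proj_pt z)) v)"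

text \<open>
  A chart is an isomorphism from an open subset of the \<open>n\<close>-dimensional complex manifold \<open>M\<close> onto an
  open subset of \<open>\<PP>\<^sup>n\<close>: a homeomorphism which identifies the holomorphic functions on open subsets
  of its source with those on open subsets of its image.  The index type \<^typ>\<open>'n option\<close> has
  \<open>n + 1\<close> elements.
\<close>

definition proj_chart ::
  "(complex^'n \<Rightarrow> 'g::topological_space \<Rightarrow> 'g) \<Rightarrow> 'g set \<Rightarrow>
   'g set \<Rightarrow> ('g \<Rightarrow> (complex^'n option) set) \<Rightarrow> bool" where
  "proj_chart \<tau> M U \<phi> \<longleftrightarrow>
     openin (top_of_set M) U \<and> openin proj_topology (\<phi> ` U)
     \<and> homeomorphic_map (top_of_set U) (subtopology proj_topology (\<phi> ` U)) \<phi>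
     \<and> (\<forall>V g. openin (top_of_set M) V \<and> V \<subseteq> U \<longrightarrow>
          (hol_on \<tau> V g \<longleftrightarrow> proj_hol_on (\<phi> ` V) (\<lambda>y. g (inv_into U \<phi> y))))"

text \<open>The transition map between two charts agrees locally with a projective-linear map.\<close>

definition proj_compatible ::
  "'g::topological_space set \<Rightarrow> 'g set \<times> ('g \<Rightarrow> (complex^'k) set) \<Rightarrow>
   'g set \<times> ('g \<Rightarrow> (complex^'k) set) \<Rightarrow> bool" where
  "proj_compatible M c c' \<longleftrightarrow>
     (\<forall>p \<in> fst c \<inter> fst c'. \<exists>V (A :: complex^'k^'k).
        openin (top_of_set M) V \<and> p \<in> V \<and> V \<subseteq> fst c \<inter> fst c' \<and> invertible A
        \<and> (\<forall>x\<in>V. snd c' x = (*v) A ` snd c x))"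

definition projective_structure ::
  "(complex^'n \<Rightarrow> 'g::topological_space \<Rightarrow> 'g) \<Rightarrow> 'g set \<Rightarrow>
   ('g set \<times> ('g \<Rightarrow> (complex^'n option) set)) set \<Rightarrow> bool" where
  "projective_structure \<tau> M \<A> \<longleftrightarrow>
     (\<forall>c\<in>\<A>. proj_chart \<tau> M (fst c) (snd c))
     \<and> (\<Union>c\<in>\<A>. fst c) = M
     \<and> (\<forall>c\<in>\<A>. \<forall>c'\<in>\<A>. proj_compatible M c c')
     \<and> (\<forall>c. proj_chart \<tau> M (fst c) (snd c)
            \<and> (\<forall>c'\<in>\<A>. proj_compatible M c c' \<and> proj_compatible M c' c) \<longrightarrow> c \<in> \<A>)"

text \<open>The equation \<open>\<nabla>(df) + f A = 0\<close>, where \<open>A\<close> is the invariant tensor given by the form \<open>a\<close>.\<close>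

definition solution_on ::
  "(complex^'n \<Rightarrow> 'g \<Rightarrow> 'g) \<Rightarrow> ('g, 'n) conn_form \<Rightarrow> (complex^'n \<Rightarrow> complex^'n \<Rightarrow> complex) \<Rightarrow>
   'g set \<Rightarrow> ('g \<Rightarrow> complex) \<Rightarrow> bool" where
  "solution_on \<tau> \<Omega> a U f \<longleftrightarrow> hol_on \<tau> U f \<and>
     (\<forall>p\<in>U. \<forall>u v. pairing (cov_deriv \<tau> \<Omega> (\<lambda>_. u) (differential \<tau> f) p) v + f p * a u v = 0)"

text \<open>
  \<open>f\<close> trivializes the sheaf of solutions over the open set \<open>U\<close>, i.e. it defines an isomorphism from
  the constant sheaf \<open>\<complex>\<^sup>n\<^sup>+\<^sup>1\<close> (whose sections over connected open sets are constants).
\<close>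

definition local_basis ::
  "(complex^'n \<Rightarrow> 'g::topological_space \<Rightarrow> 'g) \<Rightarrow> ('g, 'n) conn_form \<Rightarrow>
   (complex^'n \<Rightarrow> complex^'n \<Rightarrow> complex) \<Rightarrow> 'g set \<Rightarrow> 'g set \<Rightarrow> ('n option \<Rightarrow> 'g \<Rightarrow> complex) \<Rightarrow> bool" where
  "local_basis \<tau> \<Omega> a M U f \<longleftrightarrow>
     openin (top_of_set M) U \<and> (\<forall>i. solution_on \<tau> \<Omega> a U (f i)) \<and>
     (\<forall>V g. openin (top_of_set M) V \<and> V \<subseteq> U \<and> V \<noteq> {} \<and> connected V \<and> solution_on \<tau> \<Omega> a V g
        \<longrightarrow> (\<exists>!c :: complex^'n option. \<forall>x\<in>V. g x = (\<Sum>i\<in>UNIV. c $ i * f i x)))"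

definition defines_projective_structure ::
  "(complex^'n \<Rightarrow> 'g::topological_space \<Rightarrow> 'g) \<Rightarrow> 'g set \<Rightarrow> ('g, 'n) conn_form \<Rightarrow>
   (complex^'n \<Rightarrow> complex^'n \<Rightarrow> complex) \<Rightarrow> bool" where
  "defines_projective_structure \<tau> M \<Omega> a \<longleftrightarrow>
     (\<forall>p\<in>M. \<exists>U f. p \<in> U \<and> local_basis \<tau> \<Omega> a M U f) \<and>
     (\<exists>\<A>. projective_structure \<tau> M \<A> \<and>
        (\<forall>U f. local_basis \<tau> \<Omega> a M U f \<longrightarrow>
           (\<forall>p\<in>U. \<exists>V. openin (top_of_set M) V \<and> p \<in> V \<and> V \<subseteq> U
                      \<and> (V, \<lambda>x. proj_pt (\<chi> i. f i x)) \<in> \<A>)))"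

text \<open>
  Homomorphisms \<open>Q \<rightarrow> \<complex>\<^sup>\<times>\<close> are extended by \<^const>\<open>undefined\<close> outside the root lattice \<open>Q\<close>.  The topology
  of pointwise convergence on functions induces the usual one on \<open>H\<close>, and \<open>e\<^sup>\<alpha>\<close> is
  evaluation at \<open>\<alpha>\<close>.
\<close>

definition adjoint_torus :: "(real^'n) set \<Rightarrow> (real^'n \<Rightarrow> complex) set" where
  "adjoint_torus R = {h \<in> extensional (root_lattice R).
     (\<forall>x\<in>root_lattice R. h x \<noteq> 0) \<and>
     (\<forall>x\<in>root_lattice R. \<forall>y\<in>root_lattice R. h (x + y) = h x * h y)}"

definition mirror_complement :: "(real^'n) set \<Rightarrow> (real^'n \<Rightarrow> complex) set" where
  "mirror_complement R = {h \<in> adjoint_torus R. \<forall>\<alpha>\<in>R. h \<alpha> \<noteq> 1}"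

text \<open>
  The exponential map \<open>\<hh> \<rightarrow> H\<close> sends \<open>v\<close> to \<open>q \<mapsto> exp (q(v))\<close>; its kernel is
  \<open>2 \<pi> \<surd>-1 P\<^sup>\<or>\<close>.
\<close>

definition torus_translate ::
  "(real^'n) set \<Rightarrow> complex^'n \<Rightarrow> (real^'n \<Rightarrow> complex) \<Rightarrow> (real^'n \<Rightarrow> complex)" where
  "torus_translate R v h = (\<lambda>q\<in>root_lattice R. exp (pairing (cvec q) v) * h q)"

text \<open>
  The Lie algebra of \<open>H \<times> \<complex>\<^sup>\<times>\<close> is \<^typ>\<open>complex^'n option\<close>; the coordinate \<^const>\<open>None\<close> is the one
  of \<open>\<complex>\<^sup>\<times>\<close>, so that the corresponding invariant 1-form is \<open>dt/t\<close>.
\<close>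

definition hpart :: "complex^'n option \<Rightarrow> complex^'n" where
  "hpart v = (\<chi> i. v $ Some i)"

definition ext_torus_translate ::
  "(real^'n) set \<Rightarrow> complex^'n option \<Rightarrow>
   (real^'n \<Rightarrow> complex) \<times> complex \<Rightarrow> (real^'n \<Rightarrow> complex) \<times> complex" where
  "ext_torus_translate R v = (\<lambda>(h, t). (torus_translate R (hpart v) h, exp (v $ None) * t))"

definition Omega ::
  "(real^'n) set \<Rightarrow> (real^'n \<Rightarrow> complex) \<Rightarrow> (complex^'n \<Rightarrow> complex^'n \<Rightarrow> complex^'n) \<Rightarrow>
   (real^'n \<Rightarrow> complex, 'n) conn_form" where
  "Omega P k b h \<phi> u v =
     1/2 * (\<Sum>\<alpha>\<in>P. k \<alpha> * ((h \<alpha> + 1) / (h \<alpha> - 1)) * pairing \<phi> (cvec (coroot \<alpha>))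
              * pairing (cvec \<alpha>) u * pairing (cvec \<alpha>) v)
     + pairing \<phi> (b u v)"

text \<open>Here \<open>\<phi>\<close> stands for the 1-form \<open>hpart \<phi> + (\<phi> $ None) dt/t\<close>.\<close>

definition ext_Omega ::
  "(real^'n) set \<Rightarrow> (real^'n \<Rightarrow> complex) \<Rightarrow> (complex^'n \<Rightarrow> complex^'n \<Rightarrow> complex) \<Rightarrow>
   (complex^'n \<Rightarrow> complex^'n \<Rightarrow> complex^'n) \<Rightarrow>
   ((real^'n \<Rightarrow> complex) \<times> complex, 'n option) conn_form" where
  "ext_Omega P k a b p \<phi> u v =
     Omega P k b (fst p) (hpart \<phi>) (hpart u) (hpart v)
     - pairing (hpart \<phi>) (hpart u) * v $ None - u $ None * pairing (hpart \<phi>) (hpart v)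
     + \<phi> $ None * (a (hpart u) (hpart v) - u $ None * v $ None)"

end

(* Look for a as a multiple of the standard invariant form. Flatness of the extended connection then
   splits into the symmetry of the coefficients of nabla in all three indices and the identity saying
   that the quadratic curvature term of nabla, an invariant function on H with values in the bilinear
   forms on Lambda^2, is a multiple of the standard form. Equivariance of b under reflections makes
   the tensor of b totally symmetric and cancels its mixed terms with the sum over the roots. In the
   remaining double sum over pairs of roots, the poles along one-parameter subgroups have residues
   that cancel in pairs exchanged by a reflection, so by Liouville the sum is constant, and an
   invariant endomorphism of Lambda^2 is scalar because the root system is irreducible.
   Flatness makes the equation for the 1-jets of solutions an integrable Pfaffian system, which gives
   n + 1 independent local solutions f_i determined by their jets. Independence of the jets says that
   t f is a local biholomorphism from H x C^* to C^(n+1), so [f_0 : ... : f_n] is a chart. *)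

theory Submission
  imports Defs "HOL-Complex_Analysis.Conformal_Mappings"
begin

section \<open>Holomorphic functions of several variables\<close>

text \<open>The derivative of coth(\<alpha>/2) is a multiple of the root \<alpha>, so the first
  derivatives of the connection coefficients are symmetric on their own and flatness becomes
  algebra: the coefficient matrices of the extended connection commute at each point. Their
  commutators compare the quadratic curvature term with c times the standard form on \<Lambda>^2, so
  c is its eigenvalue there. The matrices in the directions of H, up to sign, are also those of the
  1-jet system, so one commutation identity serves both conclusions. Two obstacles shape the root
  sum. A one-parameter subgroup may meet several mirrors at one point, so the sum is evaluated for
  characters in general position and extended by continuity. A reflection moves the base point along
  with the vectors, so invariance at a fixed point depends on the sum being independent of the
  point. Analysis takes place in the Lie algebra, pulled back by translations; the torus enters
  through a few axioms on its translation action.\<close>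

lemma pairing_add_right: "pairing g (u + v) = pairing g u + pairing g v"
  by (simp add: pairing_def algebra_simps sum.distrib)

lemma pairing_add_left: "pairing (g + h) u = pairing g u + pairing h u"
  by (simp add: pairing_def algebra_simps sum.distrib)

lemma pairing_scale_right: "pairing g (c *s u) = c * pairing g u"
  by (simp add: pairing_def algebra_simps sum_distrib_left)

lemma pairing_scale_left: "pairing (c *s g) u = c * pairing g u"
  by (simp add: pairing_def algebra_simps sum_distrib_left)

lemma pairing_commute: "pairing g u = pairing u g"
  by (simp add: pairing_def mult.commute)

lemma pairing_axis_right [simp]: "pairing g (axis i c) = g $ i * c"
proof -
  have "pairing g (axis i c) = (\<Sum>j\<in>UNIV. if j = i then g $ i * c else 0)"
    unfolding pairing_def by (intro sum.cong) (auto simp: axis_def)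
  then show ?thesis by simp
qed

lemma pairing_axis_left [simp]: "pairing (axis i c) g = c * g $ i"
  by (simp add: pairing_commute[of "axis i c"])

lemma pairing_zero [simp]: "pairing 0 v = 0" "pairing g 0 = 0"
  by (auto simp: pairing_def)

lemma scaleR_vec_eq: "(r *\<^sub>R v :: complex^'m) = of_real r *s v"
  by (simp add: vec_eq_iff) (simp add: scaleR_conv_of_real)

lemma bounded_linear_pairing: "bounded_linear (pairing g)"
  unfolding linear_conv_bounded_linear[symmetric]
  by (rule linearI) (simp_all add: pairing_add_right scaleR_vec_eq pairing_scale_right scaleR_conv_of_real)

lemma bounded_linear_scale_left: "bounded_linear (\<lambda>s. s *s (v :: complex^'m))"
  unfolding linear_conv_bounded_linear[symmetric]
  by (rule linearI) (simp_all add: vec_eq_iff algebra_simps)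

lemma bounded_linear_scale_right: "bounded_linear (\<lambda>v. s *s (v :: complex^'m))"
  unfolding linear_conv_bounded_linear[symmetric]
  by (rule linearI) (simp_all add: vec_eq_iff algebra_simps)

lemma linear_pairing: "Vector_Spaces.linear (*s) (*) (pairing g)"
  unfolding Vector_Spaces.linear_iff
  by (intro conjI allI vec.vector_space_axioms vector_space_over_itself.vector_space_axioms
      pairing_add_right pairing_scale_right)

lemma linear_form_eq_pairing:
  assumes "Vector_Spaces.linear (*s) (*) D"
  shows "D v = pairing (\<chi> i. D (axis i 1)) v"
proof -
  interpret Vector_Spaces.linear "(*s)" "(*)" D by fact
  have "D v = D (\<Sum>i\<in>UNIV. v $ i *s axis i 1)" by (simp add: basis_expansion)
  also have "\<dots> = (\<Sum>i\<in>UNIV. v $ i * D (axis i 1))" by (simp add: sum scale)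
  finally show ?thesis by (simp add: pairing_def mult.commute)
qed

text \<open>Represents the complex derivative through the bilinear \<open>pairing\<close>,
  coordinate by coordinate. This is the shape of \<open>differential\<close>, which thereby becomes
  the gradient at 0 of the function pulled back by translations.\<close>

definition cgrad :: "(complex^'m \<Rightarrow> complex) \<Rightarrow> complex^'m \<Rightarrow> complex^'m" where
  "cgrad F z = (\<chi> i. deriv (\<lambda>s. F (z + s *s axis i 1)) 0)"

lemma has_derivative_line:
  assumes "(F has_derivative pairing g) (at z)"
  shows "((\<lambda>s. F (z + s *s v)) has_field_derivative pairing g v) (at 0)"
proof -
  have 1: "((\<lambda>s. z + s *s v) has_derivative (\<lambda>s. s *s v)) (at 0)"
    by (auto intro!: derivative_eq_intros bounded_linear.has_derivative[OF bounded_linear_scale_left])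
  have "((\<lambda>s. F (z + s *s v)) has_derivative (\<lambda>s. pairing g (s *s v))) (at 0)"
    using has_derivative_compose[OF 1, of F "pairing g"] assms by simp
  then show ?thesis
    by (simp add: has_field_derivative_def pairing_scale_right mult.commute[of "pairing g v"] mult_commute_abs)
qed

lemma cgrad_unique:
  assumes "(F has_derivative pairing g) (at z)"
  shows "cgrad F z = g"
  using DERIV_imp_deriv[OF has_derivative_line[OF assms, of "axis _ 1"]]
  by (simp add: cgrad_def vec_eq_iff)

lemma complex_differentiableI:
  "(F has_derivative pairing g) (at z) \<Longrightarrow> complex_differentiable_at F z"
  unfolding complex_differentiable_at_def using linear_pairing by blast

lemma complex_differentiable_has_derivative:
  assumes "complex_differentiable_at F z"
  shows "(F has_derivative pairing (cgrad F z)) (at z)"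
proof -
  obtain D where D: "Vector_Spaces.linear (*s) (*) D" "(F has_derivative D) (at z)"
    using assms unfolding complex_differentiable_at_def by blast
  have "D = pairing (\<chi> i. D (axis i 1))" using linear_form_eq_pairing[OF D(1)] by blast
  then have "(F has_derivative pairing (\<chi> i. D (axis i 1))) (at z)" using D(2) by simp
  then show ?thesis using cgrad_unique by metis
qed

lemma cgrad_line:
  "complex_differentiable_at F z \<Longrightarrow>
   ((\<lambda>s. F (z + s *s v)) has_field_derivative pairing (cgrad F z) v) (at 0)"
  by (rule has_derivative_line[OF complex_differentiable_has_derivative])

lemma complex_differentiable_line:
  assumes "complex_differentiable_at F (z + s *s v)"
  shows "((\<lambda>s. F (z + s *s v)) has_field_derivative pairing (cgrad F (z + s *s v)) v) (at s)"
proof -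
  have "((\<lambda>x. F (z + s *s v + x *s v)) has_field_derivative pairing (cgrad F (z + s *s v)) v) (at (0 + (- s) + s))"
    using cgrad_line[OF assms] by simp
  \<comment> \<open>Writing the base point 0 as \<open>s + - s\<close> lets
    \<open>DERIV_shift\<close> move it to s.\<close>
  then have "((\<lambda>x. F (z + s *s v + x *s v)) has_field_derivative pairing (cgrad F (z + s *s v)) v) (at (s + - s))"
    by (simp)
  then have "((\<lambda>x. F (z + s *s v + (x + - s) *s v)) has_field_derivative pairing (cgrad F (z + s *s v)) v) (at s)"
    unfolding DERIV_shift by simp
  moreover have "z + s *s v + (x + - s) *s v = z + x *s v" for x
    by (simp add: vec_eq_iff algebra_simps)
  ultimately show ?thesis by simp
qed

lemma complex_differentiable_isCont:
  "complex_differentiable_at F z \<Longrightarrow> isCont F z"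
  using complex_differentiable_has_derivative has_derivative_continuous by blast

lemma complex_differentiable_continuous_on:
  "(\<And>z. z \<in> S \<Longrightarrow> complex_differentiable_at F z) \<Longrightarrow> continuous_on S F"
  by (meson complex_differentiable_isCont continuous_at_imp_continuous_on)

lemma cgrad_const [simp]: "complex_differentiable_at (\<lambda>_. c) z" "cgrad (\<lambda>_. c) z = 0"
proof -
  have "((\<lambda>_. c) has_derivative pairing (0 :: complex^'a)) (at z)"
    by (auto intro!: derivative_eq_intros)
  then show "complex_differentiable_at (\<lambda>_. c) z" "cgrad (\<lambda>_. c) z = 0"
    by (auto intro: complex_differentiableI cgrad_unique)
qed

lemma cgrad_nth [simp]: "complex_differentiable_at (\<lambda>z. z $ i) z" "cgrad (\<lambda>z. z $ i) z = axis i 1"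
proof -
  have "((\<lambda>z. z $ i) has_derivative pairing (axis i 1)) (at z)"
    using bounded_linear.has_derivative[OF bounded_linear_vec_nth has_derivative_ident, of i]
    by (simp add: pairing_axis_left[abs_def])
  then show "complex_differentiable_at (\<lambda>z. z $ i) z" "cgrad (\<lambda>z. z $ i) z = axis i 1"
    by (auto intro: complex_differentiableI cgrad_unique)
qed

lemma cgrad_add:
  assumes "complex_differentiable_at F z" "complex_differentiable_at G z"
  shows "complex_differentiable_at (\<lambda>z. F z + G z) z"
    "cgrad (\<lambda>z. F z + G z) z = cgrad F z + cgrad G z"
proof -
  have "((\<lambda>z. F z + G z) has_derivative pairing (cgrad F z + cgrad G z)) (at z)"
    using assms[THEN complex_differentiable_has_derivative]
    by (auto intro!: derivative_eq_intros simp: pairing_add_left)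
  then show "complex_differentiable_at (\<lambda>z. F z + G z) z"
    "cgrad (\<lambda>z. F z + G z) z = cgrad F z + cgrad G z"
    by (auto intro: complex_differentiableI cgrad_unique)
qed

lemma cgrad_mult:
  assumes "complex_differentiable_at F z" "complex_differentiable_at G z"
  shows "complex_differentiable_at (\<lambda>z. F z * G z) z"
    "cgrad (\<lambda>z. F z * G z) z = F z *s cgrad G z + G z *s cgrad F z"
proof -
  have "((\<lambda>z. F z * G z) has_derivative pairing (F z *s cgrad G z + G z *s cgrad F z)) (at z)"
    using assms[THEN complex_differentiable_has_derivative]
    by (auto intro!: derivative_eq_intros simp: pairing_add_left pairing_scale_left)
  then show "complex_differentiable_at (\<lambda>z. F z * G z) z"
    "cgrad (\<lambda>z. F z * G z) z = F z *s cgrad G z + G z *s cgrad F z"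
    by (auto intro: complex_differentiableI cgrad_unique)
qed

lemma cgrad_cmult:
  assumes "complex_differentiable_at F z"
  shows "complex_differentiable_at (\<lambda>z. c * F z) z" "cgrad (\<lambda>z. c * F z) z = c *s cgrad F z"
  using cgrad_mult[OF cgrad_const(1) assms] by auto

lemma cgrad_minus:
  assumes "complex_differentiable_at F z"
  shows "complex_differentiable_at (\<lambda>z. - F z) z" "cgrad (\<lambda>z. - F z) z = - cgrad F z"
  using cgrad_cmult[OF assms, of "-1"] by (auto simp: vec_eq_iff)

lemma cgrad_diff:
  assumes "complex_differentiable_at F z" "complex_differentiable_at G z"
  shows "complex_differentiable_at (\<lambda>z. F z - G z) z"
    "cgrad (\<lambda>z. F z - G z) z = cgrad F z - cgrad G z"
  using cgrad_add[OF assms(1) cgrad_minus(1)[OF assms(2)]] cgrad_minus(2)[OF assms(2)] by auto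

lemma cgrad_sum:
  assumes "\<And>i. i \<in> I \<Longrightarrow> complex_differentiable_at (F i) z"
  shows "complex_differentiable_at (\<lambda>z. \<Sum>i\<in>I. F i z) z \<and>
    cgrad (\<lambda>z. \<Sum>i\<in>I. F i z) z = (\<Sum>i\<in>I. cgrad (F i) z)"
  using assms
proof (induction I rule: infinite_finite_induct)
  case (insert i I)
  then show ?case by (simp add: cgrad_add)
qed auto

lemma cgrad_chain_field:
  assumes "complex_differentiable_at F z" "(h has_field_derivative h') (at (F z))"
  shows "complex_differentiable_at (\<lambda>z. h (F z)) z" "cgrad (\<lambda>z. h (F z)) z = h' *s cgrad F z"
proof -
  have "((\<lambda>z. h (F z)) has_derivative (\<lambda>v. h' * pairing (cgrad F z) v)) (at z)"
    using has_derivative_compose[OF complex_differentiable_has_derivative[OF assms(1)]]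
      assms(2)[unfolded has_field_derivative_def] by blast
  then have "((\<lambda>z. h (F z)) has_derivative pairing (h' *s cgrad F z)) (at z)"
    by (simp add: pairing_scale_left[abs_def])
  then show "complex_differentiable_at (\<lambda>z. h (F z)) z" "cgrad (\<lambda>z. h (F z)) z = h' *s cgrad F z"
    by (auto intro: complex_differentiableI cgrad_unique)
qed

lemma has_derivative_vec_componentwise:
  fixes G :: "'a::real_normed_vector \<Rightarrow> complex^'k"
  assumes "\<And>i. ((\<lambda>x. G x $ i) has_derivative (\<lambda>v. G' v $ i)) F"
  shows "(G has_derivative G') F"
proof -
  have "linear (axis i :: complex \<Rightarrow> complex^'k)" for i
    by (rule linearI) (auto simp: axis_def vec_eq_iff)
  then have "bounded_linear (axis i :: complex \<Rightarrow> complex^'k)" for i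
    by (simp add: linear_conv_bounded_linear)
  from bounded_linear.has_derivative[OF this assms]
  have "((\<lambda>x. \<Sum>i\<in>UNIV. axis i (G x $ i)) has_derivative (\<lambda>v. \<Sum>i\<in>UNIV. axis i (G' v $ i))) F"
    by (rule has_derivative_sum)
  moreover have "(\<Sum>i\<in>UNIV. axis i (z $ i)) = z" for z :: "complex^'k"
    by (simp add: vec_eq_iff axis_def)
  ultimately show ?thesis by simp
qed

lemma cgrad_chain:
  fixes G :: "complex^'m \<Rightarrow> complex^'k"
  assumes "complex_differentiable_at F (G z)" "\<And>i. complex_differentiable_at (\<lambda>z. G z $ i) z"
  shows "complex_differentiable_at (\<lambda>z. F (G z)) z"
    "cgrad (\<lambda>z. F (G z)) z = (\<Sum>i\<in>UNIV. cgrad F (G z) $ i *s cgrad (\<lambda>z. G z $ i) z)"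
proof -
  have 1: "(G has_derivative (\<lambda>v. \<chi> i. pairing (cgrad (\<lambda>z. G z $ i) z) v)) (at z)"
    by (rule has_derivative_vec_componentwise)
      (simp add: complex_differentiable_has_derivative[OF assms(2)])
  have "((\<lambda>z. F (G z)) has_derivative
      (\<lambda>v. pairing (cgrad F (G z)) (\<chi> i. pairing (cgrad (\<lambda>z. G z $ i) z) v))) (at z)"
    using has_derivative_compose[OF 1 complex_differentiable_has_derivative[OF assms(1)]] .
  moreover have "pairing (cgrad F (G z)) (\<chi> i. pairing (cgrad (\<lambda>z. G z $ i) z) v) =
     pairing (\<Sum>i\<in>UNIV. cgrad F (G z) $ i *s cgrad (\<lambda>z. G z $ i) z) v" for v :: "complex^'m"
  proof -
    have "pairing (cgrad F (G z)) (\<chi> i. pairing (cgrad (\<lambda>z. G z $ i) z) v)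
        = (\<Sum>i\<in>UNIV. \<Sum>j\<in>UNIV. cgrad F (G z) $ i * (cgrad (\<lambda>z. G z $ i) z $ j * v $ j))"
      by (simp add: pairing_def sum_distrib_left)
    also have "\<dots> = (\<Sum>j\<in>UNIV. \<Sum>i\<in>UNIV. cgrad F (G z) $ i * (cgrad (\<lambda>z. G z $ i) z $ j * v $ j))"
      by (rule sum.swap)
    finally show ?thesis by (simp add: pairing_def sum_distrib_right mult.assoc)
  qed
  ultimately have "((\<lambda>z. F (G z)) has_derivative
      pairing (\<Sum>i\<in>UNIV. cgrad F (G z) $ i *s cgrad (\<lambda>z. G z $ i) z)) (at z)" by simp
  then show "complex_differentiable_at (\<lambda>z. F (G z)) z"
    "cgrad (\<lambda>z. F (G z)) z = (\<Sum>i\<in>UNIV. cgrad F (G z) $ i *s cgrad (\<lambda>z. G z $ i) z)"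
    by (auto intro: complex_differentiableI cgrad_unique)
qed

lemma complex_differentiable_transform:
  assumes "complex_differentiable_at F z" "open S" "z \<in> S" "\<And>x. x \<in> S \<Longrightarrow> F x = G x"
  shows "complex_differentiable_at G z" "cgrad G z = cgrad F z"
proof -
  have "(G has_derivative pairing (cgrad F z)) (at z)"
    using has_derivative_transform_within_open[OF complex_differentiable_has_derivative[OF assms(1)] assms(2,3)] assms(4)
    by auto
  then show "complex_differentiable_at G z" "cgrad G z = cgrad F z"
    by (auto intro: complex_differentiableI cgrad_unique)
qed

lemma complex_differentiable_shift:
  assumes "complex_differentiable_at F (a + z)"
  shows "complex_differentiable_at (\<lambda>z. F (a + z)) z" "cgrad (\<lambda>z. F (a + z)) z = cgrad F (a + z)"
proof -
  have 1: "((\<lambda>z. a + z) has_derivative (\<lambda>v. v)) (at z)" by (auto intro!: derivative_eq_intros)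
  have "((\<lambda>z. F (a + z)) has_derivative pairing (cgrad F (a + z))) (at z)"
    using has_derivative_compose[OF 1 complex_differentiable_has_derivative[OF assms]] .
  then show "complex_differentiable_at (\<lambda>z. F (a + z)) z" "cgrad (\<lambda>z. F (a + z)) z = cgrad F (a + z)"
    by (auto intro: complex_differentiableI cgrad_unique)
qed

section \<open>Cauchy's formula on coordinate lines: estimates, higher derivatives, series\<close>

lemma norm_scale_vec: "norm (s *s (v :: complex^'m)) = norm s * norm v"
  unfolding norm_vec_def L2_set_def
  by (simp add: norm_mult power_mult_distrib real_sqrt_mult flip: sum_distrib_left)

lemma norm_axis_complex: "norm (axis i (c :: complex) :: complex^'m) = norm c"
proof -
  have "(\<Sum>j\<in>UNIV. (norm ((axis i c :: complex^'m) $ j))\<^sup>2) = (\<Sum>j\<in>UNIV. if j = i then (norm c)\<^sup>2 else 0)"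
    by (rule sum.cong) (auto simp: axis_def)
  then show ?thesis unfolding norm_vec_def L2_set_def by simp
qed

lemma scale_axis: "(s :: complex) *s axis i 1 = axis i s"
  by (simp add: vec_eq_iff axis_def)

lemma norm_circlepath: "norm (circlepath 0 r t) = \<bar>r\<bar>"
  by (simp add: circlepath norm_mult)

text \<open>Cauchy's formula for the first derivative on the complex line through z in direction i.
  On the circle the velocity is 2 pi i times the circle variable, which cancels the prefactor and
  one power of the denominator. What remains is a parameter integral over [0, 1], ready for
  differentiation under the integral sign.\<close>

lemma cgrad_Cauchy_integral:
  fixes F :: "complex^'m \<Rightarrow> complex"
  assumes "r > 0" and F: "\<And>x. x \<in> cball z r \<Longrightarrow> complex_differentiable_at F x"
  shows "((\<lambda>t. F (z + axis i (circlepath 0 r t)) / circlepath 0 r t) has_integral cgrad F z $ i) {0..1}"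
proof -
  define f where "f s = F (z + s *s axis i 1)" for s
  have mem: "z + s *s axis i 1 \<in> cball z r" if "s \<in> cball 0 r" for s
    using that by (simp add: scale_axis dist_norm norm_axis_complex)
  have der: "(f has_field_derivative pairing (cgrad F (z + s *s axis i 1)) (axis i 1)) (at s)"
    if "s \<in> cball 0 r" for s
    unfolding f_def by (rule complex_differentiable_line[OF F[OF mem[OF that]]])
  have cont: "continuous_on (cball 0 r) f"
    by (meson DERIV_isCont continuous_at_imp_continuous_on der)
  have hol: "f holomorphic_on ball 0 r"
    unfolding holomorphic_on_def field_differentiable_def
    using der has_field_derivative_at_within by (metis ball_subset_cball subset_eq)
  have "deriv f 0 = cgrad F z $ i"
    unfolding f_def cgrad_def by simp
  moreover have w: "0 \<in> ball 0 r" using \<open>r > 0\<close> by simp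
  ultimately have "((\<lambda>u. f u / (u - 0)\<^sup>2) has_contour_integral (2 * pi * \<i>) * cgrad F z $ i) (circlepath 0 r)"
    using Cauchy_contour_integral_circlepath_2[OF cont hol w]
      has_contour_integral_integral[OF Cauchy_derivative_integral_circlepath(1)[OF cont hol w]] by simp
  then have "((\<lambda>t. f (circlepath 0 r t) / (circlepath 0 r t)\<^sup>2 * (2 * pi * \<i> * circlepath 0 r t))
      has_integral (2 * pi * \<i>) * cgrad F z $ i) {0..1}"
    unfolding has_contour_integral vector_derivative_circlepath by (simp add: circlepath mult.assoc)
  from has_integral_mult_right[OF this, of "1 / (2 * pi * \<i>)"]
  have "((\<lambda>t. 1 / (2 * pi * \<i>) * (f (circlepath 0 r t) / (circlepath 0 r t)\<^sup>2 * (2 * pi * \<i> * circlepath 0 r t)))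
      has_integral cgrad F z $ i) {0..1}" by simp
  moreover have "1 / (2 * pi * \<i>) * (f (circlepath 0 r t) / (circlepath 0 r t)\<^sup>2 * (2 * pi * \<i> * circlepath 0 r t))
     = F (z + axis i (circlepath 0 r t)) / circlepath 0 r t" for t
  proof -
    have "circlepath 0 r t \<noteq> 0" using norm_circlepath[of r t] \<open>r > 0\<close> by auto
    then show ?thesis by (simp add: f_def scale_axis power2_eq_square)
  qed
  ultimately show ?thesis by simp
qed

lemma cgrad_Cauchy_bound:
  fixes F :: "complex^'m \<Rightarrow> complex"
  assumes "r > 0" and F: "\<And>x. x \<in> cball z r \<Longrightarrow> complex_differentiable_at F x"
    and B: "\<And>x. x \<in> cball z r \<Longrightarrow> norm (F x) \<le> B"
  shows "norm (cgrad F z $ i) \<le> B / r"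
proof -
  have "norm (cgrad F z $ i) \<le> B / r * measure lborel (cbox 0 (1::real))"
  proof (rule has_integral_bound)
    show "((\<lambda>t. F (z + axis i (circlepath 0 r t)) / circlepath 0 r t) has_integral cgrad F z $ i) (cbox 0 1)"
      using cgrad_Cauchy_integral[OF assms(1,2)] by simp
    have "norm (F z) \<le> B" using B[of z] \<open>r > 0\<close> by simp
    then have "0 \<le> B" using norm_ge_zero[of "F z"] by linarith
    then show "0 \<le> B / r" using \<open>r > 0\<close> by simp
    show "norm (F (z + axis i (circlepath 0 r t)) / circlepath 0 r t) \<le> B / r" for t
      using B[of "z + axis i (circlepath 0 r t)"] \<open>r > 0\<close>
      by (simp add: norm_divide norm_circlepath dist_norm norm_axis_complex divide_right_mono)
  qed
  then show ?thesis by simp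
qed

text \<open>The derivative as a point of the normed space of bounded linear maps, as
  \<open>leibniz_rule\<close> and the inverse function theorem expect it. It depends linearly on the
  coefficients, so norm continuity can be checked on them.\<close>

definition pairing_blinfun :: "complex^'m \<Rightarrow> (complex^'m) \<Rightarrow>\<^sub>L complex" where
  "pairing_blinfun g = (\<Sum>i\<in>UNIV. blinfun_mult_right (g $ i) o\<^sub>L Blinfun (\<lambda>v. v $ i))"

lemma pairing_blinfun_apply: "blinfun_apply (pairing_blinfun g) = pairing g"
  by (auto simp: pairing_blinfun_def pairing_def blinfun.sum_left bounded_linear_Blinfun_apply bounded_linear_vec_nth)

lemma continuous_on_pairing_blinfun:
  assumes "\<And>i. continuous_on S (\<lambda>x. G x $ i)"
  shows "continuous_on S (\<lambda>x. pairing_blinfun (G x))"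
  unfolding pairing_blinfun_def
  by (intro continuous_intros bounded_linear.continuous_on[OF bounded_linear_blinfun_mult_right] assms)

text \<open>Differentiation under the integral asks for a gradient that is jointly continuous in t
  and z. Cauchy's formula supplies it: near z0 the gradient is an integral of G itself over a circle
  of fixed radius, and G is jointly continuous.\<close>

lemma cgrad_integral:
  fixes G :: "real \<Rightarrow> complex^'m \<Rightarrow> complex"
  assumes "open U" "z0 \<in> U" and cont: "continuous_on ({0..1} \<times> U) (\<lambda>(t, z). G t z)"
    and d: "\<And>t z. t \<in> {0..1} \<Longrightarrow> z \<in> U \<Longrightarrow> complex_differentiable_at (G t) z"
  shows "complex_differentiable_at (\<lambda>z. integral {0..1} (\<lambda>t. G t z)) z0"
    and "cgrad (\<lambda>z. integral {0..1} (\<lambda>t. G t z)) z0 $ i = integral {0..1} (\<lambda>t. cgrad (G t) z0 $ i)"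
    and "(\<lambda>t. cgrad (G t) z0 $ i) integrable_on {0..1}"
proof -
  obtain d where "d > 0" and dU: "cball z0 d \<subseteq> U"
    using assms(1,2) open_contains_cball by blast
  \<comment> \<open>Half of the available radius, so that circles of radius e around every point of
    the ball of radius e remain in U.\<close>
  define e where "e = d / 2"
  have "e > 0" using \<open>d > 0\<close> by (simp add: e_def)
  have sub: "x + axis j c \<in> U" if "x \<in> ball z0 e" "norm c \<le> e" for x j and c :: complex
  proof -
    have "dist z0 (x + axis j c) \<le> dist z0 x + norm c"
      using dist_triangle[of z0 "x + axis j c" x] by (simp add: dist_norm norm_axis_complex)
    then show ?thesis using that dU by (force simp: e_def)
  qed
  have subU: "cball x e \<subseteq> U" if "x \<in> ball z0 e" for x
  proof
    fix y assume "y \<in> cball x e"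
    then show "y \<in> U" using that dU dist_triangle[of z0 y x] by (force simp: e_def)
  qed
  have eq: "cgrad (G t) z $ j = integral {0..1} (\<lambda>s. G t (z + axis j (circlepath 0 e s)) / circlepath 0 e s)"
    if "z \<in> ball z0 e" "t \<in> {0..1}" for z t j
    using cgrad_Cauchy_integral[OF \<open>e > 0\<close>, of z "G t" j] d[OF that(2)] subU[OF that(1)]
    by (metis integral_unique subsetD)
  have c0: "circlepath 0 e s \<noteq> 0" for s using norm_circlepath[of e s] \<open>e > 0\<close> by auto
  have c1: "continuous_on X (\<lambda>x. circlepath 0 e (h x))" if "continuous_on X h" for X and h :: "'z::topological_space \<Rightarrow> real"
    unfolding circlepath by (intro continuous_intros that)
  have cax: "continuous_on X (\<lambda>x. axis j (h x) :: complex^'m)" if "continuous_on X h"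
    for X j and h :: "'z::topological_space \<Rightarrow> complex"
    using bounded_linear.continuous_on[OF bounded_linear_scale_left[of "axis j 1"] that]
    by (simp add: scale_axis)
  have cg: "continuous_on (ball z0 e \<times> {0..1}) (\<lambda>p. cgrad (G (snd p)) (fst p) $ j)" for j
  proof -
    have "continuous_on ((ball z0 e \<times> {0..1}) \<times> cbox 0 1)
      (\<lambda>(p, s). (\<lambda>(t, z). G t z) (snd p, fst p + axis j (circlepath 0 e s)) / circlepath 0 e s)"
      unfolding split_beta
      apply (intro continuous_intros continuous_on_compose2[OF cont[unfolded split_beta]] c1 cax)
      using sub c0 \<open>e > 0\<close> by (auto simp: norm_circlepath)
    from integral_continuous_on_param[OF this]
    show ?thesis
      by (rule continuous_on_eq) (auto simp: eq)
  qed
  have cgz0: "continuous_on {0..1} (\<lambda>t. cgrad (G t) z0 $ j)" for j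
  proof -
    have "continuous_on {0..1} (\<lambda>t. cgrad (G (snd (z0, t))) (fst (z0, t)) $ j)"
      by (rule continuous_on_compose2[OF cg, where f = "\<lambda>t. (z0, t)"])
        (use \<open>e > 0\<close> in \<open>auto intro!: continuous_intros\<close>)
    then show ?thesis by simp
  qed
  have int: "(\<lambda>t. pairing_blinfun (cgrad (G t) z0)) integrable_on {0..1}"
    by (intro integrable_continuous_interval continuous_on_pairing_blinfun cgz0)
  have "((\<lambda>z. integral (cbox 0 1) (\<lambda>t. G t z)) has_derivative
      blinfun_apply (integral (cbox 0 1) (\<lambda>t. pairing_blinfun (cgrad (G t) z0)))) (at z0 within ball z0 e)"
  proof (rule leibniz_rule)
    show "((\<lambda>z. G t z) has_derivative blinfun_apply (pairing_blinfun (cgrad (G t) z))) (at z within ball z0 e)"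
      if "z \<in> ball z0 e" "t \<in> cbox 0 1" for z t
    proof -
      have "z \<in> U" using subU[OF that(1)] \<open>e > 0\<close> by auto
      then show ?thesis
        unfolding pairing_blinfun_apply using that(2)
        by (intro has_derivative_at_withinI[OF complex_differentiable_has_derivative[OF d]]) auto
    qed
    show "(\<lambda>t. G t z) integrable_on cbox 0 1" if "z \<in> ball z0 e" for z
    proof -
      have "continuous_on {0..1} (\<lambda>t. (\<lambda>(t, z). G t z) (t, z))"
        using subU[OF that] \<open>e > 0\<close> by (intro continuous_on_compose2[OF cont] continuous_intros) auto
      then show ?thesis using integrable_continuous_interval by force
    qed
    show "continuous_on (ball z0 e \<times> cbox 0 1) (\<lambda>(z, t). pairing_blinfun (cgrad (G t) z))"
      using continuous_on_pairing_blinfun[OF cg] by (simp add: split_beta)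
  qed (use \<open>e > 0\<close> in auto)
  moreover have "at z0 within ball z0 e = at z0"
    by (rule at_within_open) (use \<open>e > 0\<close> in auto)
  moreover have ai: "blinfun_apply (integral {0..1} (\<lambda>t. pairing_blinfun (cgrad (G t) z0))) v
      = integral {0..1} (\<lambda>t. pairing (cgrad (G t) z0) v)" for v
    by (subst blinfun_apply_integral[OF int]) (simp only: pairing_blinfun_apply)
  moreover have lin: "integral {0..1} (\<lambda>t. pairing (cgrad (G t) z0) v)
      = pairing (\<chi> i. integral {0..1} (\<lambda>t. cgrad (G t) z0 $ i)) v" for v
  proof -
    have "(\<lambda>t. cgrad (G t) z0 $ i) integrable_on {0..1}" for i
      by (intro integrable_continuous_interval cgz0)
    then show ?thesis unfolding pairing_def
      by (subst integral_sum) (auto intro!: integrable_on_mult_left)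
  qed
  ultimately have D: "((\<lambda>z. integral {0..1} (\<lambda>t. G t z)) has_derivative
     pairing (\<chi> i. integral {0..1} (\<lambda>t. cgrad (G t) z0 $ i))) (at z0)"
    by (simp add: ai[abs_def] lin[abs_def])
  show "complex_differentiable_at (\<lambda>z. integral {0..1} (\<lambda>t. G t z)) z0"
    using D by (rule complex_differentiableI)
  show "cgrad (\<lambda>z. integral {0..1} (\<lambda>t. G t z)) z0 $ i = integral {0..1} (\<lambda>t. cgrad (G t) z0 $ i)"
    using cgrad_unique[OF D] by simp
  show "(\<lambda>t. cgrad (G t) z0 $ i) integrable_on {0..1}"
    by (intro integrable_continuous_interval cgz0)
qed

text \<open>Cauchy's formula writes the i-th partial derivative as a weighted mean of translates of
  F, which may be differentiated under the integral. The j-th derivative of this mean is the Cauchy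
  integral of the j-th partial derivative, that is, the i-th derivative of the latter. Existence and
  symmetry of second derivatives come from this one computation.\<close>

lemma cgrad_complex_differentiable:
  fixes F :: "complex^'m \<Rightarrow> complex"
  assumes "open U" and F: "\<And>z. z \<in> U \<Longrightarrow> complex_differentiable_at F z" and "z \<in> U"
  shows "complex_differentiable_at (\<lambda>z. cgrad F z $ i) z"
    and "cgrad (\<lambda>z. cgrad F z $ i) z $ j = cgrad (\<lambda>z. cgrad F z $ j) z $ i"
proof -
  have *: "complex_differentiable_at (\<lambda>z. cgrad F z $ i) z \<and> (\<exists>r>0. cball z r \<subseteq> U \<and>
      cgrad (\<lambda>z. cgrad F z $ i) z $ j =
        integral {0..1} (\<lambda>t. cgrad F (z + axis i (circlepath 0 r t)) $ j / circlepath 0 r t))"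
    if "z \<in> U" for z i j
  proof -
    obtain d where "d > 0" and dU: "cball z d \<subseteq> U"
      using \<open>open U\<close> \<open>z \<in> U\<close> open_contains_cball by blast
    define r where "r = d / 2"
    have "r > 0" using \<open>d > 0\<close> by (simp add: r_def)
    have subU: "cball x r \<subseteq> U" if "x \<in> ball z r" for x
    proof
      fix y assume "y \<in> cball x r"
      then show "y \<in> U" using that dU dist_triangle[of z y x] by (force simp: r_def)
    qed
    have c0: "circlepath 0 r s \<noteq> 0" for s using norm_circlepath[of r s] \<open>r > 0\<close> by auto
    define G where "G t x = inverse (circlepath 0 r t) * F (axis i (circlepath 0 r t) + x)" for t x
    have mem: "axis i (circlepath 0 r t) + x \<in> U" if "x \<in> ball z r" for t x
      using subU[OF that] \<open>r > 0\<close> by (auto simp: norm_circlepath norm_axis_complex dist_norm subset_iff)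
    have eq: "cgrad F x $ i = integral {0..1} (\<lambda>t. G t x)" if "x \<in> ball z r" for x
    proof -
      have "((\<lambda>t. F (x + axis i (circlepath 0 r t)) / circlepath 0 r t) has_integral cgrad F x $ i) {0..1}"
        by (rule cgrad_Cauchy_integral[OF \<open>r > 0\<close>]) (use F subU[OF that] in blast)
      then show ?thesis by (simp add: integral_unique G_def add.commute field_simps)
    qed
    have dG: "complex_differentiable_at (G t) x \<and>
       cgrad (G t) x = inverse (circlepath 0 r t) *s cgrad F (axis i (circlepath 0 r t) + x)"
      if "x \<in> ball z r" for t x
      unfolding G_def
      using cgrad_cmult[OF complex_differentiable_shift(1)] complex_differentiable_shift(2)
        F[OF mem[OF that]] by metis
    have cF: "continuous_on U F" using F complex_differentiable_continuous_on by blast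
    have c1: "continuous_on X (\<lambda>x. circlepath 0 r (h x))" if "continuous_on X h"
      for X and h :: "'z::topological_space \<Rightarrow> real"
      unfolding circlepath by (intro continuous_intros that)
    have cax: "continuous_on X (\<lambda>x. axis i (h x) :: complex^'m)" if "continuous_on X h"
      for X and h :: "'z::topological_space \<Rightarrow> complex"
      using bounded_linear.continuous_on[OF bounded_linear_scale_left[of "axis i 1"] that]
      by (simp add: scale_axis)
    have cont: "continuous_on ({0..1} \<times> ball z r) (\<lambda>(t, x). G t x)"
      unfolding G_def split_beta
      apply (intro continuous_intros continuous_on_compose2[OF cF] c1 cax)
      using mem c0 by auto
    have z: "z \<in> ball z r" using \<open>r > 0\<close> by simp
    have "complex_differentiable_at (\<lambda>x. integral {0..1} (\<lambda>t. G t x)) z"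
      by (rule cgrad_integral(1)[OF open_ball z cont]) (use dG in blast)
    from complex_differentiable_transform[OF this open_ball z] eq
    have D: "complex_differentiable_at (\<lambda>x. cgrad F x $ i) z"
       "cgrad (\<lambda>x. cgrad F x $ i) z = cgrad (\<lambda>x. integral {0..1} (\<lambda>t. G t x)) z" by metis+
    have "cgrad (\<lambda>x. cgrad F x $ i) z $ j = integral {0..1} (\<lambda>t. cgrad (G t) z $ j)"
      unfolding D(2) by (rule cgrad_integral(2)[OF open_ball z cont]) (use dG in blast)
    also have "\<dots> = integral {0..1} (\<lambda>t. cgrad F (z + axis i (circlepath 0 r t)) $ j / circlepath 0 r t)"
      using dG[OF z] by (simp add: add.commute field_simps)
    finally show ?thesis using D(1) \<open>r > 0\<close> subU[OF z] by blast
  qed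
  then show "complex_differentiable_at (\<lambda>z. cgrad F z $ i) z" using \<open>z \<in> U\<close> by blast
  obtain r where "r > 0" "cball z r \<subseteq> U" and r: "cgrad (\<lambda>z. cgrad F z $ i) z $ j =
        integral {0..1} (\<lambda>t. cgrad F (z + axis i (circlepath 0 r t)) $ j / circlepath 0 r t)"
    using *[OF \<open>z \<in> U\<close>] by blast
  note r
  also have "\<dots> = cgrad (\<lambda>z. cgrad F z $ j) z $ i"
    by (rule integral_unique, rule cgrad_Cauchy_integral[OF \<open>r > 0\<close>])
      (use * \<open>cball z r \<subseteq> U\<close> in blast)
  finally show "cgrad (\<lambda>z. cgrad F z $ i) z $ j = cgrad (\<lambda>z. cgrad F z $ j) z $ i" .
qed

lemma norm_pairing_le: "norm (pairing g v) \<le> (\<Sum>i\<in>UNIV. norm (g $ i)) * norm v"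
  unfolding pairing_def sum_distrib_right
  by (rule order_trans[OF norm_sum], rule sum_mono)
    (auto simp: norm_mult intro!: mult_left_mono Finite_Cartesian_Product.norm_nth_le)

text \<open>Cauchy's estimate on balls of a common radius e bounds the n-th gradient by B n / e, so
  domination of the functions passes to the gradients and the series may be differentiated
  termwise.\<close>

lemma cgrad_series:
  fixes F :: "nat \<Rightarrow> complex^'m \<Rightarrow> complex"
  assumes "open U" and F: "\<And>n z. z \<in> U \<Longrightarrow> complex_differentiable_at (F n) z"
    and B: "\<And>n z. z \<in> U \<Longrightarrow> norm (F n z) \<le> B n" and "summable B" and "x \<in> U"
  shows "complex_differentiable_at (\<lambda>z. \<Sum>n. F n z) x"
    and "(\<lambda>n. cgrad (F n) x $ i) sums (cgrad (\<lambda>z. \<Sum>n. F n z) x $ i)"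
proof -
  obtain d where "d > 0" and dU: "cball x d \<subseteq> U"
    using assms(1,5) open_contains_cball by blast
  define e where "e = d / 2"
  have "e > 0" using \<open>d > 0\<close> by (simp add: e_def)
  have subU: "cball y e \<subseteq> U" if "y \<in> ball x e" for y
  proof
    fix z assume "z \<in> cball y e"
    then show "z \<in> U" using that dU dist_triangle[of x z y] by (force simp: e_def)
  qed
  have bd: "norm (cgrad (F n) y $ i) \<le> B n / e" if "y \<in> ball x e" for n y i
    using cgrad_Cauchy_bound[OF \<open>e > 0\<close>, of y "F n" "B n" i] F B subU[OF that] by blast
  have sB: "summable (\<lambda>n. B n / e)" using \<open>summable B\<close> by (rule summable_divide)
  have sg: "summable (\<lambda>n. cgrad (F n) y $ i)" if "y \<in> ball x e" for y i
    using sB bd[OF that] by (rule summable_comparison_test'[of _ 0])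
  define g where "g y = (\<chi> i. \<Sum>n. cgrad (F n) y $ i)" for y
  have yU: "y \<in> U" if "y \<in> ball x e" for y using subU[OF that] \<open>e > 0\<close> by auto
  have sF: "summable (\<lambda>n. F n y)" if "y \<in> ball x e" for y
    using \<open>summable B\<close> B[OF yU[OF that]] by (rule summable_comparison_test'[of _ 0])
  have "\<exists>h. \<forall>y\<in>ball x e. (\<lambda>n. F n y) sums (h y) \<and> (h has_derivative pairing (g y)) (at y within ball x e)"
  proof (rule has_derivative_series)
    show "convex (ball x e)" by simp
    show "(F n has_derivative pairing (cgrad (F n) y)) (at y within ball x e)" if "y \<in> ball x e" for n y
      using F[OF yU[OF that]] complex_differentiable_has_derivative has_derivative_at_withinI by blast
    show "x \<in> ball x e" using \<open>e > 0\<close> by simp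
    then show "(\<lambda>n. F n x) sums (\<Sum>n. F n x)" using sF summable_sums by blast
    fix c :: real assume "c > 0"
    \<comment> \<open>The error allowed in each coordinate; the sum over all coordinates in
      \<open>norm_pairing_le\<close> turns it back into c.\<close>
    define c' where "c' = c / real CARD('m)"
    have "c' > 0" using \<open>c > 0\<close> by (simp add: c'_def)
    have "(\<lambda>n. \<Sum>k. B (k + n) / e) \<longlonglongrightarrow> 0" using suminf_exist_split2[OF sB] .
    then have "\<forall>\<^sub>F n in sequentially. (\<Sum>k. B (k + n) / e) < c'"
      using \<open>c' > 0\<close> by (rule order_tendstoD)
    then show "\<forall>\<^sub>F n in sequentially. \<forall>y\<in>ball x e. \<forall>h.
        norm ((\<Sum>k<n. pairing (cgrad (F k) y) h) - pairing (g y) h) \<le> c * norm h"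
    proof eventually_elim
      case (elim n)
      show ?case
      proof (intro ballI allI)
        fix y h assume y: "y \<in> ball x e"
        have tail: "norm ((\<Sum>k<n. cgrad (F k) y $ i) - g y $ i) \<le> c'" for i
        proof -
          have "(\<Sum>k. cgrad (F k) y $ i) = (\<Sum>k. cgrad (F (k + n)) y $ i) + (\<Sum>k<n. cgrad (F k) y $ i)"
            by (rule suminf_split_initial_segment[OF sg[OF y]])
          then have "norm ((\<Sum>k<n. cgrad (F k) y $ i) - g y $ i) = norm (\<Sum>k. cgrad (F (k + n)) y $ i)"
            by (simp add: g_def norm_minus_commute)
          also have "\<dots> \<le> (\<Sum>k. B (k + n) / e)"
            by (rule norm_suminf_le) (use bd[OF y] sB in \<open>auto simp: summable_iff_shift[of "\<lambda>n. B n / e"]\<close>)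
          finally show ?thesis using elim by simp
        qed
        have "(\<Sum>k<n. pairing (cgrad (F k) y) h) = pairing (\<Sum>k<n. cgrad (F k) y) h"
          by (induction n) (simp_all add: pairing_add_left)
        then have "(\<Sum>k<n. pairing (cgrad (F k) y) h) - pairing (g y) h
            = pairing ((\<Sum>k<n. cgrad (F k) y) - g y) h"
          using pairing_add_left[of "(\<Sum>k<n. cgrad (F k) y) - g y" "g y" h] by simp
        also have "norm \<dots> \<le> (\<Sum>i\<in>UNIV. norm (((\<Sum>k<n. cgrad (F k) y) - g y) $ i)) * norm h"
          by (rule norm_pairing_le)
        also have "\<dots> \<le> (\<Sum>i\<in>(UNIV :: 'm set). c') * norm h"
          using tail by (intro mult_right_mono sum_mono) simp_all
        also have "\<dots> = c * norm h" by (simp add: c'_def)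
        finally show "norm ((\<Sum>k<n. pairing (cgrad (F k) y) h) - pairing (g y) h) \<le> c * norm h" .
      qed
    qed
  qed
  then obtain h where h: "\<And>y. y \<in> ball x e \<Longrightarrow> (\<lambda>n. F n y) sums (h y)"
      "\<And>y. y \<in> ball x e \<Longrightarrow> (h has_derivative pairing (g y)) (at y within ball x e)" by blast
  have x: "x \<in> ball x e" using \<open>e > 0\<close> by simp
  have "(h has_derivative pairing (g x)) (at x)" using h(2)[OF x] at_within_open[OF x open_ball] by simp
  then have D: "((\<lambda>z. \<Sum>n. F n z) has_derivative pairing (g x)) (at x)"
    by (rule has_derivative_transform_within_open[OF _ open_ball x]) (use h(1) sums_unique in blast)
  then show "complex_differentiable_at (\<lambda>z. \<Sum>n. F n z) x" by (rule complex_differentiableI)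
  show "(\<lambda>n. cgrad (F n) x $ i) sums (cgrad (\<lambda>z. \<Sum>n. F n z) x $ i)"
    using summable_sums[OF sg[OF x]] cgrad_unique[OF D] by (simp add: g_def)
qed

section \<open>Invariant differential calculus for a translation action\<close>

text \<open>What local calculus uses of a torus: translations compose additively, and small ones
  keep a point inside a relatively open set. It is instantiated for the mirror complement and for
  its product with the punctured line.\<close>

locale translation_action =
  fixes \<tau> :: "complex^'m \<Rightarrow> 'g::topological_space \<Rightarrow> 'g" and M :: "'g set"
  assumes tau_zero: "p \<in> M \<Longrightarrow> \<tau> 0 p = p"
    and tau_add: "\<tau> (u + v) p = \<tau> u (\<tau> v p)"
    and tau_openin: "openin (top_of_set M) U \<Longrightarrow> p \<in> U \<Longrightarrow> \<exists>r>0. \<forall>v\<in>ball 0 r. \<tau> v p \<in> U"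
begin

lemma differential_eq_cgrad: "differential \<tau> F p = cgrad (\<lambda>v. F (\<tau> v p)) 0"
  by (simp add: differential_def inv_deriv_def cgrad_def)

lemma hol_onD: "hol_on \<tau> U F \<Longrightarrow> p \<in> U \<Longrightarrow> complex_differentiable_at (\<lambda>v. F (\<tau> v p)) 0"
  by (simp add: hol_on_def)

lemma hol_on_subset: "hol_on \<tau> U F \<Longrightarrow> V \<subseteq> U \<Longrightarrow> hol_on \<tau> V F"
  by (auto simp: hol_on_def)

lemma inv_deriv_eq:
  assumes "hol_on \<tau> U F" "p \<in> U"
  shows "inv_deriv \<tau> v F p = pairing (differential \<tau> F p) v"
  using DERIV_imp_deriv[OF cgrad_line[OF hol_onD[OF assms], of v]]
  by (simp add: inv_deriv_def differential_eq_cgrad)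

text \<open>Additivity of the translations turns the derivative at a translated point into the
  gradient at v of the function in exponential coordinates around p. Together with
  \<open>hol_on_iff_shift\<close> this moves questions near p to a ball in the Lie algebra.\<close>

lemma differential_shift:
  "differential \<tau> F (\<tau> v p) = cgrad (\<lambda>w. F (\<tau> w p)) v"
  unfolding differential_def inv_deriv_def cgrad_def by (simp add: tau_add[symmetric] add.commute)

lemma hol_on_iff_shift:
  "complex_differentiable_at (\<lambda>w. F (\<tau> w (\<tau> v p))) 0 \<longleftrightarrow> complex_differentiable_at (\<lambda>w. F (\<tau> w p)) v"
proof
  assume "complex_differentiable_at (\<lambda>w. F (\<tau> w (\<tau> v p))) 0"
  then have "complex_differentiable_at (\<lambda>w. F (\<tau> (w + v) p)) (- v + v)" by (simp add: tau_add)
  from complex_differentiable_shift(1)[OF this]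
  show "complex_differentiable_at (\<lambda>w. F (\<tau> w p)) v" by simp
next
  assume "complex_differentiable_at (\<lambda>w. F (\<tau> w p)) v"
  then have "complex_differentiable_at (\<lambda>w. F (\<tau> w p)) (v + 0)" by simp
  from complex_differentiable_shift(1)[OF this]
  show "complex_differentiable_at (\<lambda>w. F (\<tau> w (\<tau> v p))) 0"
    by (simp add: tau_add[symmetric] add.commute)
qed

lemma hol_on_const: "hol_on \<tau> U (\<lambda>_. c)" and differential_const [simp]: "differential \<tau> (\<lambda>_. c) p = 0"
  by (auto simp: hol_on_def differential_eq_cgrad)

lemma hol_on_add: "hol_on \<tau> U F \<Longrightarrow> hol_on \<tau> U G \<Longrightarrow> hol_on \<tau> U (\<lambda>p. F p + G p)"
  and hol_on_mult: "hol_on \<tau> U F \<Longrightarrow> hol_on \<tau> U G \<Longrightarrow> hol_on \<tau> U (\<lambda>p. F p * G p)"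
  and hol_on_minus: "hol_on \<tau> U F \<Longrightarrow> hol_on \<tau> U (\<lambda>p. - F p)"
  and hol_on_diff: "hol_on \<tau> U F \<Longrightarrow> hol_on \<tau> U G \<Longrightarrow> hol_on \<tau> U (\<lambda>p. F p - G p)"
  by (auto simp: hol_on_def cgrad_add cgrad_mult cgrad_minus cgrad_diff)

lemma hol_on_sum: "(\<And>i. i \<in> I \<Longrightarrow> hol_on \<tau> U (F i)) \<Longrightarrow> hol_on \<tau> U (\<lambda>p. \<Sum>i\<in>I. F i p)"
  unfolding hol_on_def by (auto intro!: cgrad_sum[THEN conjunct1])

lemma differential_add:
  assumes "hol_on \<tau> U F" "hol_on \<tau> U G" "p \<in> U" "p \<in> M"
  shows "differential \<tau> (\<lambda>p. F p + G p) p = differential \<tau> F p + differential \<tau> G p"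
  using assms by (simp add: differential_eq_cgrad cgrad_add hol_onD)

lemma differential_mult:
  assumes "hol_on \<tau> U F" "hol_on \<tau> U G" "p \<in> U" "p \<in> M"
  shows "differential \<tau> (\<lambda>p. F p * G p) p = F p *s differential \<tau> G p + G p *s differential \<tau> F p"
  using assms by (simp add: differential_eq_cgrad cgrad_mult hol_onD tau_zero)

lemma differential_sum:
  assumes "\<And>i. i \<in> I \<Longrightarrow> hol_on \<tau> U (F i)" "p \<in> U"
  shows "differential \<tau> (\<lambda>p. \<Sum>i\<in>I. F i p) p = (\<Sum>i\<in>I. differential \<tau> (F i) p)"
  unfolding differential_eq_cgrad using assms hol_onD by (intro cgrad_sum[THEN conjunct2]) blast

lemma hol_on_differential:
  assumes U: "openin (top_of_set M) U" and F: "hol_on \<tau> U F"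
  shows "hol_on \<tau> U (\<lambda>p. differential \<tau> F p $ i)"
    and "p \<in> U \<Longrightarrow> differential \<tau> (\<lambda>p. differential \<tau> F p $ i) p $ j
      = differential \<tau> (\<lambda>p. differential \<tau> F p $ j) p $ i"
proof -
  have *: "\<exists>r>0. \<forall>v\<in>ball 0 r. complex_differentiable_at (\<lambda>w. F (\<tau> w p)) v" if p: "p \<in> U" for p
  proof -
    obtain r where "r > 0" "\<forall>v\<in>ball 0 r. \<tau> v p \<in> U" using tau_openin[OF U p] by blast
    then show ?thesis using F hol_on_iff_shift unfolding hol_on_def by blast
  qed
  show "hol_on \<tau> U (\<lambda>p. differential \<tau> F p $ i)"
    unfolding hol_on_def differential_shift
    using * cgrad_complex_differentiable(1)[OF open_ball] centre_in_ball by metis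
  assume "p \<in> U"
  from *[OF this] obtain r where "r > 0" "\<forall>v\<in>ball 0 r. complex_differentiable_at (\<lambda>w. F (\<tau> w p)) v" by blast
  then show "differential \<tau> (\<lambda>p. differential \<tau> F p $ i) p $ j
      = differential \<tau> (\<lambda>p. differential \<tau> F p $ j) p $ i"
    unfolding differential_eq_cgrad[of "\<lambda>p. differential \<tau> F p $ _"] differential_shift
    using cgrad_complex_differentiable(2)[OF open_ball, of 0 r "\<lambda>w. F (\<tau> w p)" 0 i j] by auto
qed

lemma openin_subset_M: "openin (top_of_set M) U \<Longrightarrow> U \<subseteq> M"
  using openin_subset by fastforce

text \<open>In the invariant frame the connection is one matrix \<open>N i\<close> per direction,
  and \<open>flat\<close> is the coordinate form of dN + N N = 0, written as symmetry in i and i'.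
  It makes the second covariant derivative in invariant directions symmetric; for general vector
  fields the derivatives of their coefficients are absorbed by the bracket.\<close>

lemma flat_connectionI:
  fixes N :: "'m \<Rightarrow> 'm \<Rightarrow> 'm \<Rightarrow> 'g \<Rightarrow> complex"
  assumes Omega: "\<And>p \<phi> u j. \<Omega> p \<phi> u (axis j 1) = (\<Sum>i\<in>UNIV. u $ i * (\<Sum>k\<in>UNIV. N i j k p * \<phi> $ k))"
    and hol: "\<And>i j k. hol_on \<tau> M (N i j k)"
    and flat: "\<And>p i i' j l. p \<in> M \<Longrightarrow>
       differential \<tau> (N i' j l) p $ i + (\<Sum>k\<in>UNIV. N i j k p * N i' k l p)
     = differential \<tau> (N i j l) p $ i' + (\<Sum>k\<in>UNIV. N i' j k p * N i k l p)"
  shows "flat_connection \<tau> M \<Omega>"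
  unfolding flat_connection_def
proof (intro allI impI ballI)
  fix U X Y \<zeta> p
  assume *: "openin (top_of_set M) U \<and> hol_vec_on \<tau> U X \<and> hol_vec_on \<tau> U Y \<and> hol_vec_on \<tau> U \<zeta>"
    and "p \<in> U"
  then have U: "openin (top_of_set M) U" by blast
  have UM: "U \<subseteq> M" using openin_subset_M[OF U] .
  with \<open>p \<in> U\<close> have "p \<in> M" by blast
  have X: "hol_on \<tau> U (\<lambda>q. X q $ i)" and Y: "hol_on \<tau> U (\<lambda>q. Y q $ i)" and Z: "hol_on \<tau> U (\<lambda>q. \<zeta> q $ i)" for i
    using * by (auto simp: hol_vec_on_def)
  have N: "hol_on \<tau> U (N i j k)" for i j k using hol UM by (rule hol_on_subset)
  \<comment> \<open>Components of the covariant derivative of \<open>\<zeta>\<close> in the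
    invariant direction i; \<open>S\<close> below plays the same role for the second covariant
    derivative.\<close>
  define D where "D i j q = differential \<tau> (\<lambda>q. \<zeta> q $ j) q $ i + (\<Sum>k\<in>UNIV. N i j k q * \<zeta> q $ k)" for i j q
  have D: "hol_on \<tau> U (D i j)" for i j
    unfolding D_def by (intro hol_on_add hol_on_sum hol_on_mult N Z hol_on_differential(1)[OF U])
  have cov: "cov_deriv \<tau> \<Omega> W \<zeta> q = (\<chi> j. \<Sum>i\<in>UNIV. W q $ i * D i j q)" if "q \<in> U" for W q
    using inv_deriv_eq[OF Z that]
    by (simp add: cov_deriv_def inv_deriv_vec_def vec_eq_iff Omega D_def pairing_def algebra_simps sum.distrib)
  define S where "S i i' j = differential \<tau> (D i' j) p $ i + (\<Sum>k\<in>UNIV. N i j k p * D i' k p)" for i i' j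
  have cov2: "cov_deriv \<tau> \<Omega> W (cov_deriv \<tau> \<Omega> V \<zeta>) p $ j = (\<Sum>i\<in>UNIV. \<Sum>i'\<in>UNIV.
      W p $ i * differential \<tau> (\<lambda>q. V q $ i') p $ i * D i' j p + W p $ i * V p $ i' * S i i' j)"
    if V: "\<And>i. hol_on \<tau> U (\<lambda>q. V q $ i)" for V W j
  proof -
    have h: "hol_on \<tau> U (\<lambda>q. \<Sum>i\<in>UNIV. V q $ i * D i j q)" for j
      by (intro hol_on_sum hol_on_mult V D)
    \<comment> \<open>The coordinate formula \<open>cov\<close> is known on U only. It may be
      differentiated because a ball of translates of each point of U lies in U.\<close>
    have eq: "differential \<tau> (\<lambda>q. cov_deriv \<tau> \<Omega> V \<zeta> q $ j) p = differential \<tau> (\<lambda>q. \<Sum>i\<in>UNIV. V q $ i * D i j q) p"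
      and hc: "hol_on \<tau> U (\<lambda>q. cov_deriv \<tau> \<Omega> V \<zeta> q $ j)" for j
    proof -
      have "complex_differentiable_at (\<lambda>v. cov_deriv \<tau> \<Omega> V \<zeta> (\<tau> v q) $ j) 0 \<and>
        differential \<tau> (\<lambda>q. cov_deriv \<tau> \<Omega> V \<zeta> q $ j) q = differential \<tau> (\<lambda>q. \<Sum>i\<in>UNIV. V q $ i * D i j q) q"
        if q: "q \<in> U" for q
      proof -
        obtain r where r: "r > 0" "\<forall>v\<in>ball 0 r. \<tau> v q \<in> U" using tau_openin[OF U q] by blast
        then have eqv: "v \<in> ball 0 r \<Longrightarrow> (\<Sum>i\<in>UNIV. V (\<tau> v q) $ i * D i j (\<tau> v q)) = cov_deriv \<tau> \<Omega> V \<zeta> (\<tau> v q) $ j" for v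
          using cov by simp
        have "0 \<in> ball 0 r" using r(1) by simp
        from complex_differentiable_transform[OF hol_onD[OF h q] open_ball this eqv]
        show ?thesis unfolding differential_eq_cgrad by blast
      qed
      then show "differential \<tau> (\<lambda>q. cov_deriv \<tau> \<Omega> V \<zeta> q $ j) p = differential \<tau> (\<lambda>q. \<Sum>i\<in>UNIV. V q $ i * D i j q) p"
        "hol_on \<tau> U (\<lambda>q. cov_deriv \<tau> \<Omega> V \<zeta> q $ j)" using \<open>p \<in> U\<close> by (auto simp: hol_on_def)
    qed
    have "differential \<tau> (\<lambda>q. \<Sum>i\<in>UNIV. V q $ i * D i j q) p
       = (\<Sum>i\<in>UNIV. V p $ i *s differential \<tau> (D i j) p + D i j p *s differential \<tau> (\<lambda>q. V q $ i) p)"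
      using differential_sum[of UNIV U "\<lambda>i q. V q $ i * D i j q" p] V D \<open>p \<in> U\<close> \<open>p \<in> M\<close>
      by (simp add: hol_on_mult differential_mult[OF V D])
    then have "cov_deriv \<tau> \<Omega> W (cov_deriv \<tau> \<Omega> V \<zeta>) p $ j = (\<Sum>i\<in>UNIV. W p $ i * (
         (\<Sum>i'\<in>UNIV. V p $ i' * differential \<tau> (D i' j) p $ i + D i' j p * differential \<tau> (\<lambda>q. V q $ i') p $ i)
        + (\<Sum>k\<in>UNIV. N i j k p * (\<Sum>i'\<in>UNIV. V p $ i' * D i' k p))))"
      unfolding cov_deriv_def[of \<tau> \<Omega> W "cov_deriv \<tau> \<Omega> V \<zeta>"] inv_deriv_vec_def
      using inv_deriv_eq[OF hc \<open>p \<in> U\<close>] eq cov[OF \<open>p \<in> U\<close>]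
      by (simp add: Omega pairing_def algebra_simps sum.distrib)
    note cov_eq = this
    have swap: "(\<Sum>k\<in>UNIV. N i j k p * (\<Sum>i'\<in>UNIV. V p $ i' * D i' k p))
        = (\<Sum>i'\<in>UNIV. V p $ i' * (\<Sum>k\<in>UNIV. N i j k p * D i' k p))" for i
      unfolding sum_distrib_left by (subst sum.swap) (simp add: algebra_simps)
    show ?thesis
      unfolding cov_eq swap sum.distrib[symmetric] sum_distrib_left[of "W p $ _"]
      by (intro sum.cong refl) (simp add: S_def algebra_simps)
  qed
  have dD: "differential \<tau> (D i' j) p $ i = differential \<tau> (\<lambda>q. differential \<tau> (\<lambda>q. \<zeta> q $ j) q $ i') p $ i
      + (\<Sum>k\<in>UNIV. N i' j k p * differential \<tau> (\<lambda>q. \<zeta> q $ k) p $ i + \<zeta> p $ k * differential \<tau> (N i' j k) p $ i)" for i i' j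
  proof -
    have "differential \<tau> (D i' j) p = differential \<tau> (\<lambda>q. differential \<tau> (\<lambda>q. \<zeta> q $ j) q $ i') p
      + differential \<tau> (\<lambda>q. \<Sum>k\<in>UNIV. N i' j k q * \<zeta> q $ k) p"
      unfolding D_def
      by (rule differential_add) (auto intro!: hol_on_sum hol_on_mult N Z hol_on_differential(1)[OF U] \<open>p \<in> U\<close> \<open>p \<in> M\<close>)
    also have "differential \<tau> (\<lambda>q. \<Sum>k\<in>UNIV. N i' j k q * \<zeta> q $ k) p
       = (\<Sum>k\<in>UNIV. differential \<tau> (\<lambda>q. N i' j k q * \<zeta> q $ k) p)"
      by (rule differential_sum) (auto intro!: hol_on_mult N Z \<open>p \<in> U\<close>)
    finally show ?thesis by (simp add: differential_mult[OF N Z \<open>p \<in> U\<close> \<open>p \<in> M\<close>])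
  qed
  \<comment> \<open>Sorted by the order of derivatives of \<open>\<zeta>\<close>: the second-order
    term is symmetric as a mixed derivative, the first-order sum is visibly symmetric in i and i',
    and the coefficient of \<open>\<zeta>\<close> is symmetric by \<open>flat\<close>.\<close>
  have S_expand: "S i i' j = differential \<tau> (\<lambda>q. differential \<tau> (\<lambda>q. \<zeta> q $ j) q $ i') p $ i
      + (\<Sum>k\<in>UNIV. N i' j k p * differential \<tau> (\<lambda>q. \<zeta> q $ k) p $ i + N i j k p * differential \<tau> (\<lambda>q. \<zeta> q $ k) p $ i')
      + (\<Sum>l\<in>UNIV. \<zeta> p $ l * (differential \<tau> (N i' j l) p $ i + (\<Sum>k\<in>UNIV. N i j k p * N i' k l p)))" for i i' j
  proof -
    have "(\<Sum>k\<in>UNIV. N i j k p * (\<Sum>l\<in>UNIV. N i' k l p * \<zeta> p $ l))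
       = (\<Sum>l\<in>UNIV. \<zeta> p $ l * (\<Sum>k\<in>UNIV. N i j k p * N i' k l p))"
      unfolding sum_distrib_left by (subst sum.swap) (simp add: algebra_simps)
    then show ?thesis
      unfolding S_def dD by (simp add: D_def algebra_simps sum.distrib)
  qed
  have sym: "S i i' j = S i' i j" for i i' j
    unfolding S_expand flat[OF \<open>p \<in> M\<close>, of i' j _ i]
    using hol_on_differential(2)[OF U Z \<open>p \<in> U\<close>, of j i' i] by (simp add: algebra_simps)
  have lie: "lie_bracket \<tau> X Y p $ i' = (\<Sum>i\<in>UNIV. X p $ i * differential \<tau> (\<lambda>q. Y q $ i') p $ i
       - Y p $ i * differential \<tau> (\<lambda>q. X q $ i') p $ i)" for i'
    unfolding lie_bracket_def inv_deriv_vec_def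
    using inv_deriv_eq[OF X \<open>p \<in> U\<close>] inv_deriv_eq[OF Y \<open>p \<in> U\<close>]
    by (simp add: pairing_def algebra_simps sum_subtractf)
  \<comment> \<open>In the commutator the symmetric \<open>S\<close> cancels; the terms that
    differentiate the coefficients of X and Y are those of the bracket.\<close>
  have "cov_deriv \<tau> \<Omega> X (cov_deriv \<tau> \<Omega> Y \<zeta>) p $ j - cov_deriv \<tau> \<Omega> Y (cov_deriv \<tau> \<Omega> X \<zeta>) p $ j
      = cov_deriv \<tau> \<Omega> (lie_bracket \<tau> X Y) \<zeta> p $ j" for j
  proof -
    have "(\<Sum>i\<in>UNIV. \<Sum>i'\<in>UNIV. X p $ i * Y p $ i' * S i i' j) = (\<Sum>i\<in>UNIV. \<Sum>i'\<in>UNIV. Y p $ i * X p $ i' * S i i' j)"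
      by (subst sum.swap, intro sum.cong refl, subst sym) (simp add: mult.commute)
    moreover have "(\<Sum>i'\<in>UNIV. lie_bracket \<tau> X Y p $ i' * D i' j p)
      = (\<Sum>i\<in>UNIV. \<Sum>i'\<in>UNIV. X p $ i * differential \<tau> (\<lambda>q. Y q $ i') p $ i * D i' j p)
      - (\<Sum>i\<in>UNIV. \<Sum>i'\<in>UNIV. Y p $ i * differential \<tau> (\<lambda>q. X q $ i') p $ i * D i' j p)"
      unfolding lie sum_distrib_right left_diff_distrib sum_subtractf
      by (intro arg_cong2[where f = minus]; rule sum.swap)
    ultimately show ?thesis
      by (simp add: cov2[OF X] cov2[OF Y] cov[OF \<open>p \<in> U\<close>] sum.distrib)
  qed
  then show "curvature \<tau> \<Omega> X Y \<zeta> p = 0"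
    by (simp add: curvature_def vec_eq_iff)
qed

end

section \<open>Integrable Pfaffian systems\<close>

lemma complex_differentiable_scale:
  assumes "complex_differentiable_at F (c *s z)"
  shows "complex_differentiable_at (\<lambda>z. F (c *s z)) z" "cgrad (\<lambda>z. F (c *s z)) z = c *s cgrad F (c *s z)"
proof -
  have "((\<lambda>z. F (c *s z)) has_derivative (\<lambda>v. pairing (cgrad F (c *s z)) (c *s v))) (at z)"
    using has_derivative_compose[OF bounded_linear_imp_has_derivative[OF bounded_linear_scale_right]
      complex_differentiable_has_derivative[OF assms]] .
  moreover have "pairing (cgrad F (c *s z)) (c *s v) = pairing (c *s cgrad F (c *s z)) v" for v
    by (simp add: pairing_scale_left pairing_scale_right)
  ultimately have "((\<lambda>z. F (c *s z)) has_derivative pairing (c *s cgrad F (c *s z))) (at z)" by simp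
  then show "complex_differentiable_at (\<lambda>z. F (c *s z)) z" "cgrad (\<lambda>z. F (c *s z)) z = c *s cgrad F (c *s z)"
    by (auto intro: complex_differentiableI cgrad_unique)
qed

text \<open>Gronwall's argument: the sum of the squared norms, weighted by exp (-2 C s) with C the
  sum of bounds for all matrix entries, is nonincreasing, nonnegative and zero at the start.\<close>

lemma linear_ode_zero:
  fixes y :: "'k::finite \<Rightarrow> real \<Rightarrow> complex"
  assumes A: "\<And>p q. continuous_on {0..1} (A p q)"
    and y: "\<And>p s. s \<in> {0..1} \<Longrightarrow> (y p has_vector_derivative (\<Sum>q\<in>UNIV. A p q s * y q s)) (at s)"
    and y0: "\<And>p. y p 0 = 0" and s: "s \<in> {0..1}"
  shows "y p s = 0"
proof -
  have "\<exists>K\<ge>0. \<forall>t\<in>{0..1}. norm (A p q t) \<le> K" for p q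
    using compact_imp_bounded[OF compact_continuous_image[OF A compact_Icc, of p q]]
    by (metis bounded_pos imageI less_imp_le)
  then obtain K where K: "\<And>p q. K p q \<ge> 0" "\<And>p q t. t \<in> {0..1} \<Longrightarrow> norm (A p q t) \<le> K p q" by metis
  define C where "C = (\<Sum>p\<in>UNIV. \<Sum>q\<in>UNIV. K p q)"
  define g where "g t = exp (- 2 * C * t) * (\<Sum>p\<in>UNIV. y p t \<bullet> y p t)" for t
  have N: "norm (\<Sum>p\<in>UNIV. y p t \<bullet> (\<Sum>q\<in>UNIV. A p q t * y q t)) \<le> C * (\<Sum>p\<in>UNIV. y p t \<bullet> y p t)"
    if t: "t \<in> {0..1}" for t
  proof -
    define S where "S = (\<Sum>p\<in>UNIV. y p t \<bullet> y p t)"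
    \<comment> \<open>A product of two norms is at most the square of the larger one, and that
      square is a summand of S.\<close>
    have yS: "norm (y p t) * norm (y q t) \<le> S" for p q
    proof -
      have pp: "(norm (y p t))\<^sup>2 \<le> S" for p
        unfolding S_def power2_norm_eq_inner by (rule member_le_sum) auto
      show ?thesis
      proof (cases "norm (y p t) \<le> norm (y q t)")
        case True
        then have "norm (y p t) * norm (y q t) \<le> (norm (y q t))\<^sup>2"
          by (simp add: power2_eq_square mult_right_mono)
        then show ?thesis using pp[of q] by linarith
      next
        case False
        then have "norm (y p t) * norm (y q t) \<le> (norm (y p t))\<^sup>2"
          by (simp add: power2_eq_square mult_left_mono)
        then show ?thesis using pp[of p] by linarith
      qed
    qed
    have "norm (\<Sum>p\<in>UNIV. y p t \<bullet> (\<Sum>q\<in>UNIV. A p q t * y q t))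
        \<le> (\<Sum>p\<in>UNIV. norm (\<Sum>q\<in>UNIV. y p t \<bullet> (A p q t * y q t)))"
      unfolding inner_sum_right by (rule norm_sum)
    also have "\<dots> \<le> (\<Sum>p\<in>UNIV. \<Sum>q\<in>UNIV. norm (y p t \<bullet> (A p q t * y q t)))"
      by (intro sum_mono norm_sum)
    also have "\<dots> \<le> (\<Sum>p\<in>UNIV. \<Sum>q\<in>UNIV. K p q * S)"
    proof (intro sum_mono)
      fix p q
      have "norm (y p t \<bullet> (A p q t * y q t)) \<le> norm (y p t) * (norm (A p q t) * norm (y q t))"
        using Cauchy_Schwarz_ineq2[of "y p t" "A p q t * y q t"] by (simp add: norm_mult)
      also have "\<dots> = norm (A p q t) * (norm (y p t) * norm (y q t))" by simp
      also have "\<dots> \<le> K p q * S" by (intro mult_mono K t yS) auto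
      finally show "norm (y p t \<bullet> (A p q t * y q t)) \<le> K p q * S" .
    qed
    finally show ?thesis by (simp add: C_def S_def sum_distrib_right)
  qed
  have "g s \<le> g 0"
  proof (rule DERIV_nonpos_imp_nonincreasing[where f = g])
    fix t assume "0 \<le> t" "t \<le> s"
    then have t: "t \<in> {0..1}" using s by auto
    define Y' where "Y' p = (\<Sum>q\<in>UNIV. A p q t * y q t)" for p
    have inn: "((\<lambda>t. y p t \<bullet> y p t) has_real_derivative 2 * (y p t \<bullet> Y' p)) (at t)" for p
    proof -
      have d: "(y p has_derivative (\<lambda>h. h *\<^sub>R Y' p)) (at t)"
        using y[OF t, of p] by (simp add: Y'_def has_vector_derivative_def)
      have "((\<lambda>t. y p t \<bullet> y p t) has_derivative (\<lambda>h. y p t \<bullet> (h *\<^sub>R Y' p) + (h *\<^sub>R Y' p) \<bullet> y p t)) (at t)"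
        by (rule has_derivative_inner[OF d d])
      moreover have "(\<lambda>h. y p t \<bullet> (h *\<^sub>R Y' p) + (h *\<^sub>R Y' p) \<bullet> y p t) = (*) (2 * (y p t \<bullet> Y' p))"
        by (auto simp: inner_commute)
      ultimately show ?thesis by (simp add: has_field_derivative_def)
    qed
    have "(g has_real_derivative (exp (- 2 * C * t) * (\<Sum>p\<in>UNIV. 2 * (y p t \<bullet> Y' p))
         + (exp (- 2 * C * t) * (- 2 * C)) * (\<Sum>p\<in>UNIV. y p t \<bullet> y p t))) (at t)"
      unfolding g_def by (rule DERIV_mult' derivative_eq_intros inn refl | simp)+
    moreover have "exp (- 2 * C * t) * (\<Sum>p\<in>UNIV. 2 * (y p t \<bullet> Y' p))
         + (exp (- 2 * C * t) * (- 2 * C)) * (\<Sum>p\<in>UNIV. y p t \<bullet> y p t)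
      = 2 * exp (- 2 * C * t) * ((\<Sum>p\<in>UNIV. y p t \<bullet> Y' p) - C * (\<Sum>p\<in>UNIV. y p t \<bullet> y p t))"
      by (simp add: sum_distrib_left[symmetric] algebra_simps)
    moreover have "(\<Sum>p\<in>UNIV. y p t \<bullet> Y' p) \<le> C * (\<Sum>p\<in>UNIV. y p t \<bullet> y p t)"
      using N[OF t] unfolding Y'_def real_norm_def by linarith
    ultimately show "\<exists>d. (g has_real_derivative d) (at t) \<and> d \<le> 0"
      by (smt (verit) exp_gt_zero mult_nonneg_nonpos)
  qed (use s in auto)
  moreover have "g 0 = 0" by (simp add: g_def y0)
  ultimately have "exp (- 2 * C * s) * (\<Sum>p\<in>UNIV. y p s \<bullet> y p s) \<le> 0" by (simp add: g_def)
  then have "(\<Sum>p\<in>UNIV. y p s \<bullet> y p s) \<le> 0" by (simp add: mult_le_0_iff not_le)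
  moreover have "y p s \<bullet> y p s \<le> (\<Sum>p\<in>UNIV. y p s \<bullet> y p s)" by (rule member_le_sum) auto
  ultimately have "y p s \<bullet> y p s = 0" using inner_ge_zero[of "y p s"] by linarith
  then show ?thesis by simp
qed

lemma has_vector_derivative_segment:
  assumes "complex_differentiable_at F (z + of_real s *s v)"
  shows "((\<lambda>s. F (z + of_real s *s v)) has_vector_derivative pairing (cgrad F (z + of_real s *s v)) v) (at s)"
  using has_vector_derivative_real_field[OF complex_differentiable_line[OF assms]] .

text \<open>On the segment from x to z, which stays in S by convexity, the system restricts to a
  linear ordinary differential equation with initial value zero.\<close>

lemma pfaffian_unique:
  fixes \<Theta> :: "'m \<Rightarrow> 'k::finite \<Rightarrow> 'k \<Rightarrow> complex^'m \<Rightarrow> complex"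
  assumes "convex S" and T: "\<And>j p q z. z \<in> S \<Longrightarrow> complex_differentiable_at (\<Theta> j p q) z"
    and Y: "\<And>p z. z \<in> S \<Longrightarrow> complex_differentiable_at (Y p) z"
    and eq: "\<And>j p z. z \<in> S \<Longrightarrow> cgrad (Y p) z $ j = (\<Sum>q\<in>UNIV. \<Theta> j p q z * Y q z)"
    and "x \<in> S" "\<And>p. Y p x = 0" "z \<in> S"
  shows "Y p z = 0"
proof -
  define \<gamma> where "\<gamma> s = x + of_real s *s (z - x)" for s
  have mem: "\<gamma> s \<in> S" if "s \<in> {0..1}" for s
  proof -
    have "\<gamma> s = (1 - s) *\<^sub>R x + s *\<^sub>R z" by (simp add: \<gamma>_def scaleR_vec_eq vec_eq_iff algebra_simps)
    then show ?thesis using convexD_alt[OF \<open>convex S\<close> \<open>x \<in> S\<close> \<open>z \<in> S\<close>, of s] that by simp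
  qed
  have cont: "continuous_on {0..1} (\<lambda>s. \<Theta> j p q (\<gamma> s))" for j p q
  proof (rule continuous_on_compose2[where f = \<gamma> and g = "\<Theta> j p q"])
    show "continuous_on S (\<Theta> j p q)" using T by (rule complex_differentiable_continuous_on)
    show "continuous_on {0..1} \<gamma>" unfolding \<gamma>_def scaleR_vec_eq[symmetric] by (intro continuous_intros)
  qed (use mem in auto)
  have "Y p (\<gamma> 1) = 0"
  proof (rule linear_ode_zero[where A = "\<lambda>p q s. \<Sum>j\<in>UNIV. (z - x) $ j * \<Theta> j p q (\<gamma> s)" and y = "\<lambda>p s. Y p (\<gamma> s)"])
    show "continuous_on {0..1} (\<lambda>s. \<Sum>j\<in>UNIV. (z - x) $ j * \<Theta> j p q (\<gamma> s))" for p q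
      by (intro continuous_intros cont)
    show "((\<lambda>s. Y p (\<gamma> s)) has_vector_derivative
        (\<Sum>q\<in>UNIV. (\<Sum>j\<in>UNIV. (z - x) $ j * \<Theta> j p q (\<gamma> s)) * Y q (\<gamma> s))) (at s)" if s: "s \<in> {0..1}" for p s
    proof -
      have "((\<lambda>s. Y p (\<gamma> s)) has_vector_derivative pairing (cgrad (Y p) (\<gamma> s)) (z - x)) (at s)"
        unfolding \<gamma>_def by (rule has_vector_derivative_segment) (use Y mem[OF s] in \<open>simp add: \<gamma>_def\<close>)
      moreover have "pairing (cgrad (Y p) (\<gamma> s)) (z - x)
         = (\<Sum>q\<in>UNIV. (\<Sum>j\<in>UNIV. (z - x) $ j * \<Theta> j p q (\<gamma> s)) * Y q (\<gamma> s))"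
        unfolding pairing_def eq[OF mem[OF s]] sum_distrib_right
        by (subst sum.swap) (simp add: algebra_simps)
      ultimately show ?thesis by simp
    qed
    show "Y p (\<gamma> 0) = 0" for p using assms(6) by (simp add: \<gamma>_def)
  qed auto
  then show ?thesis by (simp add: \<gamma>_def)
qed

text \<open>The homotopy operator of the Poincare lemma: the 1-form with coefficients h is
  integrated along the segment from 0 to v.\<close>

definition radial_integral :: "('m \<Rightarrow> complex^'m \<Rightarrow> complex) \<Rightarrow> complex^'m \<Rightarrow> complex" where
  "radial_integral h v = integral {0..1} (\<lambda>t. \<Sum>j\<in>UNIV. v $ j * h j (of_real t *s v))"

text \<open>The radial derivative of the integrand is the derivative in t of t times the integrand,
  so the fundamental theorem of calculus evaluates the radial derivative of the integral. The result
  is the contraction of the form with the radial field, whether or not the form is closed; the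
  iteration in \<open>frobenius\<close> relies on this and on the bound.\<close>

lemma radial_integral:
  fixes h :: "'m \<Rightarrow> complex^'m \<Rightarrow> complex"
  assumes h: "\<And>j z. z \<in> ball 0 r \<Longrightarrow> complex_differentiable_at (h j) z" and v: "v \<in> ball 0 r"
  shows "complex_differentiable_at (radial_integral h) v"
    and "pairing (cgrad (radial_integral h) v) v = (\<Sum>j\<in>UNIV. v $ j * h j v)"
    and "(\<And>j z. z \<in> ball 0 r \<Longrightarrow> norm (h j z) \<le> c) \<Longrightarrow> norm (radial_integral h v) \<le> r * real CARD('m) * c"
proof -
  define G where "G t v = (\<Sum>j\<in>UNIV. v $ j * h j (of_real t *s v))" for t v
  have mem: "of_real t *s z \<in> ball 0 r" if "t \<in> {0..1}" "z \<in> ball 0 r" for t and z :: "complex^'m"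
  proof -
    have "\<bar>t\<bar> * norm z \<le> norm z" using that(1) by (auto intro: mult_left_le_one_le)
    then show ?thesis using that by (simp add: norm_scale_vec)
  qed
  have ch: "continuous_on (ball 0 r) (h j)" for j using h by (rule complex_differentiable_continuous_on)
  have cont: "continuous_on ({0..1} \<times> ball 0 r) (\<lambda>(t, z). G t z)"
    unfolding G_def split_beta scaleR_vec_eq[symmetric]
    by (intro continuous_intros continuous_on_compose2[OF ch])
       (use mem in \<open>auto simp: scaleR_vec_eq\<close>)
  have dG: "complex_differentiable_at (G t) z \<and> cgrad (G t) z =
      (\<Sum>j\<in>UNIV. (z $ j * of_real t) *s cgrad (h j) (of_real t *s z) + h j (of_real t *s z) *s axis j 1)"
    if "t \<in> {0..1}" "z \<in> ball 0 r" for t z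
  proof -
    note sc = complex_differentiable_scale[OF h[OF mem[OF that]]]
    have "complex_differentiable_at (\<lambda>v. v $ j * h j (of_real t *s v)) z" for j
      by (intro cgrad_mult cgrad_nth sc)
    moreover have "cgrad (\<lambda>v. v $ j * h j (of_real t *s v)) z =
       (z $ j * of_real t) *s cgrad (h j) (of_real t *s z) + h j (of_real t *s z) *s axis j 1" for j
      by (subst cgrad_mult(2)[OF cgrad_nth(1) sc(1)]) (simp add: sc(2) mult.assoc)
    ultimately show ?thesis
      unfolding G_def using cgrad_sum[of UNIV "\<lambda>j v. v $ j * h j (of_real t *s v)" z] by simp
  qed
  have eqG: "radial_integral h = (\<lambda>v. integral {0..1} (\<lambda>t. G t v))"
    by (auto simp: radial_integral_def G_def)
  have I: "complex_differentiable_at (\<lambda>z. integral {0..1} (\<lambda>t. G t z)) v"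
    "cgrad (\<lambda>z. integral {0..1} (\<lambda>t. G t z)) v $ i = integral {0..1} (\<lambda>t. cgrad (G t) v $ i)"
    "(\<lambda>t. cgrad (G t) v $ i) integrable_on {0..1}" for i
    by (rule cgrad_integral[OF open_ball v cont]; use dG in blast)+
  show "complex_differentiable_at (radial_integral h) v" unfolding eqG by (rule I(1))
  have "pairing (cgrad (radial_integral h) v) v = (\<Sum>i\<in>UNIV. integral {0..1} (\<lambda>t. cgrad (G t) v $ i * v $ i))"
    unfolding eqG pairing_def by (simp add: I(2))
  also have "\<dots> = integral {0..1} (\<lambda>t. pairing (cgrad (G t) v) v)"
    unfolding pairing_def by (rule integral_sum[symmetric]) (auto intro!: integrable_on_mult_left I(3))
  also have "\<dots> = G 1 v"
  proof (rule integral_unique)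
    have "((\<lambda>t. pairing (cgrad (G t) v) v) has_integral of_real 1 * G 1 v - of_real 0 * G 0 v) {0..1}"
    proof (rule fundamental_theorem_of_calculus)
      fix t :: real assume t: "t \<in> {0..1}"
      have hj: "((\<lambda>t. h j (of_real t *s v)) has_vector_derivative pairing (cgrad (h j) (of_real t *s v)) v) (at t)" for j
        using has_vector_derivative_segment[of "h j" 0 t v] h[OF mem[OF t v]] by simp
      have "((\<lambda>t. of_real t * G t v) has_vector_derivative
          (of_real t * (\<Sum>j\<in>UNIV. v $ j * pairing (cgrad (h j) (of_real t *s v)) v) + 1 * G t v)) (at t)"
        unfolding G_def
        by (intro has_vector_derivative_mult has_vector_derivative_sum has_vector_derivative_mult_right hj
             has_vector_derivative_of_real[of "\<lambda>t. t" 1, simplified])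
      moreover have "of_real t * (\<Sum>j\<in>UNIV. v $ j * pairing (cgrad (h j) (of_real t *s v)) v) + 1 * G t v
          = pairing (cgrad (G t) v) v"
      proof -
        have "pairing (\<Sum>j\<in>UNIV. X j) v = (\<Sum>j\<in>UNIV. pairing (X j) v)" for X :: "'m \<Rightarrow> complex^'m"
          by (simp add: pairing_def sum_distrib_right) (rule sum.swap)
        then show ?thesis
          using dG[OF t v] by (simp add: pairing_add_left pairing_scale_left sum.distrib sum_distrib_left G_def mult.assoc mult.left_commute[of "of_real t"] mult.commute[of "h _ _"])
      qed
      ultimately show "((\<lambda>t. of_real t * G t v) has_vector_derivative pairing (cgrad (G t) v) v) (at t within {0..1})"
        using has_vector_derivative_at_within by metis
    qed simp
    then show "((\<lambda>t. pairing (cgrad (G t) v) v) has_integral G 1 v) {0..1}" by simp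
  qed
  finally show "pairing (cgrad (radial_integral h) v) v = (\<Sum>j\<in>UNIV. v $ j * h j v)" by (simp add: G_def)
  assume c: "\<And>j z. z \<in> ball 0 r \<Longrightarrow> norm (h j z) \<le> c"
  have "norm (integral {0..1} (\<lambda>t. G t v)) \<le> r * real CARD('m) * c * (1 - 0)"
  proof (rule integral_bound)
    show "continuous_on {0..1} (\<lambda>t. G t v)"
    proof -
      have "continuous_on {0..1} (\<lambda>t. (\<lambda>(t, z). G t z) (t, v))"
        by (rule continuous_on_compose2[OF cont]) (use v in \<open>auto intro!: continuous_intros\<close>)
      then show ?thesis by simp
    qed
    fix t :: real assume t: "t \<in> {0..1}"
    have "norm (G t v) \<le> (\<Sum>j\<in>(UNIV :: 'm set). r * c)"
      unfolding G_def
    proof (rule sum_norm_le)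
      fix j
      have "norm (v $ j) \<le> r" using Finite_Cartesian_Product.norm_nth_le[of v j] v by simp
      moreover have "0 \<le> r" using v by (simp add: le_less_trans[OF norm_ge_zero] less_imp_le)
      ultimately show "norm (v $ j * h j (of_real t *s v)) \<le> r * c"
        using c[OF mem[OF t v]] by (simp add: norm_mult mult_mono)
    qed
    then show "norm (G t v) \<le> r * real CARD('m) * c" by (simp add: algebra_simps)
  qed simp
  then show "norm (radial_integral h v) \<le> r * real CARD('m) * c" by (simp add: eqG)
qed

text \<open>Picard iteration along rays solves the radial component of the system. Integrability
  then makes the defect of the full system obey a homogeneous linear equation along each ray, which
  forces it to vanish. The contraction factor comes from the matrix alone, so one radius serves
  every initial value.\<close>

theorem frobenius:
  fixes \<Theta> :: "'m \<Rightarrow> 'k::finite \<Rightarrow> 'k \<Rightarrow> complex^'m \<Rightarrow> complex"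
  assumes "R > 0" and hol: "\<And>j p q z. z \<in> ball 0 R \<Longrightarrow> complex_differentiable_at (\<Theta> j p q) z"
    and flat: "\<And>i j p q z. z \<in> ball 0 R \<Longrightarrow>
       cgrad (\<Theta> j p q) z $ i + (\<Sum>k\<in>UNIV. \<Theta> j p k z * \<Theta> i k q z)
     = cgrad (\<Theta> i p q) z $ j + (\<Sum>k\<in>UNIV. \<Theta> i p k z * \<Theta> j k q z)"
  obtains r where "0 < r" "r \<le> R"
    "\<And>y0 :: complex^'k. \<exists>Y. (\<forall>p. \<forall>z\<in>ball 0 r. complex_differentiable_at (Y p) z) \<and> (\<forall>p. Y p 0 = y0 $ p)
       \<and> (\<forall>p j. \<forall>z\<in>ball 0 r. cgrad (Y p) z $ j = (\<Sum>q\<in>UNIV. \<Theta> j p q z * Y q z))"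
proof -
  have "\<exists>K>0. \<forall>z\<in>cball 0 (R/2). norm (\<Theta> j p q z) \<le> K" for j p q
  proof -
    have "continuous_on (cball 0 (R/2)) (\<Theta> j p q)"
      using hol \<open>R > 0\<close> by (intro complex_differentiable_continuous_on) auto
    from compact_imp_bounded[OF compact_continuous_image[OF this compact_cball]]
    show ?thesis by (metis bounded_pos imageI)
  qed
  then obtain K where K: "\<And>j p q. K j p q > 0"
      "\<And>j p q z. z \<in> cball 0 (R/2) \<Longrightarrow> norm (\<Theta> j p q z) \<le> K j p q" by metis
  define C where "C = (\<Sum>j\<in>UNIV. \<Sum>p\<in>UNIV. \<Sum>q\<in>UNIV. K j p q)"
  have KC: "K j p q \<le> C" for j p q
  proof -
    have "K j p q \<le> (\<Sum>q\<in>UNIV. K j p q)" by (rule member_le_sum) (use K in \<open>auto simp: less_imp_le\<close>)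
    also have "\<dots> \<le> (\<Sum>p\<in>UNIV. \<Sum>q\<in>UNIV. K j p q)"
      by (rule member_le_sum) (use K in \<open>auto simp: less_imp_le intro!: sum_nonneg\<close>)
    also have "\<dots> \<le> C" unfolding C_def
      by (rule member_le_sum) (use K in \<open>auto simp: less_imp_le intro!: sum_nonneg\<close>)
    finally show ?thesis .
  qed
  have "C > 0" using KC K(1) by (rule less_le_trans[rotated])
  define L where "L = real CARD('m) * (real CARD('k) * C)"
  have "L > 0" using \<open>C > 0\<close> by (simp add: L_def)
  \<comment> \<open>R/2 keeps the closed ball inside the domain, where \<open>\<Theta>\<close> is
    bounded; 1/(2 L) makes each step of the iteration contract by 1/2.\<close>
  define r where "r = min (R/2) (1 / (2 * L))"
  have "0 < r" "r \<le> R" using \<open>R > 0\<close> \<open>L > 0\<close> by (auto simp: r_def)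
  have "r * L \<le> 1 / (2 * L) * L" using \<open>L > 0\<close> unfolding r_def by (intro mult_right_mono) auto
  then have rL: "r * L \<le> 1/2" using \<open>L > 0\<close> by simp
  have inR: "z \<in> ball 0 R" "z \<in> cball 0 (R/2)" if "z \<in> ball 0 r" for z :: "complex^'m"
    using that \<open>R > 0\<close> by (auto simp: r_def)
  show ?thesis
  proof
    show "0 < r" "r \<le> R" by fact+
    fix y0 :: "complex^'k"
    \<comment> \<open>The n-th term of the Picard series, not its partial sum: each term is the
      radial integral of \<open>\<Theta>\<close> applied to the preceding term, and the solution is
      the sum of all terms.\<close>
    define E where "E = rec_nat (\<lambda>p z. y0 $ p)
       (\<lambda>_ E p. radial_integral (\<lambda>j z. \<Sum>q\<in>UNIV. \<Theta> j p q z * E q z))"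
    have E0: "E 0 p z = y0 $ p" for p z by (simp add: E_def)
    have ESuc: "E (Suc n) p = radial_integral (\<lambda>j z. \<Sum>q\<in>UNIV. \<Theta> j p q z * E n q z)" for n p
      by (simp add: E_def)
    define B where "B = (\<Sum>p\<in>UNIV. norm (y0 $ p))"
    have "B \<ge> 0" by (simp add: B_def sum_nonneg)
    have step: "complex_differentiable_at (\<lambda>z. \<Sum>q\<in>UNIV. \<Theta> j p q z * F q z) z"
      if "\<And>q. complex_differentiable_at (F q) z" "z \<in> ball 0 r" for F :: "'k \<Rightarrow> complex^'m \<Rightarrow> complex" and j p z
      by (intro cgrad_sum[THEN conjunct1] cgrad_mult(1) hol inR that)
    have E: "(\<forall>p. \<forall>z\<in>ball 0 r. complex_differentiable_at (E n p) z) \<and>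
        (\<forall>p. \<forall>z\<in>ball 0 r. norm (E n p z) \<le> B * (1/2)^n)" for n
    proof (induction n)
      case 0
      have "norm (y0 $ p) \<le> B" for p unfolding B_def by (rule member_le_sum) auto
      moreover have "E 0 p = (\<lambda>_. y0 $ p)" for p using E0 by blast
      ultimately show ?case by simp
    next
      case (Suc n)
      have "norm (E (Suc n) p z) \<le> B * (1/2)^Suc n" if z: "z \<in> ball 0 r" for p z
      proof -
        have "norm (E (Suc n) p z) \<le> r * real CARD('m) * (real CARD('k) * (C * (B * (1/2)^n)))"
          unfolding ESuc
        proof (rule radial_integral(3)[OF _ z])
          show "complex_differentiable_at (\<lambda>z. \<Sum>q\<in>UNIV. \<Theta> j p q z * E n q z) z" if "z \<in> ball 0 r" for j z
            using Suc that by (intro step) auto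
          fix j and z :: "complex^'m" assume z: "z \<in> ball 0 r"
          have "norm (\<Sum>q\<in>UNIV. \<Theta> j p q z * E n q z) \<le> (\<Sum>q\<in>(UNIV :: 'k set). C * (B * (1/2)^n))"
          proof (rule sum_norm_le)
            fix q
            have "norm (\<Theta> j p q z) \<le> C" using K(2)[OF inR(2)[OF z]] KC order_trans by blast
            then show "norm (\<Theta> j p q z * E n q z) \<le> C * (B * (1/2)^n)"
              unfolding norm_mult using Suc z \<open>C > 0\<close> by (intro mult_mono) auto
          qed
          then show "norm (\<Sum>q\<in>UNIV. \<Theta> j p q z * E n q z) \<le> real CARD('k) * (C * (B * (1/2)^n))" by simp
        qed
        also have "\<dots> = (r * L) * (B * (1/2)^n)" by (simp add: L_def)
        also have "\<dots> \<le> 1/2 * (B * (1/2)^n)" using rL \<open>B \<ge> 0\<close> by (intro mult_right_mono) auto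
        finally show ?thesis by simp
      qed
      moreover have "complex_differentiable_at (E (Suc n) p) z" if "z \<in> ball 0 r" for p z
        unfolding ESuc
      proof (rule radial_integral(1)[OF _ that])
        show "complex_differentiable_at (\<lambda>z. \<Sum>q\<in>UNIV. \<Theta> j p q z * E n q z) z" if "z \<in> ball 0 r" for j z
          using Suc that by (intro step) auto
      qed
      ultimately show ?case by (intro conjI allI ballI)
    qed
    have Ed: "\<And>n p z. z \<in> ball 0 r \<Longrightarrow> complex_differentiable_at (E n p) z"
      and Eb: "\<And>n p z. z \<in> ball 0 r \<Longrightarrow> norm (E n p z) \<le> B * (1/2)^n" using E by blast+
    have sB: "summable (\<lambda>n. B * (1/2)^n)" by (intro summable_mult summable_geometric) simp
    define Y where "Y p z = (\<Sum>n. E n p z)" for p z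
    have Esums: "(\<lambda>n. E n p z) sums Y p z" if "z \<in> ball 0 r" for p z
      unfolding Y_def by (rule summable_sums, rule summable_comparison_test'[OF sB Eb[OF that]])
    have Yd: "complex_differentiable_at (Y p) z"
      and Yg: "(\<lambda>n. cgrad (E n p) z $ i) sums (cgrad (Y p) z $ i)" if "z \<in> ball 0 r" for p z i
      unfolding Y_def[abs_def] by (rule cgrad_series[OF open_ball Ed Eb sB that]; assumption)+
    \<comment> \<open>Taking radial derivatives shifts the series by one index, and the zeroth term
      is constant. Only the contraction with the radial field is obtained in this way.\<close>
    have Euler: "(\<Sum>j\<in>UNIV. z $ j * cgrad (Y p) z $ j) = (\<Sum>j\<in>UNIV. z $ j * (\<Sum>q\<in>UNIV. \<Theta> j p q z * Y q z))"
      if z: "z \<in> ball 0 r" for p z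
    proof -
      have "(\<lambda>n. pairing (cgrad (E n p) z) z) sums pairing (cgrad (Y p) z) z"
        unfolding pairing_def by (intro sums_sum sums_mult2 Yg z)
      moreover have "pairing (cgrad (E 0 p) z) z = 0"
      proof -
        have "E 0 p = (\<lambda>_. y0 $ p)" using E0 by blast
        then show ?thesis by simp
      qed
      ultimately have "(\<lambda>n. pairing (cgrad (E (Suc n) p) z) z) sums pairing (cgrad (Y p) z) z"
        using sums_Suc_iff[of "\<lambda>n. pairing (cgrad (E n p) z) z"] by simp
      moreover have "pairing (cgrad (E (Suc n) p) z) z = (\<Sum>j\<in>UNIV. z $ j * (\<Sum>q\<in>UNIV. \<Theta> j p q z * E n q z))" for n
        unfolding ESuc by (rule radial_integral(2)[OF _ z], rule step, rule Ed)
      moreover have "(\<lambda>n. \<Sum>j\<in>UNIV. z $ j * (\<Sum>q\<in>UNIV. \<Theta> j p q z * E n q z)) sums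
          (\<Sum>j\<in>UNIV. z $ j * (\<Sum>q\<in>UNIV. \<Theta> j p q z * Y q z))"
        by (intro sums_sum sums_mult Esums z)
      ultimately have "pairing (cgrad (Y p) z) z = (\<Sum>j\<in>UNIV. z $ j * (\<Sum>q\<in>UNIV. \<Theta> j p q z * Y q z))"
        using sums_unique2 by simp
      then show ?thesis by (simp add: pairing_def mult.commute)
    qed
    \<comment> \<open>The defect of the equation. By \<open>Euler\<close> its radial contraction
      vanishes.\<close>
    define Z where "Z k p z = cgrad (Y p) z $ k - (\<Sum>q\<in>UNIV. \<Theta> k p q z * Y q z)" for k p z
    have Ycd: "complex_differentiable_at (\<lambda>z. cgrad (Y p) z $ k) z"
      and Ysym: "cgrad (\<lambda>z. cgrad (Y p) z $ k) z $ j = cgrad (\<lambda>z. cgrad (Y p) z $ j) z $ k"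
      if "z \<in> ball 0 r" for p k j z
      using cgrad_complex_differentiable[OF open_ball Yd that] by blast+
    have Zd: "complex_differentiable_at (Z k p) z" if "z \<in> ball 0 r" for k p z
      unfolding Z_def by (intro cgrad_diff(1) Ycd step Yd that)
    have ZE: "(\<Sum>j\<in>UNIV. z $ j * Z j p z) = 0" if "z \<in> ball 0 r" for p z
      using Euler[OF that] by (simp add: Z_def right_diff_distrib sum_subtractf)
    \<comment> \<open>Differentiating \<open>ZE\<close> in direction k expresses \<open>Z k\<close>
      through the k-th derivatives of the other components, which \<open>curl\<close> exchanges for
      radial derivatives of \<open>Z k\<close>.\<close>
    have Zder: "Z k p z + (\<Sum>j\<in>UNIV. z $ j * cgrad (Z j p) z $ k) = 0" if z: "z \<in> ball 0 r" for k p z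
    proof -
      have "cgrad (\<lambda>z. \<Sum>j\<in>UNIV. z $ j * Z j p z) z = 0"
        using complex_differentiable_transform(2)[OF cgrad_const(1) open_ball z, of 0 "\<lambda>z. \<Sum>j\<in>UNIV. z $ j * Z j p z"] ZE by simp
      moreover have "cgrad (\<lambda>z. \<Sum>j\<in>UNIV. z $ j * Z j p z) z
          = (\<Sum>j\<in>UNIV. z $ j *s cgrad (Z j p) z + Z j p z *s axis j 1)"
        using cgrad_sum[of UNIV "\<lambda>j z. z $ j * Z j p z" z] cgrad_mult[OF cgrad_nth(1) Zd[OF z]] by simp
      ultimately have "(\<Sum>j\<in>UNIV. z $ j *s cgrad (Z j p) z + Z j p z *s axis j 1) $ k = 0" by simp
      then show ?thesis by (simp add: sum.distrib axis_def if_distrib add.commute cong: if_cong)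
    qed
    have dZ: "cgrad (Z j p) z $ k = cgrad (\<lambda>z. cgrad (Y p) z $ j) z $ k
        - (\<Sum>q\<in>UNIV. \<Theta> j p q z * cgrad (Y q) z $ k + Y q z * cgrad (\<Theta> j p q) z $ k)" if z: "z \<in> ball 0 r" for j p k z
    proof -
      have "cgrad (Z j p) z = cgrad (\<lambda>z. cgrad (Y p) z $ j) z - cgrad (\<lambda>z. \<Sum>q\<in>UNIV. \<Theta> j p q z * Y q z) z"
        unfolding Z_def by (intro cgrad_diff(2) Ycd step Yd z)
      also have "cgrad (\<lambda>z. \<Sum>q\<in>UNIV. \<Theta> j p q z * Y q z) z
         = (\<Sum>q\<in>UNIV. \<Theta> j p q z *s cgrad (Y q) z + Y q z *s cgrad (\<Theta> j p q) z)"
        using cgrad_sum[of UNIV "\<lambda>q z. \<Theta> j p q z * Y q z" z] cgrad_mult[OF hol[OF inR(1)[OF z]] Yd[OF z]] by simp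
      finally show ?thesis by simp
    qed
    \<comment> \<open>The defect is closed up to terms linear in itself: second derivatives of Y
      cancel by symmetry, and the terms containing Y undifferentiated cancel by
      \<open>flat\<close>.\<close>
    have curl: "cgrad (Z j p) z $ k = cgrad (Z k p) z $ j - (\<Sum>q\<in>UNIV. \<Theta> j p q z * Z k q z)
        + (\<Sum>q\<in>UNIV. \<Theta> k p q z * Z j q z)" if z: "z \<in> ball 0 r" for j p k z
    proof -
      have 1: "(\<Sum>q\<in>UNIV. \<Theta> j p q z * cgrad (Y q) z $ k) = (\<Sum>q\<in>UNIV. \<Theta> j p q z * Z k q z)
          + (\<Sum>q\<in>UNIV. Y q z * (\<Sum>l\<in>UNIV. \<Theta> j p l z * \<Theta> k l q z))" for j k
      proof -
        have "(\<Sum>q\<in>UNIV. \<Theta> j p q z * (\<Sum>l\<in>UNIV. \<Theta> k q l z * Y l z))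
           = (\<Sum>l\<in>UNIV. Y l z * (\<Sum>q\<in>UNIV. \<Theta> j p q z * \<Theta> k q l z))"
          unfolding sum_distrib_left by (subst sum.swap) (simp add: algebra_simps)
        then show ?thesis by (simp add: Z_def algebra_simps sum_subtractf)
      qed
      have "cgrad (Z j p) z $ k = cgrad (\<lambda>z. cgrad (Y p) z $ j) z $ k - (\<Sum>q\<in>UNIV. \<Theta> j p q z * Z k q z)
         - (\<Sum>q\<in>UNIV. Y q z * (cgrad (\<Theta> j p q) z $ k + (\<Sum>l\<in>UNIV. \<Theta> j p l z * \<Theta> k l q z)))" for j k
        unfolding dZ[OF z] sum.distrib 1 distrib_left by (simp add: algebra_simps)
      note e = this
      show ?thesis
        unfolding e[of j k] e[of k j] flat[OF inR(1)[OF z], of j p _ k] Ysym[OF z, of p j k] by simp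
    qed
    have radial: "Z k p z + pairing (cgrad (Z k p) z) z = (\<Sum>q\<in>UNIV. (\<Sum>j\<in>UNIV. z $ j * \<Theta> j p q z) * Z k q z)"
      if z: "z \<in> ball 0 r" for k p z
    proof -
      have a: "(\<Sum>j\<in>UNIV. z $ j * (\<Sum>q\<in>UNIV. \<Theta> k p q z * Z j q z)) = 0"
      proof -
        have "(\<Sum>j\<in>UNIV. z $ j * (\<Sum>q\<in>UNIV. \<Theta> k p q z * Z j q z))
           = (\<Sum>q\<in>UNIV. \<Theta> k p q z * (\<Sum>j\<in>UNIV. z $ j * Z j q z))"
          unfolding sum_distrib_left by (subst sum.swap) (simp add: algebra_simps)
        then show ?thesis using ZE[OF z] by simp
      qed
      have b: "(\<Sum>j\<in>UNIV. z $ j * (\<Sum>q\<in>UNIV. \<Theta> j p q z * Z k q z))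
          = (\<Sum>q\<in>UNIV. (\<Sum>j\<in>UNIV. z $ j * \<Theta> j p q z) * Z k q z)"
        unfolding sum_distrib_left sum_distrib_right by (subst sum.swap) (simp add: algebra_simps)
      have "(\<Sum>j\<in>UNIV. z $ j * cgrad (Z j p) z $ k) = (\<Sum>j\<in>UNIV. z $ j * cgrad (Z k p) z $ j)
         - (\<Sum>j\<in>UNIV. z $ j * (\<Sum>q\<in>UNIV. \<Theta> j p q z * Z k q z))
         + (\<Sum>j\<in>UNIV. z $ j * (\<Sum>q\<in>UNIV. \<Theta> k p q z * Z j q z))"
        unfolding curl[OF z, where k = k] distrib_left right_diff_distrib sum.distrib sum_subtractf ..
      moreover have "pairing (cgrad (Z k p) z) z = (\<Sum>j\<in>UNIV. z $ j * cgrad (Z k p) z $ j)"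
        by (simp add: pairing_def mult.commute)
      moreover have "Z k p z = - (\<Sum>j\<in>UNIV. z $ j * cgrad (Z j p) z $ k)"
        using Zder[OF z, of k p] by (simp add: eq_neg_iff_add_eq_0)
      ultimately show ?thesis using a b by simp
    qed
    \<comment> \<open>The function s Z(s z) starts at zero, and its derivative in s is the left-hand
      side of \<open>radial\<close> at s z. So the linear equation it satisfies along the ray is
      homogeneous.\<close>
    have Z0: "Z k p z = 0" if z: "z \<in> ball 0 r" for k p z
    proof -
      have mem: "of_real s *s z \<in> ball 0 r" if "s \<in> {0..1}" for s
      proof -
        have "\<bar>s\<bar> * norm z \<le> norm z" using that by (auto intro: mult_left_le_one_le)
        then show ?thesis using z by (simp add: norm_scale_vec)
      qed
      have cont: "continuous_on {0..1} (\<lambda>s. \<Theta> j p q (of_real s *s z))" for j p q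
      proof (rule continuous_on_compose2[where f = "\<lambda>s. of_real s *s z" and g = "\<Theta> j p q"])
        show "continuous_on (ball 0 r) (\<Theta> j p q)"
          using hol[OF inR(1)] by (rule complex_differentiable_continuous_on)
        show "continuous_on {0..1} (\<lambda>s. of_real s *s z)"
          unfolding scaleR_vec_eq[symmetric] by (intro continuous_intros)
      qed (use mem in auto)
      have "of_real 1 * Z k p (of_real 1 *s z) = 0"
      proof (rule linear_ode_zero[where A = "\<lambda>p q s. \<Sum>j\<in>UNIV. z $ j * \<Theta> j p q (of_real s *s z)"
            and y = "\<lambda>p s. of_real s * Z k p (of_real s *s z)"])
        show "continuous_on {0..1} (\<lambda>s. \<Sum>j\<in>UNIV. z $ j * \<Theta> j p q (of_real s *s z))" for p q
          by (intro continuous_intros cont)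
        fix p and s :: real assume s: "s \<in> {0..1}"
        have "((\<lambda>s. Z k p (of_real s *s z)) has_vector_derivative pairing (cgrad (Z k p) (of_real s *s z)) z) (at s)"
          using has_vector_derivative_segment[of "Z k p" 0 s z] Zd[OF mem[OF s]] by simp
        from has_vector_derivative_mult[OF has_vector_derivative_of_real[of "\<lambda>t. t" 1, simplified] this]
        have "((\<lambda>s. of_real s * Z k p (of_real s *s z)) has_vector_derivative
            (of_real s * pairing (cgrad (Z k p) (of_real s *s z)) z + Z k p (of_real s *s z))) (at s)" by simp
        moreover have "of_real s * pairing (cgrad (Z k p) (of_real s *s z)) z + Z k p (of_real s *s z)
           = (\<Sum>q\<in>UNIV. (\<Sum>j\<in>UNIV. z $ j * \<Theta> j p q (of_real s *s z)) * (of_real s * Z k q (of_real s *s z)))"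
          using radial[OF mem[OF s], of k p]
          by (simp add: pairing_scale_right sum_distrib_left sum_distrib_right algebra_simps)
        ultimately show "((\<lambda>s. of_real s * Z k p (of_real s *s z)) has_vector_derivative
           (\<Sum>q\<in>UNIV. (\<Sum>j\<in>UNIV. z $ j * \<Theta> j p q (of_real s *s z)) * (of_real s * Z k q (of_real s *s z)))) (at s)"
          by simp
      qed auto
      then show ?thesis by simp
    qed
    have "E (Suc n) p 0 = 0" for n p by (simp add: ESuc radial_integral_def)
    then have "Y p 0 = y0 $ p" for p
    proof -
      have "(\<lambda>n. E n p 0) sums (y0 $ p)"
        using sums_Suc_iff[of "\<lambda>n. E n p 0" 0] \<open>\<And>n p. E (Suc n) p 0 = 0\<close> by (simp add: E0)
      then show ?thesis using Esums[of 0 p] \<open>0 < r\<close> sums_unique2 by auto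
    qed
    then show "\<exists>Y. (\<forall>p. \<forall>z\<in>ball 0 r. complex_differentiable_at (Y p) z) \<and> (\<forall>p. Y p 0 = y0 $ p)
       \<and> (\<forall>p j. \<forall>z\<in>ball 0 r. cgrad (Y p) z $ j = (\<Sum>q\<in>UNIV. \<Theta> j p q z * Y q z))"
      using Yd Z0 by (intro exI[of _ Y]) (simp add: Z_def)
  qed
qed

section \<open>Invariant tensors of a root system\<close>

lemma scaleR_complex: "r *\<^sub>R (z :: complex) = of_real r * z"
  by (rule scaleR_conv_of_real)

lemma reflection_apply: "reflection \<alpha> *v x = x - (\<alpha> \<bullet> x) *\<^sub>R coroot \<alpha>"
proof -
  have "linear (\<lambda>x. x - (\<alpha> \<bullet> x) *\<^sub>R coroot \<alpha>)"
    by (rule linearI) (simp_all add: inner_add_right algebra_simps)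
  then show ?thesis unfolding reflection_def by (simp add: matrix_works)
qed

lemma inner_coroot_self: "\<alpha> \<noteq> 0 \<Longrightarrow> \<alpha> \<bullet> coroot \<alpha> = 2"
  by (simp add: coroot_def)

lemma reflection_self: "\<alpha> \<noteq> 0 \<Longrightarrow> reflection \<alpha> *v \<alpha> = - \<alpha>"
  by (simp add: reflection_apply coroot_def scaleR_2)

lemma reflection_orthogonal: "\<alpha> \<bullet> x = 0 \<Longrightarrow> reflection \<alpha> *v x = x"
  by (simp add: reflection_apply)

text \<open>With the coroot moved to the scalar factor, the coefficient is the Cartan integer when
  both arguments are roots.\<close>

lemma reflection_root: "reflection \<alpha> *v \<beta> = \<beta> - (\<beta> \<bullet> coroot \<alpha>) *\<^sub>R \<alpha>"
  by (simp add: reflection_apply coroot_def inner_commute)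

lemma reflection_inner: "(reflection \<alpha> *v x) \<bullet> (reflection \<alpha> *v y) = x \<bullet> y"
proof (cases "\<alpha> = 0")
  case False
  then show ?thesis
    by (simp add: reflection_apply coroot_def inner_diff_left inner_diff_right inner_commute)
qed (simp add: reflection_apply coroot_def)

lemma reflection_involution: "reflection \<alpha> *v (reflection \<alpha> *v x) = x"
proof (cases "\<alpha> = 0")
  case False
  then have "reflection \<alpha> *v (reflection \<alpha> *v x) = x - (\<alpha> \<bullet> x) *\<^sub>R coroot \<alpha> - (\<alpha> \<bullet> x - (\<alpha> \<bullet> x) * 2) *\<^sub>R coroot \<alpha>"
    using inner_coroot_self[OF False] unfolding reflection_apply by (simp add: inner_diff_right)
  then show ?thesis by (simp add: algebra_simps)
qed (simp add: reflection_apply coroot_def)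

lemma reflection_scale: "reflection \<alpha> *v (c *\<^sub>R x) = c *\<^sub>R (reflection \<alpha> *v x)"
  by (simp add: reflection_apply algebra_simps)

lemma reflection_coroot: "reflection \<gamma> *v coroot \<beta> = coroot (reflection \<gamma> *v \<beta>)"
  by (simp add: coroot_def reflection_scale reflection_inner)

locale root_sys =
  fixes R :: "(real^'n) set"
  assumes root_system: "root_system R"
begin

lemma finite_R: "finite R" and nonzero: "\<alpha> \<in> R \<Longrightarrow> \<alpha> \<noteq> 0" and span_R: "span R = UNIV"
  and reflection_closed: "\<alpha> \<in> R \<Longrightarrow> \<beta> \<in> R \<Longrightarrow> reflection \<alpha> *v \<beta> \<in> R"
  and integral: "\<alpha> \<in> R \<Longrightarrow> \<beta> \<in> R \<Longrightarrow> \<beta> \<bullet> coroot \<alpha> \<in> \<int>"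
  using root_system unfolding root_system_def by auto

lemma uminus_closed: "\<alpha> \<in> R \<Longrightarrow> - \<alpha> \<in> R"
  by (metis reflection_closed reflection_self nonzero)

lemma bij_reflection: "\<gamma> \<in> R \<Longrightarrow> bij_betw (\<lambda>\<beta>. reflection \<gamma> *v \<beta>) R R"
  by (rule bij_betwI[where g = "\<lambda>\<beta>. reflection \<gamma> *v \<beta>"]) (auto simp: reflection_closed reflection_involution)

lemma linear_zero_on_roots:
  fixes f :: "real^'n \<Rightarrow> complex"
  assumes "linear f" "\<And>\<alpha>. \<alpha> \<in> R \<Longrightarrow> f \<alpha> = 0"
  shows "f x = 0"
  using linear_eq_0_on_span[OF assms(1), of R x] assms(2) span_R by auto

lemma linear_eq_on_roots:
  fixes f g :: "real^'n \<Rightarrow> complex"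
  assumes "linear f" "linear g" "\<And>\<alpha>. \<alpha> \<in> R \<Longrightarrow> f \<alpha> = g \<alpha>"
  shows "f x = g x"
  using linear_eq_on_span[OF assms(1,2), of R x] assms(3) span_R by auto

end

section \<open>Reflection-invariant trilinear forms and their total symmetry\<close>

definition orth_part :: "real^'n \<Rightarrow> real^'n \<Rightarrow> real^'n" where
  "orth_part \<alpha> v = v - ((\<alpha> \<bullet> v) / (\<alpha> \<bullet> \<alpha>)) *\<^sub>R \<alpha>"

lemma orth_part: "\<alpha> \<noteq> 0 \<Longrightarrow> \<alpha> \<bullet> orth_part \<alpha> v = 0" "v = ((\<alpha> \<bullet> v) / (\<alpha> \<bullet> \<alpha>)) *\<^sub>R \<alpha> + orth_part \<alpha> v"
  by (auto simp: orth_part_def inner_diff_right)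

text \<open>\<open>T\<close> stands for the tensor of b with its last index lowered by the Euclidean
  structure: \<open>sym12\<close> comes from the symmetry of b and \<open>inv\<close> from its
  equivariance.\<close>

locale inv_trilinear = root_sys R for R :: "(real^'n) set" +
  fixes T :: "real^'n \<Rightarrow> real^'n \<Rightarrow> real^'n \<Rightarrow> complex"
  assumes lin1: "linear (\<lambda>u. T u v w)" and lin2: "linear (\<lambda>v. T u v w)" and lin3: "linear (\<lambda>w. T u v w)"
    and sym12: "T u v w = T v u w"
    and inv: "\<alpha> \<in> R \<Longrightarrow> T (reflection \<alpha> *v u) (reflection \<alpha> *v v) (reflection \<alpha> *v w) = T u v w"
begin

lemmas T_add = linear_add[OF lin1] linear_add[OF lin2] linear_add[OF lin3]
lemmas T_scale = linear_scale[OF lin1] linear_scale[OF lin2] linear_scale[OF lin3]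
lemmas T_neg = linear_neg[OF lin1] linear_neg[OF lin2] linear_neg[OF lin3]

definition "skew x y z = T x y z - T x z y"

lemma skew_lin: "linear (\<lambda>x. skew x y z)" "linear (\<lambda>y. skew x y z)" "linear (\<lambda>z. skew x y z)"
  unfolding skew_def by (auto intro!: linear_compose_sub lin1 lin2 lin3)

lemmas skew_add = linear_add[OF skew_lin(1)] linear_add[OF skew_lin(2)] linear_add[OF skew_lin(3)]
lemmas skew_scale = linear_scale[OF skew_lin(1)] linear_scale[OF skew_lin(2)] linear_scale[OF skew_lin(3)]
lemmas skew_diff = linear_diff[OF skew_lin(1)] linear_diff[OF skew_lin(2)] linear_diff[OF skew_lin(3)]
lemmas skew_neg = linear_neg[OF skew_lin(1)] linear_neg[OF skew_lin(2)] linear_neg[OF skew_lin(3)]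

lemma skew_self: "skew x y y = 0" and skew_swap: "skew x z y = - skew x y z"
  by (simp_all add: skew_def)

lemma skew_inv: "\<alpha> \<in> R \<Longrightarrow> skew (reflection \<alpha> *v u) (reflection \<alpha> *v v) (reflection \<alpha> *v w) = skew u v w"
  by (simp add: skew_def inv)

text \<open>Reflecting in \<beta> relates the value at (\<alpha>, \<alpha>, \<beta>) to the one at
  (\<beta>, \<beta>, \<alpha>), with a Cartan integer as factor. Going there and back multiplies by
  m/4, where m is the product of both Cartan integers, so the value is zero unless m = 4. In that
  case equality holds in Cauchy-Schwarz, the roots are proportional and antisymmetry
  applies.\<close>

lemma skew_roots:
  assumes "\<alpha> \<in> R" "\<beta> \<in> R"
  shows "skew \<alpha> \<alpha> \<beta> = 0"
proof -
  have two: "2 *\<^sub>R skew \<alpha> \<alpha> \<beta> = - (\<alpha> \<bullet> coroot \<beta>) *\<^sub>R skew \<beta> \<beta> \<alpha>" if "\<beta> \<in> R" for \<alpha> \<beta>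
  proof -
    define n where "n = \<alpha> \<bullet> coroot \<beta>"
    have "skew \<alpha> \<alpha> \<beta> = skew (\<alpha> - n *\<^sub>R \<beta>) (\<alpha> - n *\<^sub>R \<beta>) (- \<beta>)"
      using skew_inv[OF that, of \<alpha> \<alpha> \<beta>] reflection_self[OF nonzero[OF that]]
      by (simp add: reflection_root[of \<beta> \<alpha>] n_def)
    also have "\<dots> = - skew \<alpha> \<alpha> \<beta> + n *\<^sub>R skew \<beta> \<alpha> \<beta>"
      by (simp add: skew_diff skew_neg skew_scale skew_self algebra_simps)
    finally have "skew \<alpha> \<alpha> \<beta> + skew \<alpha> \<alpha> \<beta> = n *\<^sub>R skew \<beta> \<alpha> \<beta>" by simp
    then show ?thesis using skew_swap[of \<beta> \<alpha> \<beta>] by (simp only: n_def scaleR_2) simp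
  qed
  define m where "m = (\<alpha> \<bullet> coroot \<beta>) * (\<beta> \<bullet> coroot \<alpha>)"
  have "4 *\<^sub>R skew \<alpha> \<alpha> \<beta> = 2 *\<^sub>R (2 *\<^sub>R skew \<alpha> \<alpha> \<beta>)" by simp
  also have "\<dots> = - (\<alpha> \<bullet> coroot \<beta>) *\<^sub>R (2 *\<^sub>R skew \<beta> \<beta> \<alpha>)"
    unfolding two[OF assms(2)] by (simp add: scaleR_scaleR mult.commute)
  also have "\<dots> = m *\<^sub>R skew \<alpha> \<alpha> \<beta>"
    unfolding two[OF assms(1)] by (simp add: m_def)
  finally have 4: "(4 - m) *\<^sub>R skew \<alpha> \<alpha> \<beta> = 0" by (simp add: algebra_simps)
  show ?thesis
  proof (cases "m = 4")
    case True
    have pos: "\<alpha> \<bullet> \<alpha> > 0" "\<beta> \<bullet> \<beta> > 0" using assms nonzero by auto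
    from True have eq: "(\<alpha> \<bullet> \<beta>) * (\<alpha> \<bullet> \<beta>) = (\<alpha> \<bullet> \<alpha>) * (\<beta> \<bullet> \<beta>)"
      using pos by (simp add: m_def coroot_def inner_commute field_simps)
    define x where "x = (\<alpha> \<bullet> \<beta>) / (\<alpha> \<bullet> \<alpha>)"
    have "(\<beta> - x *\<^sub>R \<alpha>) \<bullet> (\<beta> - x *\<^sub>R \<alpha>) = \<beta> \<bullet> \<beta> - (\<alpha> \<bullet> \<beta>) * (\<alpha> \<bullet> \<beta>) / (\<alpha> \<bullet> \<alpha>)"
      using pos by (simp add: x_def inner_diff_left inner_diff_right inner_commute field_simps)
    also have "\<dots> = 0" using pos by (simp add: eq)
    finally have "\<beta> = x *\<^sub>R \<alpha>" by simp
    then show ?thesis by (simp add: skew_scale skew_self)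
  qed (use 4 in simp)
qed

text \<open>Put a root in the first slot and split the other two vectors along it. If both are
  orthogonal to the root, its reflection changes the sign of the first slot alone and the value is
  zero. The other parts contain the root in a second slot and vanish by \<open>skew_roots\<close>,
  extended linearly over the span of the roots.\<close>

lemma skew_zero: "skew x y z = 0"
proof -
  have 1: "skew \<alpha> \<alpha> v = 0" if "\<alpha> \<in> R" for \<alpha> v
    using linear_zero_on_roots[OF skew_lin(3)] skew_roots[OF that] by blast
  have 2: "skew \<alpha> v w = 0" if "\<alpha> \<in> R" "\<alpha> \<bullet> v = 0" "\<alpha> \<bullet> w = 0" for \<alpha> v w
    using skew_inv[OF that(1), of \<alpha> v w] reflection_self[OF nonzero[OF that(1)]] that
    by (simp add: reflection_orthogonal skew_neg)
  have "skew \<alpha> v w = 0" if "\<alpha> \<in> R" for \<alpha> v w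
  proof -
    have "skew \<alpha> (orth_part \<alpha> v) (orth_part \<alpha> w) = 0"
      using 2 that orth_part(1)[OF nonzero[OF that]] by blast
    moreover have "skew \<alpha> x \<alpha> = 0" for x using 1[OF that] skew_swap[of \<alpha> x \<alpha>] by simp
    ultimately show ?thesis
      by (subst orth_part(2)[of v \<alpha>], subst orth_part(2)[of w \<alpha>])
        (simp add: skew_add skew_scale 1[OF that] skew_self)
  qed
  then show ?thesis using linear_zero_on_roots[OF skew_lin(1)] by blast
qed

lemma sym23: "T u v w = T u w v"
  using skew_zero[of u v w] by (simp add: skew_def)

text \<open>The reflection in \<alpha> changes the sign of the first slot, so among the components
  of the other two arguments only those with exactly one further \<alpha> survive. Total symmetry
  identifies the two ways of placing it.\<close>

lemma T_root:
  assumes "\<alpha> \<in> R"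
  shows "T \<alpha> v z = ((\<alpha> \<bullet> v) / (\<alpha> \<bullet> \<alpha>)) *\<^sub>R T \<alpha> \<alpha> z + ((\<alpha> \<bullet> z) / (\<alpha> \<bullet> \<alpha>)) *\<^sub>R T \<alpha> \<alpha> v"
proof -
  have neg: "reflection \<alpha> *v \<alpha> = - \<alpha>" using reflection_self nonzero assms by blast
  have 0: "T \<alpha> v w = 0" if "\<alpha> \<bullet> v = 0" "\<alpha> \<bullet> w = 0" for v w
    using inv[OF assms, of \<alpha> v w] neg that by (simp add: reflection_orthogonal T_neg)
  have 1: "T \<alpha> \<alpha> \<alpha> = 0" using inv[OF assms, of \<alpha> \<alpha> \<alpha>] neg by (simp add: T_neg)
  have 2: "T \<alpha> (orth_part \<alpha> v) (orth_part \<alpha> z) = 0"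
    using 0 orth_part(1)[OF nonzero[OF assms]] by blast
  have 3: "T \<alpha> \<alpha> (orth_part \<alpha> x) = T \<alpha> \<alpha> x" for x
    by (subst (2) orth_part(2)[of x \<alpha>]) (simp add: T_add T_scale 1)
  have "T \<alpha> v z = T \<alpha> (((\<alpha> \<bullet> v) / (\<alpha> \<bullet> \<alpha>)) *\<^sub>R \<alpha> + orth_part \<alpha> v) (((\<alpha> \<bullet> z) / (\<alpha> \<bullet> \<alpha>)) *\<^sub>R \<alpha> + orth_part \<alpha> z)"
    by (simp flip: orth_part(2))
  also have "\<dots> = ((\<alpha> \<bullet> v) / (\<alpha> \<bullet> \<alpha>)) *\<^sub>R T \<alpha> \<alpha> (orth_part \<alpha> z) + ((\<alpha> \<bullet> z) / (\<alpha> \<bullet> \<alpha>)) *\<^sub>R T \<alpha> (orth_part \<alpha> v) \<alpha>"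
    by (simp add: T_add T_scale 1 2)
  also have "T \<alpha> (orth_part \<alpha> v) \<alpha> = T \<alpha> \<alpha> (orth_part \<alpha> v)" by (rule sym23)
  finally show ?thesis by (simp add: 3)
qed

text \<open>By \<open>T_root\<close> each value with \<alpha> in one slot is a combination of
  products of one \<alpha>-coordinate and one value of T \<alpha> \<alpha>. After substitution both
  sides consist of the same four terms. This is the cancellation of the mixed terms in
  \<open>curv_expand\<close>.\<close>

lemma root_cross_term:
  assumes "\<alpha> \<in> R"
  shows "of_real ((\<alpha> \<bullet> u) * (\<alpha> \<bullet> w)) * T v z \<alpha> + of_real ((\<alpha> \<bullet> v) * (\<alpha> \<bullet> z)) * T u w \<alpha>
    = of_real ((\<alpha> \<bullet> v) * (\<alpha> \<bullet> w)) * T u z \<alpha> + of_real ((\<alpha> \<bullet> u) * (\<alpha> \<bullet> z)) * T v w \<alpha>"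
proof -
  have "T v z \<alpha> = T \<alpha> v z" for v z by (metis sym12 sym23)
  then show ?thesis
    by (simp add: T_root[OF assms, of v z] T_root[OF assms, of u w]
      T_root[OF assms, of u z] T_root[OF assms, of v w] scaleR_complex algebra_simps)
qed

end

section \<open>The Euclidean form on the second exterior power and its invariant
  endomorphisms\<close>

definition wedge_inner :: "real^'n \<Rightarrow> real^'n \<Rightarrow> real^'n \<Rightarrow> real^'n \<Rightarrow> real" where
  "wedge_inner u v w z = (u \<bullet> w) * (v \<bullet> z) - (v \<bullet> w) * (u \<bullet> z)"

lemma wedge_inner_linear:
  "wedge_inner (x + y) v w z = wedge_inner x v w z + wedge_inner y v w z"
  "wedge_inner (c *\<^sub>R x) v w z = c * wedge_inner x v w z"
  "wedge_inner u (x + y) w z = wedge_inner u x w z + wedge_inner u y w z"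
  "wedge_inner u (x - y) w z = wedge_inner u x w z - wedge_inner u y w z"
  "wedge_inner u (c *\<^sub>R x) w z = c * wedge_inner u x w z"
  "wedge_inner u u w z = 0"
  by (auto simp: wedge_inner_def inner_add_left inner_diff_left algebra_simps)

text \<open>The Gram determinant is the squared length of a times that of the component of b
  orthogonal to a.\<close>

lemma gram_pos:
  fixes a b :: "real^'n"
  assumes "b \<notin> span {a}" "a \<noteq> 0"
  shows "(a \<bullet> a) * (b \<bullet> b) - (a \<bullet> b) * (a \<bullet> b) > 0"
proof -
  define x where "x = orth_part a b"
  have "x \<noteq> 0" using orth_part(2)[of b a] assms(1) unfolding x_def
    by (metis add.right_neutral span_base insertI1 span_scale)
  then have "x \<bullet> x > 0" by simp
  moreover have "(a \<bullet> a) * (x \<bullet> x) = (a \<bullet> a) * (b \<bullet> b) - (a \<bullet> b) * (a \<bullet> b)"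
    using assms(2) by (simp add: x_def orth_part_def inner_diff_left inner_diff_right inner_commute field_simps)
  moreover have "a \<bullet> a > 0" using assms(2) by simp
  ultimately show ?thesis by (metis mult_pos_pos)
qed

text \<open>The component of c orthogonal to the span is a witness. Such vectors serve below to test
  identities between bivectors.\<close>

lemma not_in_span_orthogonal:
  fixes c :: "real^'n"
  assumes "c \<notin> span S"
  obtains z where "\<And>x. x \<in> S \<Longrightarrow> x \<bullet> z = 0" "c \<bullet> z \<noteq> 0"
proof -
  obtain y z where yz: "y \<in> span S" "\<And>w. w \<in> span S \<Longrightarrow> orthogonal z w" "c = y + z"
    using orthogonal_subspace_decomp_exists[of S c] by blast
  have "z \<noteq> 0" using yz assms by auto
  moreover have "y \<bullet> z = 0" using yz by (simp add: orthogonal_def inner_commute)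
  then have "c \<bullet> z = z \<bullet> z" using yz(3) by (simp add: inner_add_left)
  ultimately show ?thesis using that[of z] yz(2) by (auto simp: orthogonal_def inner_commute span_base)
qed

text \<open>
  An invariant tensor of this kind is an equivariant endomorphism \<open>q\<close> of \<open>\<Lambda>\<^sup>2\<close>, and for a root
  \<open>\<alpha>\<close> the \<open>-1\<close>-eigenspace of its reflection on \<open>\<Lambda>\<^sup>2\<close> is \<open>\<alpha> \<and> V\<close>. Hence \<open>q\<close> has each
  \<open>\<alpha> \<and> \<beta>\<close> as an eigenvector, and irreducibility makes the eigenvalues agree.
\<close>

locale inv_curvature = root_sys R for R :: "(real^'n) set" +
  fixes q :: "real^'n \<Rightarrow> real^'n \<Rightarrow> real^'n \<Rightarrow> real^'n \<Rightarrow> complex"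
  assumes lin1: "linear (\<lambda>u. q u v w z)" and lin2: "linear (\<lambda>v. q u v w z)"
    and lin3: "linear (\<lambda>w. q u v w z)" and lin4: "linear (\<lambda>z. q u v w z)"
    and alt12: "q u v w z = - q v u w z" and alt34: "q u v w z = - q u v z w"
    and inv: "\<alpha> \<in> R \<Longrightarrow> q (reflection \<alpha> *v u) (reflection \<alpha> *v v) (reflection \<alpha> *v w) (reflection \<alpha> *v z) = q u v w z"
    and irred: "irreducible_roots R"
begin

lemmas q_add = linear_add[OF lin1] linear_add[OF lin2] linear_add[OF lin3] linear_add[OF lin4]
lemmas q_scale = linear_scale[OF lin1] linear_scale[OF lin2] linear_scale[OF lin3] linear_scale[OF lin4]
lemmas q_diff = linear_diff[OF lin1] linear_diff[OF lin2] linear_diff[OF lin3] linear_diff[OF lin4]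
lemmas q_neg = linear_neg[OF lin1] linear_neg[OF lin2] linear_neg[OF lin3] linear_neg[OF lin4]

lemma q_self: "q u u w z = 0" "q u v w w = 0"
  using alt12[of u u w z] alt34[of u v w w] by (auto simp: eq_neg_iff_add_eq_0)

text \<open>States that a \<and> b is an eigenvector of q with eigenvalue l. For dependent a and b
  every l qualifies, which is why the lemmas below keep track of independence.\<close>

definition eigen :: "real^'n \<Rightarrow> real^'n \<Rightarrow> complex \<Rightarrow> bool" where
  "eigen a b l \<longleftrightarrow> (\<forall>w z. q a b w z = l * of_real (wedge_inner a b w z))"

lemma eigen_parallel: "b \<in> span {a} \<Longrightarrow> eigen a b l"
  by (auto simp: span_singleton eigen_def q_scale q_self wedge_inner_linear)

lemma eigen_combination: "eigen a b l \<Longrightarrow> eigen a (x *\<^sub>R a + y *\<^sub>R b) l"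
  by (simp add: eigen_def q_add q_scale q_self wedge_inner_linear scaleR_complex)

text \<open>The reflections in a and in b both negate a \<and> b, so its image vanishes on pairs
  orthogonal to a and on pairs orthogonal to b. Expanding in the dual basis of the plane and its
  orthogonal complement leaves a single coefficient.\<close>

lemma eigen_exists:
  assumes "a \<in> R" "b \<in> R"
  shows "\<exists>l. eigen a b l"
proof (cases "b \<in> span {a}")
  case True
  then show ?thesis using eigen_parallel by blast
next
  case False
  have zero_a: "q a b w z = 0" if "a \<bullet> w = 0" "a \<bullet> z = 0" for w z
    using inv[OF assms(1), of a b w z] reflection_self[OF nonzero[OF assms(1)]] that
    by (simp add: reflection_orthogonal reflection_root[of a b] q_neg q_diff q_scale q_self)
  have zero_b: "q a b w z = 0" if "b \<bullet> w = 0" "b \<bullet> z = 0" for w z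
    using inv[OF assms(2), of a b w z] reflection_self[OF nonzero[OF assms(2)]] that
    by (simp add: reflection_orthogonal reflection_root[of b a] q_neg q_diff q_scale q_self)
  define D where "D = (a \<bullet> a) * (b \<bullet> b) - (a \<bullet> b) * (a \<bullet> b)"
  have "D > 0" unfolding D_def by (rule gram_pos[OF False nonzero[OF assms(1)]])
  \<comment> \<open>Dual basis of the plane of a and b, by Cramer's rule with the Gram determinant
    D.\<close>
  define a' where "a' = (1 / D) *\<^sub>R ((b \<bullet> b) *\<^sub>R a - (a \<bullet> b) *\<^sub>R b)"
  define b' where "b' = (1 / D) *\<^sub>R ((a \<bullet> a) *\<^sub>R b - (a \<bullet> b) *\<^sub>R a)"
  have "a \<bullet> ((b \<bullet> b) *\<^sub>R a - (a \<bullet> b) *\<^sub>R b) = D" "b \<bullet> ((b \<bullet> b) *\<^sub>R a - (a \<bullet> b) *\<^sub>R b) = 0"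
      "a \<bullet> ((a \<bullet> a) *\<^sub>R b - (a \<bullet> b) *\<^sub>R a) = 0" "b \<bullet> ((a \<bullet> a) *\<^sub>R b - (a \<bullet> b) *\<^sub>R a) = D"
    by (simp_all add: D_def inner_diff_right inner_commute[of b a] mult.commute)
  then have dual: "a \<bullet> a' = 1" "b \<bullet> a' = 0" "a \<bullet> b' = 0" "b \<bullet> b' = 1"
    using \<open>D > 0\<close> unfolding a'_def b'_def inner_scaleR_right by simp_all
  define c where "c w = w - (a \<bullet> w) *\<^sub>R a' - (b \<bullet> w) *\<^sub>R b'" for w
  have c: "a \<bullet> c w = 0" "b \<bullet> c w = 0" for w by (simp_all add: c_def inner_diff_right dual)
  have w: "w = (a \<bullet> w) *\<^sub>R a' + ((b \<bullet> w) *\<^sub>R b' + c w)" for w by (simp add: c_def)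
  have "q a b w z = q a b a' b' * of_real (wedge_inner a b w z)" for w z
  proof -
    \<comment> \<open>In each pair both vectors are orthogonal to a or both are orthogonal to b:
      \<open>a'\<close> is orthogonal to b and \<open>b'\<close> to a.\<close>
    have *: "q a b a' (c z) = 0" "q a b (c w) a' = 0" "q a b b' (c z) = 0" "q a b (c w) b' = 0" "q a b (c w) (c z) = 0"
      using zero_a zero_b c dual by auto
    have "q a b w z = q a b ((a \<bullet> w) *\<^sub>R a' + ((b \<bullet> w) *\<^sub>R b' + c w)) ((a \<bullet> z) *\<^sub>R a' + ((b \<bullet> z) *\<^sub>R b' + c z))"
      using w by simp
    also have "\<dots> = ((a \<bullet> w) * (b \<bullet> z)) *\<^sub>R q a b a' b' + ((b \<bullet> w) * (a \<bullet> z)) *\<^sub>R q a b b' a'"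
      by (simp add: q_add q_scale q_self * mult.commute)
    also have "q a b b' a' = - q a b a' b'" by (rule alt34)
    finally show ?thesis by (simp add: wedge_inner_def scaleR_complex algebra_simps)
  qed
  then show ?thesis unfolding eigen_def by blast
qed

text \<open>If c lies outside the plane of a and b, then b, c and the reflection of b in c are three
  roots, the last a combination of the others with nonzero coefficients. Each of them gives an
  eigenvector with a. Since a \<and> b and a \<and> c are independent, the three eigenvalues
  coincide.\<close>

lemma eigen_adjacent:
  assumes R: "a \<in> R" "b \<in> R" "c \<in> R" and "b \<bullet> c \<noteq> 0" and b: "b \<notin> span {a}" and l: "eigen a b l"
  shows "eigen a c l"
proof (cases "c \<in> span {a, b}")
  case True
  then obtain x y where "c = x *\<^sub>R a + y *\<^sub>R b"
    by (auto simp: span_insert span_singleton algebra_simps)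
  then show ?thesis using eigen_combination[OF l] by simp
next
  case False
  define n where "n = b \<bullet> coroot c"
  have "c \<noteq> 0" "a \<noteq> 0" using R nonzero by auto
  then have "n \<noteq> 0" using \<open>b \<bullet> c \<noteq> 0\<close> by (simp add: n_def coroot_def)
  obtain l1 where l1: "eigen a c l1" using eigen_exists R by blast
  obtain l2 where l2: "eigen a (b - n *\<^sub>R c) l2"
    using eigen_exists[OF R(1) reflection_closed[OF R(3,2)]] by (auto simp: reflection_root n_def)
  have eq: "(l2 - l) * of_real (wedge_inner a b w z) = n * (l2 - l1) * of_real (wedge_inner a c w z)" for w z
  proof -
    have "l2 * of_real (wedge_inner a (b - n *\<^sub>R c) w z) = q a (b - n *\<^sub>R c) w z" using l2 by (simp add: eigen_def)
    also have "\<dots> = l * of_real (wedge_inner a b w z) - n * (l1 * of_real (wedge_inner a c w z))"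
      using l l1 by (simp add: eigen_def q_diff q_scale scaleR_complex)
    finally show ?thesis by (simp add: wedge_inner_linear algebra_simps)
  qed
  \<comment> \<open>Testing \<open>eq\<close> on a and z isolates the coefficient of a \<and> c;
    \<open>z'\<close> below isolates that of a \<and> b.\<close>
  obtain z where z: "a \<bullet> z = 0" "b \<bullet> z = 0" "c \<bullet> z \<noteq> 0"
    using not_in_span_orthogonal[OF False] by (metis insertI1 insertI2)
  have "l2 = l1" using eq[of a z] z \<open>n \<noteq> 0\<close> \<open>a \<noteq> 0\<close> by (simp add: wedge_inner_def)
  have "b \<notin> span {a, c}"
  proof
    assume "b \<in> span {a, c}"
    then obtain x y where xy: "b = x *\<^sub>R a + y *\<^sub>R c"
      by (auto simp: span_insert span_singleton algebra_simps)
    have "y \<noteq> 0" using xy b by (auto simp: span_singleton)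
    then have "(1 / y) *\<^sub>R b = (x / y) *\<^sub>R a + c" unfolding xy by (simp add: scaleR_add_right)
    then have c: "c = (1 / y) *\<^sub>R b - (x / y) *\<^sub>R a" by simp
    have "c \<in> span {a, b}" unfolding c by (intro span_diff span_scale span_base) auto
    then show False using False by blast
  qed
  then obtain z' where z': "a \<bullet> z' = 0" "c \<bullet> z' = 0" "b \<bullet> z' \<noteq> 0"
    using not_in_span_orthogonal[of b "{a, c}"] by (metis insertI1 insertI2)
  have "l2 = l" using eq[of a z'] z' \<open>a \<noteq> 0\<close> by (simp add: wedge_inner_def)
  then show ?thesis using l1 \<open>l2 = l1\<close> by simp
qed

text \<open>If b and c are orthogonal, the reflection of b in a can replace b: it spans the same
  plane with a, so the eigenvalue is kept, and it is no longer orthogonal to c.\<close>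

lemma eigen_nonorthogonal:
  assumes R: "a \<in> R" "b \<in> R" "c \<in> R" and "a \<bullet> b \<noteq> 0" "a \<bullet> c \<noteq> 0" and b: "b \<notin> span {a}" and l: "eigen a b l"
  shows "eigen a c l"
proof (cases "b \<bullet> c = 0")
  case False
  then show ?thesis using eigen_adjacent assms by blast
next
  case True
  define n where "n = b \<bullet> coroot a"
  have "a \<noteq> 0" using R nonzero by auto
  then have "n \<noteq> 0" using \<open>a \<bullet> b \<noteq> 0\<close> by (simp add: n_def coroot_def inner_commute)
  have 1: "b - n *\<^sub>R a \<in> R" using reflection_closed[OF R(1,2)] by (simp add: reflection_root n_def)
  have 2: "eigen a (b - n *\<^sub>R a) l" using eigen_combination[OF l, of "- n" 1] by (simp add: algebra_simps)
  have 3: "b - n *\<^sub>R a \<notin> span {a}"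
  proof
    assume "b - n *\<^sub>R a \<in> span {a}"
    moreover have "n *\<^sub>R a \<in> span {a}" by (intro span_scale span_base) simp
    ultimately have "(b - n *\<^sub>R a) + n *\<^sub>R a \<in> span {a}" by (rule span_add)
    then show False using b by simp
  qed
  have "(b - n *\<^sub>R a) \<bullet> c \<noteq> 0" using True \<open>n \<noteq> 0\<close> \<open>a \<bullet> c \<noteq> 0\<close> by (simp add: inner_diff_left)
  then show ?thesis using eigen_adjacent[OF R(1) 1 R(3) _ 3 2] by blast
qed

text \<open>An induction principle: otherwise the roots with the property and those without it would
  split R into two orthogonal parts.\<close>

lemma irreducible_split:
  assumes "\<And>x y. x \<in> R \<Longrightarrow> y \<in> R \<Longrightarrow> X x \<Longrightarrow> x \<bullet> y \<noteq> 0 \<Longrightarrow> X y" "a \<in> R" "X a" "b \<in> R"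
  shows "X b"
proof (rule ccontr)
  assume "\<not> X b"
  have "{x \<in> R. X x} \<union> {x \<in> R. \<not> X x} = R" "{x \<in> R. X x} \<inter> {x \<in> R. \<not> X x} = {}" by auto
  moreover have "\<forall>x\<in>{x \<in> R. X x}. \<forall>y\<in>{x \<in> R. \<not> X x}. x \<bullet> y = 0" using assms(1) by blast
  ultimately have "{x \<in> R. X x} = {} \<or> {x \<in> R. \<not> X x} = {}"
    using irred unfolding irreducible_roots_def by blast
  then show False using assms \<open>\<not> X b\<close> by blast
qed

text \<open>The eigenvalue spreads along chains of non-orthogonal roots. A chain may pass through a
  multiple of a, where the bivector is zero and the eigenvalue is lost; there it is recovered from a
  reference root \<open>b0\<close> that is neither orthogonal nor parallel to a.\<close>

lemma eigen_uniform:
  assumes "a \<in> R"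
  shows "\<exists>l. \<forall>v. eigen a v l"
proof -
  have "\<exists>l. \<forall>b\<in>R. eigen a b l"
  proof (cases "R \<subseteq> span {a}")
    case True
    then show ?thesis using eigen_parallel by blast
  next
    case False
    then obtain b1 where b1: "b1 \<in> R" "b1 \<notin> span {a}" by blast
    have "\<exists>b0. b0 \<in> R \<and> b0 \<notin> span {a} \<and> a \<bullet> b0 \<noteq> 0"
    proof (rule ccontr)
      assume "\<not> (\<exists>b0. b0 \<in> R \<and> b0 \<notin> span {a} \<and> a \<bullet> b0 \<noteq> 0)"
      then have *: "a \<bullet> b = 0" if "b \<in> R" "b \<notin> span {a}" for b using that by blast
      have "b1 \<in> span {a}"
      proof (rule irreducible_split[where X = "\<lambda>x. x \<in> span {a}", OF _ assms _ b1(1)])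
        show "a \<in> span {a}" by (simp add: span_base)
        fix x y assume xy: "x \<in> R" "y \<in> R" "x \<in> span {a}" "x \<bullet> y \<noteq> 0"
        then have "a \<bullet> y \<noteq> 0" by (auto simp: span_singleton)
        then show "y \<in> span {a}" using *[of y] xy(2) by blast
      qed
      then show False using b1 by blast
    qed
    then obtain b0 where b0: "b0 \<in> R" "b0 \<notin> span {a}" "a \<bullet> b0 \<noteq> 0" by blast
    obtain l where l: "eigen a b0 l" using eigen_exists[OF assms b0(1)] by blast
    have "eigen a c l" if "c \<in> R" for c
    proof (rule irreducible_split[where X = "\<lambda>x. eigen a x l", OF _ b0(1) l that])
      fix x y assume xy: "x \<in> R" "y \<in> R" "eigen a x l" "x \<bullet> y \<noteq> 0"
      show "eigen a y l"
      proof (cases "x \<in> span {a}")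
        case False
        then show ?thesis using eigen_adjacent[OF assms xy(1,2,4) _ xy(3)] by blast
      next
        case True
        then have "a \<bullet> y \<noteq> 0" using xy(4) by (auto simp: span_singleton)
        then show ?thesis using eigen_nonorthogonal[OF assms b0(1) xy(2) b0(3) _ b0(2) l] by blast
      qed
    qed
    then show ?thesis by blast
  qed
  then obtain l where l: "\<And>b. b \<in> R \<Longrightarrow> eigen a b l" by blast
  have "q a v w z = l * of_real (wedge_inner a v w z)" for v w z
  proof (rule linear_eq_on_roots[of "\<lambda>v. q a v w z" "\<lambda>v. l * of_real (wedge_inner a v w z)"])
    show "linear (\<lambda>v. l * of_real (wedge_inner a v w z))"
      by (rule linearI) (auto simp: wedge_inner_linear scaleR_complex algebra_simps)
  qed (use lin2 l in \<open>auto simp: eigen_def\<close>)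
  then show ?thesis unfolding eigen_def by blast
qed

text \<open>The eigenvalues attached to two independent roots a and b agree because a \<and> b and b
  \<and> a span the same line. Since the roots span, the scalar is the same everywhere.\<close>

theorem curvature_scalar: "\<exists>l. \<forall>u v w z. q u v w z = l * of_real (wedge_inner u v w z)"
proof -
  obtain a where a: "a \<in> R" using irred by (auto simp: irreducible_roots_def)
  obtain l where l: "\<And>v. eigen a v l" using eigen_uniform[OF a] by blast
  have key: "q b v w z = l * of_real (wedge_inner b v w z)" if b: "b \<in> R" for b v w z
  proof (cases "b \<in> span {a}")
    case True
    then obtain x where "b = x *\<^sub>R a" by (auto simp: span_singleton)
    then show ?thesis using l[of v] by (simp add: eigen_def q_scale wedge_inner_linear scaleR_complex)
  next
    case False
    obtain l' where l': "\<And>v. eigen b v l'" using eigen_uniform[OF b] by blast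
    have "l * of_real (wedge_inner a b a b) = - (l' * of_real (wedge_inner b a a b))"
      using l[of b] l'[of a] alt12[of a b a b] by (simp add: eigen_def)
    then have "(l - l') * of_real (wedge_inner a b a b) = 0"
      by (simp add: wedge_inner_def inner_commute algebra_simps)
    moreover have "wedge_inner a b a b \<noteq> 0"
      using gram_pos[OF False nonzero[OF a]] by (simp add: wedge_inner_def inner_commute)
    ultimately show ?thesis using l'[of v] by (simp add: eigen_def)
  qed
  have "q u v w z = l * of_real (wedge_inner u v w z)" for u v w z
  proof (rule linear_eq_on_roots[of "\<lambda>u. q u v w z" "\<lambda>u. l * of_real (wedge_inner u v w z)"])
    show "linear (\<lambda>u. l * of_real (wedge_inner u v w z))"
      by (rule linearI) (auto simp: wedge_inner_linear scaleR_complex algebra_simps)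
  qed (rule lin1, rule key)
  then show ?thesis by blast
qed

end

section \<open>Sums over roots that do not depend on the character\<close>

text \<open>Singularities are removed one at a time; each extension agrees with f near the remaining
  points, so their limit conditions persist.\<close>

lemma holomorphic_extend_finite:
  assumes "finite K" "f holomorphic_on - K" "\<And>a. a \<in> K \<Longrightarrow> ((\<lambda>z. (z - a) * f z) \<longlongrightarrow> 0) (at a)"
  shows "\<exists>g. g holomorphic_on UNIV \<and> (\<forall>z. z \<notin> K \<longrightarrow> g z = f z)"
  using assms
proof (induction K arbitrary: f rule: finite_induct)
  case empty
  then show ?case by auto
next
  case (insert a K)
  have "open (- K)" using insert.hyps(1) by (simp add: finite_imp_closed open_Compl)
  then have a: "a \<in> interior (- K)" using insert.hyps by (simp add: interior_open)
  have "- insert a K = - K - {a}" by auto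
  then have "f holomorphic_on - K - {a}" using insert.prems by simp
  from holomorphic_on_extend_lim[OF this a] insert.prems(2)[of a]
  obtain g1 where g1: "g1 holomorphic_on - K" "\<And>z. z \<in> - K - {a} \<Longrightarrow> g1 z = f z" by auto
  have "((\<lambda>z. (z - b) * g1 z) \<longlongrightarrow> 0) (at b)" if b: "b \<in> K" for b
  proof (rule Lim_transform_within_open)
    show "((\<lambda>z. (z - b) * f z) \<longlongrightarrow> 0) (at b)" using insert.prems(2) b by blast
    show "open (- (insert a K - {b}))" using insert.hyps(1) by (intro open_Compl finite_imp_closed) simp
    show "b \<in> - (insert a K - {b})" by simp
    show "(z - b) * f z = (z - b) * g1 z" if "z \<in> - (insert a K - {b})" "z \<noteq> b" for z
      using g1(2)[of z] that by auto
  qed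
  from insert.IH[OF g1(1) this] obtain g where "g holomorphic_on UNIV" "\<And>z. z \<notin> K \<Longrightarrow> g z = g1 z" by blast
  then show ?case using g1(2) by (intro exI[of _ g]) auto
qed

text \<open>If v avoids the hyperplanes of F but lies on that of g, then N v + b avoids all of them
  for all but finitely many N. Closure under addition is the structure asked of L, so that it may be
  a lattice as well as the whole space.\<close>

lemma avoid_hyperplanes:
  fixes F L :: "(real^'n) set"
  assumes "finite F" "L \<noteq> {}" and add: "\<And>x y. x \<in> L \<Longrightarrow> y \<in> L \<Longrightarrow> x + y \<in> L"
    and "\<And>g. g \<in> F \<Longrightarrow> \<exists>b\<in>L. g \<bullet> b \<noteq> 0"
  shows "\<exists>v\<in>L. \<forall>g\<in>F. g \<bullet> v \<noteq> 0"
  using assms(1,4)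
proof (induction F rule: finite_induct)
  case empty
  then show ?case using \<open>L \<noteq> {}\<close> by blast
next
  case (insert g F)
  then obtain v where v: "v \<in> L" "\<forall>h\<in>F. h \<bullet> v \<noteq> 0" by blast
  show ?case
  proof (cases "g \<bullet> v = 0")
    case False
    then show ?thesis using v by blast
  next
    case True
    obtain b where b: "b \<in> L" "g \<bullet> b \<noteq> 0" using insert.prems by blast
    have "finite (\<Union>h\<in>F. {N::nat. real N * (h \<bullet> v) + h \<bullet> b = 0})"
    proof (intro finite_UN_I insert.hyps(1))
      fix h assume "h \<in> F"
      then have "h \<bullet> v \<noteq> 0" using v by blast
      then have "{N::nat. real N * (h \<bullet> v) + h \<bullet> b = 0} \<subseteq> {nat \<lfloor>- (h \<bullet> b) / (h \<bullet> v)\<rfloor>}"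
      proof (intro subsetI)
        fix N assume "N \<in> {N::nat. real N * (h \<bullet> v) + h \<bullet> b = 0}"
        then have "real N = - (h \<bullet> b) / (h \<bullet> v)" using \<open>h \<bullet> v \<noteq> 0\<close> by (simp add: field_simps)
        then have "N = nat \<lfloor>- (h \<bullet> b) / (h \<bullet> v)\<rfloor>" by (metis floor_of_nat nat_int)
        then show "N \<in> {nat \<lfloor>- (h \<bullet> b) / (h \<bullet> v)\<rfloor>}" by simp
      qed
      then show "finite {N::nat. real N * (h \<bullet> v) + h \<bullet> b = 0}" by (rule finite_subset) simp
    qed
    from ex_new_if_finite[OF infinite_UNIV_nat this]
    obtain N :: nat where N: "\<And>h. h \<in> F \<Longrightarrow> real N * (h \<bullet> v) + h \<bullet> b \<noteq> 0" by blast
    have "real N *\<^sub>R v + b \<in> L" for N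
    proof (induction N)
      case (Suc N)
      have "v + (real N *\<^sub>R v + b) \<in> L" by (rule add[OF v(1) Suc])
      then show ?case by (simp add: algebra_simps)
    qed (simp add: b)
    moreover have "\<forall>h\<in>insert g F. h \<bullet> (real N *\<^sub>R v + b) \<noteq> 0"
      using N b True by (auto simp: inner_add_right)
    ultimately show ?thesis by blast
  qed
qed

text \<open>The real exponential is injective, so there is at most one such e.\<close>

lemma finite_exp_level:
  assumes "g \<noteq> 0" "K \<noteq> 0"
  shows "finite {e::real. K * exp (complex_of_real (e * g)) = K'}"
proof -
  have "e = e'" if "K * exp (complex_of_real (e * g)) = K'" "K * exp (complex_of_real (e' * g)) = K'" for e e'
  proof -
    have "exp (complex_of_real (e * g)) = exp (complex_of_real (e' * g))" using that assms by (metis mult_cancel_left)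
    then have "complex_of_real (exp (e * g)) = complex_of_real (exp (e' * g))" by (simp only: exp_of_real)
    then have "e * g = e' * g" by simp
    then show ?thesis using assms by simp
  qed
  then have "{e::real. K * exp (complex_of_real (e * g)) = K'} \<subseteq> {SOME e. K * exp (complex_of_real (e * g)) = K'}"
    by (smt (verit) mem_Collect_eq singletonI someI subsetI)
  then show ?thesis by (rule finite_subset) simp
qed

text \<open>At x = exp t this is coth (t/2). In the variable x it is rational, and so is its
  restriction to a one-parameter subgroup.\<close>

definition coth_half :: "complex \<Rightarrow> complex" where
  "coth_half x = (x + 1) / (x - 1)"

lemma coth_half_inverse: "x \<noteq> 0 \<Longrightarrow> coth_half (inverse x) = - coth_half x"
  by (cases "x = 1") (auto simp: coth_half_def field_simps)

lemma coth_half_at_infinity: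
  assumes "x \<noteq> 0" "n > 0"
  shows "((\<lambda>z. coth_half (x * z ^ n)) \<longlongrightarrow> 1) at_infinity"
proof -
  have "filterlim (\<lambda>z::complex. z ^ n) at_infinity at_infinity"
    using assms(2) by (intro filterlim_power_at_infinity) auto
  then have 1: "filterlim (\<lambda>z. x * z ^ n) at_infinity at_infinity"
    by (rule tendsto_mult_filterlim_at_infinity[OF tendsto_const assms(1)])
  then have 2: "filterlim (\<lambda>z. x * z ^ n + (- 1)) at_infinity at_infinity"
    by (intro tendsto_add_filterlim_at_infinity'[OF _ tendsto_const])
  have "((\<lambda>z. 1 + 2 / (x * z ^ n + (- 1))) \<longlongrightarrow> 1 + 0) at_infinity"
    by (intro tendsto_add tendsto_const tendsto_divide_0[OF tendsto_const 2])
  moreover have "\<forall>\<^sub>F z in at_infinity. 1 + 2 / (x * z ^ n + (- 1)) = coth_half (x * z ^ n)"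
    using filterlim_at_infinity_imp_eventually_ne[OF 1, of 1]
    by eventually_elim (simp add: coth_half_def field_simps)
  ultimately show ?thesis by (simp add: tendsto_cong)
qed

lemma coth_half_simple_pole:
  assumes "x * a ^ n = 1" "n > 0"
  shows "\<exists>r. ((\<lambda>z. (z - a) * coth_half (x * z ^ n)) \<longlongrightarrow> r) (at a)"
proof -
  have "a \<noteq> 0" "x \<noteq> 0" using assms by (auto simp: power_0_left)
  define D where "D = x * (of_nat n * a ^ (n - 1))"
  have "((\<lambda>z. x * z ^ n) has_field_derivative D) (at a)"
    unfolding D_def by (auto intro!: derivative_eq_intros)
  then have "((\<lambda>z. (x * z ^ n - 1) / (z - a)) \<longlongrightarrow> D) (at a)"
    by (simp add: has_field_derivative_iff assms(1))
  moreover have "D \<noteq> 0" using \<open>a \<noteq> 0\<close> \<open>x \<noteq> 0\<close> assms(2) by (simp add: D_def)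
  moreover have "((\<lambda>z. x * z ^ n + 1) \<longlongrightarrow> x * a ^ n + 1) (at a)" by (intro tendsto_intros)
  ultimately have "((\<lambda>z. (x * z ^ n + 1) / ((x * z ^ n - 1) / (z - a))) \<longlongrightarrow> (x * a ^ n + 1) / D) (at a)"
    by (intro tendsto_divide)
  then show ?thesis by (intro exI) (simp add: coth_half_def mult.commute)
qed

lemma continuous_coth_half: "x \<noteq> 1 \<Longrightarrow> (f \<longlongrightarrow> x) F \<Longrightarrow> ((\<lambda>z. coth_half (f z)) \<longlongrightarrow> coth_half x) F"
  unfolding coth_half_def by (intro tendsto_intros) auto

section \<open>Characters on the roots and the residues of the double sum\<close>

context root_sys
begin

text \<open>What a homomorphism of the root lattice leaves on the roots: its behaviour under
  reflections. This notion is stable under the three operations applied to it: twisting by powers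
  along a coweight, twisting by real exponentials, and composing with a reflection.\<close>

definition character :: "(real^'n \<Rightarrow> complex) \<Rightarrow> bool" where
  "character \<phi> \<longleftrightarrow> (\<forall>\<alpha>\<in>R. \<phi> \<alpha> \<noteq> 0) \<and>
     (\<forall>\<alpha>\<in>R. \<forall>\<beta>\<in>R. \<phi> (reflection \<alpha> *v \<beta>) = \<phi> \<beta> * \<phi> \<alpha> powi (- \<lfloor>\<beta> \<bullet> coroot \<alpha>\<rfloor>))"

lemma character_uminus:
  assumes "character \<phi>" "\<alpha> \<in> R"
  shows "\<phi> (- \<alpha>) = inverse (\<phi> \<alpha>)"
proof -
  have "\<phi> (- \<alpha>) = \<phi> \<alpha> * \<phi> \<alpha> powi (- 2)"
    using assms reflection_self[OF nonzero[OF assms(2)]] inner_coroot_self[OF nonzero[OF assms(2)]]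
    unfolding character_def by (metis floor_numeral)
  moreover have "\<phi> \<alpha> \<noteq> 0" using assms by (simp add: character_def)
  ultimately show ?thesis by (simp add: power_int_minus power2_eq_square field_simps)
qed

lemma sum_even:
  fixes f :: "real^'n \<Rightarrow> 'b::comm_ring_1"
  assumes "\<And>\<alpha>. \<alpha> \<in> R \<Longrightarrow> f (- \<alpha>) = f \<alpha>" "\<And>\<alpha>. \<alpha> \<in> R \<Longrightarrow> \<alpha> \<bullet> \<xi> \<noteq> 0"
  shows "sum f R = 2 * sum f {\<alpha> \<in> R. \<alpha> \<bullet> \<xi> > 0}"
proof -
  define P where "P = {\<alpha> \<in> R. \<alpha> \<bullet> \<xi> > 0}"
  have R: "R = P \<union> uminus ` P"
  proof
    show "R \<subseteq> P \<union> uminus ` P"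
    proof
      fix \<alpha> assume a: "\<alpha> \<in> R"
      show "\<alpha> \<in> P \<union> uminus ` P"
      proof (cases "\<alpha> \<bullet> \<xi> > 0")
        case False
        then have "- \<alpha> \<in> P" using a assms(2)[OF a] uminus_closed by (auto simp: P_def)
        then show ?thesis by (metis UnI2 image_eqI minus_minus)
      qed (use a in \<open>simp add: P_def\<close>)
    qed
  qed (auto simp: P_def uminus_closed)
  have "sum f R = sum f P + sum f (uminus ` P)"
    by (subst R, rule sum.union_disjoint) (auto simp: P_def finite_R)
  also have "sum f (uminus ` P) = sum f P"
    by (subst sum.reindex) (auto simp: P_def assms(1) intro!: sum.cong)
  finally show ?thesis by (simp add: P_def)
qed

text \<open>Coroots are integral on the roots, and each root takes the value 2 on its own coroot. So
  every mirror misses some integral vector and \<open>avoid_hyperplanes\<close> applies.\<close>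

lemma regular_coweight:
  "\<exists>v. (\<forall>\<alpha>\<in>R. \<alpha> \<bullet> v \<in> \<int>) \<and> (\<forall>\<alpha>\<in>R. \<alpha> \<bullet> v \<noteq> 0)"
proof -
  have "\<exists>v\<in>{v. \<forall>\<alpha>\<in>R. \<alpha> \<bullet> v \<in> \<int>}. \<forall>\<alpha>\<in>R. \<alpha> \<bullet> v \<noteq> 0"
  proof (rule avoid_hyperplanes[OF finite_R])
    show "{v. \<forall>\<alpha>\<in>R. \<alpha> \<bullet> v \<in> \<int>} \<noteq> {}" by (auto intro!: exI[of _ 0])
    show "\<exists>b\<in>{v. \<forall>\<alpha>\<in>R. \<alpha> \<bullet> v \<in> \<int>}. g \<bullet> b \<noteq> 0" if "g \<in> R" for g
      using that integral inner_coroot_self[OF nonzero[OF that]] by (intro bexI[of _ "coroot g"]) auto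
  qed (auto simp: inner_add_right)
  then show ?thesis by blast
qed

end

text \<open>The coefficients of the double sum, reduced to the properties that govern its poles:
  \<open>W_self\<close> rules out double poles, \<open>W_refl\<close> makes residues cancel, and
  reducedness lets distinct positive roots be separated by a twist of the character.\<close>

locale root_weight = root_sys R for R :: "(real^'n) set" +
  fixes W :: "real^'n \<Rightarrow> real^'n \<Rightarrow> complex"
  assumes W_self: "W \<alpha> \<alpha> = 0" and W_sym: "\<alpha> \<in> R \<Longrightarrow> \<beta> \<in> R \<Longrightarrow> W \<alpha> \<beta> = W \<beta> \<alpha>"
    and W_odd: "\<alpha> \<in> R \<Longrightarrow> \<beta> \<in> R \<Longrightarrow> W \<alpha> (- \<beta>) = - W \<alpha> \<beta>"
    and W_refl: "\<gamma> \<in> R \<Longrightarrow> \<beta> \<in> R \<Longrightarrow> W \<gamma> (reflection \<gamma> *v \<beta>) = - W \<gamma> \<beta>"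
    and reduced: "reduced R"
begin

text \<open>A character with value 1 on \<gamma> is invariant under the reflection in \<gamma>,
  while the weight changes sign; re-indexing shows that the sum equals its own negative.\<close>

lemma sum_W_character_zero:
  assumes \<psi>: "character \<psi>" and "\<gamma> \<in> R" "\<psi> \<gamma> = 1"
  shows "(\<Sum>\<beta>\<in>R. W \<gamma> \<beta> * coth_half (\<psi> \<beta>)) = 0"
proof -
  have "(\<Sum>\<beta>\<in>R. W \<gamma> \<beta> * coth_half (\<psi> \<beta>))
      = (\<Sum>\<beta>\<in>R. W \<gamma> (reflection \<gamma> *v \<beta>) * coth_half (\<psi> (reflection \<gamma> *v \<beta>)))"
    using sum.reindex_bij_betw[OF bij_reflection[OF assms(2)], of "\<lambda>\<beta>. W \<gamma> \<beta> * coth_half (\<psi> \<beta>)"] by simp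
  also have "\<dots> = - (\<Sum>\<beta>\<in>R. W \<gamma> \<beta> * coth_half (\<psi> \<beta>))"
    unfolding sum_negf[symmetric]
    using assms by (intro sum.cong) (auto simp: W_refl character_def)
  finally show ?thesis by simp
qed

text \<open>Twisting the character by powers of z along the coweight v gives a rational function of
  z whose value at 1 is the sum in question. By \<open>generic\<close> no two positive roots share a
  pole, so poles are at most simple; their residues vanish by \<open>sum_W_character_zero\<close>.
  Liouville's theorem then equates the value with the limit at infinity, where every
  \<open>coth_half\<close> tends to 1.\<close>

lemma sum_W_generic:
  assumes \<phi>: "character \<phi>" and ne: "\<And>\<alpha>. \<alpha> \<in> R \<Longrightarrow> \<phi> \<alpha> \<noteq> 1"
    and v: "\<forall>\<alpha>\<in>R. \<alpha> \<bullet> v \<in> \<int>" "\<forall>\<alpha>\<in>R. \<alpha> \<bullet> v \<noteq> 0" and P: "P = {\<alpha> \<in> R. \<alpha> \<bullet> v > 0}"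
    and generic: "\<And>\<alpha> \<beta>. \<alpha> \<in> P \<Longrightarrow> \<beta> \<in> P \<Longrightarrow> \<alpha> \<noteq> \<beta> \<Longrightarrow> \<phi> \<alpha> ^ nat \<lfloor>\<beta> \<bullet> v\<rfloor> \<noteq> \<phi> \<beta> ^ nat \<lfloor>\<alpha> \<bullet> v\<rfloor>"
  shows "(\<Sum>\<alpha>\<in>P. \<Sum>\<beta>\<in>P. W \<alpha> \<beta> * (coth_half (\<phi> \<alpha>) * coth_half (\<phi> \<beta>))) = (\<Sum>\<alpha>\<in>P. \<Sum>\<beta>\<in>P. W \<alpha> \<beta>)"
proof -
  define n where "n \<alpha> = nat \<lfloor>\<alpha> \<bullet> v\<rfloor>" for \<alpha>
  have PR: "\<alpha> \<in> R" if "\<alpha> \<in> P" for \<alpha> using that P by blast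
  have "finite P" using finite_R P by simp
  have n_int: "int (n \<alpha>) = \<lfloor>\<alpha> \<bullet> v\<rfloor>" and n_pos: "n \<alpha> > 0" if a: "\<alpha> \<in> P" for \<alpha>
  proof -
    obtain k where "\<alpha> \<bullet> v = of_int k" using v(1) PR[OF a] by (meson Ints_cases)
    moreover have "\<alpha> \<bullet> v > 0" using a P by blast
    ultimately show "int (n \<alpha>) = \<lfloor>\<alpha> \<bullet> v\<rfloor>" "n \<alpha> > 0" by (auto simp: n_def)
  qed
  have \<phi>0: "\<phi> \<alpha> \<noteq> 0" if "\<alpha> \<in> R" for \<alpha> using \<phi> that by (simp add: character_def)
  define c where "c \<alpha> z = coth_half (\<phi> \<alpha> * z ^ n \<alpha>)" for \<alpha> z
  define f where "f z = (\<Sum>\<alpha>\<in>P. \<Sum>\<beta>\<in>P. W \<alpha> \<beta> * (c \<alpha> z * c \<beta> z))" for z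
  define K where "K = (\<Union>\<alpha>\<in>P. {z. \<phi> \<alpha> * z ^ n \<alpha> = 1})"
  have "finite K"
    unfolding K_def
  proof (intro finite_UN_I \<open>finite P\<close>)
    fix \<alpha> assume a: "\<alpha> \<in> P"
    have "{z. \<phi> \<alpha> * z ^ n \<alpha> = 1} = {z. z ^ n \<alpha> = 1 / \<phi> \<alpha>}" using \<phi>0[OF PR[OF a]] by (auto simp: field_simps)
    then show "finite {z. \<phi> \<alpha> * z ^ n \<alpha> = 1}" using finite_nth_roots[OF n_pos[OF a]] by simp
  qed
  have "f holomorphic_on - K"
    unfolding f_def c_def coth_half_def by (intro holomorphic_intros) (auto simp: K_def)
  moreover have "((\<lambda>z. (z - a) * f z) \<longlongrightarrow> 0) (at a)" if aK: "a \<in> K" for a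
  proof -
    obtain \<gamma> where \<gamma>: "\<gamma> \<in> P" "\<phi> \<gamma> * a ^ n \<gamma> = 1" using aK by (auto simp: K_def)
    have "a \<noteq> 0" using \<gamma> n_pos[OF \<gamma>(1)] by (auto simp: power_0_left)
    \<comment> \<open>Raising the two polar equations to the powers \<open>n \<gamma>\<close> and
      \<open>n \<alpha>\<close> eliminates a and contradicts \<open>generic\<close>.\<close>
    have other: "\<phi> \<alpha> * a ^ n \<alpha> \<noteq> 1" if "\<alpha> \<in> P" "\<alpha> \<noteq> \<gamma>" for \<alpha>
    proof
      assume eq: "\<phi> \<alpha> * a ^ n \<alpha> = 1"
      have "\<phi> \<alpha> ^ n \<gamma> * a ^ (n \<alpha> * n \<gamma>) = (\<phi> \<alpha> * a ^ n \<alpha>) ^ n \<gamma>" by (simp add: power_mult_distrib power_mult)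
      also have "\<dots> = (\<phi> \<gamma> * a ^ n \<gamma>) ^ n \<alpha>" using eq \<gamma>(2) by simp
      also have "\<dots> = \<phi> \<gamma> ^ n \<alpha> * a ^ (n \<alpha> * n \<gamma>)" by (simp add: power_mult_distrib power_mult[symmetric] mult.commute)
      finally have "\<phi> \<alpha> ^ n \<gamma> = \<phi> \<gamma> ^ n \<alpha>" using \<open>a \<noteq> 0\<close> by simp
      then show False using generic[OF that(1) \<gamma>(1) that(2)] by (simp add: n_def)
    qed
    obtain r where r: "((\<lambda>z. (z - a) * c \<gamma> z) \<longlongrightarrow> r) (at a)"
      using coth_half_simple_pole[OF \<gamma>(2) n_pos[OF \<gamma>(1)]] by (auto simp: c_def)
    have lim: "((\<lambda>z. c \<alpha> z) \<longlongrightarrow> c \<alpha> a) (at a)" if "\<alpha> \<in> P" "\<alpha> \<noteq> \<gamma>" for \<alpha>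
      unfolding c_def by (rule continuous_coth_half[OF other[OF that]]) (intro tendsto_intros)
    \<comment> \<open>Limits of the summands times z - a. The polar root \<gamma> contributes as
      first and as second index; when both indices are \<gamma> the double pole is removed by
      \<open>W_self\<close>.\<close>
    define L where "L \<alpha> \<beta> = (if \<alpha> = \<gamma> then W \<gamma> \<beta> * (r * c \<beta> a) else if \<beta> = \<gamma> then W \<gamma> \<alpha> * (r * c \<alpha> a) else 0)" for \<alpha> \<beta>
    have "((\<lambda>z. (z - a) * (W \<alpha> \<beta> * (c \<alpha> z * c \<beta> z))) \<longlongrightarrow> L \<alpha> \<beta>) (at a)" if ab: "\<alpha> \<in> P" "\<beta> \<in> P" for \<alpha> \<beta>
    proof -
      have one: "((\<lambda>z. (z - a) * (W \<gamma> \<beta> * (c \<gamma> z * c \<beta> z))) \<longlongrightarrow> W \<gamma> \<beta> * (r * c \<beta> a)) (at a)"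
        if "\<beta> \<in> P" for \<beta>
      proof (cases "\<beta> = \<gamma>")
        case False
        have "((\<lambda>z. W \<gamma> \<beta> * (((z - a) * c \<gamma> z) * c \<beta> z)) \<longlongrightarrow> W \<gamma> \<beta> * (r * c \<beta> a)) (at a)"
          by (intro tendsto_mult tendsto_const r lim that False)
        then show ?thesis by (simp add: algebra_simps)
      qed (simp add: W_self)
      consider "\<alpha> = \<gamma>" | "\<alpha> \<noteq> \<gamma>" "\<beta> = \<gamma>" | "\<alpha> \<noteq> \<gamma>" "\<beta> \<noteq> \<gamma>" by blast
      then show ?thesis
      proof cases
        case 1
        then show ?thesis using one[OF ab(2)] by (simp add: L_def)
      next
        case 2
        then show ?thesis using one[OF ab(1)] W_sym[OF PR[OF ab(1)] PR[OF ab(2)]]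
          by (simp add: L_def mult.commute[of "c \<alpha> _"])
      next
        case 3
        have "((\<lambda>z. (z - a) * (W \<alpha> \<beta> * (c \<alpha> z * c \<beta> z))) \<longlongrightarrow> (a - a) * (W \<alpha> \<beta> * (c \<alpha> a * c \<beta> a))) (at a)"
          by (intro tendsto_mult tendsto_diff tendsto_const tendsto_ident_at lim ab 3)
        then show ?thesis using 3 by (simp add: L_def)
      qed
    qed
    then have "((\<lambda>z. \<Sum>\<alpha>\<in>P. \<Sum>\<beta>\<in>P. (z - a) * (W \<alpha> \<beta> * (c \<alpha> z * c \<beta> z))) \<longlongrightarrow> (\<Sum>\<alpha>\<in>P. \<Sum>\<beta>\<in>P. L \<alpha> \<beta>)) (at a)"
      by (intro tendsto_sum)
    moreover have "(\<Sum>\<alpha>\<in>P. \<Sum>\<beta>\<in>P. L \<alpha> \<beta>) = 0"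
    proof -
      define S where "S = (\<Sum>\<beta>\<in>P. W \<gamma> \<beta> * c \<beta> a)"
      \<comment> \<open>The twisted character at the pole z = a. It takes the value 1 on \<gamma>,
        so \<open>sum_W_character_zero\<close> annihilates the residue.\<close>
      define \<psi> where "\<psi> \<alpha> = \<phi> \<alpha> * a powi \<lfloor>\<alpha> \<bullet> v\<rfloor>" for \<alpha>
      have \<psi>: "character \<psi>"
        unfolding character_def
      proof (intro conjI ballI)
        show "\<psi> \<alpha> \<noteq> 0" if "\<alpha> \<in> R" for \<alpha> using \<phi>0[OF that] \<open>a \<noteq> 0\<close> by (simp add: \<psi>_def)
        fix \<alpha> \<beta> assume ab: "\<alpha> \<in> R" "\<beta> \<in> R"
        obtain k where k: "\<alpha> \<bullet> v = of_int k" using v(1) ab by (meson Ints_cases)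
        obtain l where l: "\<beta> \<bullet> v = of_int l" using v(1) ab by (meson Ints_cases)
        obtain m where m: "\<beta> \<bullet> coroot \<alpha> = of_int m" using integral[OF ab] by (meson Ints_cases)
        have "(reflection \<alpha> *v \<beta>) \<bullet> v = of_int (l - m * k)"
          by (simp add: reflection_root inner_diff_left k l m)
        then have "\<lfloor>(reflection \<alpha> *v \<beta>) \<bullet> v\<rfloor> = l + k * (- m)" by (simp only: floor_of_int) (simp add: algebra_simps)
        moreover have "a powi (l + k * (- m)) = a powi l * (a powi k) powi (- m)"
          by (subst power_int_mult[symmetric], subst power_int_add[symmetric]) (use \<open>a \<noteq> 0\<close> in auto)
        ultimately have "\<psi> (reflection \<alpha> *v \<beta>) = \<phi> (reflection \<alpha> *v \<beta>) * (a powi l * (a powi k) powi (- m))"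
          by (simp only: \<psi>_def)
        also have "\<phi> (reflection \<alpha> *v \<beta>) = \<phi> \<beta> * \<phi> \<alpha> powi (- m)"
          using \<phi> ab m by (simp add: character_def)
        finally show "\<psi> (reflection \<alpha> *v \<beta>) = \<psi> \<beta> * \<psi> \<alpha> powi (- \<lfloor>\<beta> \<bullet> coroot \<alpha>\<rfloor>)"
          by (simp add: \<psi>_def m k l power_int_mult_distrib)
      qed
      have \<psi>c: "coth_half (\<psi> \<beta>) = c \<beta> a" if "\<beta> \<in> P" for \<beta>
        by (simp add: \<psi>_def c_def n_int[OF that, symmetric])
      have "\<psi> \<gamma> = 1" using \<gamma> by (simp add: \<psi>_def n_int[OF \<gamma>(1), symmetric])
      have "0 = (\<Sum>\<beta>\<in>R. W \<gamma> \<beta> * coth_half (\<psi> \<beta>))"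
        using sum_W_character_zero[OF \<psi> PR[OF \<gamma>(1)] \<open>\<psi> \<gamma> = 1\<close>] by simp
      also have "\<dots> = 2 * (\<Sum>\<beta>\<in>P. W \<gamma> \<beta> * coth_half (\<psi> \<beta>))"
        unfolding P
      proof (rule sum_even)
        show "W \<gamma> (- \<alpha>) * coth_half (\<psi> (- \<alpha>)) = W \<gamma> \<alpha> * coth_half (\<psi> \<alpha>)" if "\<alpha> \<in> R" for \<alpha>
          using that \<psi> by (simp add: W_odd PR[OF \<gamma>(1)] character_uminus[OF \<psi>] coth_half_inverse character_def)
      qed (use v in auto)
      finally have "S = 0" by (simp add: S_def \<psi>c cong: sum.cong)
      have "(\<Sum>\<beta>\<in>P. L \<gamma> \<beta>) = r * S" by (simp add: L_def S_def sum_distrib_left algebra_simps)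
      moreover have "(\<Sum>\<beta>\<in>P. L \<alpha> \<beta>) = W \<gamma> \<alpha> * (r * c \<alpha> a)" if "\<alpha> \<noteq> \<gamma>" for \<alpha>
        using that \<gamma>(1) \<open>finite P\<close> by (simp add: L_def)
      then have "(\<Sum>\<alpha>\<in>P - {\<gamma>}. \<Sum>\<beta>\<in>P. L \<alpha> \<beta>) = (\<Sum>\<alpha>\<in>P - {\<gamma>}. W \<gamma> \<alpha> * (r * c \<alpha> a))"
        by (intro sum.cong) auto
      moreover have "(\<Sum>\<alpha>\<in>P - {\<gamma>}. W \<gamma> \<alpha> * (r * c \<alpha> a)) = r * S"
        using \<gamma>(1) \<open>finite P\<close> W_self
        by (simp add: S_def sum.remove[of P \<gamma>] sum_distrib_left algebra_simps)
      ultimately show ?thesis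
        using \<open>S = 0\<close> sum.remove[OF \<open>finite P\<close> \<gamma>(1), of "\<lambda>\<alpha>. \<Sum>\<beta>\<in>P. L \<alpha> \<beta>"] by simp
    qed
    ultimately show ?thesis by (simp add: f_def sum_distrib_left)
  qed
  ultimately obtain g where g: "g holomorphic_on UNIV" "\<And>z. z \<notin> K \<Longrightarrow> g z = f z"
    using holomorphic_extend_finite[OF \<open>finite K\<close>] by blast
  have "(f \<longlongrightarrow> (\<Sum>\<alpha>\<in>P. \<Sum>\<beta>\<in>P. W \<alpha> \<beta> * (1 * 1))) at_infinity"
    unfolding f_def c_def
    by (intro tendsto_sum tendsto_mult tendsto_const coth_half_at_infinity n_pos \<phi>0 PR)
  moreover have "\<forall>\<^sub>F z in at_infinity. f z = g z"
  proof -
    obtain B where B: "\<And>z. z \<in> K \<Longrightarrow> norm z \<le> B"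
      using finite_imp_bounded[OF \<open>finite K\<close>] by (auto simp: bounded_iff)
    have "\<forall>z. B + 1 \<le> norm z \<longrightarrow> f z = g z"
    proof (intro allI impI)
      fix z :: complex assume "B + 1 \<le> norm z"
      then have "z \<notin> K" using B[of z] by linarith
      then show "f z = g z" using g(2) by simp
    qed
    then show ?thesis unfolding eventually_at_infinity by blast
  qed
  ultimately have "(g \<longlongrightarrow> (\<Sum>\<alpha>\<in>P. \<Sum>\<beta>\<in>P. W \<alpha> \<beta>)) at_infinity" by (simp add: tendsto_cong)
  then have "g 1 = (\<Sum>\<alpha>\<in>P. \<Sum>\<beta>\<in>P. W \<alpha> \<beta>)" by (rule Liouville_weak[OF g(1)])
  moreover have "1 \<notin> K" using ne PR by (auto simp: K_def)
  ultimately have "f 1 = (\<Sum>\<alpha>\<in>P. \<Sum>\<beta>\<in>P. W \<alpha> \<beta>)" using g(2) by simp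
  then show ?thesis by (simp add: f_def c_def)
qed

text \<open>Twisting by exp (e (\<alpha> . y)) with real e reaches general position for all but
  finitely many e. The sum is continuous at e = 0, so it has the generic value there as
  well.\<close>

lemma sum_W_positive:
  assumes \<phi>: "character \<phi>" and ne: "\<And>\<alpha>. \<alpha> \<in> R \<Longrightarrow> \<phi> \<alpha> \<noteq> 1"
    and v: "\<forall>\<alpha>\<in>R. \<alpha> \<bullet> v \<in> \<int>" "\<forall>\<alpha>\<in>R. \<alpha> \<bullet> v \<noteq> 0" and P: "P = {\<alpha> \<in> R. \<alpha> \<bullet> v > 0}"
  shows "(\<Sum>\<alpha>\<in>P. \<Sum>\<beta>\<in>P. W \<alpha> \<beta> * (coth_half (\<phi> \<alpha>) * coth_half (\<phi> \<beta>))) = (\<Sum>\<alpha>\<in>P. \<Sum>\<beta>\<in>P. W \<alpha> \<beta>)"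
proof -
  define n where "n \<alpha> = nat \<lfloor>\<alpha> \<bullet> v\<rfloor>" for \<alpha>
  have PR: "\<alpha> \<in> R" if "\<alpha> \<in> P" for \<alpha> using that P by blast
  have "finite P" using finite_R P by simp
  have n_real: "real (n \<alpha>) = \<alpha> \<bullet> v" and n_pos: "n \<alpha> > 0" if a: "\<alpha> \<in> P" for \<alpha>
  proof -
    obtain k where "\<alpha> \<bullet> v = of_int k" using v(1) PR[OF a] by (meson Ints_cases)
    moreover have "\<alpha> \<bullet> v > 0" using a P by blast
    ultimately show "real (n \<alpha>) = \<alpha> \<bullet> v" "n \<alpha> > 0" by (auto simp: n_def)
  qed
  have \<phi>0: "\<phi> \<alpha> \<noteq> 0" if "\<alpha> \<in> R" for \<alpha> using \<phi> that by (simp add: character_def)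
  \<comment> \<open>The vectors that y must not annihilate: the roots, so that the twist leaves the
    mirrors, and the differences that decide whether two roots share a pole. The latter are nonzero
    because R is reduced and the integers n are positive.\<close>
  define F where "F = R \<union> (\<lambda>(\<alpha>, \<beta>). real (n \<beta>) *\<^sub>R \<alpha> - real (n \<alpha>) *\<^sub>R \<beta>) ` {(\<alpha>, \<beta>) \<in> P \<times> P. \<alpha> \<noteq> \<beta>}"
  have "\<exists>y\<in>UNIV. \<forall>g\<in>F. g \<bullet> y \<noteq> 0"
  proof (rule avoid_hyperplanes)
    have "finite {(\<alpha>, \<beta>) \<in> P \<times> P. \<alpha> \<noteq> \<beta>}"
      by (rule finite_subset[of _ "P \<times> P"]) (auto simp: \<open>finite P\<close>)
    then show "finite F" unfolding F_def using finite_R by blast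
    show "\<exists>b\<in>UNIV. g \<bullet> b \<noteq> 0" if "g \<in> F" for g
    proof -
      have "g \<noteq> 0"
      proof (cases "g \<in> R")
        case True
        then show ?thesis by (rule nonzero)
      next
        case False
        then obtain \<alpha> \<beta> where ab: "\<alpha> \<in> P" "\<beta> \<in> P" "\<alpha> \<noteq> \<beta>" "g = real (n \<beta>) *\<^sub>R \<alpha> - real (n \<alpha>) *\<^sub>R \<beta>"
          using \<open>g \<in> F\<close> by (auto simp: F_def)
        show ?thesis
        proof
          assume "g = 0"
          then have "real (n \<alpha>) *\<^sub>R \<beta> = real (n \<beta>) *\<^sub>R \<alpha>" using ab by simp
          then have eq: "\<beta> = (real (n \<beta>) / real (n \<alpha>)) *\<^sub>R \<alpha>"
            using n_pos[OF ab(1)] by (metis divide_inverse_commute gr_implies_not0 of_nat_eq_0_iff real_vector.scale_scale scaleR_one left_inverse)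
          then have "real (n \<beta>) / real (n \<alpha>) = 1 \<or> real (n \<beta>) / real (n \<alpha>) = - 1"
            using reduced PR[OF ab(1)] PR[OF ab(2)] unfolding reduced_def by metis
          moreover have "real (n \<beta>) / real (n \<alpha>) > 0" using n_pos ab by simp
          ultimately have "\<beta> = \<alpha>" using eq by auto
          then show False using ab by simp
        qed
      qed
      then show ?thesis by (intro bexI[of _ g]) auto
    qed
  qed auto
  then obtain y where y: "\<And>g. g \<in> F \<Longrightarrow> g \<bullet> y \<noteq> 0" by blast
  define \<psi> where "\<psi> e \<alpha> = \<phi> \<alpha> * exp (complex_of_real (e * (\<alpha> \<bullet> y)))" for e \<alpha>
  have char: "character (\<psi> e)" for e
    unfolding character_def
  proof (intro conjI ballI)
    show "\<psi> e \<alpha> \<noteq> 0" if "\<alpha> \<in> R" for \<alpha> using \<phi>0[OF that] by (simp add: \<psi>_def)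
    fix \<alpha> \<beta> assume ab: "\<alpha> \<in> R" "\<beta> \<in> R"
    obtain m where m: "\<beta> \<bullet> coroot \<alpha> = of_int m" using integral[OF ab] by (meson Ints_cases)
    have "complex_of_real (e * ((reflection \<alpha> *v \<beta>) \<bullet> y))
        = complex_of_real (e * (\<beta> \<bullet> y)) + of_int (- m) * complex_of_real (e * (\<alpha> \<bullet> y))"
      by (simp add: reflection_root inner_diff_left m algebra_simps)
    then have "exp (complex_of_real (e * ((reflection \<alpha> *v \<beta>) \<bullet> y)))
        = exp (complex_of_real (e * (\<beta> \<bullet> y))) * exp (complex_of_real (e * (\<alpha> \<bullet> y))) powi (- m)"
      by (simp only: exp_add exp_power_int)
    moreover have "\<phi> (reflection \<alpha> *v \<beta>) = \<phi> \<beta> * \<phi> \<alpha> powi (- m)"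
      using \<phi> ab m by (simp add: character_def)
    ultimately show "\<psi> e (reflection \<alpha> *v \<beta>) = \<psi> e \<beta> * \<psi> e \<alpha> powi (- \<lfloor>\<beta> \<bullet> coroot \<alpha>\<rfloor>)"
      by (simp add: \<psi>_def m power_int_mult_distrib)
  qed
  \<comment> \<open>The exceptional values of e. Each condition leads to an equation K exp (e g) =
    K' with g \<noteq> 0, so it has at most one real solution.\<close>
  define D where "D = (\<Union>\<alpha>\<in>R. {e. \<psi> e \<alpha> = 1})
      \<union> (\<Union>(\<alpha>, \<beta>)\<in>{(\<alpha>, \<beta>) \<in> P \<times> P. \<alpha> \<noteq> \<beta>}. {e. \<psi> e \<alpha> ^ n \<beta> = \<psi> e \<beta> ^ n \<alpha>})"
  have "finite D"
    unfolding D_def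
  proof (intro finite_UnI finite_UN_I finite_R)
    show "finite {e. \<psi> e \<alpha> = 1}" if "\<alpha> \<in> R" for \<alpha>
      unfolding \<psi>_def by (rule finite_exp_level[OF y \<phi>0[OF that]]) (use that in \<open>simp add: F_def\<close>)
    show "finite {(\<alpha>, \<beta>) \<in> P \<times> P. \<alpha> \<noteq> \<beta>}"
      by (rule finite_subset[of _ "P \<times> P"]) (auto simp: \<open>finite P\<close>)
    fix p assume "p \<in> {(\<alpha>, \<beta>) \<in> P \<times> P. \<alpha> \<noteq> \<beta>}"
    then obtain \<alpha> \<beta> where ab: "p = (\<alpha>, \<beta>)" "\<alpha> \<in> P" "\<beta> \<in> P" "\<alpha> \<noteq> \<beta>" by auto
    define g where "g = (real (n \<beta>) *\<^sub>R \<alpha> - real (n \<alpha>) *\<^sub>R \<beta>) \<bullet> y"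
    have "g \<noteq> 0" unfolding g_def by (rule y) (use ab in \<open>auto simp: F_def\<close>)
    have "\<phi> \<alpha> ^ n \<beta> * exp (complex_of_real (e * g)) = \<phi> \<beta> ^ n \<alpha>" if "\<psi> e \<alpha> ^ n \<beta> = \<psi> e \<beta> ^ n \<alpha>" for e
    proof -
      define x where "x = exp (of_nat (n \<alpha>) * complex_of_real (e * (\<beta> \<bullet> y)))"
      have "of_nat (n \<beta>) * complex_of_real (e * (\<alpha> \<bullet> y))
          = complex_of_real (e * g) + of_nat (n \<alpha>) * complex_of_real (e * (\<beta> \<bullet> y))"
        by (simp add: g_def inner_diff_left algebra_simps)
      then have "exp (complex_of_real (e * (\<alpha> \<bullet> y))) ^ n \<beta> = exp (complex_of_real (e * g)) * x"
        unfolding exp_of_nat_mult[symmetric] x_def by (simp only: exp_add)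
      moreover have "exp (complex_of_real (e * (\<beta> \<bullet> y))) ^ n \<alpha> = x" by (simp only: x_def exp_of_nat_mult)
      ultimately have "\<phi> \<alpha> ^ n \<beta> * (exp (complex_of_real (e * g)) * x) = \<phi> \<beta> ^ n \<alpha> * x"
        using that by (simp only: \<psi>_def power_mult_distrib)
      moreover have "x \<noteq> 0" by (simp add: x_def)
      ultimately show ?thesis by (metis mult.assoc mult_right_cancel)
    qed
    then have "{e. \<psi> e \<alpha> ^ n \<beta> = \<psi> e \<beta> ^ n \<alpha>} \<subseteq> {e. \<phi> \<alpha> ^ n \<beta> * exp (complex_of_real (e * g)) = \<phi> \<beta> ^ n \<alpha>}" by blast
    moreover have "finite {e. \<phi> \<alpha> ^ n \<beta> * exp (complex_of_real (e * g)) = \<phi> \<beta> ^ n \<alpha>}"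
      by (rule finite_exp_level[OF \<open>g \<noteq> 0\<close>]) (use \<phi>0 PR ab in auto)
    ultimately show "finite (case p of (\<alpha>, \<beta>) \<Rightarrow> {e. \<psi> e \<alpha> ^ n \<beta> = \<psi> e \<beta> ^ n \<alpha>})"
      using ab finite_subset by auto
  qed
  define h where "h e = (\<Sum>\<alpha>\<in>P. \<Sum>\<beta>\<in>P. W \<alpha> \<beta> * (coth_half (\<psi> e \<alpha>) * coth_half (\<psi> e \<beta>)))" for e
  define C where "C = (\<Sum>\<alpha>\<in>P. \<Sum>\<beta>\<in>P. W \<alpha> \<beta>)"
  have hC: "h e = C" if "e \<notin> D" for e
    unfolding h_def C_def
  proof (rule sum_W_generic[OF char _ v P])
    show "\<psi> e \<alpha> \<noteq> 1" if "\<alpha> \<in> R" for \<alpha> using \<open>e \<notin> D\<close> that by (auto simp: D_def)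
    show "\<psi> e \<alpha> ^ nat \<lfloor>\<beta> \<bullet> v\<rfloor> \<noteq> \<psi> e \<beta> ^ nat \<lfloor>\<alpha> \<bullet> v\<rfloor>" if "\<alpha> \<in> P" "\<beta> \<in> P" "\<alpha> \<noteq> \<beta>" for \<alpha> \<beta>
      using \<open>e \<notin> D\<close> that by (auto simp: D_def n_def)
  qed
  have \<psi>0: "\<psi> 0 \<alpha> = \<phi> \<alpha>" for \<alpha> by (simp add: \<psi>_def)
  have "((\<lambda>e. \<psi> e \<alpha>) \<longlongrightarrow> \<psi> 0 \<alpha>) (at 0)" for \<alpha>
    unfolding \<psi>_def by (intro tendsto_intros)
  then have "(h \<longlongrightarrow> h 0) (at 0)"
    unfolding h_def by (intro tendsto_sum tendsto_mult tendsto_const continuous_coth_half) (auto simp: \<psi>0 ne PR)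
  \<comment> \<open>The value e = 0 may itself be exceptional, so h is compared with C on a
    punctured neighbourhood that avoids the other points of D.\<close>
  moreover have "\<forall>\<^sub>F e in at 0. C = h e"
  proof -
    have "open (- (D - {0}))" using \<open>finite D\<close> by (intro open_Compl finite_imp_closed) simp
    then have "\<forall>\<^sub>F e in at 0. e \<in> - (D - {0})" by (intro eventually_at_in_open') auto
    moreover have "\<forall>\<^sub>F e::real in at 0. e \<noteq> 0" by (rule eventually_neq_at_within)
    ultimately show ?thesis by eventually_elim (simp add: hC)
  qed
  ultimately have "((\<lambda>_. C) \<longlongrightarrow> h 0) (at (0::real))" by (simp add: tendsto_cong)
  then have "h 0 = C" by (simp add: tendsto_const_iff)
  then show ?thesis by (simp add: h_def C_def \<psi>0)
qed

text \<open>
  Along a generic translate of a regular cocharacter the sum is a rational function with at most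
  simple poles; their residues vanish because the reflection in the polar root changes its sign.
\<close>

theorem sum_W_constant:
  "\<exists>C. \<forall>\<phi>. character \<phi> \<and> (\<forall>\<alpha>\<in>R. \<phi> \<alpha> \<noteq> 1) \<longrightarrow>
    (\<Sum>\<alpha>\<in>R. \<Sum>\<beta>\<in>R. W \<alpha> \<beta> * (coth_half (\<phi> \<alpha>) * coth_half (\<phi> \<beta>))) = C"
proof -
  obtain v where v: "\<forall>\<alpha>\<in>R. \<alpha> \<bullet> v \<in> \<int>" "\<forall>\<alpha>\<in>R. \<alpha> \<bullet> v \<noteq> 0" using regular_coweight by blast
  define P where "P = {\<alpha> \<in> R. \<alpha> \<bullet> v > 0}"
  \<comment> \<open>The factor 4 arises because the summand is even in each root separately: the
    weight and \<open>coth_half\<close> both change sign.\<close>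
  have "(\<Sum>\<alpha>\<in>R. \<Sum>\<beta>\<in>R. W \<alpha> \<beta> * (coth_half (\<phi> \<alpha>) * coth_half (\<phi> \<beta>))) = 4 * (\<Sum>\<alpha>\<in>P. \<Sum>\<beta>\<in>P. W \<alpha> \<beta>)"
    if \<phi>: "character \<phi>" and ne: "\<forall>\<alpha>\<in>R. \<phi> \<alpha> \<noteq> 1" for \<phi>
  proof -
    have odd: "coth_half (\<phi> (- \<alpha>)) = - coth_half (\<phi> \<alpha>)" if "\<alpha> \<in> R" for \<alpha>
      using that \<phi> by (simp add: character_uminus coth_half_inverse character_def)
    have W_odd': "W (- \<alpha>) \<beta> = - W \<alpha> \<beta>" if "\<alpha> \<in> R" "\<beta> \<in> R" for \<alpha> \<beta>
      using that by (simp add: W_sym[of "- \<alpha>" \<beta>] W_sym[of \<alpha> \<beta>] uminus_closed W_odd)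
    have inner: "(\<Sum>\<beta>\<in>R. W \<alpha> \<beta> * (coth_half (\<phi> \<alpha>) * coth_half (\<phi> \<beta>)))
        = 2 * (\<Sum>\<beta>\<in>P. W \<alpha> \<beta> * (coth_half (\<phi> \<alpha>) * coth_half (\<phi> \<beta>)))" if "\<alpha> \<in> R" for \<alpha>
      unfolding P_def by (rule sum_even) (use that v(2) in \<open>auto simp: W_odd odd\<close>)
    have "(\<Sum>\<alpha>\<in>R. \<Sum>\<beta>\<in>R. W \<alpha> \<beta> * (coth_half (\<phi> \<alpha>) * coth_half (\<phi> \<beta>)))
        = 2 * (\<Sum>\<alpha>\<in>P. \<Sum>\<beta>\<in>R. W \<alpha> \<beta> * (coth_half (\<phi> \<alpha>) * coth_half (\<phi> \<beta>)))"
      unfolding P_def by (rule sum_even) (use v(2) in \<open>auto simp: W_odd' odd\<close>)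
    also have "(\<Sum>\<alpha>\<in>P. \<Sum>\<beta>\<in>R. W \<alpha> \<beta> * (coth_half (\<phi> \<alpha>) * coth_half (\<phi> \<beta>)))
        = (\<Sum>\<alpha>\<in>P. 2 * (\<Sum>\<beta>\<in>P. W \<alpha> \<beta> * (coth_half (\<phi> \<alpha>) * coth_half (\<phi> \<beta>))))"
      by (intro sum.cong refl inner) (simp add: P_def)
    also have "\<dots> = 2 * (\<Sum>\<alpha>\<in>P. \<Sum>\<beta>\<in>P. W \<alpha> \<beta>)"
      unfolding sum_distrib_left[symmetric] using sum_W_positive[OF \<phi> _ v P_def] ne by simp
    finally show ?thesis by simp
  qed
  then show ?thesis by blast
qed

end

section \<open>The curvature identity\<close>

text \<open>The Euclidean form on linear functions, extended bilinearly (without conjugation) to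
  complex values. It contracts the index shared by the two factors of the curvature term.\<close>

definition dot :: "(real^'n \<Rightarrow> complex) \<Rightarrow> (real^'n \<Rightarrow> complex) \<Rightarrow> complex" where
  "dot f g = (\<Sum>i\<in>UNIV. f (axis i 1) * g (axis i 1))"

lemma dot_commute: "dot f g = dot g f"
  by (simp add: dot_def mult.commute)

lemma dot_add: "dot (\<lambda>z. f z + f' z) g = dot f g + dot f' g" "dot f (\<lambda>z. g z + g' z) = dot f g + dot f g'"
  by (simp_all add: dot_def algebra_simps sum.distrib)

lemma dot_scale: "dot (\<lambda>z. c * f z) g = c * dot f g" "dot f (\<lambda>z. c * g z) = c * dot f g"
  by (simp_all add: dot_def sum_distrib_left algebra_simps)

lemma dot_sum: "dot (\<lambda>z. \<Sum>a\<in>A. f a z) g = (\<Sum>a\<in>A. dot (f a) g)"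
  unfolding dot_def sum_distrib_right by (rule sum.swap)

lemma linear_axis_expansion:
  fixes f :: "real^'n \<Rightarrow> complex"
  assumes "linear f"
  shows "(\<Sum>i\<in>UNIV. of_real (x $ i) * f (axis i 1)) = f x"
proof -
  have "f x = f (\<Sum>i\<in>UNIV. x $ i *s axis i 1)" by (simp add: basis_expansion)
  also have "\<dots> = (\<Sum>i\<in>UNIV. f (x $ i *\<^sub>R axis i 1))" by (simp add: linear_sum[OF assms] scalar_mult_eq_scaleR)
  finally show ?thesis by (simp add: linear_scale[OF assms] scaleR_complex)
qed

lemma dot_inner: "linear g \<Longrightarrow> dot (\<lambda>z. of_real (x \<bullet> z)) g = g x"
  by (simp add: dot_def inner_axis linear_axis_expansion)

lemma reflection_symmetric: "(reflection \<alpha> *v x) \<bullet> y = x \<bullet> (reflection \<alpha> *v y)"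
  using reflection_inner[of \<alpha> x "reflection \<alpha> *v y"] by (simp add: reflection_involution)

text \<open>A reflection is symmetric and an involution, so moving it from one factor to the other
  cancels it.\<close>

lemma dot_reflection:
  fixes f g :: "real^'n \<Rightarrow> complex"
  assumes f: "linear f" and g: "linear g"
  shows "dot (\<lambda>z. f (reflection \<alpha> *v z)) (\<lambda>z. g (reflection \<alpha> *v z)) = dot f g"
proof -
  let ?s = "\<lambda>z. reflection \<alpha> *v z"
  have g': "linear (\<lambda>z. g (?s z))" using linear_compose[OF matrix_vector_mul_linear g] by (simp add: o_def)
  have "f (?s z) = (\<Sum>i\<in>UNIV. f (axis i 1) * of_real (?s (axis i 1) \<bullet> z))" for z
  proof -
    have "f (?s z) = (\<Sum>i\<in>UNIV. of_real (?s z $ i) * f (axis i 1))" by (simp add: linear_axis_expansion[OF f])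
    moreover have "?s z $ i = ?s (axis i 1) \<bullet> z" for i
      using reflection_symmetric[of \<alpha> "axis i 1" z] by (simp add: inner_axis')
    ultimately show ?thesis by (simp add: mult.commute)
  qed
  then have "dot (\<lambda>z. f (?s z)) (\<lambda>z. g (?s z)) = (\<Sum>i\<in>UNIV. f (axis i 1) * g (?s (?s (axis i 1))))"
    by (simp add: dot_sum dot_scale dot_inner[OF g'])
  then show ?thesis by (simp add: reflection_involution dot_def)
qed

locale root_connection = inv_trilinear R T for R :: "(real^'n) set" and T +
  fixes k :: "real^'n \<Rightarrow> complex"
  assumes reduced: "reduced R" and irreducible: "irreducible_roots R"
    and k_inv: "\<alpha> \<in> R \<Longrightarrow> \<beta> \<in> R \<Longrightarrow> k (reflection \<alpha> *v \<beta>) = k \<beta>"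
begin

text \<open>The root part of the connection with all indices lowered. Its summands are even, so the
  sum over positive roots with factor 1/2 becomes a sum over all roots with factor 1/4, which is
  convenient for re-indexing by reflections.\<close>

definition root_tensor :: "(real^'n \<Rightarrow> complex) \<Rightarrow> real^'n \<Rightarrow> real^'n \<Rightarrow> real^'n \<Rightarrow> complex" where
  "root_tensor \<phi> u w z = (\<Sum>\<alpha>\<in>R. (1/4 * k \<alpha> * coth_half (\<phi> \<alpha>) * of_real ((\<alpha> \<bullet> u) * (\<alpha> \<bullet> w))) * of_real (coroot \<alpha> \<bullet> z))"

definition conn_tensor :: "(real^'n \<Rightarrow> complex) \<Rightarrow> real^'n \<Rightarrow> real^'n \<Rightarrow> real^'n \<Rightarrow> complex" where
  "conn_tensor \<phi> u w z = root_tensor \<phi> u w z + T u w z"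

text \<open>The commutator part of the curvature with one index lowered; the derivative part will be
  seen to cancel.\<close>

definition curv :: "(real^'n \<Rightarrow> complex) \<Rightarrow> real^'n \<Rightarrow> real^'n \<Rightarrow> real^'n \<Rightarrow> real^'n \<Rightarrow> complex" where
  "curv \<phi> u v w z = dot (conn_tensor \<phi> u w) (conn_tensor \<phi> v z) - dot (conn_tensor \<phi> v w) (conn_tensor \<phi> u z)"

lemma root_tensor_linear: "linear (\<lambda>u. root_tensor \<phi> u w z)" "linear (\<lambda>w. root_tensor \<phi> u w z)" "linear (\<lambda>z. root_tensor \<phi> u w z)"
  unfolding root_tensor_def
  by (rule linear_compose_sum, rule ballI, rule linearI; simp add: inner_add_right scaleR_complex algebra_simps)+

lemma conn_tensor_linear: "linear (\<lambda>u. conn_tensor \<phi> u w z)" "linear (\<lambda>w. conn_tensor \<phi> u w z)" "linear (\<lambda>z. conn_tensor \<phi> u w z)"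
  unfolding conn_tensor_def by (auto intro!: linear_compose_add root_tensor_linear lin1 lin2 lin3)

lemma dot_root_tensor:
  assumes "linear g"
  shows "dot (root_tensor \<phi> u w) g
    = (\<Sum>\<alpha>\<in>R. (1/4 * k \<alpha> * coth_half (\<phi> \<alpha>) * of_real ((\<alpha> \<bullet> u) * (\<alpha> \<bullet> w))) * g (coroot \<alpha>))"
  unfolding root_tensor_def[abs_def] dot_sum dot_scale dot_inner[OF assms] ..

text \<open>Symmetrizing the double sum in the two roots turns its coefficient into a product of two
  2 x 2 determinants. The constant is 1/2 for the symmetrization times 1/4 for each
  \<open>root_tensor\<close>.\<close>

definition weight :: "real^'n \<Rightarrow> real^'n \<Rightarrow> real^'n \<Rightarrow> real^'n \<Rightarrow> real^'n \<Rightarrow> real^'n \<Rightarrow> complex" where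
  "weight u v w z \<alpha> \<beta> = 1/32 * (k \<alpha> * k \<beta>) * of_real ((coroot \<alpha> \<bullet> coroot \<beta>)
     * ((\<alpha> \<bullet> u) * (\<beta> \<bullet> v) - (\<alpha> \<bullet> v) * (\<beta> \<bullet> u)) * ((\<alpha> \<bullet> w) * (\<beta> \<bullet> z) - (\<alpha> \<bullet> z) * (\<beta> \<bullet> w)))"

lemma k_uminus: "\<beta> \<in> R \<Longrightarrow> k (- \<beta>) = k \<beta>"
  using k_inv[of \<beta> \<beta>] reflection_self nonzero by metis

text \<open>Under the reflection in \<alpha> the determinants are unchanged, as they ignore
  multiples of \<alpha> added to \<beta>, while the inner product of the coroots changes
  sign.\<close>

lemma root_weight: "root_weight R (weight u v w z)"
proof
  fix \<alpha> \<beta> :: "real^'n"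
  show "weight u v w z \<alpha> \<alpha> = 0" by (simp add: weight_def algebra_simps)
  assume R: "\<alpha> \<in> R" "\<beta> \<in> R"
  show "weight u v w z \<alpha> \<beta> = weight u v w z \<beta> \<alpha>"
    by (simp add: weight_def inner_commute[of "coroot \<alpha>"] algebra_simps)
  have "coroot (- \<beta>) = - coroot \<beta>" by (simp add: coroot_def)
  then show "weight u v w z \<alpha> (- \<beta>) = - weight u v w z \<alpha> \<beta>"
    by (simp add: weight_def k_uminus[OF R(2)] algebra_simps)
  define n where "n = \<beta> \<bullet> coroot \<alpha>"
  have 1: "coroot \<alpha> \<bullet> coroot (reflection \<alpha> *v \<beta>) = - (coroot \<alpha> \<bullet> coroot \<beta>)"
  proof -
    have "coroot \<alpha> \<bullet> coroot (reflection \<alpha> *v \<beta>) = (reflection \<alpha> *v coroot \<alpha>) \<bullet> coroot \<beta>"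
      by (simp add: reflection_coroot[symmetric] reflection_symmetric)
    also have "reflection \<alpha> *v coroot \<alpha> = - coroot \<alpha>"
      unfolding reflection_coroot reflection_self[OF nonzero[OF R(1)]] by (simp add: coroot_def)
    finally show ?thesis by simp
  qed
  have 2: "(\<alpha> \<bullet> x) * ((reflection \<alpha> *v \<beta>) \<bullet> y) - (\<alpha> \<bullet> y) * ((reflection \<alpha> *v \<beta>) \<bullet> x) = (\<alpha> \<bullet> x) * (\<beta> \<bullet> y) - (\<alpha> \<bullet> y) * (\<beta> \<bullet> x)" for x y
    by (simp add: reflection_root inner_diff_left algebra_simps)
  show "weight u v w z \<alpha> (reflection \<alpha> *v \<beta>) = - weight u v w z \<alpha> \<beta>"
    unfolding weight_def 1 2 k_inv[OF R] by simp
qed (rule reduced)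

text \<open>The mixed terms cancel root by root by \<open>root_cross_term\<close>. What remains is
  the double sum over the roots and a term from T alone, which does not involve the
  character.\<close>

lemma curv_expand:
  "curv \<phi> u v w z = (\<Sum>\<alpha>\<in>R. \<Sum>\<beta>\<in>R. weight u v w z \<alpha> \<beta> * (coth_half (\<phi> \<alpha>) * coth_half (\<phi> \<beta>)))
     + (dot (T u w) (T v z) - dot (T v w) (T u z))"
proof -
  define a where "a \<alpha> = 1/4 * k \<alpha> * coth_half (\<phi> \<alpha>)" for \<alpha>
  have cross: "dot (root_tensor \<phi> u w) (T v z) + dot (T u w) (root_tensor \<phi> v z)
     = dot (root_tensor \<phi> v w) (T u z) + dot (T v w) (root_tensor \<phi> u z)"
  proof -
    have "a \<alpha> * of_real ((\<alpha> \<bullet> u) * (\<alpha> \<bullet> w)) * T v z (coroot \<alpha>) + a \<alpha> * of_real ((\<alpha> \<bullet> v) * (\<alpha> \<bullet> z)) * T u w (coroot \<alpha>)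
      = a \<alpha> * of_real ((\<alpha> \<bullet> v) * (\<alpha> \<bullet> w)) * T u z (coroot \<alpha>) + a \<alpha> * of_real ((\<alpha> \<bullet> u) * (\<alpha> \<bullet> z)) * T v w (coroot \<alpha>)"
      if "\<alpha> \<in> R" for \<alpha>
    proof -
      define c where "c = complex_of_real (2 / (\<alpha> \<bullet> \<alpha>))"
      have c: "T x y (coroot \<alpha>) = c * T x y \<alpha>" for x y by (simp add: coroot_def T_scale c_def scaleR_complex)
      have "(a \<alpha> * c) * (of_real ((\<alpha> \<bullet> u) * (\<alpha> \<bullet> w)) * T v z \<alpha> + of_real ((\<alpha> \<bullet> v) * (\<alpha> \<bullet> z)) * T u w \<alpha>)
         = (a \<alpha> * c) * (of_real ((\<alpha> \<bullet> v) * (\<alpha> \<bullet> w)) * T u z \<alpha> + of_real ((\<alpha> \<bullet> u) * (\<alpha> \<bullet> z)) * T v w \<alpha>)"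
        by (simp only: root_cross_term[OF that])
      then show ?thesis unfolding c by (simp only: distrib_left mult.assoc mult.left_commute[of c])
    qed
    then show ?thesis
      unfolding dot_commute[of "T _ _"] dot_root_tensor[OF lin3] sum.distrib[symmetric] a_def
      by (intro sum.cong refl) auto
  qed
  define X where "X \<alpha> \<beta> = a \<alpha> * a \<beta> * of_real ((coroot \<alpha> \<bullet> coroot \<beta>) *
     ((\<alpha> \<bullet> u) * (\<alpha> \<bullet> w) * (\<beta> \<bullet> v) * (\<beta> \<bullet> z) - (\<alpha> \<bullet> v) * (\<alpha> \<bullet> w) * (\<beta> \<bullet> u) * (\<beta> \<bullet> z)))" for \<alpha> \<beta>
  have "dot (root_tensor \<phi> u w) (root_tensor \<phi> v z) - dot (root_tensor \<phi> v w) (root_tensor \<phi> u z)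
      = (\<Sum>\<alpha>\<in>R. \<Sum>\<beta>\<in>R. X \<alpha> \<beta>)"
    unfolding dot_root_tensor[OF root_tensor_linear(3)]
    unfolding root_tensor_def sum_distrib_left sum_subtractf[symmetric]
    by (intro sum.cong refl) (simp add: X_def a_def inner_commute algebra_simps)
  also have "\<dots> = (\<Sum>\<alpha>\<in>R. \<Sum>\<beta>\<in>R. 1/2 * X \<alpha> \<beta> + 1/2 * X \<beta> \<alpha>)"
  proof -
    have "(\<Sum>\<alpha>\<in>R. \<Sum>\<beta>\<in>R. X \<alpha> \<beta>) = (\<Sum>\<alpha>\<in>R. \<Sum>\<beta>\<in>R. X \<beta> \<alpha>)" by (rule sum.swap)
    then show ?thesis unfolding sum.distrib sum_distrib_left[symmetric] by simp
  qed
  also have "\<dots> = (\<Sum>\<alpha>\<in>R. \<Sum>\<beta>\<in>R. weight u v w z \<alpha> \<beta> * (coth_half (\<phi> \<alpha>) * coth_half (\<phi> \<beta>)))"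
    by (intro sum.cong refl) (simp add: X_def a_def weight_def inner_commute[of "coroot _" "coroot _"] algebra_simps)
  finally show ?thesis
    using cross unfolding curv_def conn_tensor_def[abs_def] dot_add by (simp add: algebra_simps)
qed

lemma character_reflect:
  assumes \<phi>: "character \<phi>" and \<gamma>: "\<gamma> \<in> R"
  shows "character (\<lambda>\<alpha>. \<phi> (reflection \<gamma> *v \<alpha>))"
  unfolding character_def
proof (intro conjI ballI)
  show "\<phi> (reflection \<gamma> *v \<alpha>) \<noteq> 0" if "\<alpha> \<in> R" for \<alpha>
    using \<phi> reflection_closed[OF \<gamma> that] by (simp add: character_def)
  fix \<alpha> \<beta> assume R: "\<alpha> \<in> R" "\<beta> \<in> R"
  have m: "(reflection \<gamma> *v \<beta>) \<bullet> coroot (reflection \<gamma> *v \<alpha>) = \<beta> \<bullet> coroot \<alpha>"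
    by (simp add: reflection_coroot[symmetric] reflection_inner)
  have "reflection \<gamma> *v (reflection \<alpha> *v \<beta>) = reflection (reflection \<gamma> *v \<alpha>) *v (reflection \<gamma> *v \<beta>)"
    by (simp only: reflection_root[of \<alpha> \<beta>] reflection_root[of "reflection \<gamma> *v \<alpha>"] m
        matrix_vector_mult_diff_distrib reflection_scale)
  moreover have "\<phi> (reflection (reflection \<gamma> *v \<alpha>) *v (reflection \<gamma> *v \<beta>))
     = \<phi> (reflection \<gamma> *v \<beta>) * \<phi> (reflection \<gamma> *v \<alpha>) powi (- \<lfloor>(reflection \<gamma> *v \<beta>) \<bullet> coroot (reflection \<gamma> *v \<alpha>)\<rfloor>)"
    using \<phi> reflection_closed[OF \<gamma> R(1)] reflection_closed[OF \<gamma> R(2)] unfolding character_def by blast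
  ultimately show "\<phi> (reflection \<gamma> *v (reflection \<alpha> *v \<beta>))
     = \<phi> (reflection \<gamma> *v \<beta>) * \<phi> (reflection \<gamma> *v \<alpha>) powi (- \<lfloor>\<beta> \<bullet> coroot \<alpha>\<rfloor>)"
    by (simp only: m)
qed

text \<open>Re-indexing the sum over the roots transfers a reflection of the vectors to the
  character.\<close>

lemma conn_tensor_reflect:
  assumes \<gamma>: "\<gamma> \<in> R"
  shows "conn_tensor \<phi> (reflection \<gamma> *v u) (reflection \<gamma> *v w) (reflection \<gamma> *v z)
    = conn_tensor (\<lambda>\<alpha>. \<phi> (reflection \<gamma> *v \<alpha>)) u w z"
proof -
  have "root_tensor \<phi> (reflection \<gamma> *v u) (reflection \<gamma> *v w) (reflection \<gamma> *v z)
    = root_tensor (\<lambda>\<alpha>. \<phi> (reflection \<gamma> *v \<alpha>)) u w z"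
    unfolding root_tensor_def
    by (subst sum.reindex_bij_betw[OF bij_reflection[OF \<gamma>], symmetric])
      (intro sum.cong refl, simp add: k_inv[OF \<gamma>] reflection_inner reflection_coroot[symmetric])
  then show ?thesis by (simp add: conn_tensor_def inv[OF \<gamma>])
qed

text \<open>By \<open>sum_W_constant\<close> the value does not depend on the regular character.
  Reflecting the four vectors amounts to changing the character, so the value is invariant and
  \<open>inv_curvature\<close> applies. Without a regular character the claim is vacuous.\<close>

theorem curv_scalar:
  "\<exists>l. \<forall>\<phi>. character \<phi> \<and> (\<forall>\<alpha>\<in>R. \<phi> \<alpha> \<noteq> 1) \<longrightarrow>
     (\<forall>u v w z. curv \<phi> u v w z = l * of_real (wedge_inner u v w z))"
proof (cases "\<exists>\<phi>. character \<phi> \<and> (\<forall>\<alpha>\<in>R. \<phi> \<alpha> \<noteq> 1)")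
  case True
  then obtain \<phi>0 where \<phi>0: "character \<phi>0" "\<forall>\<alpha>\<in>R. \<phi>0 \<alpha> \<noteq> 1" by blast
  have const: "curv \<phi> u v w z = curv \<phi>0 u v w z" if "character \<phi>" "\<forall>\<alpha>\<in>R. \<phi> \<alpha> \<noteq> 1" for \<phi> u v w z
  proof -
    obtain C where "\<And>\<phi>. character \<phi> \<and> (\<forall>\<alpha>\<in>R. \<phi> \<alpha> \<noteq> 1) \<Longrightarrow>
        (\<Sum>\<alpha>\<in>R. \<Sum>\<beta>\<in>R. weight u v w z \<alpha> \<beta> * (coth_half (\<phi> \<alpha>) * coth_half (\<phi> \<beta>))) = C"
      using root_weight.sum_W_constant[OF root_weight, of u v w z] by blast
    then show ?thesis using that \<phi>0 unfolding curv_expand by simp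
  qed
  have dl: "dot (\<lambda>z. f (x + y) z) g = dot (f x) g + dot (f y) g"
      "dot g (\<lambda>z. f (x + y) z) = dot g (f x) + dot g (f y)"
    if "\<And>z. linear (\<lambda>x. f x z)" for f :: "real^'n \<Rightarrow> real^'n \<Rightarrow> complex" and x y g
    using linear_add[OF that] by (simp_all add: dot_add)
  have ds: "dot (\<lambda>z. f (c *\<^sub>R x) z) g = c *\<^sub>R dot (f x) g" "dot g (\<lambda>z. f (c *\<^sub>R x) z) = c *\<^sub>R dot g (f x)"
    if "\<And>z. linear (\<lambda>x. f x z)" for f :: "real^'n \<Rightarrow> real^'n \<Rightarrow> complex" and c x g
    using linear_scale[OF that] by (simp_all add: dot_scale scaleR_complex)
  note l1 = dl[of "\<lambda>u. conn_tensor \<phi>0 u _", OF conn_tensor_linear(1)] ds[of "\<lambda>u. conn_tensor \<phi>0 u _", OF conn_tensor_linear(1)]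
    dl[of "conn_tensor \<phi>0 _", OF conn_tensor_linear(2)] ds[of "conn_tensor \<phi>0 _", OF conn_tensor_linear(2)]
  have L: "linear (\<lambda>u. curv \<phi>0 u v w z)" "linear (\<lambda>v. curv \<phi>0 u v w z)"
       "linear (\<lambda>w. curv \<phi>0 u v w z)" "linear (\<lambda>z. curv \<phi>0 u v w z)" for u v w z
    unfolding curv_def by (rule linearI; simp add: l1 algebra_simps)+
  have A: "curv \<phi>0 u v w z = - curv \<phi>0 v u w z" "curv \<phi>0 u v w z = - curv \<phi>0 u v z w" for u v w z
    by (simp_all add: curv_def dot_commute[of "conn_tensor \<phi>0 v w"] dot_commute[of "conn_tensor \<phi>0 u w"])
  have I: "curv \<phi>0 (reflection \<gamma> *v u) (reflection \<gamma> *v v) (reflection \<gamma> *v w) (reflection \<gamma> *v z) = curv \<phi>0 u v w z"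
    if \<gamma>: "\<gamma> \<in> R" for \<gamma> u v w z
  proof -
    have d: "dot (conn_tensor \<phi>0 (reflection \<gamma> *v x) (reflection \<gamma> *v y)) (conn_tensor \<phi>0 (reflection \<gamma> *v x') (reflection \<gamma> *v y'))
      = dot (conn_tensor (\<lambda>\<alpha>. \<phi>0 (reflection \<gamma> *v \<alpha>)) x y) (conn_tensor (\<lambda>\<alpha>. \<phi>0 (reflection \<gamma> *v \<alpha>)) x' y')" for x y x' y'
      by (subst dot_reflection[OF conn_tensor_linear(3) conn_tensor_linear(3), of _ _ _ \<gamma>, symmetric])
        (simp add: conn_tensor_reflect[OF \<gamma>])
    have "curv \<phi>0 (reflection \<gamma> *v u) (reflection \<gamma> *v v) (reflection \<gamma> *v w) (reflection \<gamma> *v z)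
        = curv (\<lambda>\<alpha>. \<phi>0 (reflection \<gamma> *v \<alpha>)) u v w z"
      unfolding curv_def d ..
    also have "\<dots> = curv \<phi>0 u v w z"
      by (rule const) (use character_reflect[OF \<phi>0(1) \<gamma>] \<phi>0(2) reflection_closed[OF \<gamma>] in auto)
    finally show ?thesis .
  qed
  interpret q: inv_curvature R "curv \<phi>0"
    by (rule inv_curvature.intro[OF root_sys_axioms inv_curvature_axioms.intro[OF L A I irreducible]])
  obtain l where "\<forall>u v w z. curv \<phi>0 u v w z = l * of_real (wedge_inner u v w z)" using q.curvature_scalar by blast
  then show ?thesis using const by (intro exI[of _ l]) simp
qed blast

end

section \<open>Local charts into projective space\<close>

lemma injective_derivative_invertible:
  fixes A :: "complex^'k^'k"
  assumes "\<And>x. A *v x = 0 \<Longrightarrow> x = 0"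
  shows "invertible A"
proof -
  have "inj ((*v) A)"
    by (rule injI) (metis assms eq_iff_diff_eq_0 matrix_vector_mult_diff_distrib)
  then obtain B where "B ** A = mat 1" using matrix_left_invertible_injective by blast
  then show ?thesis using matrix_left_right_inverse unfolding invertible_def by blast
qed

lemma invertible_transpose_injective:
  fixes A :: "complex^'k^'k"
  assumes "\<And>x. (\<And>j. (\<Sum>i\<in>UNIV. x $ i * A $ i $ j) = 0) \<Longrightarrow> x = 0"
  shows "invertible A"
proof -
  have "invertible (transpose A)"
  proof (rule injective_derivative_invertible)
    fix x assume "transpose A *v x = 0"
    then show "x = 0"
      by (intro assms) (simp add: matrix_vector_mult_def transpose_def vec_eq_iff mult.commute)
  qed
  then obtain B where "transpose A ** B = mat 1" "B ** transpose A = mat 1" unfolding invertible_def by blast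
  then have "transpose B ** A = mat 1" "A ** transpose B = mat 1"
    by (metis matrix_transpose_mul transpose_mat transpose_transpose)+
  then show ?thesis unfolding invertible_def by blast
qed

text \<open>The real inverse function theorem applies, because partial derivatives of holomorphic
  functions are again holomorphic and hence continuous. The inverse is holomorphic since the inverse
  of a complex-linear bijection is complex-linear.\<close>

lemma holomorphic_inverse_function:
  fixes \<Phi> :: "complex^'k \<Rightarrow> complex^'k"
  assumes "open S" and d: "\<And>i z. z \<in> S \<Longrightarrow> complex_differentiable_at (\<lambda>z. \<Phi> z $ i) z"
    and inj: "\<And>z v. z \<in> S \<Longrightarrow> (\<And>i. pairing (cgrad (\<lambda>z. \<Phi> z $ i) z) v = 0) \<Longrightarrow> v = 0"
    and "x \<in> S"
  obtains U V \<Psi> where "open U" "U \<subseteq> S" "x \<in> U" "open V" "\<Phi> x \<in> V" "homeomorphism U V \<Phi> \<Psi>"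
    "\<And>y i. y \<in> V \<Longrightarrow> complex_differentiable_at (\<lambda>y. \<Psi> y $ i) y"
proof -
  define L where "L z v = (\<chi> i. pairing (cgrad (\<lambda>z. \<Phi> z $ i) z) v)" for z v
  define f' where "f' z = (\<Sum>i\<in>UNIV. Blinfun (\<lambda>c. axis i c :: complex^'k) o\<^sub>L pairing_blinfun (cgrad (\<lambda>z. \<Phi> z $ i) z))" for z
  have bl: "bounded_linear (\<lambda>c. axis i c :: complex^'k)" for i
    using bounded_linear_scale_left[of "axis i 1"] by (simp add: scale_axis)
  have f': "blinfun_apply (f' z) = L z" for z
  proof
    fix v
    have "blinfun_apply (f' z) v = (\<Sum>i\<in>UNIV. axis i (pairing (cgrad (\<lambda>z. \<Phi> z $ i) z) v))"
      by (simp add: f'_def blinfun.sum_left bounded_linear_Blinfun_apply[OF bl] pairing_blinfun_apply)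
    also have "\<dots> = L z v" by (simp add: L_def vec_eq_iff axis_def)
    finally show "blinfun_apply (f' z) v = L z v" .
  qed
  have lin: "L z (u + v) = L z u + L z v" "L z (c *s v) = c *s L z v" for z u v c
    by (simp_all add: L_def vec_eq_iff pairing_add_right pairing_scale_right)
  have der: "(\<Phi> has_derivative blinfun_apply (f' z)) (at z)" if "z \<in> S" for z
    unfolding f' by (rule has_derivative_vec_componentwise)
      (simp add: L_def complex_differentiable_has_derivative[OF d[OF that]])
  have cont: "continuous_on S f'"
  proof -
    have "continuous_on S (\<lambda>z. cgrad (\<lambda>z. \<Phi> z $ i) z $ j)" for i j
      using cgrad_complex_differentiable(1)[OF \<open>open S\<close> d] by (rule complex_differentiable_continuous_on)
    then have "continuous_on S (\<lambda>z. pairing_blinfun (cgrad (\<lambda>z. \<Phi> z $ i) z))" for i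
      by (rule continuous_on_pairing_blinfun)
    then show ?thesis unfolding f'_def by (intro continuous_intros)
  qed
  have "linear (blinfun_apply (f' x))" by (simp add: blinfun.bounded_linear_right bounded_linear.linear)
  moreover have "inj (blinfun_apply (f' x))"
    unfolding linear_injective_0[OF \<open>linear (blinfun_apply (f' x))\<close>]
    using inj[OF \<open>x \<in> S\<close>] by (auto simp: f' L_def vec_eq_iff)
  ultimately obtain g where g: "linear g" "g \<circ> blinfun_apply (f' x) = id"
    using linear_injective_left_inverse by blast
  have "Blinfun g o\<^sub>L f' x = id_blinfun"
    using g by (intro blinfun_eqI) (simp add: bounded_linear_Blinfun_apply linear_conv_bounded_linear fun_eq_iff)
  then obtain U V \<Psi> \<Psi>' where I: "open U" "U \<subseteq> S" "x \<in> U" "open V" "\<Phi> x \<in> V" "homeomorphism U V \<Phi> \<Psi>"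
    "\<And>y. y \<in> V \<Longrightarrow> (\<Psi> has_derivative \<Psi>' y) (at y)" "\<And>y. y \<in> V \<Longrightarrow> \<Psi>' y = inv (blinfun_apply (f' (\<Psi> y)))"
    "\<And>y. y \<in> V \<Longrightarrow> bij (blinfun_apply (f' (\<Psi> y)))"
    using inverse_function_theorem[OF \<open>open S\<close> der cont \<open>x \<in> S\<close>] by blast
  have "complex_differentiable_at (\<lambda>y. \<Psi> y $ i) y" if y: "y \<in> V" for y i
  proof -
    have bij: "bij (L (\<Psi> y))" and eq: "\<Psi>' y = inv (L (\<Psi> y))" using I(8,9)[OF y] by (auto simp: f')
    have "((\<lambda>y. \<Psi> y $ i) has_derivative (\<lambda>v. \<Psi>' y v $ i)) (at y)"
      by (rule bounded_linear.has_derivative[OF bounded_linear_vec_nth I(7)[OF y]])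
    moreover have LL: "L (\<Psi> y) (\<Psi>' y v) = v" for v
      unfolding eq using bij by (simp add: bij_is_surj surj_f_inv_f)
    have "\<Psi>' y (u + v) = \<Psi>' y u + \<Psi>' y v" for u v
      by (rule injD[OF bij_is_inj[OF bij]]) (simp add: lin LL)
    moreover have "\<Psi>' y (c *s v) = c *s \<Psi>' y v" for c v
      by (rule injD[OF bij_is_inj[OF bij]]) (simp add: lin LL)
    ultimately show ?thesis
      unfolding complex_differentiable_at_def Vector_Spaces.linear_iff
      by (intro exI[of _ "\<lambda>v. \<Psi>' y v $ i"] conjI vec.vector_space_axioms vector_space_over_itself.vector_space_axioms) auto
  qed
  then show ?thesis using that I(1-6) by blast
qed

section \<open>Homogeneous coordinates, the affine cone and charts into projective space\<close>

lemma proj_pt_scale: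
  assumes "c \<noteq> 0"
  shows "proj_pt (c *s v) = proj_pt (v :: complex^'k)"
proof (intro equalityI subsetI)
  fix x assume "x \<in> proj_pt (c *s v)"
  then obtain d where "x = (d * c) *s v" by (auto simp: proj_pt_def)
  then show "x \<in> proj_pt v" unfolding proj_pt_def by blast
next
  fix x assume "x \<in> proj_pt v"
  then obtain d where "x = d *s v" by (auto simp: proj_pt_def)
  then have "x = (d / c) *s (c *s v)" using assms by simp
  then show "x \<in> proj_pt (c *s v)" unfolding proj_pt_def by blast
qed

lemma proj_pt_eq_iff:
  assumes "u \<noteq> 0"
  shows "proj_pt u = proj_pt (v :: complex^'k) \<longleftrightarrow> (\<exists>c. c \<noteq> 0 \<and> u = c *s v)"
proof
  assume "proj_pt u = proj_pt v"
  moreover have "u \<in> proj_pt u" unfolding proj_pt_def by (rule image_eqI[of _ _ 1]) auto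
  ultimately obtain c where "u = c *s v" unfolding proj_pt_def by auto
  then show "\<exists>c. c \<noteq> 0 \<and> u = c *s v" using assms by auto
qed (auto simp: proj_pt_scale)

lemma proj_pt_matrix: "proj_pt (A *v v) = (*v) A ` proj_pt (v :: complex^'k)"
  unfolding proj_pt_def image_image by (simp add: vector_scalar_commute)

definition cone_vec :: "complex \<Rightarrow> complex^'n \<Rightarrow> complex^'n option" where
  "cone_vec c x = (\<chi> i. case i of None \<Rightarrow> c | Some j \<Rightarrow> x $ j)"

lemma cone_vec_simps [simp]: "cone_vec c x $ None = c" "hpart (cone_vec c x) = x" "cone_vec (X $ None) (hpart X) = X"
  by (auto simp: cone_vec_def hpart_def vec_eq_iff split: option.split)

lemma continuous_cone_vec: "continuous_on S (\<lambda>p. cone_vec (fst p) (snd p :: complex^'n))"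
  unfolding cone_vec_def
proof (rule continuous_on_vec_lambda)
  fix i :: "'n option"
  show "continuous_on S (\<lambda>p. case i of None \<Rightarrow> fst p | Some j \<Rightarrow> snd p $ j)"
    by (cases i) (auto intro!: continuous_intros)
qed

lemma continuous_hpart: "continuous_on S hpart"
  unfolding hpart_def by (intro continuous_intros)

lemma sum_option: "(\<Sum>i\<in>(UNIV :: 'n::finite option set). f i) = f None + (\<Sum>j\<in>UNIV. f (Some j))"
  by (simp add: UNIV_option_conv sum.insert_if sum.reindex)

text \<open>F gives homogeneous coordinates of a map to projective space.
  \<open>nondegenerate\<close> says that F and its partial derivatives are linearly independent,
  which makes [F] locally biholomorphic because source and target have the same dimension.\<close>

locale projective_immersion =
  fixes F :: "complex^'n \<Rightarrow> complex^'n option" and B :: "(complex^'n) set"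
  assumes open_B: "open B" and F: "\<And>i x. x \<in> B \<Longrightarrow> complex_differentiable_at (\<lambda>x. F x $ i) x"
    and nondegenerate: "\<And>x c v. x \<in> B \<Longrightarrow> (\<And>i. c * F x $ i + pairing (cgrad (\<lambda>x. F x $ i) x) v = 0) \<Longrightarrow> c = 0 \<and> v = 0"
begin

text \<open>The lift t F(x) with t the exponential of the extra coordinate, so that t is never zero.
  By \<open>nondegenerate\<close> its derivative is injective, and the inverse function theorem for
  this lift carries the local statements about charts.\<close>

definition cone :: "complex^'n option \<Rightarrow> complex^'n option" where
  "cone X = exp (X $ None) *s F (hpart X)"

definition cyl :: "(complex^'n) set \<Rightarrow> (complex^'n option) set" where
  "cyl V = {X. hpart X \<in> V}"

lemma open_cyl: "open V \<Longrightarrow> open (cyl V)"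
  using open_vimage[OF _ continuous_hpart] by (auto simp: cyl_def vimage_def)

lemma F_nonzero: "x \<in> B \<Longrightarrow> F x \<noteq> 0"
  using nondegenerate[of x 1 0] by auto

lemma continuous_F: "continuous_on B F"
proof -
  have "continuous_on B (\<lambda>x. \<chi> i. F x $ i)"
    by (intro continuous_on_vec_lambda complex_differentiable_continuous_on F)
  then show ?thesis by simp
qed

lemma cgrad_hpart: "complex_differentiable_at (\<lambda>X. hpart X $ j) X" "cgrad (\<lambda>X. hpart X $ j) X = axis (Some j) 1"
  unfolding hpart_def by simp_all

lemma cone_derivative:
  assumes "hpart X \<in> B"
  shows "complex_differentiable_at (\<lambda>X. cone X $ i) X"
    and "pairing (cgrad (\<lambda>X. cone X $ i) X) v
       = exp (X $ None) * (v $ None * F (hpart X) $ i + pairing (cgrad (\<lambda>x. F x $ i) (hpart X)) (hpart v))"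
proof -
  note e = cgrad_chain_field[OF cgrad_nth(1)[of None X] DERIV_exp]
  note f = cgrad_chain[OF F[OF assms, of i] cgrad_hpart(1)]
  have eq: "(\<lambda>X. cone X $ i) = (\<lambda>X. exp (X $ None) * F (hpart X) $ i)" by (simp add: cone_def)
  show "complex_differentiable_at (\<lambda>X. cone X $ i) X" unfolding eq by (intro cgrad_mult e f)
  have "pairing (\<Sum>j\<in>UNIV. a j *s axis (Some j) 1) v = (\<Sum>j\<in>UNIV. a j * v $ Some j)" for a
  proof -
    have "pairing (\<Sum>j\<in>UNIV. X j) v = (\<Sum>j\<in>UNIV. pairing (X j) v)" for X :: "'n \<Rightarrow> complex^'n option"
      unfolding pairing_def by (simp add: sum_distrib_right) (rule sum.swap)
    then show ?thesis by (simp add: pairing_scale_left)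
  qed
  then show "pairing (cgrad (\<lambda>X. cone X $ i) X) v
       = exp (X $ None) * (v $ None * F (hpart X) $ i + pairing (cgrad (\<lambda>x. F x $ i) (hpart X)) (hpart v))"
    unfolding eq cgrad_mult(2)[OF e(1) f(1)] e(2) f(2) cgrad_hpart(2) cgrad_nth(2)
    by (simp add: pairing_add_left pairing_scale_left algebra_simps) (simp add: pairing_def hpart_def mult.commute)
qed

lemma cone_injective_derivative:
  assumes "hpart X \<in> B" "\<And>i. pairing (cgrad (\<lambda>X. cone X $ i) X) v = 0"
  shows "v = 0"
proof -
  have "v $ None = 0 \<and> hpart v = 0"
    using nondegenerate[OF assms(1), of "v $ None" "hpart v"] assms(2) unfolding cone_derivative(2)[OF assms(1)] by simp
  then have "v $ i = 0" for i by (cases i) (auto simp: hpart_def vec_eq_iff)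
  then show ?thesis by (simp add: vec_eq_iff)
qed

lemma cone_local_inverse:
  assumes "open V" "V \<subseteq> B" "hpart X \<in> V"
  obtains U W \<Psi> where "open U" "U \<subseteq> cyl V" "X \<in> U" "open W" "cone X \<in> W" "homeomorphism U W cone \<Psi>"
    "\<And>y i. y \<in> W \<Longrightarrow> complex_differentiable_at (\<lambda>y. \<Psi> y $ i) y"
  by (rule holomorphic_inverse_function[OF open_cyl[OF assms(1)], of cone X])
    (use assms cone_derivative(1) cone_injective_derivative in \<open>auto simp: cyl_def\<close>)

lemma open_cone_image:
  assumes "open V" "V \<subseteq> B"
  shows "open (cone ` cyl V)"
  unfolding open_subopen[of "cone ` cyl V"]
proof
  fix y assume "y \<in> cone ` cyl V"
  then obtain X where X: "X \<in> cyl V" "y = cone X" by blast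
  then have hX: "hpart X \<in> V" by (simp add: cyl_def)
  obtain U W \<Psi> where "open U" "U \<subseteq> cyl V" "X \<in> U" "open W" "cone X \<in> W" "homeomorphism U W cone \<Psi>"
    "\<And>y i. y \<in> W \<Longrightarrow> complex_differentiable_at (\<lambda>y. \<Psi> y $ i) y"
    by (rule cone_local_inverse[OF assms hX]) (rule that)
  then have "open W \<and> y \<in> W \<and> W \<subseteq> cone ` cyl V" using X by (auto simp: homeomorphism_def)
  then show "\<exists>T. open T \<and> y \<in> T \<and> T \<subseteq> cone ` cyl V" by blast
qed

definition chart :: "complex^'n \<Rightarrow> (complex^'n option) set" where
  "chart x = proj_pt (F x)"

lemma chart_cone: "proj_pt (cone X) = chart (hpart X)"
  by (simp add: cone_def chart_def proj_pt_scale)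

lemma cone_nonzero: "hpart X \<in> B \<Longrightarrow> cone X \<noteq> 0"
  by (simp add: cone_def F_nonzero)

text \<open>Openness in projective space is tested on the preimage among nonzero vectors. That
  preimage is an image of the cone map: the logarithm of the scale supplies the extra
  coordinate.\<close>

lemma cone_over_chart:
  assumes "V \<subseteq> B"
  shows "{v. v \<noteq> 0 \<and> proj_pt v \<in> chart ` V} = cone ` cyl V"
proof (intro equalityI subsetI)
  fix v assume "v \<in> {v. v \<noteq> 0 \<and> proj_pt v \<in> chart ` V}"
  then obtain x where v: "v \<noteq> 0" "x \<in> V" "proj_pt v = proj_pt (F x)" by (auto simp: chart_def)
  then obtain c where c: "c \<noteq> 0" "v = c *s F x" using proj_pt_eq_iff by blast
  then have "v = cone (cone_vec (Ln c) x)" by (simp add: cone_def)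
  then show "v \<in> cone ` cyl V" using v(2) by (auto simp: cyl_def)
next
  fix v assume "v \<in> cone ` cyl V"
  then show "v \<in> {v. v \<noteq> 0 \<and> proj_pt v \<in> chart ` V}"
    using assms by (auto simp: cyl_def chart_cone cone_nonzero subset_iff)
qed

lemma open_chart_image:
  assumes "open V" "V \<subseteq> B"
  shows "openin proj_topology (chart ` V)"
  unfolding openin_proj_topology cone_over_chart[OF assms(2)]
  using open_cone_image[OF assms] assms(2) F_nonzero by (auto simp: chart_def proj_space_def)

lemma open_chart_preimage:
  assumes "openin proj_topology W" "open V" "V \<subseteq> B"
  shows "open {x \<in> V. chart x \<in> W}"
proof -
  have "open {v. v \<noteq> 0 \<and> proj_pt v \<in> W}" using assms(1) by (simp add: openin_proj_topology)
  from continuous_open_preimage[OF continuous_on_subset[OF continuous_F assms(3)] assms(2) this]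
  moreover have "V \<inter> F -` {v. v \<noteq> 0 \<and> proj_pt v \<in> W} = {x \<in> V. chart x \<in> W}"
    using assms(3) F_nonzero by (auto simp: chart_def subset_iff)
  ultimately show ?thesis by simp
qed

text \<open>Local injectivity of the cone map descends once the scale c in F x = c F y is
  controlled. It is the quotient of a coordinate that does not vanish at x0, so it tends to 1 and
  its logarithm to 0. Both lifts then lie where \<open>cone\<close> is injective.\<close>

lemma chart_locally_injective:
  assumes "x0 \<in> B"
  obtains r where "r > 0" "ball x0 r \<subseteq> B" "inj_on chart (ball x0 r)"
proof -
  have hX: "hpart (cone_vec 0 x0) \<in> B" using assms by simp
  obtain U W \<Psi> where "open U" "U \<subseteq> cyl B" "cone_vec 0 x0 \<in> U" "open W" "cone (cone_vec 0 x0) \<in> W" "homeomorphism U W cone \<Psi>"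
    "\<And>y i. y \<in> W \<Longrightarrow> complex_differentiable_at (\<lambda>y. \<Psi> y $ i) y"
    by (rule cone_local_inverse[OF open_B order_refl hX]) (rule that)
  then have U: "open U" "U \<subseteq> cyl B" "cone_vec 0 x0 \<in> U" "homeomorphism U W cone \<Psi>" by simp_all
  have inj: "inj_on cone U" using U(4) by (metis homeomorphism_def inj_on_inverseI)
  have "open ((\<lambda>p. cone_vec (fst p) (snd p)) -` U)" by (rule open_vimage[OF U(1) continuous_cone_vec])
  then obtain A D where AD: "open A" "open D" "0 \<in> A" "x0 \<in> D" "\<And>c x. c \<in> A \<Longrightarrow> x \<in> D \<Longrightarrow> cone_vec c x \<in> U"
    using U(3) by (fastforce elim!: open_prod_elim[of _ "(0, x0)"])
  obtain i where i: "F x0 $ i \<noteq> 0" using F_nonzero[OF assms] by (auto simp: vec_eq_iff)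
  define E where "E = {x \<in> B. F x $ i \<noteq> 0}"
  have cFi: "continuous_on B (\<lambda>x. F x $ i)" using F by (rule complex_differentiable_continuous_on)
  have "open E"
  proof -
    have "E = B \<inter> (\<lambda>x. F x $ i) -` (- {0})" by (auto simp: E_def)
    then show ?thesis using continuous_open_preimage[OF cFi open_B, of "- {0}"] by (simp add: open_Compl)
  qed
  define q where "q p = F (fst p) $ i / F (snd p) $ i" for p
  have cq: "continuous_on (E \<times> E) q"
    unfolding q_def by (intro continuous_intros continuous_on_compose2[OF cFi]) (auto simp: E_def)
  have "q (x0, x0) = 1" using i by (simp add: q_def)
  have "isCont q (x0, x0)"
    using cq \<open>open E\<close> assms i by (simp add: continuous_on_eq_continuous_at open_Times E_def)
  moreover have "isCont Ln (q (x0, x0))" unfolding \<open>q (x0, x0) = 1\<close> by (intro continuous_intros) (auto simp: complex_nonpos_Reals_iff)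
  ultimately have "((\<lambda>p. Ln (q p)) \<longlongrightarrow> 0) (at (x0, x0))"
    using isCont_o2[of "(x0, x0)" q Ln] \<open>q (x0, x0) = 1\<close> by (simp add: isCont_def)
  from topological_tendstoD[OF this AD(1,3)]
  have "\<forall>\<^sub>F p in nhds (x0, x0). Ln (q p) \<in> A"
    using AD(3) \<open>q (x0, x0) = 1\<close> by (auto simp: eventually_at_filter eventually_mono elim!: eventually_mono)
  moreover have "\<forall>\<^sub>F p in nhds (x0, x0). p \<in> (E \<inter> D) \<times> (E \<inter> D)"
    using \<open>open E\<close> AD assms i by (intro eventually_nhds_in_open open_Times open_Int) (auto simp: E_def)
  ultimately have "\<forall>\<^sub>F p in nhds (x0, x0). Ln (q p) \<in> A \<and> p \<in> (E \<inter> D) \<times> (E \<inter> D)" by (rule eventually_conj)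
  then obtain e where e: "e > 0" "\<And>p. dist p (x0, x0) < e \<Longrightarrow> Ln (q p) \<in> A \<and> p \<in> (E \<inter> D) \<times> (E \<inter> D)"
    unfolding eventually_nhds_metric by blast
  have good: "Ln (F x $ i / F y $ i) \<in> A \<and> x \<in> E \<inter> D \<and> y \<in> E \<inter> D" if "x \<in> ball x0 (e/2)" "y \<in> ball x0 (e/2)" for x y
  proof -
    have "dist (x, y) (x0, x0) \<le> dist x x0 + dist y x0"
      unfolding dist_Pair_Pair by (rule sqrt_sum_squares_le_sum) auto
    then have "dist (x, y) (x0, x0) < e" using that by (simp add: dist_commute)
    from e(2)[OF this] show ?thesis by (simp add: q_def)
  qed
  show ?thesis
  proof
    show "e/2 > 0" using e by simp
    show "ball x0 (e/2) \<subseteq> B" using good by (auto simp: E_def)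
    show "inj_on chart (ball x0 (e/2))"
    proof (rule inj_onI)
      fix x y assume xy: "x \<in> ball x0 (e/2)" "y \<in> ball x0 (e/2)" "chart x = chart y"
      note g = good[OF xy(1,2)]
      have "F x \<noteq> 0" using g F_nonzero by (auto simp: E_def)
      then obtain c where c: "c \<noteq> 0" "F x = c *s F y" using xy(3) proj_pt_eq_iff unfolding chart_def by blast
      then have "F x $ i / F y $ i = c" using g by (auto simp: E_def)
      then have "Ln c \<in> A" using g by simp
      have "cone (cone_vec 0 x) = cone (cone_vec (Ln c) y)" using c by (simp add: cone_def)
      moreover have "cone_vec 0 x \<in> U" "cone_vec (Ln c) y \<in> U" using AD(3,5) g \<open>Ln c \<in> A\<close> by auto
      ultimately have "cone_vec 0 x = cone_vec (Ln c) y" using inj by (auto dest: inj_onD)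
      then show "x = y" by (metis cone_vec_simps(2))
    qed
  qed
qed

text \<open>A function on the chart image is pulled back along F in one direction. In the other, G
  is composed with a local inverse of the cone map, which holomorphically recovers the point of the
  chart domain from a nonzero vector.\<close>

lemma chart_holomorphic_iff:
  assumes V: "open V" "V \<subseteq> D" and D: "D \<subseteq> B" "inj_on chart D"
    and G: "\<And>x. x \<in> D \<Longrightarrow> k (chart x) = G x"
  shows "proj_hol_on (chart ` V) k \<longleftrightarrow> (\<forall>x\<in>V. complex_differentiable_at G x)"
proof
  have VB: "V \<subseteq> B" using V D by blast
  assume hol: "proj_hol_on (chart ` V) k"
  show "\<forall>x\<in>V. complex_differentiable_at G x"
  proof
    fix x assume "x \<in> V"
    then have "complex_differentiable_at (\<lambda>z. k (proj_pt z)) (F x)"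
      using hol F_nonzero VB by (auto simp: proj_hol_on_def chart_def)
    from cgrad_chain(1)[OF this F] \<open>x \<in> V\<close> VB
    have "complex_differentiable_at (\<lambda>x. k (proj_pt (F x))) x" by blast
    then show "complex_differentiable_at G x"
      by (rule complex_differentiable_transform(1)[OF _ V(1) \<open>x \<in> V\<close>]) (use G V(2) in \<open>auto simp: chart_def\<close>)
  qed
next
  have VB: "V \<subseteq> B" using V D by blast
  assume hol: "\<forall>x\<in>V. complex_differentiable_at G x"
  show "proj_hol_on (chart ` V) k"
    unfolding proj_hol_on_def
  proof (intro allI impI)
    fix v assume "v \<noteq> 0 \<and> proj_pt v \<in> chart ` V"
    then have "v \<in> cone ` cyl V" using cone_over_chart[OF VB] by blast
    then obtain X where X: "v = cone X" "hpart X \<in> V" by (auto simp: cyl_def)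
    obtain U W \<Psi> where "open U" and I: "U \<subseteq> cyl V" "X \<in> U" "open W" "cone X \<in> W" "homeomorphism U W cone \<Psi>"
      "\<And>y i. y \<in> W \<Longrightarrow> complex_differentiable_at (\<lambda>y. \<Psi> y $ i) y"
      by (rule cone_local_inverse[OF V(1) VB X(2)]) (rule that)
    have "\<Psi> (cone X) = X" using I(2,5) by (simp add: homeomorphism_def)
    have "complex_differentiable_at (\<lambda>y. G (hpart (\<Psi> y))) (cone X)"
    proof (rule cgrad_chain(1))
      show "complex_differentiable_at G (hpart (\<Psi> (cone X)))" using hol X \<open>\<Psi> (cone X) = X\<close> by simp
      show "complex_differentiable_at (\<lambda>y. hpart (\<Psi> y) $ i) (cone X)" for i
        unfolding hpart_def by (simp add: I(6)[OF I(4)])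
    qed
    moreover have "G (hpart (\<Psi> y)) = k (proj_pt y)" if "y \<in> W" for y
    proof -
      have "\<Psi> y \<in> U" "cone (\<Psi> y) = y" using I(5) that by (auto simp: homeomorphism_def)
      then have "hpart (\<Psi> y) \<in> V" using I(1) by (auto simp: cyl_def)
      then have "k (chart (hpart (\<Psi> y))) = G (hpart (\<Psi> y))" using G V(2) by blast
      then show ?thesis using chart_cone[of "\<Psi> y"] \<open>cone (\<Psi> y) = y\<close> by simp
    qed
    ultimately show "complex_differentiable_at (\<lambda>z. k (proj_pt z)) v"
      unfolding X(1) by (rule complex_differentiable_transform(1)[OF _ I(3,4)])
  qed
qed

end

section \<open>The projective structure defined by a flat connection\<close>

text \<open>The two further axioms make \<open>\<lambda>v. \<tau> v p\<close> a local homeomorphism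
  near 0: a set that contains small translates of each of its points is relatively open, and small
  translations of p are distinct.\<close>

locale translation_manifold = translation_action \<tau> M
  for \<tau> :: "complex^'n \<Rightarrow> 'g::topological_space \<Rightarrow> 'g" and M +
  assumes openin_tau: "U \<subseteq> M \<Longrightarrow> (\<And>p. p \<in> U \<Longrightarrow> \<exists>r>0. \<forall>v\<in>ball 0 r. \<tau> v p \<in> U) \<Longrightarrow> openin (top_of_set M) U"
    and tau_inj: "p \<in> M \<Longrightarrow> \<exists>r>0. inj_on (\<lambda>v. \<tau> v p) (ball 0 r)"
begin

lemma openin_tau_image:
  assumes "open V" "\<And>x. x \<in> V \<Longrightarrow> \<tau> x p \<in> M"
  shows "openin (top_of_set M) ((\<lambda>x. \<tau> x p) ` V)"
proof (rule openin_tau)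
  show "(\<lambda>x. \<tau> x p) ` V \<subseteq> M" using assms(2) by blast
  fix q assume "q \<in> (\<lambda>x. \<tau> x p) ` V"
  then obtain x where x: "x \<in> V" "q = \<tau> x p" by blast
  obtain r where r: "r > 0" "ball x r \<subseteq> V" using assms(1) x(1) open_contains_ball by blast
  have "\<tau> v q \<in> (\<lambda>x. \<tau> x p) ` V" if "v \<in> ball 0 r" for v
  proof -
    have "v + x \<in> V" using that r(2) by (auto simp: dist_norm subset_iff)
    then show ?thesis unfolding x(2) tau_add[symmetric] by blast
  qed
  then show "\<exists>r>0. \<forall>v\<in>ball 0 r. \<tau> v q \<in> (\<lambda>x. \<tau> x p) ` V" using r(1) by blast
qed

lemma open_tau_preimage:
  assumes "openin (top_of_set M) W"
  shows "open {x. \<tau> x p \<in> W}"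
  unfolding open_contains_ball
proof
  fix x assume "x \<in> {x. \<tau> x p \<in> W}"
  then obtain r where r: "r > 0" "\<And>v. v \<in> ball 0 r \<Longrightarrow> \<tau> v (\<tau> x p) \<in> W"
    using tau_openin[OF assms] by blast
  have "\<tau> y p \<in> W" if "y \<in> ball x r" for y
  proof -
    have "y - x \<in> ball 0 r" using that by (simp add: dist_norm norm_minus_commute)
    from r(2)[OF this] show ?thesis by (simp add: tau_add[symmetric])
  qed
  then show "\<exists>e>0. ball x e \<subseteq> {x. \<tau> x p \<in> W}" using r(1) by blast
qed

lemma connected_tau_image:
  assumes "connected D" "\<And>x. x \<in> D \<Longrightarrow> \<tau> x p \<in> M"
  shows "connected ((\<lambda>x. \<tau> x p) ` D)"
proof (rule connected_continuous_image[OF _ assms(1)])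
  have "openin (top_of_set D) (D \<inter> (\<lambda>x. \<tau> x p) -` U)" if "openin (top_of_set M) U" for U
    using openin_open_Int[OF open_tau_preimage[OF that, of p], of D] by (simp add: vimage_def)
  then show "continuous_on D (\<lambda>x. \<tau> x p)"
    using assms(2) by (subst continuous_on_open_gen[of _ _ M]) auto
qed

end

section \<open>The Pfaffian system satisfied by 1-jets of solutions\<close>

lemma sum_axis: "(\<Sum>j\<in>UNIV. axis i (1::complex) $ j * f j) = f (i :: 'n::finite)"
proof -
  have "(\<Sum>j\<in>UNIV. axis i (1::complex) $ j * f j) = (\<Sum>j\<in>UNIV. if j = i then f i else 0)"
    by (intro sum.cong) (auto simp: axis_def)
  then show ?thesis by simp
qed

text \<open>Matrix of the first-order system for the 1-jet of a solution. The row
  \<open>None\<close> says that the derivative of f is the rest of the jet; the row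
  \<open>Some i\<close> is the second-order equation solved for the second derivatives.\<close>

definition jet_matrix ::
  "(complex^'n \<Rightarrow> complex^'n \<Rightarrow> complex) \<Rightarrow> ('n \<Rightarrow> 'n \<Rightarrow> 'n \<Rightarrow> 'g \<Rightarrow> complex) \<Rightarrow>
   'n \<Rightarrow> 'n option \<Rightarrow> 'n option \<Rightarrow> 'g \<Rightarrow> complex" where
  "jet_matrix a \<Gamma> j m m' p = (case m of
      None \<Rightarrow> (case m' of None \<Rightarrow> 0 | Some l \<Rightarrow> if l = j then 1 else 0)
    | Some i \<Rightarrow> (case m' of None \<Rightarrow> - a (axis j 1) (axis i 1) | Some l \<Rightarrow> - \<Gamma> j i l p))"

lemma sym_bilinear_form_expand:
  assumes "sym_bilinear_form a"
  shows "a u v = (\<Sum>i\<in>UNIV. \<Sum>j\<in>UNIV. u $ j * v $ i * a (axis j 1) (axis i 1))"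
proof -
  have lin: "a u v = (\<Sum>i\<in>UNIV. v $ i * a u (axis i 1))" for u v
    using linear_form_eq_pairing[of "a u" v] assms by (simp add: sym_bilinear_form_def pairing_def mult.commute)
  have sym: "a u v = a v u" for u v using assms by (simp add: sym_bilinear_form_def)
  have "a u v = (\<Sum>i\<in>UNIV. v $ i * a (axis i 1) u)" by (subst lin) (simp add: sym[of u])
  also have "\<dots> = (\<Sum>i\<in>UNIV. v $ i * (\<Sum>j\<in>UNIV. u $ j * a (axis j 1) (axis i 1)))"
    by (subst lin) (simp add: sym[of "axis _ 1" "axis _ 1"])
  finally show ?thesis by (simp add: sum_distrib_left algebra_simps)
qed

text \<open>\<open>flat\<close> is the integrability condition of the 1-jet system, in the form
  taken by \<open>frobenius\<close>.\<close>

locale projective_connection = translation_manifold \<tau> M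
  for \<tau> :: "complex^'n \<Rightarrow> 'g::topological_space \<Rightarrow> 'g" and M +
  fixes \<Omega> :: "('g, 'n) conn_form" and a and \<Gamma> :: "'n \<Rightarrow> 'n \<Rightarrow> 'n \<Rightarrow> 'g \<Rightarrow> complex"
  assumes Omega: "\<Omega> p \<phi> u (axis i 1) = (\<Sum>j\<in>UNIV. u $ j * (\<Sum>l\<in>UNIV. \<Gamma> j i l p * \<phi> $ l))"
    and a: "sym_bilinear_form a"
    and hol: "hol_on \<tau> M (\<Gamma> j i l)"
    and flat: "p \<in> M \<Longrightarrow>
       differential \<tau> (jet_matrix a \<Gamma> j m m') p $ i + (\<Sum>k\<in>UNIV. jet_matrix a \<Gamma> j m k p * jet_matrix a \<Gamma> i k m' p)
     = differential \<tau> (jet_matrix a \<Gamma> i m m') p $ j + (\<Sum>k\<in>UNIV. jet_matrix a \<Gamma> i m k p * jet_matrix a \<Gamma> j k m' p)"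
begin

abbreviation "\<Theta> \<equiv> jet_matrix a \<Gamma>"

lemma hol_jet_matrix: "hol_on \<tau> M (\<Theta> j m m')"
proof -
  have "\<Theta> j m m' = (case m of
      None \<Rightarrow> (case m' of None \<Rightarrow> (\<lambda>_. 0) | Some l \<Rightarrow> (\<lambda>_. if l = j then 1 else 0))
    | Some i \<Rightarrow> (case m' of None \<Rightarrow> (\<lambda>_. - a (axis j 1) (axis i 1)) | Some l \<Rightarrow> (\<lambda>p. - \<Gamma> j i l p)))"
    by (auto simp: jet_matrix_def split: option.split)
  then show ?thesis by (auto intro: hol_on_const hol_on_minus[OF hol] split: option.split)
qed

definition jet :: "('g \<Rightarrow> complex) \<Rightarrow> 'g \<Rightarrow> 'n option \<Rightarrow> complex" where
  "jet f p m = (case m of None \<Rightarrow> f p | Some i \<Rightarrow> differential \<tau> f p $ i)"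

lemma jet_simps [simp]: "jet f p None = f p" "jet f p (Some i) = differential \<tau> f p $ i"
  by (simp_all add: jet_def)

lemma hol_jet: "openin (top_of_set M) U \<Longrightarrow> hol_on \<tau> U f \<Longrightarrow> hol_on \<tau> U (\<lambda>q. jet f q m)"
  by (cases m) (auto intro: hol_on_differential(1))

text \<open>The equation is bilinear in u and v, so coordinate vectors suffice to test it, and
  \<open>E\<close> is the resulting coordinate form. The row \<open>None\<close> of the jet system
  holds for every f.\<close>

lemma solution_on_iff:
  assumes U: "openin (top_of_set M) U"
  shows "solution_on \<tau> \<Omega> a U f \<longleftrightarrow> hol_on \<tau> U f \<and>
    (\<forall>p\<in>U. \<forall>j m. differential \<tau> (\<lambda>q. jet f q m) p $ j = (\<Sum>k\<in>UNIV. \<Theta> j m k p * jet f p k))"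
proof (cases "hol_on \<tau> U f")
  case True
  define E where "E p j i = differential \<tau> (\<lambda>q. differential \<tau> f q $ i) p $ j
     + (\<Sum>l\<in>UNIV. \<Gamma> j i l p * differential \<tau> f p $ l) + f p * a (axis j 1) (axis i 1)" for p j i
  have val: "pairing (cov_deriv \<tau> \<Omega> (\<lambda>_. u) (differential \<tau> f) p) v + f p * a u v
     = (\<Sum>i\<in>UNIV. \<Sum>j\<in>UNIV. u $ j * v $ i * E p j i)" if p: "p \<in> U" for p u v
  proof -
    have "cov_deriv \<tau> \<Omega> (\<lambda>_. u) (differential \<tau> f) p $ i
        = (\<Sum>j\<in>UNIV. u $ j * (differential \<tau> (\<lambda>q. differential \<tau> f q $ i) p $ j + (\<Sum>l\<in>UNIV. \<Gamma> j i l p * differential \<tau> f p $ l)))" for i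
      using inv_deriv_eq[OF hol_on_differential(1)[OF U True] p]
      by (simp add: cov_deriv_def inv_deriv_vec_def Omega pairing_def sum.distrib distrib_left mult.commute)
    then have 1: "pairing (cov_deriv \<tau> \<Omega> (\<lambda>_. u) (differential \<tau> f) p) v
       = (\<Sum>i\<in>UNIV. \<Sum>j\<in>UNIV. u $ j * v $ i * (differential \<tau> (\<lambda>q. differential \<tau> f q $ i) p $ j + (\<Sum>l\<in>UNIV. \<Gamma> j i l p * differential \<tau> f p $ l)))"
      unfolding pairing_def
      by (simp only: mult.assoc mult.commute[of _ "v $ _"] mult.left_commute[of _ "v $ _"] sum_distrib_left[of "v $ _", symmetric])
    have 2: "f p * a u v = (\<Sum>i\<in>UNIV. \<Sum>j\<in>UNIV. u $ j * v $ i * (f p * a (axis j 1) (axis i 1)))"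
      unfolding sym_bilinear_form_expand[OF a, of u v] sum_distrib_left by (intro sum.cong refl) simp
    show ?thesis
      unfolding 1 2 E_def by (simp only: sum.distrib[symmetric] distrib_left)
  qed
  have eq: "(\<forall>m. differential \<tau> (\<lambda>q. jet f q m) p $ j = (\<Sum>k\<in>UNIV. \<Theta> j m k p * jet f p k)) \<longleftrightarrow> (\<forall>i. E p j i = 0)" for p j
  proof -
    have "differential \<tau> (\<lambda>q. jet f q None) p $ j = (\<Sum>k\<in>UNIV. \<Theta> j None k p * jet f p k)"
      by (simp add: sum_option jet_matrix_def if_distrib if_distribR cong: if_cong)
    moreover have "differential \<tau> (\<lambda>q. jet f q (Some i)) p $ j = (\<Sum>k\<in>UNIV. \<Theta> j (Some i) k p * jet f p k) \<longleftrightarrow> E p j i = 0" for i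
      by (simp add: sum_option jet_matrix_def E_def sum_negf algebra_simps eq_neg_iff_add_eq_0)
    ultimately show ?thesis by (metis not_None_eq)
  qed
  have "(\<forall>u v. pairing (cov_deriv \<tau> \<Omega> (\<lambda>_. u) (differential \<tau> f) p) v + f p * a u v = 0) \<longleftrightarrow> (\<forall>j i. E p j i = 0)"
    if p: "p \<in> U" for p
  proof
    assume *: "\<forall>u v. pairing (cov_deriv \<tau> \<Omega> (\<lambda>_. u) (differential \<tau> f) p) v + f p * a u v = 0"
    show "\<forall>j i. E p j i = 0"
    proof (intro allI)
      fix j i
      have "(\<Sum>i'\<in>UNIV. \<Sum>j'\<in>UNIV. axis j 1 $ j' * axis i 1 $ i' * E p j' i') = 0" using * val[OF p] by metis
      moreover have "(\<Sum>i'\<in>UNIV. \<Sum>j'\<in>UNIV. axis j 1 $ j' * axis i 1 $ i' * E p j' i') = E p j i"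
      proof -
        have "(\<Sum>i'\<in>UNIV. \<Sum>j'\<in>UNIV. axis j 1 $ j' * axis i 1 $ i' * E p j' i')
          = (\<Sum>i'\<in>UNIV. axis i 1 $ i' * (\<Sum>j'\<in>UNIV. axis j 1 $ j' * E p j' i'))"
          by (simp only: mult.assoc mult.left_commute[of "axis j 1 $ _"] sum_distrib_left)
        then show ?thesis by (simp only: sum_axis)
      qed
      ultimately show "E p j i = 0" by simp
    qed
  qed (simp add: val[OF p])
  note E_iff = this
  have "(\<forall>p\<in>U. \<forall>u v. pairing (cov_deriv \<tau> \<Omega> (\<lambda>_. u) (differential \<tau> f) p) v + f p * a u v = 0)
      \<longleftrightarrow> (\<forall>p\<in>U. \<forall>j. \<forall>i. E p j i = 0)"
    by (intro ball_cong refl E_iff)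
  then show ?thesis unfolding solution_on_def eq using True by blast
qed (simp add: solution_on_def)

lemma solution_onD:
  assumes "openin (top_of_set M) U" "solution_on \<tau> \<Omega> a U f"
  shows "hol_on \<tau> U f" and "p \<in> U \<Longrightarrow> differential \<tau> (\<lambda>q. jet f q m) p $ j = (\<Sum>k\<in>UNIV. \<Theta> j m k p * jet f p k)"
  using assms solution_on_iff by auto

lemma solution_on_subset: "solution_on \<tau> \<Omega> a U f \<Longrightarrow> V \<subseteq> U \<Longrightarrow> solution_on \<tau> \<Omega> a V f"
  by (auto simp: solution_on_def hol_on_def)

lemma jet_combination:
  assumes "\<And>i. i \<in> I \<Longrightarrow> hol_on \<tau> U (f i)" "p \<in> U"
  shows "jet (\<lambda>q. \<Sum>i\<in>I. c i * f i q) p m = (\<Sum>i\<in>I. c i * jet (f i) p m)"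
proof (cases m)
  case (Some l)
  have "differential \<tau> (\<lambda>q. c i * f i q) p = c i *s differential \<tau> (f i) p" if "i \<in> I" for i
    using cgrad_cmult(2)[OF hol_onD[OF assms(1)[OF that] assms(2)]] by (simp add: differential_eq_cgrad)
  moreover have "differential \<tau> (\<lambda>q. \<Sum>i\<in>I. c i * f i q) p = (\<Sum>i\<in>I. differential \<tau> (\<lambda>q. c i * f i q) p)"
    using assms by (intro differential_sum[of _ U] hol_on_mult hol_on_const) auto
  ultimately show ?thesis using Some by (simp add: sum_component)
qed simp

lemma solution_combination:
  assumes U: "openin (top_of_set M) U" and f: "\<And>i. i \<in> I \<Longrightarrow> solution_on \<tau> \<Omega> a U (f i)"
  shows "solution_on \<tau> \<Omega> a U (\<lambda>q. \<Sum>i\<in>I. c i * f i q)"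
  unfolding solution_on_iff[OF U]
proof (intro conjI ballI allI)
  have fh: "hol_on \<tau> U (f i)" if "i \<in> I" for i using solution_onD(1)[OF U f[OF that]] .
  show "hol_on \<tau> U (\<lambda>q. \<Sum>i\<in>I. c i * f i q)" by (intro hol_on_sum hol_on_mult hol_on_const fh)
  fix p j m assume p: "p \<in> U"
  have "differential \<tau> (\<lambda>q. jet (\<lambda>q. \<Sum>i\<in>I. c i * f i q) q m) p = differential \<tau> (\<lambda>q. \<Sum>i\<in>I. c i * jet (f i) q m) p"
  proof -
    obtain r where r: "r > 0" "\<And>v. v \<in> ball 0 r \<Longrightarrow> \<tau> v p \<in> U" using tau_openin[OF U p] by blast
    have h: "hol_on \<tau> U (\<lambda>q. \<Sum>i\<in>I. c i * jet (f i) q m)"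
      by (intro hol_on_sum hol_on_mult hol_on_const hol_jet[OF U] fh)
    have "(\<Sum>i\<in>I. c i * jet (f i) (\<tau> v p) m) = jet (\<lambda>q. \<Sum>i\<in>I. c i * f i q) (\<tau> v p) m" if "v \<in> ball 0 r" for v
      by (rule jet_combination[OF fh r(2)[OF that], symmetric])
    then show ?thesis unfolding differential_eq_cgrad[of _ p]
      by (intro complex_differentiable_transform(2)[OF hol_onD[OF h p] open_ball, of 0 r]) (use r in auto)
  qed
  also have "\<dots> = (\<Sum>i\<in>I. differential \<tau> (\<lambda>q. c i * jet (f i) q m) p)"
    using p by (intro differential_sum[of _ U] hol_on_mult hol_on_const hol_jet[OF U] fh) auto
  also have "\<dots> $ j = (\<Sum>i\<in>I. c i * differential \<tau> (\<lambda>q. jet (f i) q m) p $ j)"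
  proof -
    have "differential \<tau> (\<lambda>q. c i * jet (f i) q m) p = c i *s differential \<tau> (\<lambda>q. jet (f i) q m) p" if "i \<in> I" for i
      using cgrad_cmult(2)[OF hol_onD[OF hol_jet[OF U fh[OF that]] p]] by (simp add: differential_eq_cgrad[of _ p])
    then show ?thesis by (simp add: sum_component)
  qed
  also have "\<dots> = (\<Sum>i\<in>I. c i * (\<Sum>k\<in>UNIV. \<Theta> j m k p * jet (f i) p k))"
    by (intro sum.cong refl) (simp add: solution_onD(2)[OF U f p])
  also have "\<dots> = (\<Sum>k\<in>UNIV. \<Theta> j m k p * (\<Sum>i\<in>I. c i * jet (f i) p k))"
    unfolding sum_distrib_left by (subst sum.swap) (simp add: algebra_simps)
  finally show "differential \<tau> (\<lambda>q. jet (\<lambda>q. \<Sum>i\<in>I. c i * f i q) q m) p $ j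
     = (\<Sum>k\<in>UNIV. \<Theta> j m k p * jet (\<lambda>q. \<Sum>i\<in>I. c i * f i q) p k)"
    by (simp add: jet_combination[OF fh p])
qed

text \<open>In exponential coordinates around p the jet solves the pulled-back Pfaffian system on a
  ball, where \<open>pfaffian_unique\<close> applies.\<close>

lemma jet_zero_on_ball:
  assumes V: "openin (top_of_set M) V" and f: "solution_on \<tau> \<Omega> a V f"
    and mem: "\<And>x. x \<in> ball 0 r \<Longrightarrow> \<tau> x p \<in> V"
    and "x \<in> ball 0 r" "\<And>m. jet f (\<tau> x p) m = 0" "y \<in> ball 0 r"
  shows "jet f (\<tau> y p) m = 0"
proof (rule pfaffian_unique[of "ball 0 r" "\<lambda>j m k x. \<Theta> j m k (\<tau> x p)" "\<lambda>m x. jet f (\<tau> x p) m" x])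
  note fh = solution_onD(1)[OF V f]
  have VM: "V \<subseteq> M" using openin_subset_M[OF V] .
  fix z :: "complex^'n" assume z: "z \<in> ball 0 r"
  show "complex_differentiable_at (\<lambda>x. \<Theta> j m k (\<tau> x p)) z" for j m k
    using hol_onD[OF hol_jet_matrix[of j m k] subsetD[OF VM mem[OF z]]] unfolding hol_on_iff_shift .
  show "complex_differentiable_at (\<lambda>x. jet f (\<tau> x p) m) z" for m
    using hol_onD[OF hol_jet[OF V fh, of m] mem[OF z]] hol_on_iff_shift[of "\<lambda>q. jet f q m" z p] by blast
  show "cgrad (\<lambda>x. jet f (\<tau> x p) m) z $ j = (\<Sum>k\<in>UNIV. \<Theta> j m k (\<tau> z p) * jet f (\<tau> z p) k)" for j m
    using solution_onD(2)[OF V f mem[OF z], of m j] by (simp add: differential_shift[of "\<lambda>q. jet f q m"])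
qed (rule convex_ball assms)+

text \<open>By \<open>jet_zero_on_ball\<close> the set where the whole 1-jet vanishes and its
  complement in V are both open, and V is connected.\<close>

lemma unique_continuation:
  assumes V: "openin (top_of_set M) V" "connected V" and f: "solution_on \<tau> \<Omega> a V f"
    and "q \<in> V" "\<And>m. jet f q m = 0" "p \<in> V"
  shows "jet f p m = 0"
proof -
  define Z where "Z = {p \<in> V. \<forall>m. jet f p m = 0}"
  have VM: "V \<subseteq> M" using openin_subset_M[OF V(1)] .
  have local: "\<exists>r>0. \<forall>v\<in>ball 0 r. \<tau> v p \<in> V \<and> (\<tau> v p \<in> Z \<longleftrightarrow> p \<in> Z)" if p: "p \<in> V" for p
  proof -
    obtain r where r: "r > 0" "\<And>v. v \<in> ball 0 r \<Longrightarrow> \<tau> v p \<in> V" using tau_openin[OF V(1) p] by blast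
    have "\<tau> v p \<in> Z \<longleftrightarrow> p \<in> Z" if v: "v \<in> ball 0 r" for v
    proof -
      have 0: "0 \<in> ball 0 r" "\<tau> 0 p = p" using r(1) p VM tau_zero by auto
      have "p \<in> Z" if "\<tau> v p \<in> Z"
        using jet_zero_on_ball[OF V(1) f r(2) v _ 0(1)] that p 0(2) by (simp add: Z_def)
      moreover have "\<tau> v p \<in> Z" if "p \<in> Z"
        using jet_zero_on_ball[OF V(1) f r(2) 0(1) _ v] that r(2)[OF v] 0(2) by (simp add: Z_def)
      ultimately show ?thesis by blast
    qed
    then show ?thesis using r by blast
  qed
  have ZV: "Z \<subseteq> V" by (auto simp: Z_def)
  have oZ: "openin (top_of_set M) Z"
  proof (rule openin_tau)
    show "\<exists>r>0. \<forall>v\<in>ball 0 r. \<tau> v p \<in> Z" if "p \<in> Z" for p using local[of p] that ZV by blast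
  qed (use ZV VM in blast)
  have oC: "openin (top_of_set M) (V - Z)"
  proof (rule openin_tau)
    show "\<exists>r>0. \<forall>v\<in>ball 0 r. \<tau> v p \<in> V - Z" if "p \<in> V - Z" for p using local[of p] that by blast
  qed (use VM in blast)
  have "openin (top_of_set V) Z" "openin (top_of_set V) (V - Z)"
    using openin_subset_trans[OF oZ ZV VM] openin_subset_trans[OF oC Diff_subset VM] by auto
  then have "openin (top_of_set V) Z" "closedin (top_of_set V) Z"
    using ZV by (auto simp: closedin_def)
  then have "Z = {} \<or> Z = V" using V(2) unfolding connected_clopen by blast
  then show ?thesis using assms(4-6) by (auto simp: Z_def)
qed

end

lemma invertible_left_zero:
  fixes A :: "complex^'k^'k"
  assumes "invertible A" "\<And>j. (\<Sum>i\<in>UNIV. x $ i * A $ i $ j) = 0"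
  shows "x = 0"
proof -
  obtain B where B: "A ** B = mat 1" using assms(1) unfolding invertible_def by blast
  have 0: "transpose A *v x = 0"
    using assms(2) by (simp add: matrix_vector_mult_def transpose_def vec_eq_iff mult.commute)
  have "transpose B ** transpose A = mat 1" using B by (metis matrix_transpose_mul transpose_mat)
  then have "x = transpose B *v (transpose A *v x)"
    by (simp only: matrix_vector_mul_assoc matrix_vector_mul_lid)
  then show ?thesis by (simp only: 0 matrix_vector_mult_0_right)
qed

context projective_connection
begin

lemma good_ball:
  assumes U: "openin (top_of_set M) U" and p: "p \<in> U"
  obtains r where "r > 0" "\<And>x. x \<in> ball 0 r \<Longrightarrow> \<tau> x p \<in> U" "inj_on (\<lambda>x. \<tau> x p) (ball 0 r)"
    "\<And>y0 :: complex^'n option. \<exists>Y. (\<forall>m. \<forall>x\<in>ball 0 r. complex_differentiable_at (Y m) x) \<and> (\<forall>m. Y m 0 = y0 $ m)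
       \<and> (\<forall>m j. \<forall>x\<in>ball 0 r. cgrad (Y m) x $ j = (\<Sum>k\<in>UNIV. \<Theta> j m k (\<tau> x p) * Y k x))"
proof -
  have UM: "U \<subseteq> M" using openin_subset_M[OF U] .
  obtain r1 where r1: "r1 > 0" "\<And>x. x \<in> ball 0 r1 \<Longrightarrow> \<tau> x p \<in> U" using tau_openin[OF U p] by blast
  obtain r2 where r2: "r2 > 0" "inj_on (\<lambda>x. \<tau> x p) (ball 0 r2)" using tau_inj p UM by blast
  define R where "R = min r1 r2"
  have "R > 0" and inM: "\<And>x. x \<in> ball 0 R \<Longrightarrow> \<tau> x p \<in> M" using r1 r2 UM by (auto simp: R_def subset_iff)
  have T: "complex_differentiable_at (\<lambda>x. \<Theta> j m k (\<tau> x p)) z" if "z \<in> ball 0 R" for j m k z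
    using hol_onD[OF hol_jet_matrix[of j m k] inM[OF that]] hol_on_iff_shift[of "\<Theta> j m k" z p] by blast
  have F: "cgrad (\<lambda>x. \<Theta> j m m' (\<tau> x p)) z $ i + (\<Sum>k\<in>UNIV. \<Theta> j m k (\<tau> z p) * \<Theta> i k m' (\<tau> z p))
     = cgrad (\<lambda>x. \<Theta> i m m' (\<tau> x p)) z $ j + (\<Sum>k\<in>UNIV. \<Theta> i m k (\<tau> z p) * \<Theta> j k m' (\<tau> z p))"
    if "z \<in> ball 0 R" for i j m m' z
    using flat[OF inM[OF that], of j m m' i] by (simp add: differential_shift)
  obtain r where r: "0 < r" "r \<le> R"
    "\<And>y0 :: complex^'n option. \<exists>Y. (\<forall>m. \<forall>x\<in>ball 0 r. complex_differentiable_at (Y m) x) \<and> (\<forall>m. Y m 0 = y0 $ m)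
       \<and> (\<forall>m j. \<forall>x\<in>ball 0 r. cgrad (Y m) x $ j = (\<Sum>k\<in>UNIV. \<Theta> j m k (\<tau> x p) * Y k x))"
    by (rule frobenius[of R "\<lambda>j m k x. \<Theta> j m k (\<tau> x p)", OF \<open>R > 0\<close> T F]) auto
  show ?thesis
  proof (rule that[OF r(1) _ _ r(3)])
    show "\<tau> x p \<in> U" if "x \<in> ball 0 r" for x using r1(2)[of x] that r(2) by (simp add: R_def)
    show "inj_on (\<lambda>x. \<tau> x p) (ball 0 r)" by (rule inj_on_subset[OF r2(2)]) (use r(2) in \<open>auto simp: R_def\<close>)
  qed
qed

text \<open>A solution of the Pfaffian system is the jet of its component \<open>None\<close>, since
  the row \<open>None\<close> identifies the other components with its derivatives. Injectivity of
  the translations carries that function from the ball to the manifold.\<close>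

lemma coordinate_solution:
  fixes Y :: "'n option \<Rightarrow> complex^'n \<Rightarrow> complex"
  assumes inM: "\<And>x. x \<in> ball 0 r \<Longrightarrow> \<tau> x p \<in> M" and inj: "inj_on (\<lambda>x. \<tau> x p) (ball 0 r)"
    and Yd: "\<And>m x. x \<in> ball 0 r \<Longrightarrow> complex_differentiable_at (Y m) x"
    and Yeq: "\<And>m j x. x \<in> ball 0 r \<Longrightarrow> cgrad (Y m) x $ j = (\<Sum>k\<in>UNIV. \<Theta> j m k (\<tau> x p) * Y k x)"
  obtains f where "solution_on \<tau> \<Omega> a ((\<lambda>x. \<tau> x p) ` ball 0 r) f" "\<And>x m. x \<in> ball 0 r \<Longrightarrow> jet f (\<tau> x p) m = Y m x"
proof
  define f where "f q = Y None (inv_into (ball 0 r) (\<lambda>x. \<tau> x p) q)" for q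
  have fx: "Y None x = f (\<tau> x p)" if "x \<in> ball 0 r" for x using inv_into_f_f[OF inj that] by (simp add: f_def)
  have J: "jet f (\<tau> x p) m = Y m x" if x: "x \<in> ball 0 r" for x m
  proof (cases m)
    case (Some l)
    have "differential \<tau> f (\<tau> x p) = cgrad (Y None) x"
      unfolding differential_shift by (rule complex_differentiable_transform(2)[OF Yd[OF x] open_ball x fx])
    moreover have "(\<Sum>k\<in>UNIV. \<Theta> l None k (\<tau> x p) * Y k x) = Y (Some l) x"
      by (simp add: sum_option jet_matrix_def if_distrib if_distribR cong: if_cong)
    ultimately show ?thesis using Some Yeq[OF x, of None l] by simp
  qed (simp add: fx[OF x])
  then show "\<And>x m. x \<in> ball 0 r \<Longrightarrow> jet f (\<tau> x p) m = Y m x" .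
  have o: "openin (top_of_set M) ((\<lambda>x. \<tau> x p) ` ball 0 r)" by (rule openin_tau_image[OF open_ball inM])
  show "solution_on \<tau> \<Omega> a ((\<lambda>x. \<tau> x p) ` ball 0 r) f"
    unfolding solution_on_iff[OF o]
  proof (intro conjI ballI allI)
    show "hol_on \<tau> ((\<lambda>x. \<tau> x p) ` ball 0 r) f"
      unfolding hol_on_def
    proof
      fix q assume "q \<in> (\<lambda>x. \<tau> x p) ` ball 0 r"
      then obtain x where x: "x \<in> ball 0 r" "q = \<tau> x p" by blast
      have "complex_differentiable_at (\<lambda>w. f (\<tau> w p)) x"
        by (rule complex_differentiable_transform(1)[OF Yd[OF x(1)] open_ball x(1) fx])
      then show "complex_differentiable_at (\<lambda>v. f (\<tau> v q)) 0" unfolding x(2) using hol_on_iff_shift[of f x p] by blast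
    qed
    fix q j m assume "q \<in> (\<lambda>x. \<tau> x p) ` ball 0 r"
    then obtain x where x: "x \<in> ball 0 r" "q = \<tau> x p" by blast
    have "differential \<tau> (\<lambda>q. jet f q m) (\<tau> x p) = cgrad (Y m) x"
      unfolding differential_shift[of "\<lambda>q. jet f q m"]
      by (rule complex_differentiable_transform(2)[OF Yd[OF x(1)] open_ball x(1) J[symmetric]])
    then show "differential \<tau> (\<lambda>q. jet f q m) q $ j = (\<Sum>k\<in>UNIV. \<Theta> j m k q * jet f q k)"
      using Yeq[OF x(1), of m j] J[OF x(1)] x(2) by simp
  qed
qed

section \<open>Local bases of solutions and the matrix of their jets\<close>

lemma local_basisD:
  assumes "local_basis \<tau> \<Omega> a M U f"
  shows "openin (top_of_set M) U" "solution_on \<tau> \<Omega> a U (f i)"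
    "openin (top_of_set M) V \<Longrightarrow> V \<subseteq> U \<Longrightarrow> V \<noteq> {} \<Longrightarrow> connected V \<Longrightarrow> solution_on \<tau> \<Omega> a V g \<Longrightarrow>
      \<exists>!c :: complex^'n option. \<forall>x\<in>V. g x = (\<Sum>i\<in>UNIV. c $ i * f i x)"
  using assms unfolding local_basis_def by blast+

lemma local_basis_subset:
  assumes "local_basis \<tau> \<Omega> a M U f" "openin (top_of_set M) V" "V \<subseteq> U"
  shows "local_basis \<tau> \<Omega> a M V f"
  unfolding local_basis_def
proof (intro conjI allI impI)
  show "openin (top_of_set M) V" by fact
  show "solution_on \<tau> \<Omega> a V (f i)" for i
    using assms solution_on_subset unfolding local_basis_def by blast
  show "\<exists>!c :: complex^'n option. \<forall>x\<in>W. g x = (\<Sum>i\<in>UNIV. c $ i * f i x)"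
    if "openin (top_of_set M) W \<and> W \<subseteq> V \<and> W \<noteq> {} \<and> connected W \<and> solution_on \<tau> \<Omega> a W g" for W g
    by (rule local_basisD(3)[OF assms(1)]) (use that assms(3) in auto)
qed

lemma connected_nbhd:
  assumes U: "openin (top_of_set M) U" and p: "p \<in> U"
  obtains V where "openin (top_of_set M) V" "p \<in> V" "V \<subseteq> U" "connected V"
proof -
  obtain r where r: "r > 0" "\<And>x. x \<in> ball 0 r \<Longrightarrow> \<tau> x p \<in> U" using tau_openin[OF U p] by blast
  have UM: "U \<subseteq> M" using openin_subset_M[OF U] .
  show ?thesis
  proof (rule that)
    show "openin (top_of_set M) ((\<lambda>x. \<tau> x p) ` ball 0 r)" by (rule openin_tau_image) (use r UM in auto)
    have "p = \<tau> 0 p" using tau_zero p UM by auto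
    then show "p \<in> (\<lambda>x. \<tau> x p) ` ball 0 r" using r(1) by (intro image_eqI[of _ _ 0]) auto
    show "(\<lambda>x. \<tau> x p) ` ball 0 r \<subseteq> U" using r by blast
    show "connected ((\<lambda>x. \<tau> x p) ` ball 0 r)" by (rule connected_tau_image) (use r UM in auto)
  qed
qed

text \<open>A relation among the jets at p gives a combination with zero jet there, hence zero on a
  connected neighbourhood. The zero solution has exactly one representation in a local
  basis.\<close>

lemma local_basis_independent:
  fixes c :: "complex^'n option"
  assumes B: "local_basis \<tau> \<Omega> a M U f" and p: "p \<in> U"
    and zero: "\<And>m. (\<Sum>i\<in>UNIV. c $ i * jet (f i) p m) = 0"
  shows "c = 0"
proof -
  obtain V where V: "openin (top_of_set M) V" "p \<in> V" "V \<subseteq> U" "connected V"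
    using connected_nbhd[OF local_basisD(1)[OF B] p] .
  have fs: "solution_on \<tau> \<Omega> a V (f i)" for i by (rule solution_on_subset[OF local_basisD(2)[OF B] V(3)])
  have h: "solution_on \<tau> \<Omega> a V (\<lambda>q. \<Sum>i\<in>UNIV. c $ i * f i q)" by (rule solution_combination[OF V(1) fs])
  have "jet (\<lambda>q. \<Sum>i\<in>UNIV. c $ i * f i q) p m = 0" for m
    using jet_combination[where f = f and I = UNIV, OF solution_onD(1)[OF V(1) fs] V(2)] zero by simp
  then have "jet (\<lambda>q. \<Sum>i\<in>UNIV. c $ i * f i q) x None = 0" if "x \<in> V" for x
    using unique_continuation[OF V(1,4) h V(2) _ that] by blast
  then have c: "\<forall>x\<in>V. 0 = (\<Sum>i\<in>UNIV. c $ i * f i x)" by simp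
  have "solution_on \<tau> \<Omega> a V (\<lambda>_. 0)" using solution_combination[OF V(1), of "{}"] by simp
  from local_basisD(3)[OF B V(1,3) _ V(4) this] V(2)
  have "\<exists>!c :: complex^'n option. \<forall>x\<in>V. 0 = (\<Sum>i\<in>UNIV. c $ i * f i x)" by blast
  moreover have "\<forall>x\<in>V. 0 = (\<Sum>i\<in>UNIV. (0 :: complex^'n option) $ i * f i x)" by simp
  ultimately show ?thesis using c by blast
qed

text \<open>The basis consists of the solutions whose jets at p are the unit vectors. Unique
  continuation keeps their jets independent on the whole ball, so a given solution can be matched at
  one point of a connected set and then agrees throughout it.\<close>

lemma local_basis_exists:
  assumes U: "openin (top_of_set M) U" and p: "p \<in> U"
  obtains V f where "p \<in> V" "V \<subseteq> U" "local_basis \<tau> \<Omega> a M V f"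
proof -
  obtain r where r: "r > 0" "\<And>x. x \<in> ball 0 r \<Longrightarrow> \<tau> x p \<in> U" "inj_on (\<lambda>x. \<tau> x p) (ball 0 r)"
    and sol: "\<And>y0 :: complex^'n option. \<exists>Y. (\<forall>m. \<forall>x\<in>ball 0 r. complex_differentiable_at (Y m) x) \<and> (\<forall>m. Y m 0 = y0 $ m)
       \<and> (\<forall>m j. \<forall>x\<in>ball 0 r. cgrad (Y m) x $ j = (\<Sum>k\<in>UNIV. \<Theta> j m k (\<tau> x p) * Y k x))"
    using good_ball[OF U p] by blast
  have UM: "U \<subseteq> M" using openin_subset_M[OF U] .
  have inM: "\<And>x. x \<in> ball 0 r \<Longrightarrow> \<tau> x p \<in> M" using r UM by blast
  define V where "V = (\<lambda>x. \<tau> x p) ` ball 0 r"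
  have oV: "openin (top_of_set M) V" unfolding V_def by (rule openin_tau_image[OF open_ball inM])
  have "\<tau> 0 p = p" using tau_zero p UM by blast
  then have "p \<in> V" using r(1) unfolding V_def by (intro image_eqI[of _ _ 0]) auto
  have cV: "connected V" unfolding V_def by (rule connected_tau_image[OF _ inM]) auto
  have "\<exists>f. solution_on \<tau> \<Omega> a V f \<and> (\<forall>m. jet f p m = axis i 1 $ m)" for i :: "'n option"
  proof -
    obtain Y where Y: "\<And>m x. x \<in> ball 0 r \<Longrightarrow> complex_differentiable_at (Y m) x" "\<And>m. Y m 0 = (axis i 1 :: complex^'n option) $ m"
      "\<And>m j x. x \<in> ball 0 r \<Longrightarrow> cgrad (Y m) x $ j = (\<Sum>k\<in>UNIV. \<Theta> j m k (\<tau> x p) * Y k x)"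
      using sol[of "axis i 1"] by blast
    obtain f where f: "solution_on \<tau> \<Omega> a ((\<lambda>x. \<tau> x p) ` ball 0 r) f" "\<And>x m. x \<in> ball 0 r \<Longrightarrow> jet f (\<tau> x p) m = Y m x"
      by (rule coordinate_solution[OF inM r(3) Y(1,3)]; (assumption | (rule that; blast)))
    have "jet f p m = axis i 1 $ m" for m
      using f(2)[of 0 m] Y(2)[of m] r(1) \<open>\<tau> 0 p = p\<close> by simp
    then show ?thesis using f(1) unfolding V_def by blast
  qed
  then obtain f where f: "\<And>i. solution_on \<tau> \<Omega> a V (f i)" "\<And>i m. jet (f i) p m = (axis i 1 :: complex^'n option) $ m" by metis
  have fh: "\<And>i. hol_on \<tau> V (f i)" using solution_onD(1)[OF oV f(1)] .
  have indep: "c = 0" if q: "q \<in> V" and zero: "\<And>m. (\<Sum>i\<in>UNIV. c $ i * jet (f i) q m) = 0" for c :: "complex^'n option" and q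
  proof -
    have "jet (\<lambda>q. \<Sum>i\<in>UNIV. c $ i * f i q) q m = 0" for m using jet_combination[where f = f and I = UNIV, OF fh q] zero by simp
    from unique_continuation[OF oV cV solution_combination[OF oV f(1)] q this \<open>p \<in> V\<close>]
    have "(\<Sum>i\<in>UNIV. c $ i * (axis i 1 :: complex^'n option) $ m) = 0" for m
      unfolding jet_combination[where f = f and I = UNIV, OF fh \<open>p \<in> V\<close>] f(2) .
    moreover have "(\<Sum>i\<in>UNIV. c $ i * (axis i 1 :: complex^'n option) $ m) = c $ m" for m
    proof -
      have "(\<Sum>i\<in>UNIV. c $ i * (axis i 1 :: complex^'n option) $ m) = (\<Sum>i\<in>UNIV. if i = m then c $ m else 0)"
        by (intro sum.cong) (auto simp: axis_def)
      then show ?thesis by simp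
    qed
    ultimately show ?thesis by (simp add: vec_eq_iff)
  qed
  have "local_basis \<tau> \<Omega> a M V f"
    unfolding local_basis_def
  proof (intro conjI allI impI oV f(1))
    fix W g assume "openin (top_of_set M) W \<and> W \<subseteq> V \<and> W \<noteq> {} \<and> connected W \<and> solution_on \<tau> \<Omega> a W g"
    then have W: "openin (top_of_set M) W" "W \<subseteq> V" "connected W" and g: "solution_on \<tau> \<Omega> a W g" and "W \<noteq> {}" by auto
    then obtain q where q: "q \<in> W" by blast
    have fW: "solution_on \<tau> \<Omega> a W (f i)" for i by (rule solution_on_subset[OF f(1) W(2)])
    \<comment> \<open>The Wronskian matrix at q, whose columns are the jets of the basis;
      \<open>c\<close> below is chosen to match the jet of g.\<close>
    define A :: "complex^'n option^'n option" where "A = (\<chi> m i. jet (f i) q m)"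
    have "invertible A"
    proof (rule injective_derivative_invertible)
      fix c assume "A *v c = 0"
      then have "(\<Sum>i\<in>UNIV. c $ i * jet (f i) q m) = 0" for m
        by (simp add: A_def matrix_vector_mult_def vec_eq_iff mult.commute)
      then show "c = 0" using indep W(2) q by blast
    qed
    then obtain A' where A': "A ** A' = mat 1" unfolding invertible_def by blast
    define c where "c = A' *v (\<chi> m. jet g q m)"
    have "A *v c = (\<chi> m. jet g q m)" by (simp add: c_def matrix_vector_mul_assoc A')
    then have c: "(\<Sum>i\<in>UNIV. c $ i * jet (f i) q m) = jet g q m" for m
      by (simp add: A_def matrix_vector_mult_def vec_eq_iff mult.commute)
    \<comment> \<open>The difference of g and its candidate expansion, written as a single
      combination over an index set with one more element, so that the lemmas on combinations cover
      it.\<close>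
    define G where "G i = (case i of None \<Rightarrow> g | Some i \<Rightarrow> f i)" for i
    define d where "d i = (case i of None \<Rightarrow> 1 | Some i \<Rightarrow> - c $ i)" for i
    have dG: "(\<Sum>i\<in>UNIV. d i * G i x) = g x - (\<Sum>i\<in>UNIV. c $ i * f i x)" for x
      unfolding sum_option[of "\<lambda>i. d i * G i x"] by (simp add: d_def G_def sum_negf)
    have G: "solution_on \<tau> \<Omega> a W (G i)" for i using g fW by (cases i) (auto simp: G_def)
    have "jet (\<lambda>x. \<Sum>i\<in>UNIV. d i * G i x) q m = 0" for m
      unfolding jet_combination[where f = G and I = UNIV, OF solution_onD(1)[OF W(1) G] q]
        sum_option[of "\<lambda>i. d i * jet (G i) q m"]
      using c[of m] by (simp add: d_def G_def sum_negf)
    from unique_continuation[OF W(1,3) solution_combination[OF W(1) G] q this, of _ None]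
    have ex: "\<forall>x\<in>W. g x = (\<Sum>i\<in>UNIV. c $ i * f i x)" by (simp add: dG)
    show "\<exists>!c :: complex^'n option. \<forall>x\<in>W. g x = (\<Sum>i\<in>UNIV. c $ i * f i x)"
    proof (rule ex1I[of _ c])
      fix c' :: "complex^'n option" assume c': "\<forall>x\<in>W. g x = (\<Sum>i\<in>UNIV. c' $ i * f i x)"
      have zero: "(\<Sum>i\<in>UNIV. (c' - c) $ i * f i x) = 0" if "x \<in> W" for x
        using c' ex that by (simp add: left_diff_distrib sum_subtractf)
      have "jet (\<lambda>x. \<Sum>i\<in>UNIV. (c' - c) $ i * f i x) q m = 0" for m
      proof (cases m)
        case None
        then show ?thesis using zero q by simp
      next
        case (Some l)
        obtain s where s: "s > 0" "\<And>v. v \<in> ball 0 s \<Longrightarrow> \<tau> v q \<in> W" using tau_openin[OF W(1) q] by blast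
        have "cgrad (\<lambda>v. \<Sum>i\<in>UNIV. (c' - c) $ i * f i (\<tau> v q)) 0 = cgrad (\<lambda>_. 0) (0 :: complex^'n)"
          by (rule complex_differentiable_transform(2)[OF cgrad_const(1) open_ball, of 0 0 s]) (use s zero in auto)
        then show ?thesis using Some by (simp add: differential_eq_cgrad)
      qed
      then have "(\<Sum>i\<in>UNIV. (c' - c) $ i * jet (f i) q m) = 0" for m
        using jet_combination[where f = f and I = UNIV, OF solution_onD(1)[OF W(1) fW] q, of "\<lambda>i. (c' - c) $ i" m] by simp
      then have "c' - c = 0" using indep W(2) q by blast
      then show "c' = c" by simp
    qed (rule ex)
  qed
  moreover have "V \<subseteq> U" using r(2) by (auto simp: V_def)
  ultimately show ?thesis using that[OF \<open>p \<in> V\<close>] by simp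
qed

text \<open>On a connected set each f' i has constant coefficients with respect to f. The matrix is
  invertible because a relation among its rows would be a relation among the jets of f' at
  p.\<close>

lemma local_basis_transition:
  assumes B: "local_basis \<tau> \<Omega> a M U f" and B': "local_basis \<tau> \<Omega> a M U' f'" and p: "p \<in> U" "p \<in> U'"
  obtains V and A :: "complex^'n option^'n option" where
    "openin (top_of_set M) V" "p \<in> V" "V \<subseteq> U \<inter> U'" "invertible A"
    "\<And>x. x \<in> V \<Longrightarrow> (\<chi> i. f' i x) = A *v (\<chi> i. f i x)"
proof -
  have "openin (top_of_set M) (U \<inter> U')" using local_basisD(1)[OF B] local_basisD(1)[OF B'] by blast
  then obtain V where V: "openin (top_of_set M) V" "p \<in> V" "V \<subseteq> U \<inter> U'" "connected V"
    by (rule connected_nbhd) (use p in auto)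
  have fs: "solution_on \<tau> \<Omega> a V (f i)" for i by (rule solution_on_subset[OF local_basisD(2)[OF B]]) (use V in blast)
  have fs': "solution_on \<tau> \<Omega> a V (f' i)" for i by (rule solution_on_subset[OF local_basisD(2)[OF B']]) (use V in blast)
  have "\<exists>c :: complex^'n option. \<forall>x\<in>V. f' i x = (\<Sum>j\<in>UNIV. c $ j * f j x)" for i
    using local_basisD(3)[OF B V(1) _ _ V(4) fs'] V by blast
  then obtain C :: "'n option \<Rightarrow> complex^'n option" where C: "\<And>i x. x \<in> V \<Longrightarrow> f' i x = (\<Sum>j\<in>UNIV. C i $ j * f j x)" by metis
  define A where "A = (\<chi> i. C i)"
  have jetC: "jet (f' i) p m = (\<Sum>j\<in>UNIV. C i $ j * jet (f j) p m)" for i m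
  proof -
    obtain s where s: "s > 0" "\<And>v. v \<in> ball 0 s \<Longrightarrow> \<tau> v p \<in> V" using tau_openin[OF V(1,2)] by blast
    have "hol_on \<tau> V (\<lambda>x. \<Sum>j\<in>UNIV. C i $ j * f j x)"
      by (rule solution_onD(1)[OF V(1) solution_combination[OF V(1) fs]])
    from complex_differentiable_transform(2)[OF hol_onD[OF this V(2)] open_ball, of 0 s "\<lambda>v. f' i (\<tau> v p)"]
    have "differential \<tau> (f' i) p = differential \<tau> (\<lambda>x. \<Sum>j\<in>UNIV. C i $ j * f j x) p"
      using s C by (simp add: differential_eq_cgrad)
    then have "jet (f' i) p m = jet (\<lambda>x. \<Sum>j\<in>UNIV. C i $ j * f j x) p m"
      using C[OF V(2)] by (cases m) auto
    then show ?thesis using jet_combination[where f = f and I = UNIV, OF solution_onD(1)[OF V(1) fs] V(2)] by simp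
  qed
  have "invertible A"
  proof (rule invertible_transpose_injective)
    fix x :: "complex^'n option" assume x: "\<And>j. (\<Sum>i\<in>UNIV. x $ i * A $ i $ j) = 0"
    have "(\<Sum>i\<in>UNIV. x $ i * jet (f' i) p m) = 0" for m
    proof -
      have "(\<Sum>i\<in>UNIV. x $ i * jet (f' i) p m) = (\<Sum>i\<in>UNIV. \<Sum>j\<in>UNIV. x $ i * A $ i $ j * jet (f j) p m)"
        by (simp add: jetC A_def sum_distrib_left mult.assoc)
      also have "\<dots> = (\<Sum>j\<in>UNIV. (\<Sum>i\<in>UNIV. x $ i * A $ i $ j) * jet (f j) p m)"
        unfolding sum_distrib_right by (rule sum.swap)
      finally show ?thesis by (simp add: x)
    qed
    then show "x = 0" by (rule local_basis_independent[OF B' p(2)])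
  qed
  then show ?thesis using that V C by (simp add: A_def matrix_vector_mult_def vec_eq_iff)
qed

text \<open>Used for the maximality of the atlas: a linear change of homogeneous coordinates is a
  change of basis of solutions. Coefficients of a solution transform by the inverse
  transpose.\<close>

lemma local_basis_linear:
  fixes A :: "complex^'n option^'n option"
  assumes B: "local_basis \<tau> \<Omega> a M U f" and "invertible A"
  shows "local_basis \<tau> \<Omega> a M U (\<lambda>i x. \<Sum>j\<in>UNIV. A $ i $ j * f j x)"
  unfolding local_basis_def
proof (intro conjI allI impI)
  note U = local_basisD(1)[OF B]
  show "openin (top_of_set M) U" by (rule U)
  show "solution_on \<tau> \<Omega> a U (\<lambda>x. \<Sum>j\<in>UNIV. A $ i $ j * f j x)" for i
    by (rule solution_combination[OF U local_basisD(2)[OF B]])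
  fix V g assume "openin (top_of_set M) V \<and> V \<subseteq> U \<and> V \<noteq> {} \<and> connected V \<and> solution_on \<tau> \<Omega> a V g"
  then obtain c :: "complex^'n option" where c: "\<And>c'. (\<forall>x\<in>V. g x = (\<Sum>i\<in>UNIV. c' $ i * f i x)) \<longleftrightarrow> c' = c"
  proof -
    assume *: "openin (top_of_set M) V \<and> V \<subseteq> U \<and> V \<noteq> {} \<and> connected V \<and> solution_on \<tau> \<Omega> a V g"
    have "\<exists>!c :: complex^'n option. \<forall>x\<in>V. g x = (\<Sum>i\<in>UNIV. c $ i * f i x)"
      by (rule local_basisD(3)[OF B]) (use * in auto)
    then show ?thesis using that by blast
  qed
  have eq: "(\<Sum>i\<in>UNIV. d $ i * (\<Sum>j\<in>UNIV. A $ i $ j * f j x)) = (\<Sum>j\<in>UNIV. (transpose A *v d) $ j * f j x)" for d x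
  proof -
    have "(\<Sum>i\<in>UNIV. d $ i * (\<Sum>j\<in>UNIV. A $ i $ j * f j x)) = (\<Sum>j\<in>UNIV. \<Sum>i\<in>UNIV. d $ i * (A $ i $ j * f j x))"
      unfolding sum_distrib_left by (rule sum.swap)
    then show ?thesis by (simp add: matrix_vector_mult_def transpose_def sum_distrib_right mult.assoc mult.left_commute)
  qed
  obtain A' where A': "A ** A' = mat 1" "A' ** A = mat 1" using \<open>invertible A\<close> unfolding invertible_def by blast
  then have t: "transpose A' ** transpose A = mat 1" "transpose A ** transpose A' = mat 1"
    by (metis matrix_transpose_mul transpose_mat)+
  note tt = matrix_vector_mul_assoc t matrix_vector_mul_lid
  show "\<exists>!d :: complex^'n option. \<forall>x\<in>V. g x = (\<Sum>i\<in>UNIV. d $ i * (\<Sum>j\<in>UNIV. A $ i $ j * f j x))"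
    unfolding eq c
  proof (rule ex1I[of _ "transpose A' *v c"])
    show "transpose A *v (transpose A' *v c) = c" by (simp only: tt)
    show "d = transpose A' *v c" if "transpose A *v d = c" for d
      unfolding that[symmetric] by (simp only: tt)
  qed
qed

end

context projective_connection
begin

text \<open>Independence of the jets makes the basis a \<open>projective_immersion\<close> in
  exponential coordinates. Its properties are transported from a small ball D to the translates V of
  p, where injectivity identifies functions on V with functions on D.\<close>

lemma local_basis_chart:
  assumes B: "local_basis \<tau> \<Omega> a M U f" and p: "p \<in> U"
  obtains V where "openin (top_of_set M) V" "p \<in> V" "V \<subseteq> U" "proj_chart \<tau> M V (\<lambda>x. proj_pt (\<chi> i. f i x))"
proof -
  note U = local_basisD(1)[OF B]
  note fh = solution_onD(1)[OF U local_basisD(2)[OF B]]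
  have UM: "U \<subseteq> M" using openin_subset_M[OF U] .
  obtain r where r: "r > 0" "\<And>x. x \<in> ball 0 r \<Longrightarrow> \<tau> x p \<in> U" "inj_on (\<lambda>x. \<tau> x p) (ball 0 r)"
    using good_ball[OF U p] by metis
  define F where "F x = (\<chi> i. f i (\<tau> x p))" for x
  have Fd: "complex_differentiable_at (\<lambda>x. F x $ i) x" if "x \<in> ball 0 r" for i x
    using hol_onD[OF fh[of i] r(2)[OF that]] hol_on_iff_shift[of "f i" x p] by (simp add: F_def)
  interpret F: projective_immersion F "ball 0 r"
  proof
    show "open (ball (0 :: complex^'n) r)" by simp
    show "complex_differentiable_at (\<lambda>x. F x $ i) x" if "x \<in> ball 0 r" for i x by (rule Fd[OF that])
    fix x c v assume x: "x \<in> ball 0 r" and z: "\<And>i. c * F x $ i + pairing (cgrad (\<lambda>x. F x $ i) x) v = 0"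
    \<comment> \<open>A relation c F + dF(v) = 0 is a relation with coefficients (c, v) among the
      rows of the Wronskian, and the Wronskian is invertible.\<close>
    define J :: "complex^'n option^'n option" where "J = (\<chi> m i. jet (f i) (\<tau> x p) m)"
    have "invertible J"
    proof (rule injective_derivative_invertible)
      fix d assume "J *v d = 0"
      then have "(\<Sum>i\<in>UNIV. d $ i * jet (f i) (\<tau> x p) m) = 0" for m
        by (simp add: J_def matrix_vector_mult_def vec_eq_iff mult.commute)
      then show "d = 0" by (rule local_basis_independent[OF B r(2)[OF x]])
    qed
    moreover have "(\<Sum>m\<in>UNIV. cone_vec c v $ m * J $ m $ i) = 0" for i
    proof -
      have "cgrad (\<lambda>x. F x $ i) x = differential \<tau> (f i) (\<tau> x p)" by (simp add: F_def differential_shift)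
      then show ?thesis
        using z[of i] unfolding sum_option[of "\<lambda>m. cone_vec c v $ m * J $ m $ i"]
        by (simp add: J_def cone_vec_def F_def pairing_def mult.commute)
    qed
    ultimately have "cone_vec c v = 0" by (rule invertible_left_zero)
    then show "c = 0 \<and> v = 0"
      by (metis cone_vec_simps(1,2) zero_index vec_eq_iff hpart_def vec_lambda_beta)
  qed
  obtain s where s: "s > 0" "ball 0 s \<subseteq> ball (0 :: complex^'n) r" "inj_on F.chart (ball 0 s)"
    using F.chart_locally_injective[of 0] r(1) by auto
  define D where "D = ball (0 :: complex^'n) s"
  define V where "V = (\<lambda>x. \<tau> x p) ` D"
  define \<phi> where "\<phi> q = proj_pt (\<chi> i. f i q)" for q
  have \<phi>: "\<phi> (\<tau> x p) = F.chart x" for x by (simp add: \<phi>_def F.chart_def F_def)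
  have DU: "\<tau> x p \<in> U" if "x \<in> D" for x using that s(2) r(2) unfolding D_def by blast
  have oV: "openin (top_of_set M) V" unfolding V_def by (rule openin_tau_image) (use DU UM in \<open>auto simp: D_def\<close>)
  have "\<tau> 0 p = p" using tau_zero p UM by blast
  then have pV: "p \<in> V" using s(1) unfolding V_def by (intro image_eqI[of _ _ 0]) (auto simp: D_def)
  have VU: "V \<subseteq> U" using DU by (auto simp: V_def)
  have inj\<phi>: "inj_on \<phi> V"
    using s(3) by (auto simp: inj_on_def V_def \<phi> D_def)
  define pre where "pre W = {x \<in> D. \<tau> x p \<in> W}" for W
  have pre: "open (pre W)" "pre W \<subseteq> D" if "openin (top_of_set M) W" for W
  proof -
    have "pre W = D \<inter> {x. \<tau> x p \<in> W}" by (auto simp: pre_def)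
    then show "open (pre W)" using open_Int[OF open_ball open_tau_preimage[OF that, of p]] by (simp only: D_def)
  qed (auto simp: pre_def)
  have pre_image: "W = (\<lambda>x. \<tau> x p) ` pre W" "\<phi> ` W = F.chart ` pre W" if "W \<subseteq> V" for W
  proof -
    show W: "W = (\<lambda>x. \<tau> x p) ` pre W" using that by (auto simp: pre_def V_def)
    show "\<phi> ` W = F.chart ` pre W" by (subst W) (simp add: image_image \<phi>)
  qed
  have Dr: "D \<subseteq> ball 0 r" using s(2) by (simp add: D_def)
  have open_image: "openin proj_topology (\<phi> ` W)" if "openin (top_of_set M) W" "W \<subseteq> V" for W
    unfolding pre_image(2)[OF that(2)] by (rule F.open_chart_image) (use pre[OF that(1)] Dr in auto)
  have oD: "open D" by (simp add: D_def)
  have "proj_chart \<tau> M V \<phi>"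
    unfolding proj_chart_def
  proof (intro conjI allI impI)
    show "openin (top_of_set M) V" by (rule oV)
    show o\<phi>: "openin proj_topology (\<phi> ` V)" by (rule open_image[OF oV order_refl])
    show "homeomorphic_map (top_of_set V) (subtopology proj_topology (\<phi> ` V)) \<phi>"
    proof (rule bijective_open_imp_homeomorphic_map)
      have "continuous_map (top_of_set V) proj_topology \<phi>"
        unfolding continuous_map
      proof (intro conjI allI impI)
        show "\<phi> ` topspace (top_of_set V) \<subseteq> topspace proj_topology"
          using openin_subset[OF o\<phi>] by simp
        fix W :: "(complex^'n option) set set" assume W: "openin proj_topology W"
        have "{x \<in> topspace (top_of_set V). \<phi> x \<in> W} = (\<lambda>x. \<tau> x p) ` {x \<in> D. F.chart x \<in> W}"
          by (auto simp: V_def \<phi>)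
        moreover have "openin (top_of_set M) ((\<lambda>x. \<tau> x p) ` {x \<in> D. F.chart x \<in> W})"
          by (rule openin_tau_image[OF F.open_chart_preimage[OF W oD Dr]]) (use DU UM in auto)
        ultimately show "openin (top_of_set V) {x \<in> topspace (top_of_set V). \<phi> x \<in> W}"
          using openin_subset_trans[of M "(\<lambda>x. \<tau> x p) ` {x \<in> D. F.chart x \<in> W}" V] order_trans[OF VU UM]
          by (simp only: V_def image_mono Collect_subset)
      qed
      then show "continuous_map (top_of_set V) (subtopology proj_topology (\<phi> ` V)) \<phi>"
        by (simp add: continuous_map_in_subtopology)
      show "open_map (top_of_set V) (subtopology proj_topology (\<phi> ` V)) \<phi>"
        unfolding open_map_def
      proof (intro allI impI)
        fix W assume W: "openin (top_of_set V) W"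
        then have "W \<subseteq> V" using openin_subset by fastforce
        then have "openin proj_topology (\<phi> ` W)" using open_image[OF openin_trans[OF W oV]] by blast
        then show "openin (subtopology proj_topology (\<phi> ` V)) (\<phi> ` W)"
          using \<open>W \<subseteq> V\<close> unfolding openin_subtopology by (intro exI[of _ "\<phi> ` W"]) auto
      qed
      show "\<phi> ` topspace (top_of_set V) = topspace (subtopology proj_topology (\<phi> ` V))"
        using openin_subset[OF o\<phi>] by (simp add: topspace_subtopology) blast
      show "inj_on \<phi> (topspace (top_of_set V))" using inj\<phi> by simp
    qed
    fix W g assume "openin (top_of_set M) W \<and> W \<subseteq> V"
    then have W: "openin (top_of_set M) W" "W \<subseteq> V" by auto
    have "hol_on \<tau> W g \<longleftrightarrow> (\<forall>x\<in>pre W. complex_differentiable_at (\<lambda>w. g (\<tau> w p)) x)"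
      unfolding hol_on_def by (subst pre_image(1)[OF W(2)]) (simp add: hol_on_iff_shift[of g])
    also have "\<dots> \<longleftrightarrow> proj_hol_on (F.chart ` pre W) (\<lambda>y. g (inv_into V \<phi> y))"
    proof (rule F.chart_holomorphic_iff[OF pre[OF W(1)] Dr, symmetric])
      show "inj_on F.chart D" using s(3) by (simp add: D_def)
      show "g (inv_into V \<phi> (F.chart x)) = g (\<tau> x p)" if "x \<in> D" for x
      proof -
        have "\<tau> x p \<in> V" using that by (simp add: V_def)
        from inv_into_f_f[OF inj\<phi> this] show ?thesis by (simp add: \<phi>)
      qed
    qed
    finally show "hol_on \<tau> W g \<longleftrightarrow> proj_hol_on (\<phi> ` W) (\<lambda>y. g (inv_into V \<phi> y))"
      unfolding pre_image(2)[OF W(2)] .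
  qed
  then show ?thesis using that[OF oV pV VU] by (simp add: \<phi>_def[abs_def])
qed

text \<open>Charts that are given by a local basis near each point, with a basis that may vary from
  point to point. This freedom is what makes the collection maximal.\<close>

definition atlas :: "('g set \<times> ('g \<Rightarrow> (complex^'n option) set)) set" where
  "atlas = {(V, \<phi>). proj_chart \<tau> M V \<phi> \<and>
     (\<forall>p\<in>V. \<exists>U f. local_basis \<tau> \<Omega> a M U f \<and> p \<in> U \<and> U \<subseteq> V \<and> (\<forall>x\<in>U. \<phi> x = proj_pt (\<chi> i. f i x)))}"

lemma atlasD:
  assumes "(V, \<phi>) \<in> atlas" "p \<in> V"
  obtains U f where "local_basis \<tau> \<Omega> a M U f" "p \<in> U" "U \<subseteq> V" "\<And>x. x \<in> U \<Longrightarrow> \<phi> x = proj_pt (\<chi> i. f i x)"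
  using assms unfolding atlas_def by blast

lemma local_basis_atlas:
  assumes B: "local_basis \<tau> \<Omega> a M U f" and p: "p \<in> U"
  shows "\<exists>V. openin (top_of_set M) V \<and> p \<in> V \<and> V \<subseteq> U \<and> (V, \<lambda>x. proj_pt (\<chi> i. f i x)) \<in> atlas"
proof -
  obtain V where V: "openin (top_of_set M) V" "p \<in> V" "V \<subseteq> U" "proj_chart \<tau> M V (\<lambda>x. proj_pt (\<chi> i. f i x))"
    using local_basis_chart[OF B p] .
  have "local_basis \<tau> \<Omega> a M V f" by (rule local_basis_subset[OF B V(1,3)])
  then have "(V, \<lambda>x. proj_pt (\<chi> i. f i x)) \<in> atlas" using V(4) unfolding atlas_def by blast
  then show ?thesis using V by blast
qed

lemma atlas_compatible:
  assumes c: "c \<in> atlas" "c' \<in> atlas"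
  shows "proj_compatible M c c'"
  unfolding proj_compatible_def
proof
  fix p assume p: "p \<in> fst c \<inter> fst c'"
  obtain U f where 1: "local_basis \<tau> \<Omega> a M U f" "p \<in> U" "U \<subseteq> fst c" "\<And>x. x \<in> U \<Longrightarrow> snd c x = proj_pt (\<chi> i. f i x)"
    using atlasD[of "fst c" "snd c" p] c p by auto
  obtain U' f' where 2: "local_basis \<tau> \<Omega> a M U' f'" "p \<in> U'" "U' \<subseteq> fst c'" "\<And>x. x \<in> U' \<Longrightarrow> snd c' x = proj_pt (\<chi> i. f' i x)"
    using atlasD[of "fst c'" "snd c'" p] c p by auto
  obtain V and A :: "complex^'n option^'n option" where
    V: "openin (top_of_set M) V" "p \<in> V" "V \<subseteq> U \<inter> U'" "invertible A"
    "\<And>x. x \<in> V \<Longrightarrow> (\<chi> i. f' i x) = A *v (\<chi> i. f i x)"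
    by (rule local_basis_transition[OF 1(1) 2(1) 1(2) 2(2)]) (rule that; assumption)
  have "snd c' x = (*v) A ` snd c x" if "x \<in> V" for x
  proof -
    have "x \<in> U" "x \<in> U'" using that V(3) by blast+
    then show ?thesis unfolding 1(4)[OF \<open>x \<in> U\<close>] 2(4)[OF \<open>x \<in> U'\<close>] V(5)[OF that] by (simp only: proj_pt_matrix)
  qed
  then show "\<exists>V (A :: complex^'n option^'n option). openin (top_of_set M) V \<and> p \<in> V \<and> V \<subseteq> fst c \<inter> fst c' \<and> invertible A
        \<and> (\<forall>x\<in>V. snd c' x = (*v) A ` snd c x)"
  proof (intro exI conjI)
    show "V \<subseteq> fst c \<inter> fst c'" using V(3) 1(3) 2(3) by blast
  qed (use V in auto)
qed

lemma atlas_cover: "(\<Union>c\<in>atlas. fst c) = M"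
proof
  show "(\<Union>c\<in>atlas. fst c) \<subseteq> M"
  proof (rule UN_least)
    fix c assume "c \<in> atlas"
    then have "openin (top_of_set M) (fst c)" unfolding atlas_def proj_chart_def by auto
    then show "fst c \<subseteq> M" by (rule openin_subset_M)
  qed
  show "M \<subseteq> (\<Union>c\<in>atlas. fst c)"
  proof
    fix p assume p: "p \<in> M"
    have oM: "openin (top_of_set M) M" by simp
    obtain V f where "p \<in> V" "V \<subseteq> M" "local_basis \<tau> \<Omega> a M V f"
      by (rule local_basis_exists[OF oM p]) (rule that; assumption)
    from local_basis_atlas[OF this(3,1)] show "p \<in> (\<Union>c\<in>atlas. fst c)" by force
  qed
qed

text \<open>Near each point the given chart is the image under an invertible matrix A of a chart
  defined by a local basis f, and A f is again a local basis by
  \<open>local_basis_linear\<close>.\<close>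

lemma atlas_maximal:
  assumes chart: "proj_chart \<tau> M (fst c) (snd c)" and comp: "\<And>c'. c' \<in> atlas \<Longrightarrow> proj_compatible M c' c"
  shows "c \<in> atlas"
proof -
  have o: "openin (top_of_set M) (fst c)" using chart by (simp add: proj_chart_def)
  have "\<exists>U f. local_basis \<tau> \<Omega> a M U f \<and> p \<in> U \<and> U \<subseteq> fst c \<and> (\<forall>x\<in>U. snd c x = proj_pt (\<chi> i. f i x))"
    if p: "p \<in> fst c" for p
  proof -
    have "p \<in> M" using p openin_subset_M[OF o] by blast
    then obtain c' where c': "c' \<in> atlas" "p \<in> fst c'" using atlas_cover by blast
    obtain U f where 1: "local_basis \<tau> \<Omega> a M U f" "p \<in> U" "U \<subseteq> fst c'" "\<And>x. x \<in> U \<Longrightarrow> snd c' x = proj_pt (\<chi> i. f i x)"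
      using atlasD[of "fst c'" "snd c'" p] c' by auto
    have "p \<in> fst c' \<inter> fst c" using p c'(2) by blast
    from comp[OF c'(1), unfolded proj_compatible_def, THEN bspec, OF this]
    obtain V and A :: "complex^'n option^'n option" where "openin (top_of_set M) V \<and> p \<in> V \<and> V \<subseteq> fst c' \<inter> fst c
      \<and> invertible A \<and> (\<forall>x\<in>V. snd c x = (*v) A ` snd c' x)" by (elim exE)
    then have V: "openin (top_of_set M) V" "p \<in> V" "V \<subseteq> fst c' \<inter> fst c"
      "invertible A" "\<And>x. x \<in> V \<Longrightarrow> snd c x = (*v) A ` snd c' x" by simp_all
    have oUV: "openin (top_of_set M) (U \<inter> V)" using local_basisD(1)[OF 1(1)] V(1) by blast
    have B: "local_basis \<tau> \<Omega> a M (U \<inter> V) (\<lambda>i x. \<Sum>j\<in>UNIV. A $ i $ j * f j x)"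
      by (rule local_basis_linear[OF local_basis_subset[OF 1(1) oUV Int_lower1] V(4)])
    have "snd c x = proj_pt (\<chi> i. \<Sum>j\<in>UNIV. A $ i $ j * f j x)" if "x \<in> U \<inter> V" for x
    proof -
      have "(\<chi> i. \<Sum>j\<in>UNIV. A $ i $ j * f j x) = A *v (\<chi> i. f i x)" by (simp add: matrix_vector_mult_def)
      then show ?thesis using that V(5)[of x] 1(4)[of x] by (simp add: proj_pt_matrix)
    qed
    moreover have "p \<in> U \<inter> V" "U \<inter> V \<subseteq> fst c" using 1 V by auto
    ultimately show ?thesis using B by blast
  qed
  then show ?thesis using chart unfolding atlas_def by (cases c) auto
qed

theorem defines_projective_structure: "defines_projective_structure \<tau> M \<Omega> a"
  unfolding defines_projective_structure_def
proof (intro conjI ballI exI[of _ atlas] allI impI)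
  fix p assume p: "p \<in> M"
  have oM: "openin (top_of_set M) M" by simp
  obtain V f where "p \<in> V" "V \<subseteq> M" "local_basis \<tau> \<Omega> a M V f"
    by (rule local_basis_exists[OF oM p]) (rule that; assumption)
  then show "\<exists>U f. p \<in> U \<and> local_basis \<tau> \<Omega> a M U f" by blast
next
  show "projective_structure \<tau> M atlas"
    unfolding projective_structure_def
    using atlas_compatible atlas_cover atlas_maximal by (auto simp: atlas_def)
next
  fix U f p assume "local_basis \<tau> \<Omega> a M U f" "p \<in> U"
  then show "\<exists>V. openin (top_of_set M) V \<and> p \<in> V \<and> V \<subseteq> U \<and> (V, \<lambda>x. proj_pt (\<chi> i. f i x)) \<in> atlas"
    by (rule local_basis_atlas)
qed

end

section \<open>The adjoint torus\<close>

lemma cvec_add: "cvec (x + y) = cvec x + cvec y" and cvec_scale: "cvec (c *\<^sub>R x) = of_real c *s cvec x"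
  by (simp_all add: cvec_def vec_eq_iff)

lemma linear_pairing_cvec: "linear (\<lambda>x. pairing (cvec x) v)"
  by (rule linearI) (simp_all add: cvec_add cvec_scale pairing_add_left pairing_scale_left scaleR_complex)

text \<open>Such an x is an integral multiple of 2 pi i, and 0 is the only one of norm below
  1.\<close>

lemma exp_eq_1_small:
  assumes "exp x = 1" "norm (x :: complex) < 1"
  shows "x = 0"
proof -
  obtain n :: int where n: "Re x = 0" "Im x = of_int (2 * n) * pi" using assms(1) by (auto simp: exp_eq_1)
  have "\<bar>Im x\<bar> < 1" using abs_Im_le_cmod[of x] assms(2) by linarith
  then have *: "\<bar>of_int n * (2 * pi)\<bar> < (1::real)" using n(2) by (simp add: algebra_simps)
  have "n = 0"
  proof (rule ccontr)
    assume "n \<noteq> 0"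
    then have "1 \<le> \<bar>real_of_int n\<bar>" by linarith
    then have "1 * (2 * pi) \<le> \<bar>real_of_int n\<bar> * (2 * pi)" by (intro mult_right_mono) auto
    moreover have "\<bar>real_of_int n\<bar> * (2 * pi) < 1" using * by (simp add: abs_mult)
    ultimately show False using pi_gt3 by linarith
  qed
  then show ?thesis using n by (simp add: complex_eq_iff)
qed

context root_sys
begin

abbreviation "Q \<equiv> root_lattice R"
abbreviation "H \<equiv> adjoint_torus R"
abbreviation "Ho \<equiv> mirror_complement R"
abbreviation "\<tau> \<equiv> torus_translate R"

lemma Q_add: "x \<in> Q \<Longrightarrow> y \<in> Q \<Longrightarrow> x + y \<in> Q"
proof -
  assume "x \<in> Q" "y \<in> Q"
  then obtain c d where "x = (\<Sum>\<alpha>\<in>R. of_int (c \<alpha>) *\<^sub>R \<alpha>)" "y = (\<Sum>\<alpha>\<in>R. of_int (d \<alpha>) *\<^sub>R \<alpha>)"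
    unfolding root_lattice_def by blast
  then have "x + y = (\<Sum>\<alpha>\<in>R. of_int (c \<alpha> + d \<alpha>) *\<^sub>R \<alpha>)" by (simp add: sum.distrib scaleR_add_left)
  then show ?thesis unfolding root_lattice_def by (intro CollectI exI[of _ "\<lambda>\<alpha>. c \<alpha> + d \<alpha>"]) simp
qed

lemma Q_scale: "x \<in> Q \<Longrightarrow> of_int n *\<^sub>R x \<in> Q"
proof -
  assume "x \<in> Q"
  then obtain c where "x = (\<Sum>\<alpha>\<in>R. of_int (c \<alpha>) *\<^sub>R \<alpha>)" unfolding root_lattice_def by blast
  then have "of_int n *\<^sub>R x = (\<Sum>\<alpha>\<in>R. of_int (n * c \<alpha>) *\<^sub>R \<alpha>)" by (simp add: scaleR_sum_right)
  then show ?thesis unfolding root_lattice_def by (intro CollectI exI[of _ "\<lambda>\<alpha>. n * c \<alpha>"]) simp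
qed

lemma R_Q: "\<alpha> \<in> R \<Longrightarrow> \<alpha> \<in> Q"
proof -
  assume a: "\<alpha> \<in> R"
  have "(\<Sum>\<beta>\<in>R. of_int (if \<beta> = \<alpha> then 1 else 0) *\<^sub>R \<beta>) = (\<Sum>\<beta>\<in>R. if \<beta> = \<alpha> then \<alpha> else 0)"
    by (rule sum.cong) auto
  then have "\<alpha> = (\<Sum>\<beta>\<in>R. of_int (if \<beta> = \<alpha> then 1 else 0) *\<^sub>R \<beta>)" using a finite_R by simp
  then show ?thesis unfolding root_lattice_def by (intro CollectI exI[of _ "\<lambda>\<beta>. if \<beta> = \<alpha> then 1 else 0"]) simp
qed

lemma zero_Q: "0 \<in> Q"
  unfolding root_lattice_def by (intro CollectI exI[of _ "\<lambda>_. 0"]) simp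

lemma torusD:
  assumes "h \<in> H"
  shows "x \<in> Q \<Longrightarrow> h x \<noteq> 0" "x \<in> Q \<Longrightarrow> y \<in> Q \<Longrightarrow> h (x + y) = h x * h y" "h \<in> extensional Q" "h 0 = 1"
proof -
  show 1: "x \<in> Q \<Longrightarrow> h x \<noteq> 0" "x \<in> Q \<Longrightarrow> y \<in> Q \<Longrightarrow> h (x + y) = h x * h y" "h \<in> extensional Q" for x y
    using assms by (auto simp: adjoint_torus_def)
  have "h (0 + 0) = h 0 * h 0" "h 0 \<noteq> 0" by (intro 1 zero_Q)+
  then show "h 0 = 1" by simp
qed

lemma torus_scale:
  assumes h: "h \<in> H" and x: "x \<in> Q"
  shows "h (of_int n *\<^sub>R x) = h x powi n"
proof -
  have nat: "h (of_int (int m) *\<^sub>R x) = h x ^ m" for m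
  proof (induction m)
    case (Suc m)
    have "of_int (int (Suc m)) *\<^sub>R x = x + of_int (int m) *\<^sub>R x" by (simp add: algebra_simps)
    then show ?case by (simp only: torusD(2)[OF h x Q_scale[OF x]] Suc power_Suc)
  qed (simp add: torusD(4)[OF h])
  show ?thesis
  proof (cases "n \<ge> 0")
    case True
    then obtain m where "n = int m" using nonneg_int_cases by blast
    then show ?thesis using nat by simp
  next
    case False
    then obtain m where m: "n = - int m" by (metis int_cases linear nonneg_int_cases minus_minus neg_0_le_iff_le)
    have "h (of_int n *\<^sub>R x + of_int (int m) *\<^sub>R x) = h (of_int n *\<^sub>R x) * h x ^ m"
      unfolding torusD(2)[OF h Q_scale[OF x] Q_scale[OF x]] nat ..
    moreover have "of_int n *\<^sub>R x + of_int (int m) *\<^sub>R x = 0" by (simp add: m)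
    ultimately have "h (of_int n *\<^sub>R x) * h x ^ m = 1" using torusD(4)[OF h] by simp
    then have "h (of_int n *\<^sub>R x) = inverse (h x ^ m)" by (metis inverse_unique mult.commute)
    then show ?thesis by (simp add: m power_int_minus)
  qed
qed

text \<open>The roots generate the lattice, a homomorphism is determined by its values on
  generators, and extensionality fixes the values elsewhere.\<close>

lemma torus_eqI:
  assumes h: "h \<in> H" and h': "h' \<in> H" and eq: "\<And>\<alpha>. \<alpha> \<in> R \<Longrightarrow> h \<alpha> = h' \<alpha>"
  shows "h = h'"
proof (rule extensionalityI[OF torusD(3)[OF h] torusD(3)[OF h']])
  fix x assume "x \<in> Q"
  then obtain c where x: "x = (\<Sum>\<alpha>\<in>R. of_int (c \<alpha>) *\<^sub>R \<alpha>)" unfolding root_lattice_def by blast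
  have "A \<subseteq> R \<Longrightarrow> (\<Sum>\<alpha>\<in>A. of_int (c \<alpha>) *\<^sub>R \<alpha>) \<in> Q \<and> h (\<Sum>\<alpha>\<in>A. of_int (c \<alpha>) *\<^sub>R \<alpha>) = h' (\<Sum>\<alpha>\<in>A. of_int (c \<alpha>) *\<^sub>R \<alpha>)"
    if "finite A" for A
    using that
  proof (induction A rule: finite_induct)
    case empty
    then show ?case by (simp add: zero_Q torusD(4)[OF h] torusD(4)[OF h'])
  next
    case (insert a A)
    then have aQ: "of_int (c a) *\<^sub>R a \<in> Q" and IH: "(\<Sum>\<alpha>\<in>A. of_int (c \<alpha>) *\<^sub>R \<alpha>) \<in> Q"
      "h (\<Sum>\<alpha>\<in>A. of_int (c \<alpha>) *\<^sub>R \<alpha>) = h' (\<Sum>\<alpha>\<in>A. of_int (c \<alpha>) *\<^sub>R \<alpha>)" using R_Q Q_scale by auto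
    have "h (of_int (c a) *\<^sub>R a) = h' (of_int (c a) *\<^sub>R a)"
      using insert.prems by (simp add: torus_scale[OF h] torus_scale[OF h'] R_Q eq)
    then show ?case using insert.hyps IH aQ by (simp add: Q_add torusD(2)[OF h] torusD(2)[OF h'])
  qed
  then show "h x = h' x" using x finite_R by blast
qed

lemma torus_character:
  assumes h: "h \<in> H"
  shows "character h"
  unfolding character_def
proof (intro conjI ballI)
  show "h \<alpha> \<noteq> 0" if "\<alpha> \<in> R" for \<alpha> by (rule torusD(1)[OF h R_Q[OF that]])
  fix \<alpha> \<beta> assume ab: "\<alpha> \<in> R" "\<beta> \<in> R"
  obtain m where m: "\<beta> \<bullet> coroot \<alpha> = of_int m" using integral[OF ab] by (meson Ints_cases)
  have "reflection \<alpha> *v \<beta> = \<beta> + of_int (- m) *\<^sub>R \<alpha>" by (simp add: reflection_root m)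
  then show "h (reflection \<alpha> *v \<beta>) = h \<beta> * h \<alpha> powi (- \<lfloor>\<beta> \<bullet> coroot \<alpha>\<rfloor>)"
    by (simp only: torusD(2)[OF h R_Q[OF ab(2)] Q_scale[OF R_Q[OF ab(1)]]] torus_scale[OF h R_Q[OF ab(1)]] m floor_of_int)
qed

lemma tau_apply: "q \<in> Q \<Longrightarrow> \<tau> v h q = exp (pairing (cvec q) v) * h q"
  by (simp add: torus_translate_def)

lemma tau_torus: "h \<in> H \<Longrightarrow> \<tau> v h \<in> H"
  unfolding adjoint_torus_def
  by (auto simp: tau_apply Q_add cvec_add pairing_add_left exp_add) (simp add: torus_translate_def)

lemma tau_zero: "h \<in> H \<Longrightarrow> \<tau> 0 h = h"
  by (rule torus_eqI) (simp_all add: tau_torus tau_apply R_Q)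

lemma tau_add: "\<tau> (u + v) h = \<tau> u (\<tau> v h)"
  by (auto simp: torus_translate_def fun_eq_iff pairing_add_right exp_add)

lemma continuous_tau: "continuous_on S (\<lambda>v. \<tau> v h)"
proof (rule continuous_on_coordinatewise_then_product)
  fix q
  show "continuous_on S (\<lambda>v. \<tau> v h q)"
    by (cases "q \<in> Q") (auto simp: torus_translate_def intro!: continuous_intros bounded_linear.continuous_on[OF bounded_linear_pairing])
qed

lemma tau_mirror_complement:
  assumes h: "h \<in> Ho"
  shows "open {v. \<tau> v h \<in> Ho}"
proof -
  have H: "h \<in> H" using h by (simp add: mirror_complement_def)
  have "{v. \<tau> v h \<in> Ho} = (\<Inter>\<alpha>\<in>R. (\<lambda>v. exp (pairing (cvec \<alpha>) v) * h \<alpha>) -` (- {1}))"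
    using tau_torus[OF H] by (auto simp: mirror_complement_def tau_apply R_Q)
  moreover have "open ((\<lambda>v. exp (pairing (cvec \<alpha>) v) * h \<alpha>) -` (- {1}))" for \<alpha>
    by (intro open_vimage open_Compl closed_singleton continuous_intros bounded_linear.continuous_on[OF bounded_linear_pairing])
  ultimately show ?thesis using finite_R by (simp add: open_INT)
qed

lemma pairing_zero_on_roots:
  assumes "\<And>\<alpha>. \<alpha> \<in> R \<Longrightarrow> pairing (cvec \<alpha>) w = 0"
  shows "w = 0"
proof -
  have z: "pairing (cvec x) w = 0" for x by (rule linear_zero_on_roots[OF linear_pairing_cvec assms])
  have "cvec (axis i 1) = axis i 1" for i :: 'n by (simp add: cvec_def vec_eq_iff axis_def)
  then have "w $ i = 0" for i using z[of "axis i 1"] by simp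
  then show ?thesis by (simp add: vec_eq_iff)
qed

text \<open>If two small vectors give the same translate, every root takes on their difference a
  value of norm below 1 whose exponential is 1. This value is 0, and the roots span.\<close>

lemma tau_injective:
  assumes h: "h \<in> Ho"
  shows "\<exists>r>0. inj_on (\<lambda>v. \<tau> v h) (ball 0 r)"
proof -
  have H: "h \<in> H" using h by (simp add: mirror_complement_def)
  \<comment> \<open>Bounds the norm of every root as a linear form, with 1 added for positivity. Two
    vectors of norm below 1/(2 K) differ by less than 1/K.\<close>
  define K where "K = 1 + (\<Sum>\<alpha>\<in>R. \<Sum>i\<in>UNIV. norm (cvec \<alpha> $ i))"
  have K: "(\<Sum>i\<in>UNIV. norm (cvec \<alpha> $ i)) \<le> K" if "\<alpha> \<in> R" for \<alpha>
  proof -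
    have "(\<Sum>i\<in>UNIV. norm (cvec \<alpha> $ i)) \<le> (\<Sum>\<alpha>\<in>R. \<Sum>i\<in>UNIV. norm (cvec \<alpha> $ i))"
      by (rule member_le_sum[OF that]) (auto simp: finite_R sum_nonneg)
    then show ?thesis by (simp add: K_def)
  qed
  have "K > 0" unfolding K_def by (intro add_pos_nonneg sum_nonneg) auto
  define r where "r = 1 / (2 * K)"
  have "inj_on (\<lambda>v. \<tau> v h) (ball 0 r)"
  proof (rule inj_onI)
    fix u v assume uv: "u \<in> ball 0 r" "v \<in> ball 0 r" "\<tau> u h = \<tau> v h"
    have "pairing (cvec \<alpha>) (u - v) = 0" if a: "\<alpha> \<in> R" for \<alpha>
    proof (rule exp_eq_1_small)
      have "exp (pairing (cvec \<alpha>) u) * h \<alpha> = exp (pairing (cvec \<alpha>) v) * h \<alpha>"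
        using uv(3) tau_apply[OF R_Q[OF a]] by metis
      then have "exp (pairing (cvec \<alpha>) u) = exp (pairing (cvec \<alpha>) v)" using torusD(1)[OF H R_Q[OF a]] by simp
      then show "exp (pairing (cvec \<alpha>) (u - v)) = 1"
        using pairing_add_right[of "cvec \<alpha>" "u - v" v] by (simp add: exp_add)
      have "norm (u - v) < 2 * r" using norm_triangle_ineq4[of u v] uv by simp
      then have "K * norm (u - v) < K * (2 * r)" using \<open>K > 0\<close> by simp
      moreover have "norm (pairing (cvec \<alpha>) (u - v)) \<le> K * norm (u - v)"
        by (rule order_trans[OF norm_pairing_le mult_right_mono[OF K[OF a]]]) simp
      ultimately show "norm (pairing (cvec \<alpha>) (u - v)) < 1" using \<open>K > 0\<close> by (simp add: r_def)
    qed
    then have "u - v = 0" by (rule pairing_zero_on_roots)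
    then show "u = v" by simp
  qed
  moreover have "r > 0" using \<open>K > 0\<close> by (simp add: r_def)
  ultimately show ?thesis by blast
qed

text \<open>An operator commuting with the reflections, acting on all roots by one scalar when R is
  irreducible. Dividing by this scalar recovers a vector from its values on the roots.\<close>

definition gram :: "real^'n \<Rightarrow> real^'n" where
  "gram x = (\<Sum>\<beta>\<in>R. (\<beta> \<bullet> x) *\<^sub>R \<beta>)"

lemma gram_symmetric: "gram x \<bullet> y = x \<bullet> gram y"
  by (simp add: gram_def inner_sum_left inner_sum_right inner_commute mult.commute)

text \<open>The reflection in \<alpha> commutes with the operator and negates \<alpha>, so it
  negates the image of \<alpha>, which therefore lies on the line of \<alpha>.\<close>

lemma gram_root:
  assumes a: "\<alpha> \<in> R"
  shows "gram \<alpha> = ((\<alpha> \<bullet> gram \<alpha>) / (\<alpha> \<bullet> \<alpha>)) *\<^sub>R \<alpha>"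
proof -
  have lin: "linear (\<lambda>x. reflection \<alpha> *v x)" by (rule matrix_vector_mul_linear)
  have "reflection \<alpha> *v gram \<alpha> = (\<Sum>\<beta>\<in>R. (\<beta> \<bullet> \<alpha>) *\<^sub>R (reflection \<alpha> *v \<beta>))"
    by (simp add: gram_def linear_sum[OF lin] reflection_scale)
  also have "\<dots> = (\<Sum>\<beta>\<in>R. ((reflection \<alpha> *v \<beta>) \<bullet> \<alpha>) *\<^sub>R (reflection \<alpha> *v (reflection \<alpha> *v \<beta>)))"
    using sum.reindex_bij_betw[OF bij_reflection[OF a], of "\<lambda>\<beta>. (\<beta> \<bullet> \<alpha>) *\<^sub>R (reflection \<alpha> *v \<beta>)"] by simp
  also have "\<dots> = (\<Sum>\<beta>\<in>R. - ((\<beta> \<bullet> \<alpha>) *\<^sub>R \<beta>))"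
    by (intro sum.cong refl) (simp add: reflection_involution reflection_symmetric reflection_self[OF nonzero[OF a]])
  finally have "gram \<alpha> - (\<alpha> \<bullet> gram \<alpha>) *\<^sub>R coroot \<alpha> = - gram \<alpha>"
    unfolding reflection_apply by (simp add: gram_def sum_negf)
  then have "2 *\<^sub>R gram \<alpha> = (\<alpha> \<bullet> gram \<alpha>) *\<^sub>R coroot \<alpha>" by (simp add: scaleR_2 algebra_simps)
  then have "(1/2) *\<^sub>R (2 *\<^sub>R gram \<alpha>) = (1/2) *\<^sub>R ((\<alpha> \<bullet> gram \<alpha>) *\<^sub>R coroot \<alpha>)" by (rule arg_cong)
  then show ?thesis by (simp add: coroot_def)
qed

text \<open>A function l with the reflection behaviour of a linear form comes from the vector that
  sums l(\<beta>) \<beta>, up to the eigenvalue of \<open>gram\<close>. The eigenvalue is common to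
  all roots, as roots with distinct eigenvalues of this symmetric operator are orthogonal.
  Re-indexing the sum by the reflection in \<alpha> evaluates it.\<close>

lemma root_logarithm:
  fixes l :: "real^'n \<Rightarrow> complex"
  assumes irred: "irreducible_roots R"
    and l: "\<And>\<alpha> \<beta>. \<alpha> \<in> R \<Longrightarrow> \<beta> \<in> R \<Longrightarrow> l (reflection \<alpha> *v \<beta>) = l \<beta> - of_real (\<beta> \<bullet> coroot \<alpha>) * l \<alpha>"
    and "\<alpha>0 \<in> R" "\<alpha> \<in> R"
  shows "(\<Sum>\<beta>\<in>R. l \<beta> * of_real (\<alpha> \<bullet> \<beta>)) = of_real ((\<alpha>0 \<bullet> gram \<alpha>0) / (\<alpha>0 \<bullet> \<alpha>0)) * l \<alpha>"
proof -
  define c where "c \<alpha> = (\<alpha> \<bullet> gram \<alpha>) / (\<alpha> \<bullet> \<alpha>)" for \<alpha>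
  have "c \<alpha> = c \<alpha>0"
  proof (rule ccontr)
    assume ne: "c \<alpha> \<noteq> c \<alpha>0"
    have "x \<bullet> y = 0" if "x \<in> R" "y \<in> R" "c x \<noteq> c y" for x y
    proof -
      have "c x * (x \<bullet> y) = gram x \<bullet> y" by (subst gram_root[OF that(1)]) (simp add: c_def)
      also have "\<dots> = x \<bullet> gram y" by (rule gram_symmetric)
      also have "\<dots> = c y * (x \<bullet> y)" by (subst gram_root[OF that(2)]) (simp add: c_def)
      finally show ?thesis using that(3) by simp
    qed
    then have "\<forall>x\<in>{x \<in> R. c x = c \<alpha>}. \<forall>y\<in>{x \<in> R. c x \<noteq> c \<alpha>}. x \<bullet> y = 0" by auto
    moreover have "{x \<in> R. c x = c \<alpha>} \<union> {x \<in> R. c x \<noteq> c \<alpha>} = R" "{x \<in> R. c x = c \<alpha>} \<inter> {x \<in> R. c x \<noteq> c \<alpha>} = {}" by auto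
    ultimately have "{x \<in> R. c x = c \<alpha>} = {} \<or> {x \<in> R. c x \<noteq> c \<alpha>} = {}"
      using irred unfolding irreducible_roots_def by blast
    moreover have "\<alpha> \<in> {x \<in> R. c x = c \<alpha>}" "\<alpha>0 \<in> {x \<in> R. c x \<noteq> c \<alpha>}" using assms(3,4) ne by auto
    ultimately show False by blast
  qed
  define m where "m = (\<Sum>\<beta>\<in>R. l \<beta> * of_real (\<alpha> \<bullet> \<beta>))"
  have "m = (\<Sum>\<beta>\<in>R. l (reflection \<alpha> *v \<beta>) * of_real (\<alpha> \<bullet> (reflection \<alpha> *v \<beta>)))"
    unfolding m_def using sum.reindex_bij_betw[OF bij_reflection[OF assms(4)], of "\<lambda>\<beta>. l \<beta> * of_real (\<alpha> \<bullet> \<beta>)"] by simp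
  also have "\<dots> = (\<Sum>\<beta>\<in>R. of_real ((\<beta> \<bullet> coroot \<alpha>) * (\<alpha> \<bullet> \<beta>)) * l \<alpha> - l \<beta> * of_real (\<alpha> \<bullet> \<beta>))"
  proof (intro sum.cong refl)
    fix \<beta> assume b: "\<beta> \<in> R"
    have "\<alpha> \<bullet> (reflection \<alpha> *v \<beta>) = - (\<alpha> \<bullet> \<beta>)"
      using reflection_symmetric[of \<alpha> \<alpha> \<beta>] by (simp add: reflection_self[OF nonzero[OF assms(4)]])
    then show "l (reflection \<alpha> *v \<beta>) * of_real (\<alpha> \<bullet> (reflection \<alpha> *v \<beta>))
       = of_real ((\<beta> \<bullet> coroot \<alpha>) * (\<alpha> \<bullet> \<beta>)) * l \<alpha> - l \<beta> * of_real (\<alpha> \<bullet> \<beta>)"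
      by (simp add: l[OF assms(4) b] algebra_simps)
  qed
  also have "\<dots> = of_real (\<Sum>\<beta>\<in>R. (\<beta> \<bullet> coroot \<alpha>) * (\<alpha> \<bullet> \<beta>)) * l \<alpha> - m"
    by (simp add: m_def sum_subtractf sum_distrib_right)
  also have "(\<Sum>\<beta>\<in>R. (\<beta> \<bullet> coroot \<alpha>) * (\<alpha> \<bullet> \<beta>)) = 2 * c \<alpha>"
    by (simp add: c_def gram_def coroot_def inner_sum_right sum_distrib_left sum_divide_distrib inner_commute mult.commute mult.left_commute)
  finally have "2 * m = 2 * (of_real (c \<alpha>) * l \<alpha>)" by simp
  then have "m = of_real (c \<alpha>0) * l \<alpha>" using \<open>c \<alpha> = c \<alpha>0\<close> by simp
  then show ?thesis by (simp only: m_def c_def)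
qed

lemma gram_pos_root: "\<alpha> \<in> R \<Longrightarrow> (\<alpha> \<bullet> gram \<alpha>) / (\<alpha> \<bullet> \<alpha>) > 0"
proof -
  assume a: "\<alpha> \<in> R"
  have "(\<alpha> \<bullet> \<alpha>) * (\<alpha> \<bullet> \<alpha>) \<le> (\<Sum>\<beta>\<in>R. (\<beta> \<bullet> \<alpha>) * (\<beta> \<bullet> \<alpha>))"
    by (rule member_le_sum[OF a]) (auto simp: finite_R)
  also have "\<dots> = \<alpha> \<bullet> gram \<alpha>" by (simp add: gram_def inner_sum_right inner_commute)
  finally show ?thesis using nonzero[OF a] by (simp add: less_le_trans[rotated])
qed

text \<open>In the topology of pointwise convergence a neighbourhood of p may be cut out by
  requiring the ratios h \<alpha> / p \<alpha> to be near 1. Their logarithms are so small that they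
  satisfy the reflection relations exactly, not merely modulo 2 pi i. \<open>root_logarithm\<close>
  then assembles them into a small vector that translates p to h.\<close>

lemma tau_neighbourhood:
  assumes irred: "irreducible_roots R" and p: "p \<in> Ho" and "r > 0"
  shows "\<exists>T. open T \<and> p \<in> T \<and> (\<forall>h\<in>Ho \<inter> T. \<exists>v\<in>ball 0 r. h = \<tau> v p)"
proof -
  have H: "p \<in> H" using p by (simp add: mirror_complement_def)
  obtain \<alpha>0 where \<alpha>0: "\<alpha>0 \<in> R" using irred by (auto simp: irreducible_roots_def)
  define c where "c = complex_of_real ((\<alpha>0 \<bullet> gram \<alpha>0) / (\<alpha>0 \<bullet> \<alpha>0))"
  have "c \<noteq> 0" using gram_pos_root[OF \<alpha>0] unfolding c_def by (metis less_irrefl of_real_eq_0_iff)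
  define l where "l h \<alpha> = Ln (h \<alpha> / p \<alpha>)" for h :: "real^'n \<Rightarrow> complex" and \<alpha>
  define v where "v h = (\<Sum>\<beta>\<in>R. (l h \<beta> / c) *s cvec \<beta>)" for h
  \<comment> \<open>If all logarithms have norm below 1/K, the error in a reflection relation has
    norm below 1, and \<open>exp_eq_1_small\<close> makes it 0.\<close>
  define K where "K = 2 + (\<Sum>\<alpha>\<in>R. \<Sum>\<beta>\<in>R. \<bar>\<beta> \<bullet> coroot \<alpha>\<bar>)"
  have K: "2 + \<bar>\<beta> \<bullet> coroot \<alpha>\<bar> \<le> K" if "\<alpha> \<in> R" "\<beta> \<in> R" for \<alpha> \<beta>
  proof -
    have "\<bar>\<beta> \<bullet> coroot \<alpha>\<bar> \<le> (\<Sum>\<beta>\<in>R. \<bar>\<beta> \<bullet> coroot \<alpha>\<bar>)" by (rule member_le_sum[OF that(2)]) (auto simp: finite_R)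
    also have "\<dots> \<le> (\<Sum>\<alpha>\<in>R. \<Sum>\<beta>\<in>R. \<bar>\<beta> \<bullet> coroot \<alpha>\<bar>)"
      by (rule member_le_sum[OF that(1)]) (auto simp: finite_R sum_nonneg)
    finally show ?thesis by (simp add: K_def)
  qed
  have "K > 0" using K[OF \<alpha>0 \<alpha>0] by linarith
  \<comment> \<open>Ratios in the right half-plane, where the principal logarithm is
    continuous.\<close>
  define S where "S = (\<Inter>\<alpha>\<in>R. (\<lambda>h :: real^'n \<Rightarrow> complex. h \<alpha> / p \<alpha>) -` {z. Re z > 0})"
  have cp: "continuous_on UNIV (\<lambda>h :: real^'n \<Rightarrow> complex. h \<alpha> / p \<alpha>)" if "\<alpha> \<in> R" for \<alpha>
    by (intro continuous_intros continuous_on_product_coordinates) (use torusD(1)[OF H R_Q[OF that]] in auto)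
  have "open S"
    unfolding S_def by (intro open_INT finite_R ballI open_vimage cp open_halfspace_Re_gt)
  have cl: "continuous_on S (\<lambda>h. l h \<alpha>)" if "\<alpha> \<in> R" for \<alpha>
    unfolding l_def
    by (intro continuous_on_Ln' continuous_on_subset[OF cp[OF that]])
      (use that in \<open>auto simp: S_def complex_nonpos_Reals_iff\<close>)
  have cv: "continuous_on S v"
    unfolding v_def using \<open>c \<noteq> 0\<close>
    by (intro continuous_on_sum bounded_linear.continuous_on[OF bounded_linear_scale_left] continuous_on_divide continuous_on_const cl) auto
  define T where "T = (S \<inter> v -` ball 0 r) \<inter> (\<Inter>\<alpha>\<in>R. S \<inter> (\<lambda>h. l h \<alpha>) -` ball 0 (1 / K))"
  have "open T"
    unfolding T_def
    by (intro open_Int open_INT finite_R ballI continuous_open_preimage[OF cv \<open>open S\<close>] continuous_open_preimage[OF cl \<open>open S\<close>] open_ball)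
  moreover have "p \<in> T"
  proof -
    have "p \<alpha> / p \<alpha> = 1" if "\<alpha> \<in> R" for \<alpha> using torusD(1)[OF H R_Q[OF that]] by simp
    then have "p \<in> S" "\<And>\<alpha>. \<alpha> \<in> R \<Longrightarrow> l p \<alpha> = 0" by (auto simp: S_def l_def)
    then show ?thesis using \<open>r > 0\<close> \<open>K > 0\<close> by (simp add: T_def v_def)
  qed
  moreover have "\<exists>v\<in>ball 0 r. h = \<tau> v p" if h: "h \<in> Ho \<inter> T" for h
  proof -
    have hH: "h \<in> H" using h by (simp add: mirror_complement_def)
    have small: "norm (l h \<alpha>) < 1 / K" if "\<alpha> \<in> R" for \<alpha>
    proof -
      have "h \<in> (\<lambda>h. l h \<alpha>) -` ball 0 (1 / K)" using h that unfolding T_def by blast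
      then show ?thesis by simp
    qed
    have el: "exp (l h \<alpha>) = h \<alpha> / p \<alpha>" if "\<alpha> \<in> R" for \<alpha>
      unfolding l_def using torusD(1)[OF H R_Q[OF that]] torusD(1)[OF hH R_Q[OF that]] by simp
    have lrefl: "l h (reflection \<alpha> *v \<beta>) = l h \<beta> - of_real (\<beta> \<bullet> coroot \<alpha>) * l h \<alpha>" if ab: "\<alpha> \<in> R" "\<beta> \<in> R" for \<alpha> \<beta>
    proof -
      obtain m where m: "\<beta> \<bullet> coroot \<alpha> = of_int m" using integral[OF ab] by (meson Ints_cases)
      define x where "x = l h (reflection \<alpha> *v \<beta>) - (l h \<beta> - of_real (\<beta> \<bullet> coroot \<alpha>) * l h \<alpha>)"
      have "exp (of_real (\<beta> \<bullet> coroot \<alpha>) * l h \<alpha>) = (h \<alpha> / p \<alpha>) powi m"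
        unfolding el[OF ab(1), symmetric] exp_power_int by (simp add: m)
      moreover have "h (reflection \<alpha> *v \<beta>) / p (reflection \<alpha> *v \<beta>) = (h \<beta> / p \<beta>) / (h \<alpha> / p \<alpha>) powi m"
        using torus_character[OF hH] torus_character[OF H] ab
        by (simp add: character_def m power_int_divide_distrib power_int_minus field_simps)
      ultimately have "exp (l h (reflection \<alpha> *v \<beta>)) = exp (l h \<beta> - of_real (\<beta> \<bullet> coroot \<alpha>) * l h \<alpha>)"
        using el[OF reflection_closed[OF ab]] el[OF ab(2)] by (simp add: exp_diff)
      then have "exp x = 1" by (simp add: x_def exp_diff)
      moreover have "norm x < 1"
      proof -
        have "norm x \<le> norm (l h (reflection \<alpha> *v \<beta>)) + (norm (l h \<beta>) + \<bar>\<beta> \<bullet> coroot \<alpha>\<bar> * norm (l h \<alpha>))"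
          unfolding x_def by (intro order_trans[OF norm_triangle_ineq4] add_left_mono order_trans[OF norm_triangle_ineq4]) (simp add: norm_mult)
        also have "\<dots> < 1 / K + (1 / K + \<bar>\<beta> \<bullet> coroot \<alpha>\<bar> * (1 / K))"
          by (intro add_strict_mono add_less_le_mono mult_left_mono less_imp_le[OF small] small reflection_closed ab) auto
        also have "\<dots> = (2 + \<bar>\<beta> \<bullet> coroot \<alpha>\<bar>) / K" by (simp add: add_divide_distrib)
        also have "\<dots> \<le> 1" using K[OF ab] \<open>K > 0\<close> by simp
        finally show ?thesis .
      qed
      ultimately have "x = 0" by (rule exp_eq_1_small)
      then show ?thesis by (simp add: x_def)
    qed
    have log: "(\<Sum>\<beta>\<in>R. l h \<beta> * of_real (\<alpha> \<bullet> \<beta>)) = of_real ((\<alpha>0 \<bullet> gram \<alpha>0) / (\<alpha>0 \<bullet> \<alpha>0)) * l h \<alpha>"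
      if "\<alpha> \<in> R" for \<alpha>
      by (rule root_logarithm[OF irred _ \<alpha>0 that]) (rule lrefl)
    have "pairing (cvec \<alpha>) (v h) = l h \<alpha>" if a: "\<alpha> \<in> R" for \<alpha>
    proof -
      have "pairing (cvec \<alpha>) (v h) = (\<Sum>\<beta>\<in>R. pairing (cvec \<alpha>) ((l h \<beta> / c) *s cvec \<beta>))"
        unfolding v_def using linear_sum[OF bounded_linear.linear[OF bounded_linear_pairing[of "cvec \<alpha>"]]] by blast
      also have "\<dots> = (\<Sum>\<beta>\<in>R. l h \<beta> * of_real (\<alpha> \<bullet> \<beta>)) / c"
        by (simp add: pairing_scale_right sum_divide_distrib) (simp add: pairing_def cvec_def inner_vec_def)
      also have "\<dots> = l h \<alpha>" using log[OF a] \<open>c \<noteq> 0\<close> by (simp add: c_def)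
      finally show ?thesis .
    qed
    then have "h = \<tau> (v h) p"
      using torusD(1)[OF H R_Q] by (intro torus_eqI[OF hH tau_torus[OF H]]) (simp add: tau_apply R_Q el)
    moreover have "v h \<in> ball 0 r" using h by (simp add: T_def)
    ultimately show ?thesis by blast
  qed
  ultimately show ?thesis by blast
qed

lemma translation_manifold_torus:
  assumes irred: "irreducible_roots R"
  shows "translation_manifold \<tau> Ho"
proof
  show "\<tau> 0 p = p" if "p \<in> Ho" for p using that tau_zero by (simp add: mirror_complement_def)
  show "\<tau> (u + v) p = \<tau> u (\<tau> v p)" for u v p by (rule tau_add)
  show "\<exists>r>0. inj_on (\<lambda>v. \<tau> v p) (ball 0 r)" if "p \<in> Ho" for p by (rule tau_injective[OF that])
  show "\<exists>r>0. \<forall>v\<in>ball 0 r. \<tau> v p \<in> U" if U: "openin (top_of_set Ho) U" and p: "p \<in> U" for U p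
  proof -
    obtain T where T: "open T" "U = Ho \<inter> T" using U by (auto simp: openin_open)
    have pH: "p \<in> Ho" "p \<in> H" using p T by (auto simp: mirror_complement_def)
    have "open ({v. \<tau> v p \<in> Ho} \<inter> (\<lambda>v. \<tau> v p) -` T)"
      by (intro open_Int tau_mirror_complement[OF pH(1)] open_vimage[OF T(1) continuous_tau])
    moreover have "0 \<in> {v. \<tau> v p \<in> Ho} \<inter> (\<lambda>v. \<tau> v p) -` T" using p T tau_zero[OF pH(2)] by auto
    ultimately obtain r where "r > 0" "ball 0 r \<subseteq> {v. \<tau> v p \<in> Ho} \<inter> (\<lambda>v. \<tau> v p) -` T"
      using open_contains_ball by blast
    then show ?thesis using T(2) by blast
  qed
  show "openin (top_of_set Ho) U" if "U \<subseteq> Ho" and loc: "\<And>p. p \<in> U \<Longrightarrow> \<exists>r>0. \<forall>v\<in>ball 0 r. \<tau> v p \<in> U" for U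
  proof (subst openin_subopen, intro ballI)
    fix p assume p: "p \<in> U"
    obtain r where r: "r > 0" "\<forall>v\<in>ball 0 r. \<tau> v p \<in> U" using loc[OF p] by blast
    obtain T where T: "open T" "p \<in> T" "\<forall>h\<in>Ho \<inter> T. \<exists>v\<in>ball 0 r. h = \<tau> v p"
      using tau_neighbourhood[OF irred _ r(1), of p] p \<open>U \<subseteq> Ho\<close> by blast
    have "openin (top_of_set Ho) (Ho \<inter> T)" using T(1) by (rule openin_open_Int)
    moreover have "Ho \<inter> T \<subseteq> U"
    proof
      fix h assume "h \<in> Ho \<inter> T"
      then obtain v where "v \<in> ball 0 r" "h = \<tau> v p" using T(3) by blast
      then show "h \<in> U" using r(2) by simp
    qed
    ultimately show "\<exists>T. openin (top_of_set Ho) T \<and> p \<in> T \<and> T \<subseteq> U" using T(2) p \<open>U \<subseteq> Ho\<close> by blast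
  qed
qed

section \<open>The product of the torus with the punctured line\<close>

lemma hpart_add: "hpart (u + v) = hpart u + hpart v"
  by (simp add: hpart_def vec_eq_iff)

lemma translation_action_ext: "translation_action (ext_torus_translate R) (Ho \<times> (- {0}))"
proof
  show "ext_torus_translate R 0 p = p" if "p \<in> Ho \<times> (- {0})" for p
    using that tau_zero by (auto simp: ext_torus_translate_def mirror_complement_def hpart_def zero_vec_def[symmetric])
  show "ext_torus_translate R (u + v) p = ext_torus_translate R u (ext_torus_translate R v p)" for u v p
    by (auto simp: ext_torus_translate_def split_beta hpart_add tau_add exp_add)
  show "\<exists>r>0. \<forall>v\<in>ball 0 r. ext_torus_translate R v p \<in> U"
    if U: "openin (top_of_set (Ho \<times> (- {0}))) U" and p: "p \<in> U" for U p
  proof -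
    obtain T where T: "open T" "U = (Ho \<times> (- {0})) \<inter> T" using U by (auto simp: openin_open)
    obtain h t where ht: "p = (h, t)" "h \<in> Ho" "h \<in> H" "t \<noteq> 0" using p T by (cases p) (auto simp: mirror_complement_def)
    have "continuous_on UNIV (\<lambda>v. ext_torus_translate R v p)"
      unfolding ext_torus_translate_def ht(1) prod.case
      by (intro continuous_on_Pair continuous_on_compose2[OF continuous_tau continuous_hpart] continuous_intros) auto
    then have "open (hpart -` {v. \<tau> v h \<in> Ho} \<inter> (\<lambda>v. ext_torus_translate R v p) -` T)"
      by (intro open_Int open_vimage[OF tau_mirror_complement[OF ht(2)] continuous_hpart] open_vimage[OF T(1)])
    moreover have "hpart (0 :: complex^'n option) = 0" by (simp add: hpart_def vec_eq_iff)
    then have "0 \<in> hpart -` {v. \<tau> v h \<in> Ho} \<inter> (\<lambda>v. ext_torus_translate R v p) -` T"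
      using p T ht tau_zero[OF ht(3)] by (simp add: ext_torus_translate_def)
    ultimately obtain r where r: "r > 0" "ball 0 r \<subseteq> hpart -` {v. \<tau> v h \<in> Ho} \<inter> (\<lambda>v. ext_torus_translate R v p) -` T"
      using open_contains_ball by blast
    have "ext_torus_translate R v p \<in> U" if "v \<in> ball 0 r" for v
    proof -
      have "\<tau> (hpart v) h \<in> Ho" "ext_torus_translate R v p \<in> T" using r(2) that by auto
      then show ?thesis using T(2) ht by (simp add: ext_torus_translate_def)
    qed
    then show ?thesis using r(1) by blast
  qed
qed

end

section \<open>The toric connection\<close>

lemma linear_form_expand:
  assumes "\<And>x y. D (x + y) = D x + D y" "\<And>c x. D (c *s x) = c * D x"
  shows "D (v :: complex^'m) = (\<Sum>i\<in>UNIV. v $ i * D (axis i 1))"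
proof -
  have "Vector_Spaces.linear (*s) (*) D"
    unfolding Vector_Spaces.linear_iff
    by (intro conjI allI vec.vector_space_axioms vector_space_over_itself.vector_space_axioms assms)
  from linear_form_eq_pairing[OF this, of v] show ?thesis by (simp add: pairing_def mult.commute)
qed

lemma cvec_axis: "cvec (axis i 1) = axis i 1"
  by (simp add: cvec_def vec_eq_iff axis_def)

lemma weyl_act_cvec: "weyl_act w (cvec x) = cvec (w *v x)"
  by (simp add: weyl_act_def map_matrix_def matrix_vector_mult_def cvec_def vec_eq_iff)

lemma reflection_matrix_symmetric: "reflection \<gamma> $ i $ j = reflection \<gamma> $ j $ i"
  using reflection_symmetric[of \<gamma> "axis j 1" "axis i 1"]
  by (simp add: inner_axis inner_axis' matrix_vector_mult_basis column_def)

lemma pairing_reflection: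
  "pairing (weyl_act (reflection \<gamma>) x) (cvec z) = pairing x (cvec (reflection \<gamma> *v z))"
proof -
  have "pairing (weyl_act (reflection \<gamma>) x) (cvec z)
      = (\<Sum>i\<in>UNIV. \<Sum>j\<in>UNIV. of_real (reflection \<gamma> $ i $ j) * x $ j * of_real (z $ i))"
    by (simp add: pairing_def weyl_act_def map_matrix_def matrix_vector_mult_def cvec_def sum_distrib_right)
  also have "\<dots> = (\<Sum>j\<in>UNIV. \<Sum>i\<in>UNIV. x $ j * (of_real (reflection \<gamma> $ j $ i) * of_real (z $ i)))"
    by (subst sum.swap, intro sum.cong refl, subst reflection_matrix_symmetric) simp
  also have "\<dots> = pairing x (cvec (reflection \<gamma> *v z))"
    by (simp add: pairing_def matrix_vector_mult_def cvec_def sum_distrib_left)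
  finally show ?thesis .
qed

lemma cgrad_hpart_chain:
  fixes F :: "complex^'n \<Rightarrow> complex"
  assumes "complex_differentiable_at F (hpart X)"
  shows "complex_differentiable_at (\<lambda>X. F (hpart X)) X"
    and "cgrad (\<lambda>X. F (hpart X)) X = cone_vec 0 (cgrad F (hpart X))"
proof -
  have h: "complex_differentiable_at (\<lambda>X. hpart X $ j) X" "cgrad (\<lambda>X. hpart X $ j) X = axis (Some j) 1" for j :: 'n
    unfolding hpart_def by simp_all
  show "complex_differentiable_at (\<lambda>X. F (hpart X)) X" by (rule cgrad_chain(1)[OF assms h(1)])
  have "cgrad (\<lambda>X. F (hpart X)) X = (\<Sum>j\<in>UNIV. cgrad F (hpart X) $ j *s axis (Some j) 1)"
    using cgrad_chain(2)[OF assms h(1)] by (simp add: h(2))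
  also have "\<dots> = cone_vec 0 (cgrad F (hpart X))"
  proof -
    have "(\<Sum>j\<in>UNIV. cgrad F (hpart X) $ j *s axis (Some j) 1) $ m = cone_vec 0 (cgrad F (hpart X)) $ m" for m
    proof (cases m)
      case (Some l)
      have "(\<Sum>j\<in>UNIV. cgrad F (hpart X) $ j * axis (Some j) 1 $ Some l) = (\<Sum>j\<in>UNIV. if j = l then cgrad F (hpart X) $ l else 0)"
        by (intro sum.cong) (auto simp: axis_def)
      then show ?thesis using Some by (simp add: cone_vec_def sum_component)
    qed (simp add: cone_vec_def axis_def sum_component)
    then show ?thesis by (simp add: vec_eq_iff)
  qed
  finally show "cgrad (\<lambda>X. F (hpart X)) X = cone_vec 0 (cgrad F (hpart X))" .
qed

locale toric_connection = root_sys R for R :: "(real^'n) set" +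
  fixes P :: "(real^'n) set" and k :: "real^'n \<Rightarrow> complex" and b :: "complex^'n \<Rightarrow> complex^'n \<Rightarrow> complex^'n"
  assumes reduced: "reduced R" and irreducible: "irreducible_roots R" and positive: "positive_roots R P"
    and k_weyl: "\<forall>w\<in>weyl_group R. \<forall>\<alpha>\<in>R. k (w *v \<alpha>) = k \<alpha>"
    and b_sym: "sym_bilinear_map b"
    and b_weyl: "\<forall>w\<in>weyl_group R. \<forall>u v. b (weyl_act w u) (weyl_act w v) = weyl_act w (b u v)"
begin

lemma reflection_weyl: "\<gamma> \<in> R \<Longrightarrow> reflection \<gamma> \<in> weyl_group R"
  using weyl_group.step[OF _ weyl_group.one] by fastforce

lemma b_simps: "b u v = b v u" "b (u + u') v = b u v + b u' v" "b (c *s u) v = c *s b u v"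
    "b u (v + v') = b u v + b u v'" "b u (c *s v) = c *s b u v" "b u 0 = 0"
proof -
  show comm: "b u v = b v u" for u v using b_sym by (simp add: sym_bilinear_map_def)
  have "Vector_Spaces.linear (*s) (*s) (b u)" for u using b_sym by (simp add: sym_bilinear_map_def)
  then show r: "b u (v + v') = b u v + b u v'" "b u (c *s v) = c *s b u v" for u v v' c
    by (auto simp: Vector_Spaces.linear_iff)
  show "b (u + u') v = b u v + b u' v" "b (c *s u) v = c *s b u v"
    using comm r by metis+
  show "b u 0 = 0" using r(2)[of u 0 0] by simp
qed

text \<open>The tensor of b on real vectors, with its last index lowered. It determines b, as the
  standard basis is real.\<close>

definition "T u v w = pairing (b (cvec u) (cvec v)) (cvec w)"

lemma T_linear: "linear (\<lambda>u. T u v w)" "linear (\<lambda>v. T u v w)" "linear (\<lambda>w. T u v w)"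
  unfolding T_def
  by (rule linearI; simp add: cvec_add cvec_scale b_simps(2-5) pairing_add_left pairing_add_right pairing_scale_left pairing_scale_right scaleR_complex)+

lemma T_commute: "T u v w = T v u w"
  by (simp add: T_def b_simps(1)[of "cvec u"])

lemma T_reflection:
  assumes "\<gamma> \<in> R"
  shows "T (reflection \<gamma> *v u) (reflection \<gamma> *v v) (reflection \<gamma> *v w) = T u v w"
  using b_weyl reflection_weyl[OF assms]
  by (simp add: T_def weyl_act_cvec[symmetric, of _ u] weyl_act_cvec[symmetric, of _ v] pairing_reflection reflection_involution)

lemma k_reflection: "\<alpha> \<in> R \<Longrightarrow> \<beta> \<in> R \<Longrightarrow> k (reflection \<alpha> *v \<beta>) = k \<beta>"
  using k_weyl reflection_weyl by blast

sublocale root_connection R T k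
  by (intro root_connection.intro inv_trilinear.intro inv_trilinear_axioms.intro root_connection_axioms.intro
      root_sys_axioms T_linear T_commute T_reflection k_reflection reduced irreducible)

sublocale torus: translation_manifold \<tau> Ho
  by (rule translation_manifold_torus[OF irreducible])

sublocale ext: translation_action "ext_torus_translate R" "Ho \<times> (- {0})"
  by (rule translation_action_ext)

lemma P_R: "\<alpha> \<in> P \<Longrightarrow> \<alpha> \<in> R"
  using positive by (auto simp: positive_roots_def)

text \<open>Christoffel coefficients: direction j, component i of the result, coefficient of the
  l-th coordinate form.\<close>

definition Gamma :: "'n \<Rightarrow> 'n \<Rightarrow> 'n \<Rightarrow> (real^'n \<Rightarrow> complex) \<Rightarrow> complex" where
  "Gamma j i l h = Omega P k b h (axis l 1) (axis j 1) (axis i 1)"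

lemma Omega_expand: "Omega P k b h \<phi> u v = (\<Sum>j\<in>UNIV. u $ j * (\<Sum>l\<in>UNIV. \<phi> $ l * Omega P k b h (axis l 1) (axis j 1) v))"
proof -
  have 1: "Omega P k b h \<phi> (x + y) v = Omega P k b h \<phi> x v + Omega P k b h \<phi> y v"
    "Omega P k b h \<phi> (c *s x) v = c * Omega P k b h \<phi> x v" for \<phi> x y c
    by (simp_all add: Omega_def pairing_add_right pairing_scale_right b_simps(2,3) sum.distrib distrib_left distrib_right
        sum_distrib_left mult.assoc mult.left_commute[of c])
  have 2: "Omega P k b h (x + y) u v = Omega P k b h x u v + Omega P k b h y u v"
    "Omega P k b h (c *s x) u v = c * Omega P k b h x u v" for u x y c
    by (simp_all add: Omega_def pairing_add_left pairing_scale_left sum.distrib distrib_left distrib_right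
        sum_distrib_left mult.assoc mult.left_commute[of c])
  have "Omega P k b h \<phi> u v = (\<Sum>j\<in>UNIV. u $ j * Omega P k b h \<phi> (axis j 1) v)"
    by (rule linear_form_expand[of "\<lambda>u. Omega P k b h \<phi> u v", OF 1])
  moreover have "Omega P k b h \<phi> (axis j 1) v = (\<Sum>l\<in>UNIV. \<phi> $ l * Omega P k b h (axis l 1) (axis j 1) v)" for j
    by (rule linear_form_expand[of "\<lambda>\<phi>. Omega P k b h \<phi> (axis j 1) v", OF 2])
  ultimately show ?thesis by simp
qed

text \<open>Replacing \<alpha> by its negative changes four signs, those of
  \<open>coth_half\<close>, of the coroot and of two factors \<alpha>. The sum over positive roots
  is therefore half of the sum over all roots.\<close>

lemma Gamma_conn_tensor:
  assumes h: "h \<in> Ho"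
  shows "Gamma j i l h = conn_tensor h (axis j 1) (axis i 1) (axis l 1)"
proof -
  obtain \<xi> where \<xi>: "\<forall>\<alpha>\<in>R. \<alpha> \<bullet> \<xi> \<noteq> 0" "P = {\<alpha> \<in> R. \<alpha> \<bullet> \<xi> > 0}" using positive by (auto simp: positive_roots_def)
  have ch: "character h" using h torus_character by (simp add: mirror_complement_def)
  define f where "f \<alpha> = 1/4 * k \<alpha> * coth_half (h \<alpha>) * of_real ((\<alpha> \<bullet> axis j 1) * (\<alpha> \<bullet> axis i 1)) * of_real (coroot \<alpha> \<bullet> axis l 1)" for \<alpha>
  have "root_tensor h (axis j 1) (axis i 1) (axis l 1) = sum f R" by (simp add: root_tensor_def f_def)
  also have "\<dots> = 2 * sum f P"
    unfolding \<xi>(2)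
  proof (rule sum_even)
    fix \<alpha> assume a: "\<alpha> \<in> R"
    have "coroot (- \<alpha>) = - coroot \<alpha>" by (simp add: coroot_def)
    moreover have "coth_half (h (- \<alpha>)) = - coth_half (h \<alpha>)"
      using ch a by (simp add: character_uminus coth_half_inverse character_def)
    ultimately show "f (- \<alpha>) = f \<alpha>" by (simp add: f_def k_uminus[OF a])
  qed (use \<xi> in auto)
  also have "2 * sum f P = 1/2 * (\<Sum>\<alpha>\<in>P. k \<alpha> * ((h \<alpha> + 1) / (h \<alpha> - 1)) * pairing (axis l 1) (cvec (coroot \<alpha>))
              * pairing (cvec \<alpha>) (axis j 1) * pairing (cvec \<alpha>) (axis i 1))"
    unfolding sum_distrib_left by (intro sum.cong refl) (simp add: f_def coth_half_def[symmetric] inner_axis cvec_def mult_ac)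
  finally show ?thesis
    by (simp add: Gamma_def Omega_def conn_tensor_def T_def cvec_axis)
qed

text \<open>The function depends on v through the value of \<alpha> on v alone, so its gradient is a
  multiple of the root.\<close>

lemma coth_half_differential:
  assumes h: "h \<in> Ho" and \<alpha>: "\<alpha> \<in> R"
  obtains D where "complex_differentiable_at (\<lambda>v. coth_half (\<tau> v h \<alpha>)) 0" "cgrad (\<lambda>v. coth_half (\<tau> v h \<alpha>)) 0 = D *s cvec \<alpha>"
proof -
  have ne: "h \<alpha> \<noteq> 1" using h \<alpha> by (simp add: mirror_complement_def)
  have "(pairing (cvec \<alpha>) has_derivative pairing (cvec \<alpha>)) (at 0)"
    by (rule bounded_linear_imp_has_derivative[OF bounded_linear_pairing])
  then have p: "complex_differentiable_at (pairing (cvec \<alpha>)) 0" "cgrad (pairing (cvec \<alpha>)) 0 = cvec \<alpha>"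
    by (auto intro: complex_differentiableI cgrad_unique)
  have "(\<lambda>x. (exp x * h \<alpha> + 1) / (exp x * h \<alpha> - 1)) field_differentiable at 0"
    by (intro derivative_intros field_differentiable_within_exp) (use ne in auto)
  then obtain D where "((\<lambda>x. coth_half (exp x * h \<alpha>)) has_field_derivative D) (at 0)"
    unfolding field_differentiable_def coth_half_def by blast
  then have "((\<lambda>x. coth_half (exp x * h \<alpha>)) has_field_derivative D) (at (pairing (cvec \<alpha>) 0))" by simp
  from cgrad_chain_field[OF p(1) this] show ?thesis
    using that[of D] by (simp add: tau_apply R_Q[OF \<alpha>] p(2))
qed

text \<open>By \<open>coth_half_differential\<close> each root term of the derivative contains the
  components of \<alpha> in directions j and m as a symmetric product. This is why no derivatives
  survive in the curvature.\<close>

lemma Gamma_differential: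
  assumes h: "h \<in> Ho"
  shows "complex_differentiable_at (\<lambda>v. Gamma j i l (\<tau> v h)) 0"
    and "cgrad (\<lambda>v. Gamma j i l (\<tau> v h)) 0 $ m = cgrad (\<lambda>v. Gamma m i l (\<tau> v h)) 0 $ j"
proof -
  have "\<exists>D. \<forall>\<alpha>\<in>P. complex_differentiable_at (\<lambda>v. coth_half (\<tau> v h \<alpha>)) 0 \<and> cgrad (\<lambda>v. coth_half (\<tau> v h \<alpha>)) 0 = D \<alpha> *s cvec \<alpha>"
    by (rule bchoice) (metis coth_half_differential[OF h] P_R)
  then obtain D where D: "\<And>\<alpha>. \<alpha> \<in> P \<Longrightarrow> complex_differentiable_at (\<lambda>v. coth_half (\<tau> v h \<alpha>)) 0"
      "\<And>\<alpha>. \<alpha> \<in> P \<Longrightarrow> cgrad (\<lambda>v. coth_half (\<tau> v h \<alpha>)) 0 = D \<alpha> *s cvec \<alpha>" by blast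
  define e where "e \<alpha> = 1/2 * k \<alpha> * cvec (coroot \<alpha>) $ l * cvec \<alpha> $ i" for \<alpha>
  have eq: "(\<lambda>v. Gamma j i l (\<tau> v h)) = (\<lambda>v. (\<Sum>\<alpha>\<in>P. (e \<alpha> * cvec \<alpha> $ j) * coth_half (\<tau> v h \<alpha>)) + b (axis j 1) (axis i 1) $ l)" for j
    unfolding fun_eq_iff Gamma_def Omega_def coth_half_def[symmetric] e_def sum_distrib_left
    by (intro allI arg_cong2[of _ _ _ _ "(+)"] sum.cong refl) (simp_all add: pairing_commute[of "axis l 1"] mult_ac)
  have s: "complex_differentiable_at (\<lambda>v. \<Sum>\<alpha>\<in>P. (e \<alpha> * cvec \<alpha> $ j) * coth_half (\<tau> v h \<alpha>)) 0 \<and>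
      cgrad (\<lambda>v. \<Sum>\<alpha>\<in>P. (e \<alpha> * cvec \<alpha> $ j) * coth_half (\<tau> v h \<alpha>)) 0 = (\<Sum>\<alpha>\<in>P. cgrad (\<lambda>v. (e \<alpha> * cvec \<alpha> $ j) * coth_half (\<tau> v h \<alpha>)) 0)" for j
    by (rule cgrad_sum) (rule cgrad_cmult(1)[OF D(1)])
  show "complex_differentiable_at (\<lambda>v. Gamma j i l (\<tau> v h)) 0"
    unfolding eq by (intro cgrad_add(1) cgrad_const s[THEN conjunct1])
  have "cgrad (\<lambda>v. Gamma j i l (\<tau> v h)) 0 = (\<Sum>\<alpha>\<in>P. (e \<alpha> * cvec \<alpha> $ j) *s (D \<alpha> *s cvec \<alpha>))" for j
    unfolding eq cgrad_add(2)[OF s[THEN conjunct1] cgrad_const(1)] s[THEN conjunct2] cgrad_const(2) add_0_right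
    by (intro sum.cong refl) (simp only: cgrad_cmult(2)[OF D(1)] D(2))
  then show "cgrad (\<lambda>v. Gamma j i l (\<tau> v h)) 0 $ m = cgrad (\<lambda>v. Gamma m i l (\<tau> v h)) 0 $ j"
    by (simp add: sum_component algebra_simps)
qed

text \<open>The coroot is proportional to the root, which makes the root part totally symmetric; for
  b the symmetry is \<open>sym23\<close>.\<close>

lemma Gamma_sym:
  assumes "h \<in> Ho"
  shows "Gamma j i l h = Gamma i j l h" "Gamma j i l h = Gamma j l i h"
proof -
  have r: "root_tensor h u w z = root_tensor h w u z" "root_tensor h u w z = root_tensor h u z w" for u w z
    unfolding root_tensor_def by (intro sum.cong refl, simp add: coroot_def)+
  show "Gamma j i l h = Gamma i j l h" "Gamma j i l h = Gamma j l i h"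
    unfolding Gamma_conn_tensor[OF assms] conn_tensor_def using r sym12 sym23 by metis+
qed

text \<open>Coefficients of the extended connection for the form c times \<open>pairing\<close>: I
  is the direction, J the component of the result, L the component of the given form, and
  \<open>None\<close> belongs to dt/t. The direction \<open>None\<close> gives minus the identity
  matrix.\<close>

definition ext_coeff :: "complex \<Rightarrow> 'n option \<Rightarrow> 'n option \<Rightarrow> 'n option \<Rightarrow> (real^'n \<Rightarrow> complex) \<Rightarrow> complex" where
  "ext_coeff c I J L h = (case I of
      None \<Rightarrow> (case J of None \<Rightarrow> (case L of None \<Rightarrow> -1 | Some l \<Rightarrow> 0)
                      | Some j \<Rightarrow> (case L of None \<Rightarrow> 0 | Some l \<Rightarrow> if l = j then -1 else 0))
    | Some i \<Rightarrow> (case J of None \<Rightarrow> (case L of None \<Rightarrow> 0 | Some l \<Rightarrow> if l = i then -1 else 0)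
                      | Some j \<Rightarrow> (case L of None \<Rightarrow> if i = j then c else 0 | Some l \<Rightarrow> Gamma i j l h)))"

lemma ext_coeff_differential:
  assumes h: "h \<in> Ho"
  shows "complex_differentiable_at (\<lambda>v. ext_coeff c I J L (\<tau> v h)) 0"
    and "cgrad (\<lambda>v. ext_coeff c (Some i) J L (\<tau> v h)) 0 $ m = cgrad (\<lambda>v. ext_coeff c (Some m) J L (\<tau> v h)) 0 $ i"
    and "cgrad (\<lambda>v. ext_coeff c None J L (\<tau> v h)) 0 = 0"
  by (cases I; cases J; cases L; simp add: ext_coeff_def Gamma_differential[OF h] cong: if_cong)
    (cases J; cases L; simp add: ext_coeff_def Gamma_differential(2)[OF h, of i _ _ m] cong: if_cong)+

lemma sum_delta_neg: "(\<Sum>x\<in>UNIV. (if x = i then -1 else 0) * f x) = - f (i :: 'n)"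
    "(\<Sum>x\<in>UNIV. f x * (if x = i then -1 else 0)) = - f (i :: 'n)"
    "(\<Sum>x\<in>UNIV. f x * (if i = x then -1 else 0)) = - f (i :: 'n)"
    "(\<Sum>x\<in>UNIV. f x * (if i = x then c else 0)) = f (i :: 'n) * c"
    "(\<Sum>x\<in>UNIV. (if x = i then -1 else 0) * (if l = x then -1 else 0)) = (if l = i then 1 else (0 :: complex))"
    for f :: "'n \<Rightarrow> complex"
  by (simp_all add: if_distrib[of "\<lambda>x. x * _"] if_distrib[of "\<lambda>x. _ * x"] cong: if_cong)

text \<open>The matrix in direction dt/t is scalar. For two directions of H the blocks that meet
  \<open>None\<close> once express symmetries of \<open>Gamma\<close>. In the remaining block the
  products of c with the entries -1 contribute -c times \<open>wedge_inner\<close>, which cancels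
  the curvature term of \<open>Gamma\<close> because c is its eigenvalue.\<close>

lemma ext_coeff_commute:
  assumes c: "\<And>u v w z. curv h u v w z = c * of_real (wedge_inner u v w z)" and h: "h \<in> Ho"
  shows "(\<Sum>K\<in>UNIV. ext_coeff c I J K h * ext_coeff c I' K L h) = (\<Sum>K\<in>UNIV. ext_coeff c I' J K h * ext_coeff c I K L h)"
proof -
  have quad: "(\<Sum>x\<in>UNIV. Gamma i j x h * Gamma i' x l h) + (if i = j then c else 0) * (if l = i' then -1 else 0)
     = (\<Sum>x\<in>UNIV. Gamma i' j x h * Gamma i x l h) + (if i' = j then c else 0) * (if l = i then -1 else 0)" for i i' j l
  proof -
    have d: "dot (conn_tensor h (axis i 1) (axis j 1)) (conn_tensor h (axis i' 1) (axis l 1)) = (\<Sum>x\<in>UNIV. Gamma i j x h * Gamma i' x l h)" for i j i' l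
      unfolding dot_def Gamma_conn_tensor[OF h, symmetric] by (intro sum.cong refl) (simp add: Gamma_sym(2)[OF h, of i' l])
    have "(\<Sum>x\<in>UNIV. Gamma i j x h * Gamma i' x l h) - (\<Sum>x\<in>UNIV. Gamma i' j x h * Gamma i x l h)
      = c * of_real (wedge_inner (axis i 1) (axis i' 1) (axis j 1) (axis l 1))"
      using c[of "axis i 1" "axis i' 1" "axis j 1" "axis l 1"] unfolding curv_def d .
    also have "\<dots> = (if i = j then c else 0) * (if l = i' then 1 else 0) - (if i' = j then c else 0) * (if l = i then 1 else 0)"
      by (auto simp: wedge_inner_def inner_axis_axis)
    finally show ?thesis by (auto simp: algebra_simps split: if_splits)
  qed
  have *: "(\<Sum>K\<in>UNIV. ext_coeff c (Some i) J K h * ext_coeff c None K L h) = (\<Sum>K\<in>UNIV. ext_coeff c None J K h * ext_coeff c (Some i) K L h)" for i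
    unfolding sum_option[of "\<lambda>K. ext_coeff c (Some i) J K h * ext_coeff c None K L h"] sum_option[of "\<lambda>K. ext_coeff c None J K h * ext_coeff c (Some i) K L h"]
    by (cases J; cases L; simp add: ext_coeff_def sum_delta_neg)
  have **: "(\<Sum>K\<in>UNIV. ext_coeff c (Some i) J K h * ext_coeff c (Some i') K L h) = (\<Sum>K\<in>UNIV. ext_coeff c (Some i') J K h * ext_coeff c (Some i) K L h)" for i i'
    unfolding sum_option[of "\<lambda>K. ext_coeff c (Some i) J K h * ext_coeff c (Some i') K L h"] sum_option[of "\<lambda>K. ext_coeff c (Some i') J K h * ext_coeff c (Some i) K L h"]
  proof (cases J)
    case None
    show "ext_coeff c (Some i) J None h * ext_coeff c (Some i') None L h + (\<Sum>j\<in>UNIV. ext_coeff c (Some i) J (Some j) h * ext_coeff c (Some i') (Some j) L h)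
       = ext_coeff c (Some i') J None h * ext_coeff c (Some i) None L h + (\<Sum>j\<in>UNIV. ext_coeff c (Some i') J (Some j) h * ext_coeff c (Some i) (Some j) L h)"
      using None by (cases L) (auto simp: ext_coeff_def sum_delta_neg Gamma_sym(1)[OF h, of i' i])
  next
    case (Some j)
    show "ext_coeff c (Some i) J None h * ext_coeff c (Some i') None L h + (\<Sum>j\<in>UNIV. ext_coeff c (Some i) J (Some j) h * ext_coeff c (Some i') (Some j) L h)
       = ext_coeff c (Some i') J None h * ext_coeff c (Some i) None L h + (\<Sum>j\<in>UNIV. ext_coeff c (Some i') J (Some j) h * ext_coeff c (Some i) (Some j) L h)"
    proof (cases L)
      case None
      have "Gamma i j i' h = Gamma i' j i h" using Gamma_sym[OF h] by metis
      then show ?thesis using Some None by (simp add: ext_coeff_def sum_delta_neg)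
    next
      case (Some l)
      then show ?thesis using \<open>J = Some j\<close> quad[of i j i' l] by (simp add: ext_coeff_def add.commute)
    qed
  qed
  show ?thesis by (cases I; cases I') (simp_all add: * **)
qed

lemma ext_Omega_expand:
  "ext_Omega P k (\<lambda>u v. c * pairing u v) b p \<phi> u (axis J 1) = (\<Sum>I\<in>UNIV. u $ I * (\<Sum>L\<in>UNIV. ext_coeff c I J L (fst p) * \<phi> $ L))"
proof (cases J)
  case None
  have hp: "hpart (axis None 1 :: complex^'n option) = 0" by (simp add: hpart_def vec_eq_iff axis_def)
  have "Omega P k b (fst p) (hpart \<phi>) (hpart u) 0 = 0" by (simp add: Omega_def b_simps(6))
  then show ?thesis
    using None unfolding sum_option
    by (simp add: zero_vec_def[symmetric] ext_Omega_def hp ext_coeff_def sum_delta_neg axis_def pairing_def hpart_def sum_negf algebra_simps)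
next
  case (Some j)
  have hp: "hpart (axis (Some j) 1 :: complex^'n option) = axis j 1" "(axis (Some j) 1 :: complex^'n option) $ None = 0"
    by (simp_all add: hpart_def vec_eq_iff axis_def)
  have hn: "hpart x $ j = x $ Some j" for x :: "complex^'n option" by (simp add: hpart_def)
  have "Omega P k b (fst p) (hpart \<phi>) (hpart u) (axis j 1) = (\<Sum>i\<in>UNIV. u $ Some i * (\<Sum>l\<in>UNIV. Gamma i j l (fst p) * \<phi> $ Some l))"
    unfolding Omega_expand[of "fst p" "hpart \<phi>" "hpart u"] by (simp add: Gamma_def hpart_def mult.commute)
  moreover have "(\<Sum>i\<in>UNIV. u $ Some i * ((if i = j then c else 0) * \<phi> $ None)) = \<phi> $ None * (c * u $ Some j)"
  proof -
    have "(\<Sum>i\<in>UNIV. u $ Some i * ((if i = j then c else 0) * \<phi> $ None)) = (\<Sum>i\<in>UNIV. if i = j then \<phi> $ None * (c * u $ Some j) else 0)"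
      by (intro sum.cong) auto
    then show ?thesis by simp
  qed
  ultimately show ?thesis
    using Some unfolding sum_option
    by (simp add: ext_Omega_def hp hn ext_coeff_def sum_delta_neg distrib_left sum.distrib algebra_simps)
qed

text \<open>The constant c is the eigenvalue from \<open>curv_scalar\<close>. In both integrability
  conditions the derivative part is symmetric by \<open>ext_coeff_differential\<close> and the
  quadratic part by \<open>ext_coeff_commute\<close>, each separately.\<close>

theorem flat_and_projective:
  "\<exists>c. flat_connection (ext_torus_translate R) (Ho \<times> (- {0})) (ext_Omega P k (\<lambda>u v. c * pairing u v) b)
     \<and> defines_projective_structure \<tau> Ho (Omega P k b) (\<lambda>u v. c * pairing u v)"
proof -
  obtain c where c: "\<And>\<phi>. character \<phi> \<and> (\<forall>\<alpha>\<in>R. \<phi> \<alpha> \<noteq> 1) \<Longrightarrow> (\<forall>u v w z. curv \<phi> u v w z = c * of_real (wedge_inner u v w z))"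
    using curv_scalar by blast
  have comm: "(\<Sum>K\<in>UNIV. ext_coeff c I J K h * ext_coeff c I' K L h) = (\<Sum>K\<in>UNIV. ext_coeff c I' J K h * ext_coeff c I K L h)"
    if "h \<in> Ho" for h I I' J L
    using c[of h] torus_character[of h] that by (intro ext_coeff_commute) (auto simp: mirror_complement_def)
  define a :: "complex^'n \<Rightarrow> complex^'n \<Rightarrow> complex" where "a u v = c * pairing u v" for u v
  have "flat_connection (ext_torus_translate R) (Ho \<times> (- {0})) (ext_Omega P k a b)"
  proof (rule ext.flat_connectionI[where N = "\<lambda>I J L p. ext_coeff c I J L (fst p)"])
    show "ext_Omega P k a b p \<phi> u (axis J 1) = (\<Sum>I\<in>UNIV. u $ I * (\<Sum>L\<in>UNIV. ext_coeff c I J L (fst p) * \<phi> $ L))" for p \<phi> u J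
      using ext_Omega_expand by (simp add: a_def[abs_def])
    have e: "(\<lambda>v. ext_coeff c I J L (fst (ext_torus_translate R v p))) = (\<lambda>v. ext_coeff c I J L (\<tau> (hpart v) (fst p)))" for I J L p
      by (simp add: ext_torus_translate_def split_beta)
    have h0: "hpart (0 :: complex^'n option) = 0" by (simp add: hpart_def vec_eq_iff)
    have d: "complex_differentiable_at (\<lambda>v. ext_coeff c I J L (\<tau> v (fst p))) (hpart (0 :: complex^'n option))" if "p \<in> Ho \<times> (- {0})" for I J L and p :: "(real^'n \<Rightarrow> complex) \<times> complex"
      unfolding h0 by (rule ext_coeff_differential(1)) (use that in auto)
    show "hol_on (ext_torus_translate R) (Ho \<times> (- {0})) (\<lambda>p. ext_coeff c I J L (fst p))" for I J L
      unfolding hol_on_def e using cgrad_hpart_chain(1)[OF d] by blast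
    fix p I I' J L assume p: "p \<in> Ho \<times> (- {0 :: complex})"
    then have h: "fst p \<in> Ho" by auto
    have dd: "differential (ext_torus_translate R) (\<lambda>p. ext_coeff c I J L (fst p)) p = cone_vec 0 (cgrad (\<lambda>v. ext_coeff c I J L (\<tau> v (fst p))) 0)" for I J L
      unfolding ext.differential_eq_cgrad e cgrad_hpart_chain(2)[OF d[OF p]] h0 ..
    have "cone_vec 0 (cgrad (\<lambda>v. ext_coeff c I' J L (\<tau> v (fst p))) 0) $ I = cone_vec 0 (cgrad (\<lambda>v. ext_coeff c I J L (\<tau> v (fst p))) 0) $ I'"
      by (cases I; cases I') (simp_all add: cone_vec_def ext_coeff_differential(2,3)[OF h])
    then show "differential (ext_torus_translate R) (\<lambda>p. ext_coeff c I' J L (fst p)) p $ I + (\<Sum>K\<in>UNIV. ext_coeff c I J K (fst p) * ext_coeff c I' K L (fst p))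
      = differential (ext_torus_translate R) (\<lambda>p. ext_coeff c I J L (fst p)) p $ I' + (\<Sum>K\<in>UNIV. ext_coeff c I' J K (fst p) * ext_coeff c I K L (fst p))"
      unfolding dd comm[OF h, of I J I'] by simp
  qed
  moreover have "defines_projective_structure \<tau> Ho (Omega P k b) a"
  proof -
    have axis_nth: "axis i (1 :: complex) $ j = (if i = j then 1 else 0)" for i j :: 'n by (simp add: axis_def)
    \<comment> \<open>The 1-jet matrices are the negatives of the extended matrices in the
      directions of H. The sign disappears from products and factors out of derivatives, so
      integrability carries over.\<close>
    have jm: "jet_matrix a Gamma j m m' = (\<lambda>h. - ext_coeff c (Some j) m m' h)" for j m m'
      by (auto simp: jet_matrix_def ext_coeff_def a_def fun_eq_iff axis_nth split: option.split)
    interpret projective_connection \<tau> Ho "Omega P k b" a Gamma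
    proof
      show "Omega P k b p \<phi> u (axis i 1) = (\<Sum>j\<in>UNIV. u $ j * (\<Sum>l\<in>UNIV. Gamma j i l p * \<phi> $ l))" for p \<phi> u i
        unfolding Omega_expand[of p \<phi> u] by (simp add: Gamma_def mult.commute)
      show "sym_bilinear_form a"
        unfolding sym_bilinear_form_def Vector_Spaces.linear_iff
        by (intro conjI allI vec.vector_space_axioms vector_space_over_itself.vector_space_axioms)
          (simp_all add: a_def pairing_commute pairing_add_right pairing_scale_right algebra_simps)
      show "hol_on \<tau> Ho (Gamma j i l)" for j i l
        unfolding hol_on_def using Gamma_differential(1) by blast
      fix p j i m m' assume p: "p \<in> Ho"
      have d: "differential \<tau> (\<lambda>h. - ext_coeff c (Some j) m m' h) p = - cgrad (\<lambda>v. ext_coeff c (Some j) m m' (\<tau> v p)) 0" for j m m'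
        unfolding torus.differential_eq_cgrad by (rule cgrad_minus(2)[OF ext_coeff_differential(1)[OF p]])
      show "differential \<tau> (jet_matrix a Gamma j m m') p $ i + (\<Sum>k\<in>UNIV. jet_matrix a Gamma j m k p * jet_matrix a Gamma i k m' p)
        = differential \<tau> (jet_matrix a Gamma i m m') p $ j + (\<Sum>k\<in>UNIV. jet_matrix a Gamma i m k p * jet_matrix a Gamma j k m' p)"
        unfolding jm d using comm[OF p, of "Some j" m "Some i" m'] ext_coeff_differential(2)[OF p, of c j m m' i] by simp
    qed
    show ?thesis by (rule defines_projective_structure)
  qed
  ultimately show ?thesis unfolding a_def[abs_def] by blast
qed

text \<open>Complexified reflections are still symmetric involutions, so they preserve the bilinear
  form, and they generate the group.\<close>

lemma weyl_group_pairing: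
  assumes "w \<in> weyl_group R"
  shows "pairing (weyl_act w u) (weyl_act w v) = pairing u v"
  using assms
proof (induction arbitrary: u v rule: weyl_group.induct)
  case one
  have "map_matrix complex_of_real (mat 1 :: real^'n^'n) = mat 1" by (simp add: map_matrix_def mat_def vec_eq_iff)
  then show ?case by (simp add: weyl_act_def)
next
  case (step \<alpha> w)
  have mm: "map_matrix complex_of_real (A ** B) = map_matrix complex_of_real A ** map_matrix complex_of_real B" for A B :: "real^'n^'n"
    by (simp add: map_matrix_def matrix_matrix_mult_def vec_eq_iff)
  have "pairing (weyl_act (reflection \<alpha>) x) (weyl_act (reflection \<alpha>) y) = pairing x y" for x y
  proof -
    have r: "pairing (weyl_act (reflection \<alpha>) x) (axis i 1) = pairing x (weyl_act (reflection \<alpha>) (axis i 1))" for x i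
      using pairing_reflection[of \<alpha> x "axis i 1"] by (simp add: cvec_axis weyl_act_cvec[symmetric])
    have l: "pairing (weyl_act (reflection \<alpha>) x) z = pairing x (weyl_act (reflection \<alpha>) z)" for x z
    proof -
      have "pairing (weyl_act (reflection \<alpha>) x) z = (\<Sum>i\<in>UNIV. z $ i * pairing (weyl_act (reflection \<alpha>) x) (axis i 1))"
        by (rule linear_form_expand) (simp_all add: pairing_add_right pairing_scale_right)
      moreover have "pairing x (weyl_act (reflection \<alpha>) z) = (\<Sum>i\<in>UNIV. z $ i * pairing x (weyl_act (reflection \<alpha>) (axis i 1)))"
        by (rule linear_form_expand) (simp_all add: weyl_act_def matrix_vector_right_distrib vector_scalar_commute pairing_add_right pairing_scale_right)
      ultimately show ?thesis by (simp only: r)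
    qed
    have "reflection \<alpha> ** reflection \<alpha> = mat 1"
      by (simp add: matrix_eq matrix_vector_mul_assoc[symmetric] reflection_involution)
    then have "map_matrix complex_of_real (reflection \<alpha>) ** map_matrix complex_of_real (reflection \<alpha>) = mat 1"
      unfolding mm[symmetric] by (simp add: map_matrix_def mat_def vec_eq_iff)
    then show ?thesis unfolding l by (simp only: weyl_act_def matrix_vector_mul_assoc matrix_vector_mul_lid)
  qed
  then show ?case using step.IH by (simp add: weyl_act_def mm matrix_vector_mul_assoc[symmetric])
qed

end

theorem theorem2p15:
  fixes R P :: "(real^'n) set"
    and k :: "real^'n \<Rightarrow> complex"
    and b :: "complex^'n \<Rightarrow> complex^'n \<Rightarrow> complex^'n"
  assumes "root_system R" and "reduced R" and "irreducible_roots R"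
    and "positive_roots R P"
    and "\<forall>w\<in>weyl_group R. \<forall>\<alpha>\<in>R. k (w *v \<alpha>) = k \<alpha>"
    and "sym_bilinear_map b"
    and "\<forall>w\<in>weyl_group R. \<forall>u v. b (weyl_act w u) (weyl_act w v) = weyl_act w (b u v)"
  shows "\<exists>a :: complex^'n \<Rightarrow> complex^'n \<Rightarrow> complex.
     sym_bilinear_form a
     \<and> (\<forall>w\<in>weyl_group R. \<forall>u v. a (weyl_act w u) (weyl_act w v) = a u v)
     \<and> flat_connection (ext_torus_translate R) (mirror_complement R \<times> (- {0})) (ext_Omega P k a b)
     \<and> defines_projective_structure (torus_translate R) (mirror_complement R) (Omega P k b) a"
proof -
  interpret toric_connection R P k b
    by unfold_locales (rule assms)+
  obtain c where c: "flat_connection (ext_torus_translate R) (mirror_complement R \<times> (- {0})) (ext_Omega P k (\<lambda>u v. c * pairing u v) b)"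
     "defines_projective_structure (torus_translate R) (mirror_complement R) (Omega P k b) (\<lambda>u v. c * pairing u v)"
    using flat_and_projective by blast
  have "sym_bilinear_form (\<lambda>u v. c * pairing u v :: complex)"
    unfolding sym_bilinear_form_def Vector_Spaces.linear_iff
    by (intro conjI allI vec.vector_space_axioms vector_space_over_itself.vector_space_axioms)
      (simp_all add: pairing_commute pairing_add_right pairing_scale_right algebra_simps)
  moreover have "\<forall>w\<in>weyl_group R. \<forall>u v. c * pairing (weyl_act w u) (weyl_act w v) = c * pairing u v"
    by (simp add: weyl_group_pairing)
  ultimately show ?thesis using c by (intro exI[of _ "\<lambda>u v. c * pairing u v"]) simp
qed

end
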